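(* Let $\lambda$ be a partition of $n\geq 1$, let $T$ be a standard Young tableau of shape $\lambda$, and let $T'$ be the standard tableau obtained from $T$ by deleting the box containing $n$. If the component $\mathcal{K}^{T'}$ is singular, then the component $\mathcal{K}^{T}$ is singular. Moreover, if $n$ lies in the last column of $T$, then $\mathcal{K}^T$ is singular if and only if $\mathcal{K}^{T'}$ is singular.
   Context: For a partition $\lambda=(\lambda_1\geq\cdots\geq\lambda_k>0)$ of $n$, $Y_\lambda$ is the Young diagram with left-justified rows of lengths $\lambda_1,\dots,\lambda_k$; a (standard) Young tableau of shape $\lambda$ is a filling of $Y_\lambda$ with $1,\dots,n$, each once, increasing along rows (left to right) and down columns. $\mathrm{sh}(T)$ denotes the shape of $T$, and for $0\le i\leq n$, $\pi_{1,i}(T)$ denotes the tableau obtained from $T$ by deleting the boxes containing $i+1,\dots,n$. Components: for a nilpotent $u\in\mathrm{End}(V)$, $V=\mathbb{C}^n$, let $Y(u)$ be the Young diagram whose row lengths are the Jordan block sizes of $u$, and let $\mathcal{B}_u$ be the variety of complete flags $(V_0,\ldots,V_n)$ of $V$ with $u(V_i)\subset V_i$ for all $i$. If $Y(u)=Y_\lambda$, then for each standard tableau $T$ of shape $\lambda$ put $$\mathcal{F}_T=\{(V_0,\ldots,V_n)\in\mathcal{B}_u : Y(u|_{V_i})=\mathrm{sh}(\pi_{1,i}(T)),\ 0\leq i\leq n\},\qquad \mathcal{K}^T=\overline{\mathcal{F}_T}.$$ By a theorem of Spaltenstein, the $\mathcal{K}^T$ ($T$ standard of shape $\lambda$) are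 exactly the irreducible components of $\mathcal{B}_u$; up to isomorphism $\mathcal{K}^T$ depends only on $T$. In particular $\mathcal{K}^{T'}$ is a component of the Springer fiber $\mathcal{B}_{u'}$, where $u'$ is a nilpotent endomorphism of an $(n-1)$-dimensional space with $Y(u')=\mathrm{sh}(T')$. *)

theory Defs
  imports
    "HOL-Analysis.Abstract_Topology"
    "HOL-Library.Extended_Nat"
    "HOL-Library.Function_Algebras"
    "Jordan_Normal_Form.Jordan_Normal_Form"
    "Jordan_Normal_Form.DL_Rank"
begin

text \<open>Partitions are lists of row lengths; tableaux are lists of rows, from top to bottom.\<close>

definition is_partition :: "nat list \<Rightarrow> nat \<Rightarrow> bool" where
  "is_partition lam n \<longleftrightarrow> sorted_wrt (\<ge>) lam \<and> 0 \<notin> set lam \<and> sum_list lam = n"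

definition shape :: "nat list list \<Rightarrow> nat list" where
  "shape T = map length T"

definition standard_tableau :: "nat list \<Rightarrow> nat list list \<Rightarrow> bool" where
  "standard_tableau lam T \<longleftrightarrow>
     shape T = lam \<and>
     distinct (concat T) \<and> set (concat T) = {1..sum_list lam} \<and>
     (\<forall>row\<in>set T. sorted_wrt (<) row) \<and>
     (\<forall>r c. Suc r < length T \<and> c < length (T ! r) \<and> c < length (T ! Suc r) \<longrightarrow>
        T ! r ! c < T ! Suc r ! c)"

text \<open>The tableau \<open>\<pi>\<^sub>1\<^sub>,\<^sub>i(T)\<close>: rows that become empty are dropped.\<close>

definition restrict_tableau :: "nat \<Rightarrow> nat list list \<Rightarrow> nat list list" where
  "restrict_tableau i T = filter (\<lambda>row. row \<noteq> []) (map (filter (\<lambda>e. e \<le> i)) T)"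

definition in_last_column :: "nat \<Rightarrow> nat list list \<Rightarrow> bool" where
  "in_last_column m T \<longleftrightarrow>
     (\<exists>r c. r < length T \<and> c < length (T ! r) \<and> T ! r ! c = m \<and> Suc c = length (T ! 0))"

definition nilpotent_mat :: "nat \<Rightarrow> complex mat \<Rightarrow> bool" where
  "nilpotent_mat n u \<longleftrightarrow> u \<in> carrier_mat n n \<and> (\<exists>k. u ^\<^sub>m k = 0\<^sub>m n n)"

text \<open>\<open>Y(u) = Y\<^sub>\<mu>\<close> for a nilpotent square matrix \<open>u\<close>; \<open>\<mu>\<close> is determined by \<open>u\<close>
  when it is required to be sorted.\<close>

definition young_diagram :: "complex mat \<Rightarrow> nat list \<Rightarrow> bool" where
  "young_diagram u mu \<longleftrightarrow> sorted_wrt (\<ge>) mu \<and> jordan_nf u (map (\<lambda>m. (m, 0)) mu)"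

text \<open>\<open>Y(u|\<^sub>W) = Y\<^sub>\<mu>\<close> for a \<open>u\<close>-stable subspace \<open>W\<close> of \<open>\<complex>\<^sup>n\<close>: the columns of \<open>P\<close> are a
  basis of \<open>W\<close>, and \<open>A\<close> is the matrix of \<open>u|\<^sub>W\<close> in that basis.\<close>

definition young_diagram_on :: "nat \<Rightarrow> complex mat \<Rightarrow> complex vec set \<Rightarrow> nat list \<Rightarrow> bool" where
  "young_diagram_on n u W mu \<longleftrightarrow>
     (\<exists>k. \<exists>P\<in>carrier_mat n k. \<exists>A\<in>carrier_mat k k.
        vec_space.rank n P = k \<and> vec_space.col_space n P = W \<and>
        u * P = P * A \<and> young_diagram A mu)"

text \<open>Affine space with coordinates indexed by a finite set \<open>I\<close>. As \<open>\<complex>\<close> is infinite,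
  polynomials in these coordinates are identified with polynomial functions.\<close>

definition affine_space :: "'i set \<Rightarrow> ('i \<Rightarrow> complex) set" where
  "affine_space I = {x. \<forall>i. i \<notin> I \<longrightarrow> x i = 0}"

inductive_set polynomials :: "'i set \<Rightarrow> (('i \<Rightarrow> complex) \<Rightarrow> complex) set" for I :: "'i set" where
  const: "(\<lambda>x. c) \<in> polynomials I"
| coord: "i \<in> I \<Longrightarrow> (\<lambda>x. x i) \<in> polynomials I"
| add: "f \<in> polynomials I \<Longrightarrow> g \<in> polynomials I \<Longrightarrow> (\<lambda>x. f x + g x) \<in> polynomials I"
| mult: "f \<in> polynomials I \<Longrightarrow> g \<in> polynomials I \<Longrightarrow> (\<lambda>x. f x * g x) \<in> polynomials I"

definition algebraic_set :: "'i set \<Rightarrow> ('i \<Rightarrow> complex) set \<Rightarrow> bool" where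
  "algebraic_set I X \<longleftrightarrow>
     (\<exists>F\<subseteq>polynomials I. X = {x \<in> affine_space I. \<forall>f\<in>F. f x = 0})"

definition vanishing_ideal :: "'i set \<Rightarrow> ('i \<Rightarrow> complex) set \<Rightarrow> (('i \<Rightarrow> complex) \<Rightarrow> complex) set" where
  "vanishing_ideal I X = {f \<in> polynomials I. \<forall>x\<in>X. f x = 0}"

text \<open>The Zariski tangent space at \<open>x\<close> of \<open>X\<close> with its reduced structure: the vectors killed by
  the differentials at \<open>x\<close> of all elements of the full vanishing ideal.\<close>

definition tangent_space :: "'i set \<Rightarrow> ('i \<Rightarrow> complex) set \<Rightarrow> ('i \<Rightarrow> complex) \<Rightarrow> ('i \<Rightarrow> complex) set" where
  "tangent_space I X x =
     {v \<in> affine_space I. \<forall>f\<in>vanishing_ideal I X.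
        ((\<lambda>t. f (\<lambda>i. x i + t * v i)) has_field_derivative 0) (at 0)}"

definition tangent_dim :: "'i set \<Rightarrow> ('i \<Rightarrow> complex) set \<Rightarrow> ('i \<Rightarrow> complex) \<Rightarrow> nat" where
  "tangent_dim I X x = vector_space.dim (\<lambda>(c::complex) v i. c * v i) (tangent_space I X x)"

definition algebraically_independent_on ::
    "('i \<Rightarrow> complex) set \<Rightarrow> nat \<Rightarrow> (nat \<Rightarrow> ('i \<Rightarrow> complex) \<Rightarrow> complex) \<Rightarrow> bool" where
  "algebraically_independent_on Y k f \<longleftrightarrow>
     (\<forall>p\<in>polynomials {..<k}. (\<forall>y\<in>Y. p (\<lambda>j. f j y) = 0) \<longrightarrow> (\<forall>z. p z = 0))"

text \<open>The dimension of a nonempty locally closed set is the maximal number of polynomial functions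
  that are algebraically independent on it; when the set is irreducible this is the transcendence
  degree of its function field. The dimension at a point is the minimum over a basis of Zariski
  open neighbourhoods.\<close>

definition alg_dim :: "'i set \<Rightarrow> ('i \<Rightarrow> complex) set \<Rightarrow> enat" where
  "alg_dim I Y = Sup {enat k |k. \<exists>f. (\<forall>j<k. f j \<in> polynomials I) \<and> algebraically_independent_on Y k f}"

definition local_dim :: "'i set \<Rightarrow> ('i \<Rightarrow> complex) set \<Rightarrow> ('i \<Rightarrow> complex) \<Rightarrow> enat" where
  "local_dim I X x = Inf {alg_dim I {y \<in> X. h y \<noteq> 0} |h. h \<in> polynomials I \<and> h x \<noteq> 0}"

definition singular_point :: "'i set \<Rightarrow> ('i \<Rightarrow> complex) set \<Rightarrow> ('i \<Rightarrow> complex) \<Rightarrow> bool" where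
  "singular_point I X x \<longleftrightarrow> x \<in> X \<and> enat (tangent_dim I X x) \<noteq> local_dim I X x"

text \<open>A flag \<open>(V\<^sub>0, \<dots>, V\<^sub>n)\<close> of \<open>\<complex>\<^sup>n\<close> is a list of length \<open>n + 1\<close>.\<close>

definition flags :: "nat \<Rightarrow> complex vec set list set" where
  "flags n = {Vs. length Vs = Suc n \<and>
     (\<forall>i\<le>n. VectorSpace.subspace class_ring (Vs ! i) (module_vec TYPE(complex) n) \<and>
        vectorspace.dim class_ring ((module_vec TYPE(complex) n)\<lparr>carrier := Vs ! i\<rparr>) = i) \<and>
     (\<forall>i<n. Vs ! i \<subseteq> Vs ! Suc i)}"

definition flag_of :: "nat \<Rightarrow> complex mat \<Rightarrow> complex vec set list" where
  "flag_of n g = map (\<lambda>k. vec_space.col_space n (mat_of_cols n (take k (cols g)))) [0..<Suc n]"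

text \<open>The variety structure is glued from the charts \<open>x \<mapsto> g U(x) F\<close> for \<open>g \<in> GL\<^sub>n(\<complex>)\<close>, where \<open>U(x)\<close>
  runs over the lower unitriangular matrices and \<open>F\<close> is the standard flag: these are isomorphisms
  of affine space onto the translates of the big cell, which form an open cover.\<close>

definition chart_index :: "nat \<Rightarrow> (nat \<times> nat) set" where
  "chart_index n = {(i, j). j < i \<and> i < n}"

definition lower_unitriangular :: "nat \<Rightarrow> (nat \<times> nat \<Rightarrow> complex) \<Rightarrow> complex mat" where
  "lower_unitriangular n x = mat n n (\<lambda>(i, j). if i = j then 1 else if j < i then x (i, j) else 0)"

definition chart :: "nat \<Rightarrow> complex mat \<Rightarrow> (nat \<times> nat \<Rightarrow> complex) \<Rightarrow> complex vec set list" where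
  "chart n g x = flag_of n (g * lower_unitriangular n x)"

definition chart_preimage ::
    "nat \<Rightarrow> complex mat \<Rightarrow> complex vec set list set \<Rightarrow> (nat \<times> nat \<Rightarrow> complex) set" where
  "chart_preimage n g Z = {x \<in> affine_space (chart_index n). chart n g x \<in> Z}"

definition GL :: "nat \<Rightarrow> complex mat set" where
  "GL n = {g \<in> carrier_mat n n. invertible_mat g}"

definition zariski_open :: "nat \<Rightarrow> complex vec set list set \<Rightarrow> bool" where
  "zariski_open n U \<longleftrightarrow> U \<subseteq> flags n \<and>
     (\<forall>g\<in>GL n. algebraic_set (chart_index n) (affine_space (chart_index n) - chart_preimage n g U))"

definition zariski :: "nat \<Rightarrow> complex vec set list topology" where
  "zariski n = topology (zariski_open n)"

lemma algebraic_set_Un: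
  assumes "algebraic_set I X" "algebraic_set I Y"
  shows "algebraic_set I (X \<union> Y)"
proof -
  obtain F G where F: "F \<subseteq> polynomials I" "X = {x \<in> affine_space I. \<forall>f\<in>F. f x = 0}"
    and G: "G \<subseteq> polynomials I" "Y = {x \<in> affine_space I. \<forall>g\<in>G. g x = 0}"
    using assms unfolding algebraic_set_def by blast
  let ?H = "{\<lambda>x. f x * g x |f g. f \<in> F \<and> g \<in> G}"
  have "?H \<subseteq> polynomials I"
    using F(1) G(1) polynomials.mult by blast
  moreover have "X \<union> Y = {x \<in> affine_space I. \<forall>h\<in>?H. h x = 0}"
  proof (intro equalityI subsetI)
    fix x assume "x \<in> X \<union> Y"
    then show "x \<in> {x \<in> affine_space I. \<forall>h\<in>?H. h x = 0}"
      unfolding F(2) G(2) by auto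
  next
    fix x assume x: "x \<in> {x \<in> affine_space I. \<forall>h\<in>?H. h x = 0}"
    have "x \<in> Y" if nX: "x \<notin> X"
    proof -
      obtain f where f: "f \<in> F" "f x \<noteq> 0"
        using nX x unfolding F(2) by blast
      have "g x = 0" if "g \<in> G" for g
      proof -
        have "(\<lambda>x. f x * g x) \<in> ?H"
          using f(1) that by auto
        then have "f x * g x = 0"
          using x by fastforce
        then show ?thesis
          using f(2) by simp
      qed
      then show ?thesis
        using x unfolding G(2) by simp
    qed
    then show "x \<in> X \<union> Y"
      by blast
  qed
  ultimately show ?thesis
    unfolding algebraic_set_def by blast
qed

lemma algebraic_set_Inter:
  assumes "\<And>X. X \<in> \<X> \<Longrightarrow> algebraic_set I X"
  shows "algebraic_set I (affine_space I \<inter> \<Inter>\<X>)"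
proof -
  have "\<exists>F. \<forall>X\<in>\<X>. F X \<subseteq> polynomials I \<and> X = {x \<in> affine_space I. \<forall>f\<in>F X. f x = 0}"
    using assms unfolding algebraic_set_def by (intro bchoice ballI) simp
  then obtain F where FX: "\<forall>X\<in>\<X>. F X \<subseteq> polynomials I \<and> X = {x \<in> affine_space I. \<forall>f\<in>F X. f x = 0}"
    by (rule exE)
  have F: "F X \<subseteq> polynomials I" "X = {x \<in> affine_space I. \<forall>f\<in>F X. f x = 0}" if "X \<in> \<X>" for X
    using bspec[OF FX that] by (rule conjunct1, rule conjunct2)
  have "(\<Union>X\<in>\<X>. F X) \<subseteq> polynomials I"
    using F(1) by blast
  moreover have "affine_space I \<inter> \<Inter>\<X> = {x \<in> affine_space I. \<forall>f\<in>(\<Union>X\<in>\<X>. F X). f x = 0}"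
  proof (intro equalityI subsetI)
    fix x assume x: "x \<in> affine_space I \<inter> \<Inter>\<X>"
    have "f x = 0" if "X \<in> \<X>" "f \<in> F X" for X f
      using x that F(2)[OF that(1)] by auto
    then show "x \<in> {x \<in> affine_space I. \<forall>f\<in>(\<Union>X\<in>\<X>. F X). f x = 0}"
      using x by auto
  next
    fix x assume x: "x \<in> {x \<in> affine_space I. \<forall>f\<in>(\<Union>X\<in>\<X>. F X). f x = 0}"
    have "x \<in> X" if "X \<in> \<X>" for X
      by (subst F(2)[OF that]) (use x that in auto)
    then show "x \<in> affine_space I \<inter> \<Inter>\<X>"
      using x by auto
  qed
  ultimately show ?thesis
    unfolding algebraic_set_def by blast
qed

lemma istopology_zariski_open: "istopology (zariski_open n)"
  unfolding istopology_def
proof (intro conjI allI impI)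
  let ?I = "chart_index n"
  fix U V assume U: "zariski_open n U" and V: "zariski_open n V"
  have "affine_space ?I - chart_preimage n g (U \<inter> V) =
      (affine_space ?I - chart_preimage n g U) \<union> (affine_space ?I - chart_preimage n g V)" for g
    unfolding chart_preimage_def by blast
  then show "zariski_open n (U \<inter> V)"
    using U V unfolding zariski_open_def by (auto intro: algebraic_set_Un)
next
  let ?I = "chart_index n"
  fix \<K> assume K: "\<forall>U\<in>\<K>. zariski_open n U"
  have eq: "affine_space ?I - chart_preimage n g (\<Union>\<K>) =
      affine_space ?I \<inter> \<Inter>((\<lambda>U. affine_space ?I - chart_preimage n g U) ` \<K>)" for g
    unfolding chart_preimage_def by blast
  have "algebraic_set ?I (affine_space ?I - chart_preimage n g (\<Union>\<K>))" if "g \<in> GL n" for g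
    unfolding eq
  proof (rule algebraic_set_Inter)
    fix X assume "X \<in> (\<lambda>U. affine_space ?I - chart_preimage n g U) ` \<K>"
    then show "algebraic_set ?I X"
      using K that unfolding zariski_open_def by auto
  qed
  moreover have "\<Union>\<K> \<subseteq> flags n"
    using K unfolding zariski_open_def by auto
  ultimately show "zariski_open n (\<Union>\<K>)"
    unfolding zariski_open_def by simp
qed

lemma openin_zariski: "openin (zariski n) U \<longleftrightarrow> zariski_open n U"
  unfolding zariski_def by (simp add: istopology_zariski_open)

text \<open>Singularity of a closed subset of the flag variety, with its reduced structure.\<close>

definition singular :: "nat \<Rightarrow> complex vec set list set \<Rightarrow> bool" where
  "singular n Z \<longleftrightarrow> (\<exists>g\<in>GL n. \<exists>x. singular_point (chart_index n) (chart_preimage n g Z) x)"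

definition springer_fiber :: "nat \<Rightarrow> complex mat \<Rightarrow> complex vec set list set" where
  "springer_fiber n u = {Vs \<in> flags n. \<forall>i\<le>n. \<forall>v\<in>Vs ! i. u *\<^sub>v v \<in> Vs ! i}"

definition flags_of_tableau :: "nat \<Rightarrow> complex mat \<Rightarrow> nat list list \<Rightarrow> complex vec set list set" where
  "flags_of_tableau n u T =
     {Vs \<in> springer_fiber n u. \<forall>i\<le>n. young_diagram_on n u (Vs ! i) (shape (restrict_tableau i T))}"

definition springer_component :: "nat \<Rightarrow> complex mat \<Rightarrow> nat list list \<Rightarrow> complex vec set list set" where
  "springer_component n u T = zariski n closure_of flags_of_tableau n u T"

end

theory Submission
  imports
    Defs
    "Jordan_Normal_Form.Jordan_Normal_Form_Existence"
    "Jordan_Normal_Form.Jordan_Normal_Form_Uniqueness"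
begin

text \<open>Let \<open>a\<close> be the column of the box containing \<open>n\<close>. For a flag in \<open>\<F>\<^sub>T\<close> the hyperplane \<open>V\<^sub>n\<^sub>-\<^sub>1\<close> contains
  the image of \<open>u\<close> and the kernel of \<open>u\<^sup>a\<^sup>-\<^sup>1\<close>, and \<open>u\<close> restricts to it with the Jordan type of \<open>T'\<close>. The
  hyperplanes of the latter kind are one orbit of the centralizer of \<open>u\<close>, open in the linear space of the former,
  and the centralizer contains a polynomial family that trivializes the map from the component to hyperplanes near a point of
  this orbit. So there \<open>\<K>\<^sup>T\<close> is locally isomorphic to the product of \<open>\<K>\<^sup>T\<^sup>'\<close> with an affine space, and a
  product with an affine space is singular at a point if and only if the first factor is. Over every flag
  of \<open>\<K>\<^sup>T\<^sup>'\<close> there is such a point, which gives the first claim. If \<open>n\<close> is in the last column then every hyperplane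
  that satisfies the two closed conditions is in the orbit, so every flag of \<open>\<K>\<^sup>T\<close> is such a point.

  Singular points are compared through affine charts: the Zariski tangent space is transported by the differentials of
  mutually inverse rational maps, and the dimension is controlled by the growth of the space of polynomial functions.\<close>

text \<open>The set of flags in \<open>flags_of_tableau\<close> need not be closed, and its closure
  comes without equations. But a set and its closure have the same vanishing ideal and the same
  dimensions of open pieces, so the tangent space and the local dimension at a point of the closure
  are read off the dense set, even if the point lies outside it. In a chart the dense set is given
  by \<open>N * U = U * B\<close> with \<open>U\<close> unitriangular, \<open>B\<close> triangular
  with leading blocks of prescribed Jordan type, and \<open>N\<close> a conjugate of
  \<open>u\<close>; varying \<open>N\<close> replaces varying the chart.

  Dimension is defined through polynomial functions, on sets not known to be irreducible, while the
  local isomorphisms are rational. The growth estimate shows that denominators, or a factor of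
  affine space, give no unexpected independent functions.

  The trivializing elements of the centralizer are the identity plus linear combinations of matrices
  \<open>X\<close>, each a sum of products \<open>M^i * W * M^(a-1-i)\<close> with \<open>W\<close>
  of rank at most one and annihilated by \<open>M^a\<close> from both sides; the last row of
  \<open>X\<close> can be prescribed in every direction allowed by the two closed
  conditions.\<close>

interpretation fs: vector_space "\<lambda>(c::complex) (v::'i \<Rightarrow> complex) i. c * v i"
  by unfold_locales (auto simp: fun_eq_iff algebra_simps)

lemma sum_fun_apply: "(\<Sum>a\<in>E. f a) x = (\<Sum>a\<in>E. f a x)" for f :: "'a \<Rightarrow> 'b \<Rightarrow> 'c::comm_monoid_add"
  by (induction E rule: infinite_finite_induct) auto

subsection \<open>Polynomial functions\<close>

lemma polynomials_sum: "(\<And>a. a \<in> E \<Longrightarrow> f a \<in> polynomials I) \<Longrightarrow> (\<lambda>x. \<Sum>a\<in>E. f a x) \<in> polynomials I"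
proof (induction E rule: infinite_finite_induct)
  case (insert a E)
  then show ?case using polynomials.add[of "f a" I "\<lambda>x. \<Sum>a\<in>E. f a x"] by simp
qed (auto intro: polynomials.const)

lemma polynomials_prod: "(\<And>a. a \<in> E \<Longrightarrow> f a \<in> polynomials I) \<Longrightarrow> (\<lambda>x. \<Prod>a\<in>E. f a x) \<in> polynomials I"
proof (induction E rule: infinite_finite_induct)
  case (insert a E)
  then show ?case using polynomials.mult[of "f a" I "\<lambda>x. \<Prod>a\<in>E. f a x"] by simp
qed (auto intro: polynomials.const)

lemma polynomials_power: "f \<in> polynomials I \<Longrightarrow> (\<lambda>x. f x ^ k) \<in> polynomials I"
  by (induction k) (auto intro: polynomials.intros)

lemma polynomials_uminus: "f \<in> polynomials I \<Longrightarrow> (\<lambda>x. - f x) \<in> polynomials I"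
  using polynomials.mult[OF polynomials.const[of "-1"], of f I] by simp

lemma polynomials_diff: "f \<in> polynomials I \<Longrightarrow> g \<in> polynomials I \<Longrightarrow> (\<lambda>x. f x - g x) \<in> polynomials I"
  using polynomials.add[OF _ polynomials_uminus, of f I g] by simp

lemma polynomials_subst:
  assumes "f \<in> polynomials I" "\<And>i. i \<in> I \<Longrightarrow> \<phi> i \<in> polynomials J"
  shows "(\<lambda>x. f (\<lambda>i. \<phi> i x)) \<in> polynomials J"
  using assms(1) by (induction) (auto intro: polynomials.intros assms(2))

lemma polynomials_mono: "f \<in> polynomials I \<Longrightarrow> I \<subseteq> J \<Longrightarrow> f \<in> polynomials J"
  using polynomials_subst[of f I "\<lambda>i x. x i" J] by (auto intro: polynomials.intros)

lemma polynomials_cong: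
  assumes "f \<in> polynomials I" "\<And>i. i \<in> I \<Longrightarrow> x i = y i"
  shows "f x = f y"
  using assms(1) by induction (auto simp: assms(2))

section \<open>Monomials, degree, and uniqueness of coefficients\<close>

definition exps :: "'i set \<Rightarrow> ('i \<Rightarrow> nat) set" where
  "exps I = {a. \<forall>i. i \<notin> I \<longrightarrow> a i = 0}"

definition mon :: "'i set \<Rightarrow> ('i \<Rightarrow> nat) \<Rightarrow> ('i \<Rightarrow> complex) \<Rightarrow> complex" where
  "mon I a x = (\<Prod>i\<in>I. x i ^ a i)"

lemma mon_poly: "mon I a \<in> polynomials I"
  unfolding mon_def by (intro polynomials_prod polynomials_power polynomials.coord)

lemma mon_add: "mon I (\<lambda>i. a i + b i) x = mon I a x * mon I b x"
  unfolding mon_def by (simp add: power_add prod.distrib)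

definition deg_le :: "'i set \<Rightarrow> nat \<Rightarrow> (('i \<Rightarrow> complex) \<Rightarrow> complex) set" where
  "deg_le I d = fs.span (mon I ` {a \<in> exps I. sum a I \<le> d})"

lemma deg_le_mono: "f \<in> deg_le I d \<Longrightarrow> d \<le> e \<Longrightarrow> f \<in> deg_le I e"
  unfolding deg_le_def by (rule subsetD[OF fs.span_mono]) auto

lemma deg_le_mult:
  assumes "f \<in> deg_le I d" "g \<in> deg_le I e"
  shows "(\<lambda>x. f x * g x) \<in> deg_le I (d + e)"
proof -
  have mm: "(\<lambda>x. mon I a x * mon I b x) \<in> deg_le I (d + e)"
    if "a \<in> {a \<in> exps I. sum a I \<le> d}" "b \<in> {a \<in> exps I. sum a I \<le> e}" for a b
  proof -
    have "mon I (\<lambda>i. a i + b i) \<in> deg_le I (d + e)"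
      unfolding deg_le_def using that by (intro fs.span_base imageI) (auto simp: exps_def sum.distrib)
    moreover have "mon I (\<lambda>i. a i + b i) = (\<lambda>x. mon I a x * mon I b x)"
      by (simp add: fun_eq_iff mon_add)
    ultimately show ?thesis by simp
  qed
  have sp: "fs.subspace (deg_le I (d + e))" unfolding deg_le_def by (rule fs.subspace_span)
  have 1: "(\<lambda>x. mon I a x * g x) \<in> deg_le I (d + e)" if "a \<in> {a \<in> exps I. sum a I \<le> d}" for a
    using assms(2) unfolding deg_le_def[of I e]
  proof (induction rule: fs.span_induct_alt)
    case base
    then show ?case using fs.subspace_0[OF sp] by (simp add: zero_fun_def)
  next
    case (step c b y)
    from step(1) obtain b' where "b = mon I b'" "b' \<in> {a \<in> exps I. sum a I \<le> e}" by auto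
    with mm[OF that, of b'] have "(\<lambda>x. mon I a x * b x) \<in> deg_le I (d + e)" by simp
    from fs.subspace_add[OF sp fs.subspace_scale[OF sp this, of c] step(2)]
    show ?case by (simp add: plus_fun_def algebra_simps)
  qed
  show ?thesis using assms(1) unfolding deg_le_def[of I d]
  proof (induction rule: fs.span_induct_alt)
    case base
    then show ?case using fs.subspace_0[OF sp] by (simp add: zero_fun_def)
  next
    case (step c b y)
    from step(1) obtain b' where b': "b = mon I b'" "b' \<in> {a \<in> exps I. sum a I \<le> d}" by auto
    from 1[OF b'(2)] b'(1) have "(\<lambda>x. b x * g x) \<in> deg_le I (d + e)" by simp
    from fs.subspace_add[OF sp fs.subspace_scale[OF sp this, of c] step(2)]
    show ?case by (simp add: plus_fun_def algebra_simps)
  qed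
qed

lemma deg_le_const: "(\<lambda>x. c) \<in> deg_le I d"
proof -
  have "mon I (\<lambda>_. 0) \<in> mon I ` {a \<in> exps I. sum a I \<le> d}" by (intro imageI) (auto simp: exps_def)
  from fs.span_scale[OF fs.span_base[OF this], of c]
  show ?thesis unfolding deg_le_def by (simp add: mon_def)
qed

lemma deg_le_power: "f \<in> deg_le I d \<Longrightarrow> (\<lambda>x. f x ^ k) \<in> deg_le I (k * d)"
proof (induction k)
  case (Suc k)
  from deg_le_mult[OF Suc(2) Suc(1)[OF Suc(2)]] show ?case by simp
qed (auto intro: deg_le_const)

lemma deg_le_prod:
  "(\<And>a. a \<in> E \<Longrightarrow> f a \<in> deg_le I d) \<Longrightarrow> (\<lambda>x. \<Prod>a\<in>E. f a x) \<in> deg_le I (card E * d)"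
proof (induction E rule: infinite_finite_induct)
  case (insert a E)
  have "(\<lambda>x. f a x * (\<Prod>a\<in>E. f a x)) \<in> deg_le I (d + card E * d)"
    using insert by (intro deg_le_mult) auto
  then show ?case using insert by simp
qed (auto intro: deg_le_const)

lemma poly_deg_le:
  assumes "f \<in> polynomials I" "finite I"
  shows "\<exists>d. f \<in> deg_le I d"
  using assms(1)
proof induction
  case (const c)
  then show ?case using deg_le_const by blast
next
  case (coord i)
  have "mon I (\<lambda>j. if j = i then 1 else 0) \<in> deg_le I 1"
    unfolding deg_le_def using coord assms(2) by (intro fs.span_base imageI) (auto simp: exps_def)
  moreover have "mon I (\<lambda>j. if j = i then 1 else 0) = (\<lambda>x. x i)"
    unfolding mon_def using coord assms(2)
    by (auto simp: fun_eq_iff if_distrib prod.delta cong: if_cong)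
  ultimately show ?case by auto
next
  case (add f g)
  then obtain d e where "f \<in> deg_le I d" "g \<in> deg_le I e" by auto
  then have "f \<in> deg_le I (d + e)" "g \<in> deg_le I (d + e)" by (auto intro: deg_le_mono)
  then have "f + g \<in> deg_le I (d + e)" unfolding deg_le_def by (rule fs.span_add)
  then show ?case by (auto simp: plus_fun_def)
next
  case (mult f g)
  then show ?case using deg_le_mult by blast
qed

text \<open>The span gives coefficients indexed by monomial functions. Selecting one exponent vector
  for each of them gives coefficients indexed by exponents, before it is known that distinct
  exponents give distinct functions.\<close>

lemma deg_le_expansion:
  assumes "f \<in> deg_le I d"
  shows "\<exists>E c. finite E \<and> E \<subseteq> exps I \<and> (\<forall>x. f x = (\<Sum>a\<in>E. c a * mon I a x))"
proof -
  obtain t r where t: "finite t" "t \<subseteq> mon I ` {a \<in> exps I. sum a I \<le> d}"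
    "f = (\<Sum>v\<in>t. (\<lambda>x. r v * v x))"
    using assms unfolding deg_le_def fs.span_explicit by auto
  from finite_subset_image[OF t(1,2)] obtain C where C: "C \<subseteq> {a \<in> exps I. sum a I \<le> d}" "finite C" "t = mon I ` C"
    by blast
  from subset_image_inj[of t "mon I" C] C(3) obtain E where E: "E \<subseteq> C" "inj_on (mon I) E" "t = mon I ` E" by auto
  have "f x = (\<Sum>a\<in>E. r (mon I a) * mon I a x)" for x
    unfolding t(3) E(3) sum.reindex[OF E(2)] by (simp add: sum_fun_apply)
  then show ?thesis using E(1) C by (intro exI[of _ E] exI[of _ "\<lambda>a. r (mon I a)"]) (auto intro: finite_subset)
qed

text \<open>Positional notation: the exponent of the new variable is a digit below \<open>M\<close>,
  and the old weights are scaled by \<open>M\<close>. Injectivity makes the weight a total order on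
  the finitely many monomials in question; weights at least 1 let the weight bound every single
  exponent.\<close>

lemma weight_exists:
  assumes "finite I" "finite E" "E \<subseteq> exps I"
  shows "\<exists>w::'i \<Rightarrow> nat. (\<forall>i. w i \<ge> 1) \<and> inj_on (\<lambda>a. \<Sum>i\<in>I. w i * a i) E"
  using assms
proof (induction I arbitrary: E rule: finite_induct)
  case empty
  then have "E \<subseteq> {\<lambda>_. 0}" by (auto simp: exps_def)
  then show ?case by (intro exI[of _ "\<lambda>_. 1"] conjI inj_onI) auto
next
  case (insert i0 I)
  let ?r = "\<lambda>a i. if i \<in> I then a i else (0::nat)"
  have "\<exists>w::'i \<Rightarrow> nat. (\<forall>i. w i \<ge> 1) \<and> inj_on (\<lambda>a. \<Sum>i\<in>I. w i * a i) (?r ` E)"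
    by (rule insert.IH) (use insert.prems in \<open>auto simp: exps_def\<close>)
  then obtain w where w: "\<forall>i. w i \<ge> (1::nat)" "inj_on (\<lambda>a. \<Sum>i\<in>I. w i * a i) (?r ` E)" by auto
  define M where "M = Suc (\<Sum>a\<in>E. a i0)"
  have M: "a i0 < M" if "a \<in> E" for a
    unfolding M_def using member_le_sum[of a E "\<lambda>a. a i0"] insert.prems that by auto
  define w' where "w' = (\<lambda>i. if i = i0 then 1 else M * w i)"
  have s: "(\<Sum>i\<in>insert i0 I. w' i * a i) = a i0 + M * (\<Sum>i\<in>I. w i * a i)" for a
  proof -
    have "(\<Sum>i\<in>I. w' i * a i) = (\<Sum>i\<in>I. M * (w i * a i))"
      using insert.hyps by (intro sum.cong) (auto simp: w'_def)
    then show ?thesis using insert.hyps by (simp add: w'_def sum_distrib_left)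
  qed
  have "inj_on (\<lambda>a. \<Sum>i\<in>insert i0 I. w' i * a i) E"
  proof (rule inj_onI)
    fix a b assume ab: "a \<in> E" "b \<in> E" "(\<Sum>i\<in>insert i0 I. w' i * a i) = (\<Sum>i\<in>insert i0 I. w' i * b i)"
    then have e: "a i0 + M * (\<Sum>i\<in>I. w i * a i) = b i0 + M * (\<Sum>i\<in>I. w i * b i)" unfolding s by simp
    from arg_cong[OF e, of "\<lambda>x. x mod M"] M[OF ab(1)] M[OF ab(2)] have e1: "a i0 = b i0" by simp
    with e have "M * (\<Sum>i\<in>I. w i * a i) = M * (\<Sum>i\<in>I. w i * b i)" by linarith
    then have "(\<Sum>i\<in>I. w i * a i) = (\<Sum>i\<in>I. w i * b i)" by (simp add: M_def del: mult_Suc)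
    then have "(\<Sum>i\<in>I. w i * ?r a i) = (\<Sum>i\<in>I. w i * ?r b i)" by simp
    with inj_onD[OF w(2), of "?r a" "?r b"] ab have "?r a = ?r b" by auto
    then have e2: "a i = b i" if "i \<in> I" for i using that by (metis (full_types))
    show "a = b"
    proof
      fix i
      have "a \<in> exps (insert i0 I)" "b \<in> exps (insert i0 I)" using ab insert.prems(2) by auto
      then show "a i = b i"
        using e1 e2 by (cases "i = i0 \<or> i \<in> I") (auto simp: exps_def)
    qed
  qed
  moreover have "\<forall>i. w' i \<ge> 1" using w(1) by (auto simp: w'_def M_def intro!: trans_le_add1)
  ultimately show ?case by blast
qed

text \<open>On the curve with coordinates \<open>s ^ w i\<close> the monomials of \<open>E\<close>
  become distinct powers of \<open>s\<close>, and a polynomial in one variable that vanishes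
  everywhere is zero.\<close>

lemma poly_zero_coeffs:
  assumes "finite I" "finite E" "E \<subseteq> exps I" "\<And>x. (\<Sum>a\<in>E. c a * mon I a x) = 0" "a \<in> E"
  shows "c a = 0"
proof -
  obtain w :: "'a \<Rightarrow> nat" where w: "inj_on (\<lambda>a. \<Sum>i\<in>I. w i * a i) E" (is "inj_on ?W E")
    using weight_exists[OF assms(1-3)] by blast
  define p where "p = (\<Sum>a\<in>E. Polynomial.monom (c a) (?W a))"
  have "poly p s = 0" for s
  proof -
    have "mon I a (\<lambda>i. s ^ w i) = s ^ ?W a" for a
      unfolding mon_def by (simp add: power_sum power_mult)
    with assms(4)[of "\<lambda>i. s ^ w i"] show ?thesis
      unfolding p_def by (simp add: poly_sum poly_monom)
  qed
  then have "p = 0" using poly_all_0_iff_0[of p] by simp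
  then have "0 = coeff p (?W a)" by simp
  also have "\<dots> = (\<Sum>b\<in>E. if b = a then c b else 0)"
    unfolding p_def coeff_sum using inj_onD[OF w _ _ assms(5)] by (intro sum.cong) auto
  also have "\<dots> = c a" using assms by simp
  finally show ?thesis by simp
qed

subsection \<open>Growth of the space of polynomial functions\<close>

text \<open>Extension by zero keeps the functions on \<open>Y\<close> in the vector space of all
  functions, so that linear relations on \<open>Y\<close> are relations of
  \<open>fs\<close>.\<close>

definition res :: "'a set \<Rightarrow> ('a \<Rightarrow> complex) \<Rightarrow> 'a \<Rightarrow> complex" where
  "res Y f = (\<lambda>y. if y \<in> Y then f y else 0)"

lemma res_add: "res Y (\<lambda>y. f y + g y) = res Y f + res Y g"
  by (auto simp: res_def fun_eq_iff)

lemma res_scale: "res Y (\<lambda>y. c * f y) = (\<lambda>y. c * res Y f y)"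
  by (auto simp: res_def fun_eq_iff)

text \<open>The polynomials of degree at most \<open>N\<close> restrict to a space of functions on \<open>Y\<close> of dimension
  \<open>O((N + 1)\<^sup>k)\<close>.\<close>

definition growth :: "'i set \<Rightarrow> ('i \<Rightarrow> complex) set \<Rightarrow> nat \<Rightarrow> bool" where
  "growth I Y k \<longleftrightarrow> (\<exists>C. \<forall>N. \<exists>S. finite S \<and> card S \<le> C * (N + 1) ^ k \<and>
     (\<forall>a\<in>exps I. sum a I \<le> N \<longrightarrow> res Y (mon I a) \<in> fs.span S))"

lemma exps_mono: "S \<subseteq> I \<Longrightarrow> exps S \<subseteq> exps I"
  by (auto simp: exps_def)

lemma card_exps_le:
  assumes "finite I"
  shows "finite {a \<in> exps I. \<forall>i\<in>I. a i < B i}" "card {a \<in> exps I. \<forall>i\<in>I. a i < B i} \<le> (\<Prod>i\<in>I. B i)"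
proof -
  let ?f = "\<lambda>f i. if i \<in> I then f i else (0::nat)"
  have sub: "{a \<in> exps I. \<forall>i\<in>I. a i < B i} \<subseteq> ?f ` (PiE I (\<lambda>i. {..<B i}))"
  proof
    fix a assume "a \<in> {a \<in> exps I. \<forall>i\<in>I. a i < B i}"
    then have "a = ?f (restrict a I)" "restrict a I \<in> PiE I (\<lambda>i. {..<B i})"
      by (auto simp: exps_def fun_eq_iff)
    then show "a \<in> ?f ` (PiE I (\<lambda>i. {..<B i}))" by blast
  qed
  have fin: "finite (PiE I (\<lambda>i. {..<B i}))" using assms by (intro finite_PiE) auto
  show "finite {a \<in> exps I. \<forall>i\<in>I. a i < B i}" using sub fin by (meson finite_imageI finite_subset)
  have "card {a \<in> exps I. \<forall>i\<in>I. a i < B i} \<le> card (PiE I (\<lambda>i. {..<B i}))"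
    using sub fin by (meson card_image_le card_mono finite_imageI le_trans)
  also have "\<dots> = (\<Prod>i\<in>I. B i)" using assms by (simp add: card_PiE)
  finally show "card {a \<in> exps I. \<forall>i\<in>I. a i < B i} \<le> (\<Prod>i\<in>I. B i)" .
qed

text \<open>A relation among each \<open>k + 1\<close> coordinates rewrites its leading monomial. The monomials that are
  not rewritten have at most \<open>k\<close> large exponents. The weights \<open>w\<close> replace a monomial order.\<close>

lemma growth_of_dependent:
  fixes I :: "'i set" and Y :: "('i \<Rightarrow> complex) set"
  assumes fin: "finite I"
    and dep: "\<And>S. S \<subseteq> I \<Longrightarrow> card S = Suc k \<Longrightarrow>
      \<exists>p\<in>polynomials S. (\<exists>x. p x \<noteq> 0) \<and> (\<forall>y\<in>Y. p y = 0)"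
  shows "growth I Y k"
proof -
  let ?SS = "{S. S \<subseteq> I \<and> card S = Suc k}"
  have finSS: "finite ?SS" using fin by simp
  have "\<exists>E c. finite E \<and> E \<noteq> {} \<and> E \<subseteq> exps S \<and> (\<forall>a\<in>E. c a \<noteq> 0) \<and> (\<forall>y\<in>Y. (\<Sum>a\<in>E. c a * mon I a y) = 0)"
    if "S \<in> ?SS" for S
  proof -
    from that have finS: "finite S" using fin by (auto intro: finite_subset)
    from dep[of S] that obtain p where p: "p \<in> polynomials S" "\<exists>x. p x \<noteq> 0" "\<forall>y\<in>Y. p y = 0" by auto
    from poly_deg_le[OF p(1) finS] deg_le_expansion obtain E c where
      E: "finite E" "E \<subseteq> exps S" "\<And>x. p x = (\<Sum>a\<in>E. c a * mon S a x)" by metis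
    have m: "mon S a x = mon I a x" if "a \<in> E" for a x
      unfolding mon_def using \<open>S \<in> ?SS\<close> that E(2) fin
      by (intro prod.mono_neutral_left) (auto simp: exps_def)
    let ?E = "{a \<in> E. c a \<noteq> 0}"
    have pe: "p x = (\<Sum>a\<in>?E. c a * mon I a x)" for x
      unfolding E(3) using E(1) m by (intro sum.mono_neutral_cong_right) auto
    have "?E \<noteq> {}" using p(2) pe by (metis sum.empty)
    then show ?thesis using E p(3) pe by (intro exI[of _ ?E] exI[of _ c]) auto
  qed
  then have "\<forall>S\<in>?SS. \<exists>E c. finite E \<and> E \<noteq> {} \<and> E \<subseteq> exps S \<and> (\<forall>a\<in>E. c a \<noteq> 0) \<and> (\<forall>y\<in>Y. (\<Sum>a\<in>E. c a * mon I a y) = 0)"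
    by blast
  from bchoice[OF this] obtain E where "\<forall>S\<in>?SS. \<exists>c. finite (E S) \<and> E S \<noteq> {} \<and> E S \<subseteq> exps S \<and> (\<forall>a\<in>E S. c a \<noteq> 0) \<and> (\<forall>y\<in>Y. (\<Sum>a\<in>E S. c a * mon I a y) = 0)" ..
  from bchoice[OF this] obtain c where Ec: "\<forall>S\<in>?SS. finite (E S) \<and> E S \<noteq> {} \<and> E S \<subseteq> exps S \<and> (\<forall>a\<in>E S. c S a \<noteq> 0) \<and> (\<forall>y\<in>Y. (\<Sum>a\<in>E S. c S a * mon I a y) = 0)" ..
  have EI: "E S \<subseteq> exps I" if "S \<in> ?SS" for S
    using bspec[OF Ec that] exps_mono[of S I] that by blast
  have finE: "finite (\<Union>S\<in>?SS. E S)" using finSS Ec by auto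
  obtain w :: "'i \<Rightarrow> nat" where w: "\<And>i. w i \<ge> 1" "inj_on (\<lambda>a. \<Sum>i\<in>I. w i * a i) (\<Union>S\<in>?SS. E S)"
    using weight_exists[OF fin finE] EI by blast
  define W where "W = (\<lambda>a. \<Sum>i\<in>I. w i * a i)"
  \<comment> \<open>The weight is injective on all supports together, so each relation has exactly
    one leading exponent.\<close>
  have "\<exists>b\<in>E S. \<forall>a\<in>E S. a \<noteq> b \<longrightarrow> W a < W b" if "S \<in> ?SS" for S
  proof -
    have ne: "finite (W ` E S)" "W ` E S \<noteq> {}" using Ec that by auto
    from Max_in[OF this] obtain b where b: "b \<in> E S" "W b = Max (W ` E S)" by auto
    have "W a < W b" if "a \<in> E S" "a \<noteq> b" for a
    proof -
      have "W a \<le> W b" using b(2) Max_ge[OF ne(1)] that by auto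
      moreover have "W a \<noteq> W b" using inj_onD[OF w(2), of a b] that b(1) \<open>S \<in> ?SS\<close> unfolding W_def by blast
      ultimately show ?thesis by simp
    qed
    with b(1) show ?thesis by blast
  qed
  then have "\<forall>S\<in>?SS. \<exists>b. b \<in> E S \<and> (\<forall>a\<in>E S. a \<noteq> b \<longrightarrow> W a < W b)" by blast
  from bchoice[OF this] obtain b where b: "\<forall>S\<in>?SS. b S \<in> E S \<and> (\<forall>a\<in>E S. a \<noteq> b S \<longrightarrow> W a < W (b S))" ..
  \<comment> \<open>\<open>D\<close> exceeds all exponents of all leading monomials: a monomial with
    \<open>k + 1\<close> exponents at least \<open>D\<close> is divisible by one of these and can be
    rewritten.\<close>
  define D where "D = Suc (\<Sum>S\<in>?SS. \<Sum>i\<in>I. b S i)"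
  have bD: "b S i < D" if "S \<in> ?SS" "i \<in> I" for S i
  proof -
    have "b S i \<le> (\<Sum>i\<in>I. b S i)" using fin that by (intro member_le_sum) auto
    also have "\<dots> \<le> (\<Sum>S\<in>?SS. \<Sum>i\<in>I. b S i)" using member_le_sum[of S ?SS "\<lambda>S. \<Sum>i\<in>I. b S i"] finSS that by auto
    finally show ?thesis by (simp add: D_def)
  qed
  define nrm where "nrm a \<longleftrightarrow> a \<in> exps I \<and> card {i \<in> I. D \<le> a i} \<le> k" for a :: "'i \<Rightarrow> nat"
  have red: "res Y (mon I a) \<in> fs.span ((\<lambda>a. res Y (mon I a)) ` {a'. nrm a' \<and> W a' \<le> W a})" if "a \<in> exps I" for a
    using that
  proof (induction "W a" arbitrary: a rule: less_induct)
    case less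
    show ?case
    proof (cases "nrm a")
      case True
      then show ?thesis by (intro fs.span_base imageI) auto
    next
      case False
      then have "Suc k \<le> card {i \<in> I. D \<le> a i}" using less.prems by (auto simp: nrm_def)
      then obtain S where S: "S \<subseteq> {i \<in> I. D \<le> a i}" "card S = Suc k" by (meson obtain_subset_with_card_n)
      then have SS: "S \<in> ?SS" by auto
      note bS = bspec[OF b SS] and ES = bspec[OF Ec SS]
      have ba: "b S i \<le> a i" for i
      proof (cases "i \<in> S")
        case True
        then show ?thesis using S(1) bD[OF SS, of i] by fastforce
      next
        case False
        moreover have "b S \<in> exps S" using bS ES by blast
        ultimately show ?thesis by (simp add: exps_def)
      qed
      let ?sh = "\<lambda>e i. (a i - b S i) + e i"
      let ?sp = "fs.span ((\<lambda>a. res Y (mon I a)) ` {a'. nrm a' \<and> W a' \<le> W a})"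
      \<comment> \<open>Multiplying the relation by the cofactor of its leading monomial replaces
        \<open>a\<close> by the exponents \<open>?sh e\<close>, which have smaller weight.\<close>
      have "?sh e i + b S i = a i + e i" for e i using ba[of i] by simp
      then have Wsh: "W (?sh e) + W (b S) = W a + W e" for e
        unfolding W_def sum.distrib[symmetric] add_mult_distrib2[symmetric] by presburger
      have "res Y (mon I a) = (\<Sum>e\<in>E S - {b S}. (\<lambda>y. (- c S e / c S (b S)) * res Y (mon I (?sh e)) y))"
      proof
        fix y
        show "res Y (mon I a) y = (\<Sum>e\<in>E S - {b S}. (\<lambda>y. (- c S e / c S (b S)) * res Y (mon I (?sh e)) y)) y"
        proof (cases "y \<in> Y")
          case True
          have "a = (\<lambda>i. (a i - b S i) + b S i)" using ba by (auto simp: fun_eq_iff)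
          then have ma: "mon I a y = mon I (\<lambda>i. a i - b S i) y * mon I (b S) y" by (metis mon_add)
          have "(\<Sum>e\<in>E S. c S e * mon I e y) = 0" using ES True by blast
          then have "c S (b S) * mon I (b S) y = - (\<Sum>e\<in>E S - {b S}. c S e * mon I e y)"
            using ES bS by (simp add: sum.remove[of "E S" "b S"] add_eq_0_iff)
          moreover have "c S (b S) \<noteq> 0" using ES bS by blast
          ultimately have "mon I (b S) y = (\<Sum>e\<in>E S - {b S}. (- c S e / c S (b S)) * mon I e y)"
            by (simp add: field_simps sum_negf sum_divide_distrib[symmetric])
          then have "mon I a y = (\<Sum>e\<in>E S - {b S}. (- c S e / c S (b S)) * mon I (?sh e) y)"
            unfolding ma mon_add by (simp add: sum_distrib_left mult_ac)
          then show ?thesis using True by (simp add: res_def sum_fun_apply)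
        qed (simp add: res_def sum_fun_apply)
      qed
      also have "\<dots> \<in> ?sp"
      proof (rule fs.span_sum, rule fs.span_scale)
        fix e assume e: "e \<in> E S - {b S}"
        then have "W e < W (b S)" using bS by blast
        then have lt: "W (?sh e) < W a" using Wsh[of e] by linarith
        have "?sh e \<in> exps I" using less.prems EI[OF SS] e by (auto simp: exps_def)
        from less.hyps[OF lt this]
        show "res Y (mon I (?sh e)) \<in> ?sp"
          by (rule subsetD[OF fs.span_mono, rotated]) (use lt in auto)
      qed
      finally show ?thesis .
    qed
  qed
  \<comment> \<open>Degree at most \<open>N\<close> implies weight at most \<open>M * N\<close>, and
    \<open>M * N + 1 \<le> (M + 1) * (N + 1)\<close> turns the count below into a multiple of
    \<open>(N + 1) ^ k\<close>.\<close>
  define M where "M = (\<Sum>i\<in>I. w i)"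
  \<comment> \<open>Choose the set \<open>K\<close> of at most \<open>k\<close> coordinates with
    exponent at least \<open>D\<close>: exponents in \<open>K\<close> are at most \<open>L\<close>
    because weights are at least 1, and the others are below \<open>D\<close>.\<close>
  have cnt: "finite {a. nrm a \<and> W a \<le> L} \<and> card {a. nrm a \<and> W a \<le> L} \<le> 2 ^ card I * (D ^ card I * (L + 1) ^ k)" for L
  proof -
    let ?B = "\<lambda>K i. if i \<in> K then L + 1 else D"
    let ?A = "\<lambda>K. {a \<in> exps I. \<forall>i\<in>I. a i < ?B K i}"
    let ?KK = "{K. K \<subseteq> I \<and> card K \<le> k}"
    have fKK: "finite ?KK" and cKK: "card ?KK \<le> 2 ^ card I"
      using fin card_mono[of "Pow I" ?KK] by (auto simp: card_Pow)
    have sub: "{a. nrm a \<and> W a \<le> L} \<subseteq> (\<Union>K\<in>?KK. ?A K)"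
    proof
      fix a assume "a \<in> {a. nrm a \<and> W a \<le> L}"
      then have a: "a \<in> exps I" "card {i \<in> I. D \<le> a i} \<le> k" "W a \<le> L" by (auto simp: nrm_def)
      have "a i \<le> L" if "i \<in> I" for i
      proof -
        have "a i \<le> w i * a i" using w(1)[of i] by simp
        also have "\<dots> \<le> W a" unfolding W_def using fin that member_le_sum[of i I "\<lambda>i. w i * a i"] by auto
        finally show ?thesis using a(3) by simp
      qed
      then have "a \<in> ?A {i \<in> I. D \<le> a i}" using a(1) by (auto simp: less_Suc_eq_le)
      then show "a \<in> (\<Union>K\<in>?KK. ?A K)" using a(2) by (intro UN_I[of "{i \<in> I. D \<le> a i}"]) auto
    qed
    have cA: "card (?A K) \<le> D ^ card I * (L + 1) ^ k" if "K \<in> ?KK" for K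
    proof -
      have "card (?A K) \<le> (\<Prod>i\<in>I. ?B K i)" by (rule card_exps_le(2)[OF fin])
      also have "\<dots> \<le> (\<Prod>i\<in>I. D * (if i \<in> K then L + 1 else 1))"
        by (intro prod_mono) (auto simp: D_def)
      also have "\<dots> = D ^ card I * (\<Prod>i\<in>I. (if i \<in> K then L + 1 else 1))" by (simp add: prod.distrib)
      also have "(\<Prod>i\<in>I. (if i \<in> K then L + 1 else 1)) = (\<Prod>i\<in>K. L + 1)"
        using that fin by (intro prod.mono_neutral_cong_right) auto
      also have "\<dots> = (L + 1) ^ card K" by simp
      also have "\<dots> \<le> (L + 1) ^ k" using that by (intro power_increasing) auto
      finally show ?thesis by simp
    qed
    have fA: "finite (\<Union>K\<in>?KK. ?A K)" by (rule finite_UN_I[OF fKK card_exps_le(1)[OF fin]])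
    have "card {a. nrm a \<and> W a \<le> L} \<le> card (\<Union>K\<in>?KK. ?A K)" by (rule card_mono[OF fA sub])
    also have "\<dots> \<le> (\<Sum>K\<in>?KK. card (?A K))" by (rule card_UN_le[OF fKK])
    also have "\<dots> \<le> (\<Sum>K\<in>?KK. D ^ card I * (L + 1) ^ k)" by (rule sum_mono[OF cA])
    also have "\<dots> = card ?KK * (D ^ card I * (L + 1) ^ k)" by simp
    also have "\<dots> \<le> 2 ^ card I * (D ^ card I * (L + 1) ^ k)" using cKK by (rule mult_le_mono1)
    finally show ?thesis using finite_subset[OF sub fA] by blast
  qed
  show ?thesis unfolding growth_def
  proof (rule exI[of _ "2 ^ card I * D ^ card I * (M + 1) ^ k"], rule allI)
    fix N
    let ?S = "(\<lambda>a. res Y (mon I a)) ` {a'. nrm a' \<and> W a' \<le> M * N}"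
    have "card ?S \<le> 2 ^ card I * (D ^ card I * (M * N + 1) ^ k)"
      using cnt[of "M * N"] by (meson card_image_le le_trans)
    also have "\<dots> \<le> 2 ^ card I * (D ^ card I * ((M + 1) * (N + 1)) ^ k)"
      by (intro mult_le_mono2 power_mono) (auto simp: algebra_simps)
    finally have cS: "card ?S \<le> 2 ^ card I * D ^ card I * (M + 1) ^ k * (N + 1) ^ k"
      by (simp only: power_mult_distrib mult_ac)
    have "res Y (mon I a) \<in> fs.span ?S" if "a \<in> exps I" "sum a I \<le> N" for a
    proof -
      have "w i \<le> M" if "i \<in> I" for i
        unfolding M_def using member_le_sum[of i I w] fin that by simp
      then have "W a \<le> (\<Sum>i\<in>I. M * a i)" unfolding W_def by (intro sum_mono mult_le_mono1)
      also have "\<dots> = M * sum a I" by (simp add: sum_distrib_left)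
      also have "\<dots> \<le> M * N" using that by simp
      finally have "W a \<le> M * N" .
      then show ?thesis by (intro subsetD[OF fs.span_mono red[OF that(1)]]) auto
    qed
    then show "\<exists>S. finite S \<and> card S \<le> 2 ^ card I * D ^ card I * (M + 1) ^ k * (N + 1) ^ k \<and>
        (\<forall>a\<in>exps I. sum a I \<le> N \<longrightarrow> res Y (mon I a) \<in> fs.span S)"
      using cS cnt[of "M * N"] by (intro exI[of _ ?S]) auto
  qed
qed

text \<open>\<open>fs.dependent\<close> speaks of sets, but the count needs a family: a repeated
  member is already a relation, and otherwise the family is a set too large to be independent in the
  span of \<open>S\<close>.\<close>

lemma linear_relation:
  fixes f :: "'e \<Rightarrow> 'a \<Rightarrow> complex"
  assumes "finite E" "finite S" "card S < card E" "\<And>e. e \<in> E \<Longrightarrow> f e \<in> fs.span S"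
  shows "\<exists>c. (\<exists>e\<in>E. c e \<noteq> 0) \<and> (\<forall>y. (\<Sum>e\<in>E. c e * f e y) = 0)"
proof (cases "inj_on f E")
  case False
  then obtain e1 e2 where e: "e1 \<in> E" "e2 \<in> E" "e1 \<noteq> e2" "f e1 = f e2" by (auto simp: inj_on_def)
  let ?c = "\<lambda>e. if e = e1 then 1 else if e = e2 then -1 else (0::complex)"
  have "(\<Sum>e\<in>E. ?c e * f e y) = (\<Sum>e\<in>{e1, e2}. ?c e * f e y)" for y
    using assms(1) e by (intro sum.mono_neutral_right) auto
  then have "(\<Sum>e\<in>E. ?c e * f e y) = 0" for y using e by simp
  then show ?thesis using e by (intro exI[of _ ?c]) auto
next
  case True
  have "fs.dependent (f ` E)"
  proof (rule ccontr)
    assume "fs.independent (f ` E)"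
    from fs.independent_span_bound[OF assms(2) this] assms(4) have "card (f ` E) \<le> card S" by auto
    then show False using assms(3) card_image[OF True] by simp
  qed
  then obtain u where u: "\<exists>v\<in>f ` E. u v \<noteq> 0" "(\<Sum>v\<in>f ` E. (\<lambda>y. u v * v y)) = 0"
    using fs.dependent_finite[of "f ` E"] assms(1) by auto
  have "(\<Sum>e\<in>E. u (f e) * f e y) = 0" for y
    using fun_cong[OF u(2), of y] unfolding sum.reindex[OF True] by (simp add: sum_fun_apply)
  then show ?thesis using u(1) by (intro exI[of _ "\<lambda>e. u (f e)"]) auto
qed

lemma growth_deg_le:
  assumes "f \<in> deg_le I N" "\<forall>a\<in>exps I. sum a I \<le> N \<longrightarrow> res Y (mon I a) \<in> fs.span S"
  shows "res Y f \<in> fs.span S"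
  using assms(1) unfolding deg_le_def
proof (induction rule: fs.span_induct_alt)
  case base
  show ?case using fs.span_zero[of S] by (simp add: res_def zero_fun_def)
next
  case (step c b y)
  then have "res Y b \<in> fs.span S" using assms(2) by auto
  from fs.span_add[OF fs.span_scale[OF this, of c] step(2)]
  have "(\<lambda>z. c * res Y b z) + res Y y \<in> fs.span S" .
  then show ?case by (metis (no_types, lifting) ext plus_fun_def res_add res_scale)
qed

text \<open>Counting: the \<open>(N + 1) ^ m\<close> monomials in the quotients with exponents at
  most \<open>N\<close> get the common denominator \<open>Q ^ (m * N)\<close>, and their numerators
  are polynomials of degree at most \<open>m * N * d\<close>. If \<open>m > k\<close>, then for
  large \<open>N\<close> there are more of them than the growth of \<open>Y\<close> admits, so they
  are dependent on \<open>Y\<close>.\<close>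

lemma independent_le_growth:
  assumes fin: "finite I" and gr: "growth I Y k"
    and P: "\<And>j. j < m \<Longrightarrow> P j \<in> polynomials I" and Q: "Q \<in> polynomials I" "\<And>y. y \<in> Y \<Longrightarrow> Q y \<noteq> 0"
    and ind: "algebraically_independent_on Y m (\<lambda>j y. P j y / Q y)"
  shows "m \<le> k"
proof (rule ccontr)
  assume "\<not> m \<le> k"
  have "\<forall>j\<in>{..<m}. \<exists>d. P j \<in> deg_le I d" using P poly_deg_le[OF _ fin] by auto
  from bchoice[OF this] obtain dd where dd: "\<And>j. j < m \<Longrightarrow> P j \<in> deg_le I (dd j)" by auto
  obtain dq where dq: "Q \<in> deg_le I dq" using poly_deg_le[OF Q(1) fin] by auto
  define d where "d = dq + (\<Sum>j<m. dd j)"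
  have dP: "P j \<in> deg_le I d" if "j < m" for j
  proof (rule deg_le_mono[OF dd[OF that]])
    have "dd j \<le> (\<Sum>j<m. dd j)" using that by (intro member_le_sum) simp_all
    then show "dd j \<le> d" by (simp add: d_def)
  qed
  have dQ: "Q \<in> deg_le I d" by (rule deg_le_mono[OF dq]) (auto simp: d_def)
  obtain C where C: "\<And>N. \<exists>S. finite S \<and> card S \<le> C * (N + 1) ^ k \<and>
     (\<forall>a\<in>exps I. sum a I \<le> N \<longrightarrow> res Y (mon I a) \<in> fs.span S)" using gr unfolding growth_def by blast
  have key: "(N + 1) ^ m \<le> C * (m * (N * d) + 1) ^ k" for N
  proof (rule ccontr)
    assume neg: "\<not> ?thesis"
    obtain S where S: "finite S" "card S \<le> C * (m * (N * d) + 1) ^ k"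
      "\<forall>a\<in>exps I. sum a I \<le> m * (N * d) \<longrightarrow> res Y (mon I a) \<in> fs.span S" using C by blast
    define E where "E = (\<lambda>f i. if i \<in> {..<m} then f i else (0::nat)) ` (PiE {..<m} (\<lambda>_. {..N}))"
    have finE: "finite E" unfolding E_def by (intro finite_imageI finite_PiE) auto
    have cE: "card E = (N + 1) ^ m"
    proof -
      have "inj_on (\<lambda>f i. if i \<in> {..<m} then f i else (0::nat)) (PiE {..<m} (\<lambda>_. {..N}))"
      proof (rule inj_onI)
        fix f g assume fg: "f \<in> PiE {..<m} (\<lambda>_. {..N})" "g \<in> PiE {..<m} (\<lambda>_. {..N})"
          "(\<lambda>i. if i \<in> {..<m} then f i else 0) = (\<lambda>i. if i \<in> {..<m} then g i else 0)"
        have "f i = g i" if "i \<in> {..<m}" for i using fun_cong[OF fg(3), of i] that by simp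
        then show "f = g" using fg by (meson PiE_ext)
      qed
      then show ?thesis unfolding E_def by (simp add: card_image card_PiE)
    qed
    have Eex: "E \<subseteq> exps {..<m}" unfolding E_def exps_def by (rule image_subsetI) simp
    have EN: "e j \<le> N" if "e \<in> E" for e j
    proof -
      from that obtain f where f: "f \<in> PiE {..<m} (\<lambda>_. {..N})" "e = (\<lambda>i. if i \<in> {..<m} then f i else 0)"
        unfolding E_def by blast
      show ?thesis using PiE_mem[OF f(1), of j] by (simp add: f(2))
    qed
    \<comment> \<open>Each factor is filled up by powers of \<open>Q\<close> to total exponent
      \<open>N\<close>, so that all numerators belong to one denominator and one degree
      bound.\<close>
    define G where "G e y = (\<Prod>j<m. P j y ^ e j * Q y ^ (N - e j))" for e :: "nat \<Rightarrow> nat" and y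
    have Gd: "G e \<in> deg_le I (m * (N * d))" if "e \<in> E" for e
    proof -
      have "(\<lambda>y. P j y ^ e j * Q y ^ (N - e j)) \<in> deg_le I (N * d)" if "j \<in> {..<m}" for j
      proof -
        have "(\<lambda>y. P j y ^ e j * Q y ^ (N - e j)) \<in> deg_le I (e j * d + (N - e j) * d)"
          using dP dQ that by (intro deg_le_mult deg_le_power) auto
        also have "e j * d + (N - e j) * d = N * d"
          using EN[OF \<open>e \<in> E\<close>, of j] by (simp add: add_mult_distrib[symmetric])
        finally show ?thesis .
      qed
      from deg_le_prod[OF this, of "{..<m}"] show ?thesis unfolding G_def by simp
    qed
    have "card S < card E" using S(2) neg cE by simp
    from linear_relation[OF finE S(1) this, of "\<lambda>e. res Y (G e)"] growth_deg_le[OF Gd S(3)]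
    obtain c where c: "\<exists>e\<in>E. c e \<noteq> 0" "\<And>y. (\<Sum>e\<in>E. c e * res Y (G e) y) = 0" by blast
    define p where "p z = (\<Sum>e\<in>E. c e * mon {..<m} e z)" for z
    have pp: "p \<in> polynomials {..<m}" unfolding p_def
      by (intro polynomials_sum polynomials.mult polynomials.const mon_poly)
    have "p (\<lambda>j. P j y / Q y) = 0" if y: "y \<in> Y" for y
    proof -
      have "mon {..<m} e (\<lambda>j. P j y / Q y) * Q y ^ (m * N) = G e y" if "e \<in> E" for e
      proof -
        have "Q y ^ (m * N) = (\<Prod>j<m. Q y ^ N)" by (simp add: power_mult mult.commute)
        then have "mon {..<m} e (\<lambda>j. P j y / Q y) * Q y ^ (m * N) = (\<Prod>j<m. (P j y / Q y) ^ e j * Q y ^ N)"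
          by (simp add: mon_def prod.distrib)
        also have "\<dots> = G e y" unfolding G_def
        proof (rule prod.cong[OF refl])
          fix j
          have "Q y ^ N = Q y ^ e j * Q y ^ (N - e j)" using EN[OF that, of j] by (simp add: power_add[symmetric])
          then show "(P j y / Q y) ^ e j * Q y ^ N = P j y ^ e j * Q y ^ (N - e j)"
            using Q(2)[OF y] by (simp add: power_divide)
        qed
        finally show ?thesis .
      qed
      then have "p (\<lambda>j. P j y / Q y) * Q y ^ (m * N) = (\<Sum>e\<in>E. c e * G e y)"
        unfolding p_def by (simp add: sum_distrib_right mult.assoc)
      also have "\<dots> = 0" using c(2)[of y] y by (simp add: res_def)
      finally show ?thesis using Q(2)[OF y] by simp
    qed
    then have "p z = 0" for z using ind pp unfolding algebraically_independent_on_def by blast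
    then have "c e = 0" if "e \<in> E" for e
      using poly_zero_coeffs[OF _ finE Eex, of c e] that unfolding p_def by auto
    then show False using c(1) by blast
  qed
  \<comment> \<open>With this \<open>N\<close> the upper bound is at most
    \<open>N * (N + 1) ^ k\<close>, while the number of monomials is at least
    \<open>(N + 1) ^ (k + 1)\<close>.\<close>
  define N where "N = C * (m * d + 1) ^ k"
  have "(N + 1) * (N + 1) ^ k \<le> (N + 1) ^ m"
    using power_increasing[of "Suc k" m "N + 1"] \<open>\<not> m \<le> k\<close> by simp
  also have "\<dots> \<le> C * (m * (N * d) + 1) ^ k" by (rule key)
  also have "\<dots> \<le> C * ((m * d + 1) * (N + 1)) ^ k"
    by (intro mult_le_mono2 power_mono) (auto simp: algebra_simps)
  also have "\<dots> = N * (N + 1) ^ k" unfolding N_def by (simp only: power_mult_distrib mult.assoc)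
  finally show False by simp
qed

subsection \<open>Dimension\<close>

lemma le_alg_dimI:
  assumes "\<And>j. j < m \<Longrightarrow> f j \<in> polynomials I" "algebraically_independent_on Y m f"
  shows "enat m \<le> alg_dim I Y"
  unfolding alg_dim_def by (rule Sup_upper) (use assms in auto)

lemma alg_dim_leI:
  assumes "\<And>m f. (\<And>j. j < m \<Longrightarrow> f j \<in> polynomials I) \<Longrightarrow> algebraically_independent_on Y m f \<Longrightarrow> enat m \<le> b"
  shows "alg_dim I Y \<le> b"
  unfolding alg_dim_def by (rule Sup_least) (use assms in auto)

text \<open>It suffices to test coordinate functions: any \<open>k + 1\<close> of them are dependent
  on \<open>Y\<close>, which is the input of \<open>growth_of_dependent\<close>.\<close>

lemma growth_of_alg_dim:
  assumes fin: "finite I" and le: "alg_dim I Y \<le> enat k"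
  shows "growth I Y k"
proof (rule growth_of_dependent[OF fin])
  fix S assume S: "S \<subseteq> I" "card S = Suc k"
  then have finS: "finite S" using fin by (auto intro: finite_subset)
  obtain h where h: "bij_betw h {..<Suc k} S" using ex_bij_betw_nat_finite[OF finS] S by (auto simp: atLeast0LessThan)
  have hS: "h j \<in> S" if "j < Suc k" for j using h that by (auto simp: bij_betw_def)
  have "\<not> algebraically_independent_on Y (Suc k) (\<lambda>j y. y (h j))"
  proof
    assume "algebraically_independent_on Y (Suc k) (\<lambda>j y. y (h j))"
    then have "enat (Suc k) \<le> alg_dim I Y"
      using hS S(1) by (intro le_alg_dimI[where f = "\<lambda>j y. y (h j)"]) (auto intro: polynomials.coord)
    then show False using le by (metis Suc_n_not_le_n enat_ord_simps(1) order_trans)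
  qed
  then obtain p z where p: "p \<in> polynomials {..<Suc k}" "\<forall>y\<in>Y. p (\<lambda>j. y (h j)) = 0" "p z \<noteq> 0"
    unfolding algebraically_independent_on_def by blast
  have "(\<lambda>y. p (\<lambda>j. y (h j))) \<in> polynomials S"
    using polynomials_subst[OF p(1), of "\<lambda>j y. y (h j)" S] hS by (auto intro: polynomials.coord)
  \<comment> \<open>The coordinates \<open>h j\<close> are distinct, so a point where
    \<open>p\<close> is nonzero lifts to one where the relation between them is nonzero.\<close>
  moreover have "p (\<lambda>j. (z \<circ> the_inv_into {..<Suc k} h) (h j)) = p z"
    using h by (intro polynomials_cong[OF p(1)]) (auto simp: bij_betw_def the_inv_into_f_f simp del: lessThan_Suc)
  ultimately show "\<exists>p\<in>polynomials S. (\<exists>x. p x \<noteq> 0) \<and> (\<forall>y\<in>Y. p y = 0)"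
    using p by (intro bexI[of _ "\<lambda>y. p (\<lambda>j. y (h j))"] conjI exI[of _ "z \<circ> the_inv_into {..<Suc k} h"]) auto
qed

text \<open>The dimension in the definition allows polynomial functions only. Growth bounds the
  number of independent quotients by the same value, and this is what makes the dimension comparable
  under rational maps.\<close>

lemma le_alg_dim_rational:
  assumes fin: "finite I"
    and P: "\<And>j. j < m \<Longrightarrow> P j \<in> polynomials I" and Q: "Q \<in> polynomials I" "\<And>y. y \<in> Y \<Longrightarrow> Q y \<noteq> 0"
    and ind: "algebraically_independent_on Y m (\<lambda>j y. P j y / Q y)"
  shows "enat m \<le> alg_dim I Y"
proof (rule ccontr)
  assume "\<not> enat m \<le> alg_dim I Y"
  then have lt: "alg_dim I Y < enat m" by simp
  then obtain k where k: "alg_dim I Y = enat k" "k < m" by (cases "alg_dim I Y") auto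
  have "growth I Y k" by (rule growth_of_alg_dim[OF fin]) (simp add: k)
  from independent_le_growth[OF fin this P Q ind] k show False by simp
qed

lemma alg_dim_mono:
  assumes "Y \<subseteq> Z" shows "alg_dim I Y \<le> alg_dim I Z"
  by (rule alg_dim_leI, rule le_alg_dimI) (use assms in \<open>auto simp: algebraically_independent_on_def subset_eq\<close>)

text \<open>The supremum may be infinite, so a finite family is extracted for each \<open>m\<close>
  separately. On the empty set even the empty family is dependent, because a nonzero constant
  vanishes there vacuously; hence \<open>Y \<noteq> {}\<close>.\<close>

lemma independent_of_le_alg_dim:
  assumes "enat m \<le> alg_dim I Y" "Y \<noteq> {}"
  shows "\<exists>f. (\<forall>j<m. f j \<in> polynomials I) \<and> algebraically_independent_on Y m f"
proof (cases m)
  case 0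
  have "algebraically_independent_on Y 0 f" for f :: "nat \<Rightarrow> ('a \<Rightarrow> complex) \<Rightarrow> complex"
    unfolding algebraically_independent_on_def
  proof (intro ballI impI allI)
    fix p z assume p: "p \<in> polynomials {..<0}" "\<forall>y\<in>Y. p (\<lambda>j. f j y) = 0"
    obtain y where "y \<in> Y" using assms by auto
    then have "p (\<lambda>j. f j y) = 0" using p by auto
    then show "p z = 0" using polynomials_cong[OF p(1), of z "\<lambda>j. f j y"] by auto
  qed
  then show ?thesis using 0 by auto
next
  case (Suc m')
  have "\<exists>k f. m \<le> k \<and> (\<forall>j<k. f j \<in> polynomials I) \<and> algebraically_independent_on Y k f"
  proof (rule ccontr)
    assume neg: "\<not> ?thesis"
    have "alg_dim I Y \<le> enat m'"
    proof (rule alg_dim_leI)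
      fix k f assume "\<And>j. j < k \<Longrightarrow> f j \<in> polynomials I" "algebraically_independent_on Y k f"
      then have "\<not> m \<le> k" using neg by auto
      then show "enat k \<le> enat m'" using Suc by simp
    qed
    then show False using assms(1) Suc by (metis Suc_n_not_le_n enat_ord_simps(1) order_trans)
  qed
  then obtain k f where kf: "m \<le> k" "\<forall>j<k. f j \<in> polynomials I" "algebraically_independent_on Y k f" by auto
  have "algebraically_independent_on Y m f"
    using kf(1,3) polynomials_mono[of _ "{..<m}" "{..<k}"] unfolding algebraically_independent_on_def by auto
  then show ?thesis using kf by (intro exI[of _ f]) auto
qed

section \<open>Products with an affine space: growth and dimension\<close>

definition restr :: "'i set \<Rightarrow> ('i \<Rightarrow> complex) \<Rightarrow> 'i \<Rightarrow> complex" where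
  "restr J z = (\<lambda>i. if i \<in> J then z i else 0)"

text \<open>The product \<open>Y \<times> \<complex>\<^sup>K\<close>.\<close>

definition cyl :: "'i set \<Rightarrow> 'i set \<Rightarrow> ('i \<Rightarrow> complex) set \<Rightarrow> ('i \<Rightarrow> complex) set" where
  "cyl J K Y = {z \<in> affine_space (J \<union> K). restr J z \<in> Y}"

lemma restr_affine: "restr J z \<in> affine_space J"
  by (simp add: restr_def affine_space_def)

lemma restr_id: "z \<in> affine_space J \<Longrightarrow> restr J z = z"
  by (auto simp: restr_def affine_space_def)

lemma polynomials_restr: "f \<in> polynomials J \<Longrightarrow> f (restr J z) = f z"
  using polynomials_cong[of f J "restr J z" z] by (simp add: restr_def)

text \<open>A monomial splits into a part over \<open>J\<close>, whose restriction lies in the span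
  already found for \<open>Y\<close>, and one of at most \<open>(N + 1) ^ card K\<close> monomials
  over \<open>K\<close>.\<close>

lemma growth_cyl:
  assumes fin: "finite J" "finite K" "J \<inter> K = {}" and gr: "growth J Y k"
  shows "growth (J \<union> K) (cyl J K Y) (k + card K)"
proof -
  obtain C where C: "\<And>N. \<exists>S. finite S \<and> card S \<le> C * (N + 1) ^ k \<and>
     (\<forall>a\<in>exps J. sum a J \<le> N \<longrightarrow> res Y (mon J a) \<in> fs.span S)" using gr unfolding growth_def by blast
  show ?thesis unfolding growth_def
  proof (rule exI[of _ C], rule allI)
    fix N
    obtain S where S: "finite S" "card S \<le> C * (N + 1) ^ k"
      "\<forall>a\<in>exps J. sum a J \<le> N \<longrightarrow> res Y (mon J a) \<in> fs.span S" using C by blast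
    let ?Z = "cyl J K Y"
    let ?E = "{b \<in> exps K. \<forall>i\<in>K. b i < N + 1}"
    define T where "T = (\<lambda>b s. res ?Z (\<lambda>z. s (restr J z) * mon K b z))"
    let ?S = "(\<lambda>(s, b). T b s) ` (S \<times> ?E)"
    have finS: "finite ?S" using S(1) card_exps_le(1)[OF fin(2), of "\<lambda>_. N + 1"] by (intro finite_imageI finite_cartesian_product) auto
    have "card ?S \<le> card (S \<times> ?E)"
      using S(1) card_exps_le(1)[OF fin(2), of "\<lambda>_. N + 1"] by (intro card_image_le finite_cartesian_product) auto
    also have "\<dots> = card S * card ?E" by (rule card_cartesian_product)
    also have "\<dots> \<le> C * (N + 1) ^ k * (N + 1) ^ card K"
      using S(2) card_exps_le(2)[OF fin(2), of "\<lambda>_. N + 1"] by (intro mult_le_mono) auto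
    finally have cS: "card ?S \<le> C * (N + 1) ^ (k + card K)" by (simp add: power_add)
    have Tsp: "T b f \<in> fs.span ?S" if "f \<in> fs.span S" "b \<in> ?E" for f b
      using that(1)
    proof (induction rule: fs.span_induct_alt)
      case base
      have "T b 0 = 0" by (simp add: T_def res_def fun_eq_iff)
      then show ?case by (metis fs.span_zero)
    next
      case (step c s y)
      have "T b s \<in> fs.span ?S" using step(1) that(2) by (intro fs.span_base image_eqI[of _ _ "(s, b)"]) auto
      from fs.span_add[OF fs.span_scale[OF this, of c] step(2)]
      show ?case
        by (rule back_subst[of "\<lambda>x. x \<in> fs.span ?S"]) (simp add: T_def res_def fun_eq_iff algebra_simps)
    qed
    have "res ?Z (mon (J \<union> K) a) \<in> fs.span ?S" if a: "a \<in> exps (J \<union> K)" "sum a (J \<union> K) \<le> N" for a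
    proof -
      let ?aJ = "\<lambda>i. if i \<in> J then a i else 0" and ?aK = "\<lambda>i. if i \<in> K then a i else 0"
      have s: "sum a J + sum a K \<le> N" using a(2) fin by (simp add: sum.union_disjoint)
      have "?aJ \<in> exps J" "sum ?aJ J \<le> N" using s by (auto simp: exps_def)
      then have 1: "res Y (mon J ?aJ) \<in> fs.span S" using S(3) by blast
      have "a i \<le> N" if "i \<in> K" for i using s member_le_sum[of i K a] that fin by simp
      then have 2: "?aK \<in> ?E" by (auto simp: exps_def less_Suc_eq_le)
      have "res ?Z (mon (J \<union> K) a) = T ?aK (res Y (mon J ?aJ))"
      proof
        fix z show "res ?Z (mon (J \<union> K) a) z = T ?aK (res Y (mon J ?aJ)) z"
        proof (cases "z \<in> ?Z")
          case True
          then have "restr J z \<in> Y" by (simp add: cyl_def)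
          moreover have "mon (J \<union> K) a z = mon J ?aJ (restr J z) * mon K ?aK z"
            unfolding mon_def using fin by (simp add: prod.union_disjoint restr_def)
          ultimately show ?thesis using True by (simp add: T_def res_def)
        qed (simp add: T_def res_def)
      qed
      then show ?thesis using Tsp[OF 1 2] by simp
    qed
    then show "\<exists>S. finite S \<and> card S \<le> C * (N + 1) ^ (k + card K) \<and>
       (\<forall>a\<in>exps (J \<union> K). sum a (J \<union> K) \<le> N \<longrightarrow> res ?Z (mon (J \<union> K) a) \<in> fs.span S)"
      using finS cS by (intro exI[of _ ?S]) auto
  qed
qed

text \<open>An upper bound for arbitrary families on the product is not visible from families on the
  factors; growth supplies it.\<close>

lemma alg_dim_cyl_le:
  assumes fin: "finite J" "finite K" "J \<inter> K = {}"
  shows "alg_dim (J \<union> K) (cyl J K Y) \<le> alg_dim J Y + enat (card K)"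
proof (cases "alg_dim J Y")
  case (enat k)
  have gr: "growth (J \<union> K) (cyl J K Y) (k + card K)"
    by (rule growth_cyl[OF fin growth_of_alg_dim[OF fin(1)]]) (simp add: enat)
  show ?thesis
  proof (rule alg_dim_leI)
    fix m f assume f: "\<And>j. j < m \<Longrightarrow> f j \<in> polynomials (J \<union> K)" "algebraically_independent_on (cyl J K Y) m f"
    have "m \<le> k + card K"
      by (rule independent_le_growth[OF _ gr, of m f "\<lambda>_. 1"]) (use fin f polynomials.const in auto)
    then show "enat m \<le> alg_dim J Y + enat (card K)" by (simp add: enat)
  qed
qed simp

text \<open>Restriction to lines replaces the irreducibility of affine space in
  \<open>alg_dim_cyl_ge\<close>.\<close>

lemma line_poly:
  assumes "f \<in> polynomials I"
  shows "\<exists>q. \<forall>s. f (\<lambda>i. x i + s * v i) = poly q s"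
  using assms
proof induction
  case (const c)
  then show ?case by (intro exI[of _ "[:c:]"]) simp
next
  case (coord i)
  then show ?case by (intro exI[of _ "[:x i, v i:]"]) simp
next
  case (add f g)
  then show ?case by (metis poly_add)
next
  case (mult f g)
  then show ?case by (metis poly_mult)
qed

text \<open>Independent functions on \<open>Y0\<close> together with the coordinates in
  \<open>K\<close> stay independent on the open part \<open>h \<noteq> 0\<close>. Over a point of
  \<open>Y0\<close>, a line in the directions of \<open>K\<close> starts where \<open>h\<close> is
  nonzero; a relation vanishes at almost all points of the line, hence at all of them.\<close>

lemma alg_dim_cyl_ge:
  assumes fin: "finite J" "finite K" "J \<inter> K = {}" and Y: "Y \<subseteq> affine_space J"
    and h: "h \<in> polynomials (J \<union> K)"
    and Y0: "Y0 = {y \<in> Y. h (\<lambda>i. if i \<in> K then c i else y i) \<noteq> 0}" "Y0 \<noteq> {}"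
  shows "alg_dim J Y0 + enat (card K) \<le> alg_dim (J \<union> K) {z \<in> cyl J K Y. h z \<noteq> 0}"
proof -
  let ?d = "card K" and ?Z = "{z \<in> cyl J K Y. h z \<noteq> 0}"
  have main: "enat (m + ?d) \<le> alg_dim (J \<union> K) ?Z" if m: "enat m \<le> alg_dim J Y0" for m
  proof -
    obtain f where f: "\<And>j. j < m \<Longrightarrow> f j \<in> polynomials J" "algebraically_independent_on Y0 m f"
      using independent_of_le_alg_dim[OF m Y0(2)] by blast
    obtain \<kappa> where \<kappa>: "bij_betw \<kappa> {..<?d} K" using ex_bij_betw_nat_finite[OF fin(2)] by (auto simp: atLeast0LessThan)
    define F where "F = (\<lambda>j z. if j < m then f j z else z (\<kappa> (j - m)))"
    have \<kappa>K: "\<kappa> j \<in> K" if "j < ?d" for j using \<kappa> that by (auto simp: bij_betw_def)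
    have "F j \<in> polynomials (J \<union> K)" if "j < m + ?d" for j
    proof (cases "j < m")
      case True
      then show ?thesis using polynomials_mono[OF f(1)[OF True], of "J \<union> K"] by (simp add: F_def)
    next
      case False
      then show ?thesis using that \<kappa>K[of "j - m"] by (simp add: F_def polynomials.coord)
    qed
    moreover have "algebraically_independent_on ?Z (m + ?d) F"
      unfolding algebraically_independent_on_def
    proof (intro ballI impI allI)
      fix p w assume p: "p \<in> polynomials {..<m + ?d}" and p0: "\<forall>z\<in>?Z. p (\<lambda>j. F j z) = 0"
      have 1: "p (\<lambda>j. if j < m then f j y else w j) = 0" if y: "y \<in> Y0" for y
      proof -
        \<comment> \<open>The line starts at the values \<open>c\<close>, where \<open>h\<close>
          does not vanish, and at \<open>s = 1\<close> reaches the arbitrary values \<open>w\<close>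
          of the coordinates in \<open>K\<close>.\<close>
        define x where "x = (\<lambda>i. if i \<in> K then c i else y i)"
        define v where "v = (\<lambda>i. if i \<in> K then w (m + the_inv_into {..<?d} \<kappa> i) - c i else 0)"
        have yJ: "y \<in> Y" "y \<in> affine_space J" using y Y Y0 by auto
        have xJ: "restr J (\<lambda>i. x i + s * v i) = y" for s
          using fin(3) yJ(2) by (auto simp: restr_def x_def v_def affine_space_def fun_eq_iff)
        have Fl: "F j (\<lambda>i. x i + s * v i) = (if j < m then f j y else x (\<kappa> (j - m)) + s * v (\<kappa> (j - m)))" for j s
          using f(1)[of j] polynomials_restr[of "f j" J "\<lambda>i. x i + s * v i"] by (auto simp: F_def xJ)
        obtain q1 where q1: "\<And>s. h (\<lambda>i. x i + s * v i) = poly q1 s" using line_poly[OF h] by blast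
        obtain q2 where q2: "\<And>s. p (\<lambda>j. (if j < m then f j y else x (\<kappa> (j - m))) + s * (if j < m then 0 else v (\<kappa> (j - m)))) = poly q2 s"
          using line_poly[OF p, of "\<lambda>j. if j < m then f j y else x (\<kappa> (j - m))" "\<lambda>j. if j < m then 0 else v (\<kappa> (j - m))"]
          by blast
        have q2': "p (\<lambda>j. F j (\<lambda>i. x i + s * v i)) = poly q2 s" for s
          unfolding q2[symmetric] Fl by (rule arg_cong[of _ _ p]) auto
        have "poly (q1 * q2) s = 0" for s
        proof (cases "poly q1 s = 0")
          case False
          have "(\<lambda>i. x i + s * v i) \<in> affine_space (J \<union> K)"
            using yJ(2) by (auto simp: affine_space_def x_def v_def)
          then have "(\<lambda>i. x i + s * v i) \<in> ?Z" using False q1 xJ yJ by (simp add: cyl_def)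
          from bspec[OF p0 this] show ?thesis unfolding q2' by simp
        qed simp
        then have "q1 * q2 = 0" using poly_all_0_iff_0[of "q1 * q2"] by blast
        moreover have "q1 \<noteq> 0"
        proof
          assume "q1 = 0"
          then have "h (\<lambda>i. x i + 0 * v i) = 0" unfolding q1 by simp
          then show False using y Y0 by (simp add: x_def)
        qed
        ultimately have "poly q2 1 = 0" by simp
        then have "p (\<lambda>j. F j (\<lambda>i. x i + 1 * v i)) = 0" using q2' by metis
        moreover have "p (\<lambda>j. F j (\<lambda>i. x i + 1 * v i)) = p (\<lambda>j. if j < m then f j y else w j)"
        proof (rule polynomials_cong[OF p])
          fix j assume "j \<in> {..<m + ?d}"
          then have "j < m \<or> j - m < ?d \<and> m \<le> j" by auto
          then show "F j (\<lambda>i. x i + 1 * v i) = (if j < m then f j y else w j)"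
            unfolding Fl using \<kappa>K[of "j - m"] \<kappa> the_inv_into_f_f[of \<kappa> "{..<?d}" "j - m"]
            by (auto simp: x_def v_def bij_betw_def)
        qed
        ultimately show ?thesis by simp
      qed
      have "(\<lambda>u. if j < m then u j else w j) \<in> polynomials {..<m}" for j
        by (cases "j < m") (simp_all add: polynomials.coord polynomials.const)
      then have "(\<lambda>u. p (\<lambda>j. if j < m then u j else w j)) \<in> polynomials {..<m}"
        by (rule polynomials_subst[OF p])
      from f(2)[unfolded algebraically_independent_on_def, THEN bspec, OF this, THEN mp] 1
      have "\<forall>z. p (\<lambda>j. if j < m then z j else w j) = 0" by simp
      from spec[OF this, of w] show "p w = 0" by simp
    qed
    ultimately show ?thesis by (rule le_alg_dimI)
  qed
  show ?thesis
  proof (cases "alg_dim J Y0")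
    case (enat k)
    then show ?thesis using main[of k] by simp
  next
    case infinity
    have le: "enat (m + ?d) \<le> alg_dim (J \<union> K) ?Z" for m
      by (rule main) (simp add: infinity)
    have "alg_dim (J \<union> K) ?Z = \<infinity>"
    proof (cases "alg_dim (J \<union> K) ?Z")
      case (enat k)
      then show ?thesis using le[of "Suc k"] by simp
    qed
    then show ?thesis by simp
  qed
qed

section \<open>Zariski closures and local dimension\<close>

definition zariski_cl :: "'i set \<Rightarrow> ('i \<Rightarrow> complex) set \<Rightarrow> ('i \<Rightarrow> complex) set" where
  "zariski_cl I A = {x \<in> affine_space I. \<forall>f\<in>vanishing_ideal I A. f x = 0}"

lemma zariski_clD: "x \<in> zariski_cl I A \<Longrightarrow> f \<in> vanishing_ideal I A \<Longrightarrow> f x = 0"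
  by (simp add: zariski_cl_def)

lemma zariski_cl_nonvanishing:
  assumes "x \<in> zariski_cl I A" "h \<in> polynomials I" "h x \<noteq> 0"
  shows "\<exists>y\<in>A. h y \<noteq> 0"
proof (rule ccontr)
  assume "\<not> ?thesis"
  then have "h \<in> vanishing_ideal I A" using assms(2) by (simp add: vanishing_ideal_def)
  then show False using zariski_clD[OF assms(1)] assms(3) by blast
qed

text \<open>\<open>enat\<close> is well-ordered, so the infimum is a minimum and one principal
  neighbourhood realizes the local dimension.\<close>

lemma local_dim_attained:
  "\<exists>h. h \<in> polynomials I \<and> h x \<noteq> 0 \<and> local_dim I X x = alg_dim I {y \<in> X. h y \<noteq> 0}"
proof -
  let ?S = "{alg_dim I {y \<in> X. h y \<noteq> 0} |h. h \<in> polynomials I \<and> h x \<noteq> 0}"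
  have "alg_dim I {y \<in> X. (\<lambda>_. 1 :: complex) y \<noteq> 0} \<in> ?S"
    by (rule CollectI, rule exI[of _ "\<lambda>_. 1"]) (simp add: polynomials.const)
  then have "Inf ?S \<in> ?S" by (rule wellorder_InfI)
  then show ?thesis unfolding local_dim_def by blast
qed

lemma local_dim_le: "h \<in> polynomials I \<Longrightarrow> h x \<noteq> 0 \<Longrightarrow> local_dim I X x \<le> alg_dim I {y \<in> X. h y \<noteq> 0}"
  unfolding local_dim_def by (rule Inf_lower) blast

text \<open>An optimal neighbourhood of the base point pulls back to the product. Conversely, an
  optimal one in the product is cut with the slice through \<open>z0\<close>, which gives a
  neighbourhood in the base; membership in the closure makes this neighbourhood meet
  \<open>Y\<close>.\<close>

lemma local_dim_cyl:
  assumes fin: "finite J" "finite K" "J \<inter> K = {}" and Y: "Y \<subseteq> affine_space J"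
    and z0: "z0 \<in> affine_space (J \<union> K)" "restr J z0 \<in> zariski_cl J Y"
  shows "local_dim (J \<union> K) (cyl J K Y) z0 = local_dim J Y (restr J z0) + enat (card K)"
proof (rule antisym)
  obtain h where h: "h \<in> polynomials J" "h (restr J z0) \<noteq> 0"
    "local_dim J Y (restr J z0) = alg_dim J {y \<in> Y. h y \<noteq> 0}"
    using local_dim_attained[of J "restr J z0" Y] by blast
  have "{z \<in> cyl J K Y. h z \<noteq> 0} = cyl J K {y \<in> Y. h y \<noteq> 0}"
    using polynomials_restr[OF h(1)] by (auto simp: cyl_def)
  moreover have "local_dim (J \<union> K) (cyl J K Y) z0 \<le> alg_dim (J \<union> K) {z \<in> cyl J K Y. h z \<noteq> 0}"
    using h polynomials_restr[OF h(1), of z0] by (intro local_dim_le) (auto intro: polynomials_mono)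
  ultimately show "local_dim (J \<union> K) (cyl J K Y) z0 \<le> local_dim J Y (restr J z0) + enat (card K)"
    using alg_dim_cyl_le[OF fin, of "{y \<in> Y. h y \<noteq> 0}"] h(3) by simp
next
  obtain h where h: "h \<in> polynomials (J \<union> K)" "h z0 \<noteq> 0"
    "local_dim (J \<union> K) (cyl J K Y) z0 = alg_dim (J \<union> K) {y \<in> cyl J K Y. h y \<noteq> 0}"
    using local_dim_attained[of "J \<union> K" z0 "cyl J K Y"] by blast
  define h' where "h' = (\<lambda>y. h (\<lambda>i. if i \<in> K then z0 i else y i))"
  have hp: "h' \<in> polynomials J" unfolding h'_def
  proof (rule polynomials_subst[OF h(1)])
    fix i assume "i \<in> J \<union> K"
    then show "(\<lambda>y. if i \<in> K then z0 i else y i) \<in> polynomials J"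
      by (cases "i \<in> K") (simp_all add: polynomials.coord polynomials.const)
  qed
  have "(\<lambda>i. if i \<in> K then z0 i else restr J z0 i) = z0"
    using z0(1) by (auto simp: restr_def affine_space_def)
  then have h0: "h' (restr J z0) \<noteq> 0" using h(2) by (simp add: h'_def)
  obtain y where "y \<in> Y" "h' y \<noteq> 0"
    using zariski_cl_nonvanishing[OF z0(2) hp h0] by blast
  then have "{y \<in> Y. h' y \<noteq> 0} \<noteq> {}" by auto
  from alg_dim_cyl_ge[OF fin Y h(1) _ this, of z0] h(3)
  have "alg_dim J {y \<in> Y. h' y \<noteq> 0} + enat (card K) \<le> local_dim (J \<union> K) (cyl J K Y) z0"
    by (simp add: h'_def)
  moreover have "local_dim J Y (restr J z0) \<le> alg_dim J {y \<in> Y. h' y \<noteq> 0}" by (rule local_dim_le[OF hp h0])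
  ultimately show "local_dim J Y (restr J z0) + enat (card K) \<le> local_dim (J \<union> K) (cyl J K Y) z0"
    by (meson add_right_mono order_trans)
qed

text \<open>If \<open>p\<close> of the functions \<open>f j\<close> vanishes on the part of
  \<open>A\<close> where \<open>h\<close> is nonzero, its product with \<open>h\<close> vanishes on
  all of \<open>A\<close>, and therefore on the closure.\<close>

lemma alg_dim_zariski_cl:
  assumes A: "A \<subseteq> affine_space I" and h: "h \<in> polynomials I"
  shows "alg_dim I {y \<in> zariski_cl I A. h y \<noteq> 0} = alg_dim I {y \<in> A. h y \<noteq> 0}"
proof (rule antisym)
  show "alg_dim I {y \<in> zariski_cl I A. h y \<noteq> 0} \<le> alg_dim I {y \<in> A. h y \<noteq> 0}"
  proof (rule alg_dim_leI, rule le_alg_dimI)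
    fix m f assume f: "\<And>j. j < m \<Longrightarrow> f j \<in> polynomials I"
      "algebraically_independent_on {y \<in> zariski_cl I A. h y \<noteq> 0} m f"
    show "algebraically_independent_on {y \<in> A. h y \<noteq> 0} m f"
      unfolding algebraically_independent_on_def
    proof (intro ballI impI allI)
      fix p z assume p: "p \<in> polynomials {..<m}" "\<forall>y\<in>{y \<in> A. h y \<noteq> 0}. p (\<lambda>j. f j y) = 0"
      have "(\<lambda>y. h y * p (\<lambda>j. f j y)) \<in> polynomials I"
        using polynomials.mult[OF h polynomials_subst[OF p(1), of f I]] f(1) by auto
      then have "(\<lambda>y. h y * p (\<lambda>j. f j y)) \<in> vanishing_ideal I A" using p(2) by (auto simp: vanishing_ideal_def)
      then have "p (\<lambda>j. f j y) = 0" if "y \<in> zariski_cl I A" "h y \<noteq> 0" for y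
        using zariski_clD[OF that(1), of "\<lambda>y. h y * p (\<lambda>j. f j y)"] that(2) by simp
      then show "p z = 0" using f(2) p(1) unfolding algebraically_independent_on_def by blast
    qed
  qed
  show "alg_dim I {y \<in> A. h y \<noteq> 0} \<le> alg_dim I {y \<in> zariski_cl I A. h y \<noteq> 0}"
    by (rule alg_dim_mono) (use A in \<open>auto simp: zariski_cl_def vanishing_ideal_def\<close>)
qed

text \<open>This removes closures from all later comparisons: both invariants are computed from
  \<open>A\<close>, and only the membership of \<open>x\<close> refers to the closure.\<close>

lemma singular_point_zariski_cl:
  assumes A: "A \<subseteq> affine_space I"
  shows "singular_point I (zariski_cl I A) x \<longleftrightarrow>
    x \<in> zariski_cl I A \<and> enat (tangent_dim I A x) \<noteq> local_dim I A x"
proof -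
  have "vanishing_ideal I (zariski_cl I A) = vanishing_ideal I A"
    using A by (auto simp: vanishing_ideal_def zariski_cl_def)
  then have "tangent_dim I (zariski_cl I A) x = tangent_dim I A x"
    by (simp add: tangent_dim_def tangent_space_def)
  moreover have "local_dim I (zariski_cl I A) x = local_dim I A x"
    unfolding local_dim_def
    by (rule arg_cong[where f = Inf]) (metis (no_types, lifting) alg_dim_zariski_cl[OF A])
  ultimately show ?thesis by (simp add: singular_point_def)
qed

subsection \<open>Regular functions and local isomorphisms\<close>

text \<open>The quotient has to represent \<open>R\<close> on an open subset of the ambient space,
  not just on a subvariety, because derivatives are taken along lines that leave the set.\<close>

definition regular_at :: "'i set \<Rightarrow> ('i \<Rightarrow> complex) \<Rightarrow> (('i \<Rightarrow> complex) \<Rightarrow> complex) \<Rightarrow> bool" where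
  "regular_at I x0 R \<longleftrightarrow> (\<exists>F\<in>polynomials I. \<exists>H\<in>polynomials I. H x0 \<noteq> 0 \<and> (\<forall>x. H x \<noteq> 0 \<longrightarrow> R x = F x / H x))"

lemma regular_atI:
  "F \<in> polynomials I \<Longrightarrow> H \<in> polynomials I \<Longrightarrow> H x0 \<noteq> 0 \<Longrightarrow> (\<And>x. H x \<noteq> 0 \<Longrightarrow> R x = F x / H x) \<Longrightarrow> regular_at I x0 R"
  unfolding regular_at_def by blast

lemma regular_at_poly: "F \<in> polynomials I \<Longrightarrow> regular_at I x0 F"
  by (rule regular_atI[of F I "\<lambda>_. 1"]) (auto intro: polynomials.const)

lemma regular_at_add:
  assumes "regular_at I x0 R" "regular_at I x0 S"
  shows "regular_at I x0 (\<lambda>x. R x + S x)"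
proof -
  from assms obtain F H G K where *: "F \<in> polynomials I" "H \<in> polynomials I" "H x0 \<noteq> 0" "\<And>x. H x \<noteq> 0 \<Longrightarrow> R x = F x / H x"
    "G \<in> polynomials I" "K \<in> polynomials I" "K x0 \<noteq> 0" "\<And>x. K x \<noteq> 0 \<Longrightarrow> S x = G x / K x"
    unfolding regular_at_def by metis
  show ?thesis
    by (rule regular_atI[of "\<lambda>x. F x * K x + G x * H x" I "\<lambda>x. H x * K x"])
      (use * in \<open>auto intro!: polynomials.intros simp: field_simps\<close>)
qed

lemma regular_at_mult:
  assumes "regular_at I x0 R" "regular_at I x0 S"
  shows "regular_at I x0 (\<lambda>x. R x * S x)"
proof -
  from assms obtain F H G K where *: "F \<in> polynomials I" "H \<in> polynomials I" "H x0 \<noteq> 0" "\<And>x. H x \<noteq> 0 \<Longrightarrow> R x = F x / H x"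
    "G \<in> polynomials I" "K \<in> polynomials I" "K x0 \<noteq> 0" "\<And>x. K x \<noteq> 0 \<Longrightarrow> S x = G x / K x"
    unfolding regular_at_def by metis
  show ?thesis
    by (rule regular_atI[of "\<lambda>x. F x * G x" I "\<lambda>x. H x * K x"])
      (use * in \<open>auto intro!: polynomials.intros\<close>)
qed

lemma regular_at_divide:
  assumes "regular_at I x0 R" "regular_at I x0 S" "S x0 \<noteq> 0"
  shows "regular_at I x0 (\<lambda>x. R x / S x)"
proof -
  from assms obtain F H G K where *: "F \<in> polynomials I" "H \<in> polynomials I" "H x0 \<noteq> 0" "\<And>x. H x \<noteq> 0 \<Longrightarrow> R x = F x / H x"
    "G \<in> polynomials I" "K \<in> polynomials I" "K x0 \<noteq> 0" "\<And>x. K x \<noteq> 0 \<Longrightarrow> S x = G x / K x"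
    unfolding regular_at_def by metis
  have "G x0 \<noteq> 0" using * assms(3) by auto
  then show ?thesis
    by (intro regular_atI[of "\<lambda>x. F x * K x * K x" I "\<lambda>x. H x * G x * K x"])
      (use * in \<open>auto intro!: polynomials.intros\<close>)
qed

lemma regular_at_uminus: "regular_at I x0 R \<Longrightarrow> regular_at I x0 (\<lambda>x. - R x)"
  using regular_at_mult[OF regular_at_poly[OF polynomials.const[of "-1"]], of I x0 R] by simp

lemma regular_at_diff: "regular_at I x0 R \<Longrightarrow> regular_at I x0 S \<Longrightarrow> regular_at I x0 (\<lambda>x. R x - S x)"
  using regular_at_add[OF _ regular_at_uminus, of I x0 R S] by simp

lemma regular_at_const: "regular_at I x0 (\<lambda>_. c)"
  by (rule regular_at_poly[OF polynomials.const])

lemma regular_at_sum: "(\<And>a. a \<in> E \<Longrightarrow> regular_at I x0 (f a)) \<Longrightarrow> regular_at I x0 (\<lambda>x. \<Sum>a\<in>E. f a x)"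
proof (induction E rule: infinite_finite_induct)
  case (insert a E)
  then show ?case using regular_at_add[of I x0 "f a" "\<lambda>x. \<Sum>a\<in>E. f a x"] by simp
qed (simp_all add: regular_at_const)

lemma regular_at_poly_comp:
  assumes "f \<in> polynomials I'" "\<And>i. i \<in> I' \<Longrightarrow> regular_at I x0 (\<lambda>x. \<phi> x i)"
  shows "regular_at I x0 (\<lambda>x. f (\<phi> x))"
  using assms(1)
  by induction (auto intro: regular_at_const regular_at_add regular_at_mult assms(2))

lemma regular_at_comp:
  assumes "regular_at I' (\<phi> x0) R" "\<And>i. i \<in> I' \<Longrightarrow> regular_at I x0 (\<lambda>x. \<phi> x i)"
  shows "regular_at I x0 (\<lambda>x. R (\<phi> x))"
proof -
  from assms(1) obtain F H where FH: "F \<in> polynomials I'" "H \<in> polynomials I'" "H (\<phi> x0) \<noteq> 0" "\<And>x. H x \<noteq> 0 \<Longrightarrow> R x = F x / H x"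
    unfolding regular_at_def by metis
  define F1 where "F1 = (\<lambda>x. F (\<phi> x))"
  define H1 where "H1 = (\<lambda>x. H (\<phi> x))"
  have F: "regular_at I x0 F1" unfolding F1_def by (rule regular_at_poly_comp[where f = F and \<phi> = \<phi>, OF FH(1) assms(2)])
  have H: "regular_at I x0 H1" unfolding H1_def by (rule regular_at_poly_comp[where f = H and \<phi> = \<phi>, OF FH(2) assms(2)])
  have "H1 x0 \<noteq> 0" using FH(3) by (simp add: H1_def)
  define R1 where "R1 = (\<lambda>x. F1 x / H1 x)"
  have R: "regular_at I x0 R1" unfolding R1_def by (rule regular_at_divide[OF F H \<open>H1 x0 \<noteq> 0\<close>])
  obtain G K where GK: "G \<in> polynomials I" "K \<in> polynomials I" "K x0 \<noteq> 0" "\<And>x. K x \<noteq> 0 \<Longrightarrow> H1 x = G x / K x"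
    using H unfolding regular_at_def by blast
  obtain G' K' where GK': "G' \<in> polynomials I" "K' \<in> polynomials I" "K' x0 \<noteq> 0" "\<And>x. K' x \<noteq> 0 \<Longrightarrow> R1 x = G' x / K' x"
    using R unfolding regular_at_def by blast
  have "G x0 \<noteq> 0" using GK \<open>H1 x0 \<noteq> 0\<close> by auto
  \<comment> \<open>\<open>R\<close> is known as a quotient only where \<open>H (\<phi> x)\<close>
    is nonzero; the numerator \<open>G\<close> of that function enters the denominator to guarantee
    it.\<close>
  show ?thesis
  proof (rule regular_atI[of "\<lambda>x. G' x * K x * G x" I "\<lambda>x. K' x * K x * G x"])
    fix x assume "K' x * K x * G x \<noteq> 0"
    then have nz: "K' x \<noteq> 0" "K x \<noteq> 0" "G x \<noteq> 0" by auto
    then have "H (\<phi> x) \<noteq> 0" using GK(4) by (simp add: H1_def)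
    then have "R (\<phi> x) = G' x / K' x" using FH(4) GK'(4)[OF nz(1)] by (simp add: R1_def F1_def H1_def)
    then show "R (\<phi> x) = G' x * K x * G x / (K' x * K x * G x)" using nz by simp
  qed (use GK GK' \<open>G x0 \<noteq> 0\<close> in \<open>auto intro!: polynomials.mult\<close>)
qed

text \<open>Multiplying numerator and denominator by \<open>h * H\<close> makes the numerator vanish
  on all of \<open>A\<close>, also where \<open>h\<close> or \<open>H\<close> is zero.\<close>

lemma regular_vanishing:
  assumes R: "regular_at I x0 R" and h: "h \<in> polynomials I" "h x0 \<noteq> 0"
    and van: "\<And>x. x \<in> A \<Longrightarrow> h x \<noteq> 0 \<Longrightarrow> R x = 0"
  shows "\<exists>G\<in>vanishing_ideal I A. \<exists>H\<in>polynomials I. H x0 \<noteq> 0 \<and> (\<forall>x. H x \<noteq> 0 \<longrightarrow> R x = G x / H x)"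
proof -
  from R obtain F H where FH: "F \<in> polynomials I" "H \<in> polynomials I" "H x0 \<noteq> 0" "\<And>x. H x \<noteq> 0 \<Longrightarrow> R x = F x / H x"
    unfolding regular_at_def by metis
  have "h x * H x * F x = 0" if "x \<in> A" for x
    using van[OF that] FH(4)[of x] by (cases "h x = 0"; cases "H x = 0") simp_all
  then have "(\<lambda>x. h x * H x * F x) \<in> vanishing_ideal I A"
    using h FH by (auto simp: vanishing_ideal_def intro!: polynomials.mult)
  moreover have "(\<lambda>x. h x * H x * H x) \<in> polynomials I" using h FH by (intro polynomials.mult)
  ultimately show ?thesis using h FH
    by (intro bexI[of _ "\<lambda>x. h x * H x * F x"] bexI[of _ "\<lambda>x. h x * H x * H x"]) auto
qed

text \<open>The chain rule along curves is taken as the definition of a gradient, so that everything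
  stays in one complex variable, as in \<open>tangent_space\<close>. Lines would not suffice,
  because a local isomorphism maps a line to a curve.\<close>

definition has_gradient :: "'i set \<Rightarrow> (('i \<Rightarrow> complex) \<Rightarrow> complex) \<Rightarrow> ('i \<Rightarrow> complex) \<Rightarrow> ('i \<Rightarrow> complex) \<Rightarrow> bool" where
  "has_gradient I R x0 g \<longleftrightarrow> (\<forall>\<gamma> w. (\<forall>i\<in>I. \<gamma> 0 i = x0 i \<and> ((\<lambda>t. \<gamma> t i) has_field_derivative w i) (at 0)) \<longrightarrow>
     ((\<lambda>t. R (\<gamma> t)) has_field_derivative (\<Sum>i\<in>I. g i * w i)) (at 0))"

lemma has_gradientD:
  assumes "has_gradient I R x0 g" "\<And>i. i \<in> I \<Longrightarrow> \<gamma> 0 i = x0 i"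
    "\<And>i. i \<in> I \<Longrightarrow> ((\<lambda>t. \<gamma> t i) has_field_derivative w i) (at 0)"
  shows "((\<lambda>t. R (\<gamma> t)) has_field_derivative (\<Sum>i\<in>I. g i * w i)) (at 0)"
  using assms unfolding has_gradient_def by blast

lemma line_derivative: "((\<lambda>t. x i + t * v i) has_field_derivative v i) (at 0)" for x v :: "'i \<Rightarrow> complex"
  by (auto intro!: derivative_eq_intros)

lemma polynomials_has_gradient:
  assumes "f \<in> polynomials I" "finite I"
  shows "\<exists>g. has_gradient I f x0 g"
  using assms(1)
proof induction
  case (const c)
  then show ?case by (intro exI[of _ "\<lambda>_. 0"]) (simp add: has_gradient_def)
next
  case (coord i)
  have "(\<Sum>j\<in>I. (if j = i then 1 else 0) * w j) = w i" for w :: "'a \<Rightarrow> complex"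
    using coord assms(2) by (simp add: if_distrib[of "\<lambda>x. x * _"] cong: if_cong)
  then show ?case using coord by (intro exI[of _ "\<lambda>j. if j = i then 1 else 0"]) (auto simp: has_gradient_def)
next
  case (add f g)
  then obtain a b where "has_gradient I f x0 a" "has_gradient I g x0 b" by auto
  then have "has_gradient I (\<lambda>x. f x + g x) x0 (\<lambda>i. a i + b i)"
    unfolding has_gradient_def by (auto simp: distrib_right sum.distrib intro: DERIV_add)
  then show ?case by blast
next
  case (mult f g)
  then obtain a b where ab: "has_gradient I f x0 a" "has_gradient I g x0 b" by auto
  have "has_gradient I (\<lambda>x. f x * g x) x0 (\<lambda>i. a i * g x0 + b i * f x0)"
    unfolding has_gradient_def
  proof (intro allI impI)
    fix \<gamma> w assume c: "\<forall>i\<in>I. \<gamma> 0 i = x0 i \<and> ((\<lambda>t. \<gamma> t i) has_field_derivative w i) (at 0)"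
    have "f (\<gamma> 0) = f x0" "g (\<gamma> 0) = g x0"
      using polynomials_cong[OF mult.hyps(1), of "\<gamma> 0" x0] polynomials_cong[OF mult.hyps(2), of "\<gamma> 0" x0] c by auto
    have "((\<lambda>t. f (\<gamma> t)) has_field_derivative (\<Sum>i\<in>I. a i * w i)) (at 0)"
      by (rule has_gradientD[OF ab(1)]) (use c in auto)
    moreover have "((\<lambda>t. g (\<gamma> t)) has_field_derivative (\<Sum>i\<in>I. b i * w i)) (at 0)"
      by (rule has_gradientD[OF ab(2)]) (use c in auto)
    ultimately have "((\<lambda>t. f (\<gamma> t) * g (\<gamma> t)) has_field_derivative
        (\<Sum>i\<in>I. a i * w i) * g (\<gamma> 0) + (\<Sum>i\<in>I. b i * w i) * f (\<gamma> 0)) (at 0)" by (rule DERIV_mult)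
    moreover have "(\<Sum>i\<in>I. a i * w i) * g (\<gamma> 0) + (\<Sum>i\<in>I. b i * w i) * f (\<gamma> 0) = (\<Sum>i\<in>I. (a i * g x0 + b i * f x0) * w i)"
      unfolding \<open>f (\<gamma> 0) = f x0\<close> \<open>g (\<gamma> 0) = g x0\<close>
      by (simp add: algebra_simps sum.distrib sum_distrib_left)
    ultimately show "((\<lambda>t. f (\<gamma> t) * g (\<gamma> t)) has_field_derivative (\<Sum>i\<in>I. (a i * g x0 + b i * f x0) * w i)) (at 0)"
      by simp
  qed
  then show ?case by blast
qed

lemma quotient_derivative:
  fixes G H R :: "complex \<Rightarrow> complex"
  assumes "(G has_field_derivative a) (at 0)" "(H has_field_derivative b) (at 0)"
    "H 0 \<noteq> 0" "\<And>t. H t \<noteq> 0 \<Longrightarrow> R t = G t / H t"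
  shows "(R has_field_derivative (a * H 0 - G 0 * b) / (H 0 * H 0)) (at 0)"
proof -
  have "(H \<longlongrightarrow> H 0) (nhds 0)"
    using DERIV_isCont[OF assms(2)] by (simp add: isCont_def tendsto_at_iff_tendsto_nhds)
  from tendsto_imp_eventually_ne[OF this assms(3)]
  have "\<forall>\<^sub>F t in nhds 0. R t = G t / H t" by eventually_elim (rule assms(4))
  from DERIV_cong_ev[OF refl this refl] DERIV_divide[OF assms(1,2,3)] show ?thesis by blast
qed

lemma regular_has_gradient:
  assumes "regular_at I x0 R" "finite I"
  shows "\<exists>g. has_gradient I R x0 g"
proof -
  from assms obtain F H where FH: "F \<in> polynomials I" "H \<in> polynomials I" "H x0 \<noteq> 0" "\<And>x. H x \<noteq> 0 \<Longrightarrow> R x = F x / H x"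
    unfolding regular_at_def by metis
  from FH obtain a b where ab: "has_gradient I F x0 a" "has_gradient I H x0 b"
    using polynomials_has_gradient[OF _ assms(2)] by metis
  have "has_gradient I R x0 (\<lambda>i. (a i * H x0 - F x0 * b i) / (H x0 * H x0))"
    unfolding has_gradient_def
  proof (intro allI impI)
    fix \<gamma> w assume c: "\<forall>i\<in>I. \<gamma> 0 i = x0 i \<and> ((\<lambda>t. \<gamma> t i) has_field_derivative w i) (at 0)"
    have e: "F (\<gamma> 0) = F x0" "H (\<gamma> 0) = H x0"
      using polynomials_cong[OF FH(1), of "\<gamma> 0" x0] polynomials_cong[OF FH(2), of "\<gamma> 0" x0] c by auto
    have "((\<lambda>t. R (\<gamma> t)) has_field_derivative
      ((\<Sum>i\<in>I. a i * w i) * H (\<gamma> 0) - F (\<gamma> 0) * (\<Sum>i\<in>I. b i * w i)) / (H (\<gamma> 0) * H (\<gamma> 0))) (at 0)"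
    proof (rule quotient_derivative)
      show "((\<lambda>t. F (\<gamma> t)) has_field_derivative (\<Sum>i\<in>I. a i * w i)) (at 0)"
        by (rule has_gradientD[OF ab(1)]) (use c in auto)
      show "((\<lambda>t. H (\<gamma> t)) has_field_derivative (\<Sum>i\<in>I. b i * w i)) (at 0)"
        by (rule has_gradientD[OF ab(2)]) (use c in auto)
    qed (use e FH in auto)
    also have "((\<Sum>i\<in>I. a i * w i) * H (\<gamma> 0) - F (\<gamma> 0) * (\<Sum>i\<in>I. b i * w i)) / (H (\<gamma> 0) * H (\<gamma> 0))
      = (\<Sum>i\<in>I. (a i * H x0 - F x0 * b i) / (H x0 * H x0) * w i)"
      unfolding e by (simp add: sum_distrib_left sum_distrib_right sum_subtractf[symmetric] sum_divide_distrib algebra_simps)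
    finally show "((\<lambda>t. R (\<gamma> t)) has_field_derivative (\<Sum>i\<in>I. (a i * H x0 - F x0 * b i) / (H x0 * H x0) * w i)) (at 0)" .
  qed
  then show ?thesis by blast
qed

text \<open>Tangent vectors are defined by vanishing polynomials only. A regular function that
  vanishes on \<open>A\<close> near \<open>x0\<close> is \<open>G / H\<close> with \<open>G\<close>
  in the ideal; since \<open>G\<close> and its derivative along \<open>v\<close> vanish at
  \<open>x0\<close>, so does the derivative of the quotient.\<close>

lemma tangent_regular:
  assumes v: "v \<in> tangent_space I A x0" and fin: "finite I" and x0: "x0 \<in> zariski_cl I A"
    and R: "regular_at I x0 R" and h: "h \<in> polynomials I" "h x0 \<noteq> 0"
    and van: "\<And>x. x \<in> A \<Longrightarrow> h x \<noteq> 0 \<Longrightarrow> R x = 0"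
  shows "((\<lambda>t. R (\<lambda>i. x0 i + t * v i)) has_field_derivative 0) (at 0)"
proof -
  from regular_vanishing[OF R h van] obtain G H where GH: "G \<in> vanishing_ideal I A" "H \<in> polynomials I" "H x0 \<noteq> 0" "\<And>x. H x \<noteq> 0 \<Longrightarrow> R x = G x / H x"
    by blast
  obtain b where b: "has_gradient I H x0 b" using polynomials_has_gradient[OF GH(2) fin] by blast
  have "((\<lambda>t. G (\<lambda>i. x0 i + t * v i)) has_field_derivative 0) (at 0)"
    using v GH(1) by (auto simp: tangent_space_def)
  moreover have "((\<lambda>t. H (\<lambda>i. x0 i + t * v i)) has_field_derivative (\<Sum>i\<in>I. b i * v i)) (at 0)"
    by (rule has_gradientD[OF b]) (simp_all add: line_derivative)
  ultimately have "((\<lambda>t. R (\<lambda>i. x0 i + t * v i)) has_field_derivative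
      (0 * H (\<lambda>i. x0 i + 0 * v i) - G (\<lambda>i. x0 i + 0 * v i) * (\<Sum>i\<in>I. b i * v i))
        / (H (\<lambda>i. x0 i + 0 * v i) * H (\<lambda>i. x0 i + 0 * v i))) (at 0)"
    using GH(3,4) by (intro quotient_derivative) simp_all
  moreover have "G x0 = 0" using x0 GH(1) by (auto simp: zariski_cl_def)
  ultimately show ?thesis by simp
qed

text \<open>Gradients turn the derivative conditions into linear equations in
  \<open>v\<close>.\<close>

lemma tangent_space_subspace:
  assumes "finite I"
  shows "fs.subspace (tangent_space I A x0)"
proof -
  have e: "v \<in> tangent_space I A x0 \<longleftrightarrow> v \<in> affine_space I \<and> (\<forall>f\<in>vanishing_ideal I A. \<forall>g. has_gradient I f x0 g \<longrightarrow> (\<Sum>i\<in>I. g i * v i) = 0)" for v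
  proof -
    have "((\<lambda>t. f (\<lambda>i. x0 i + t * v i)) has_field_derivative 0) (at 0) \<longleftrightarrow> (\<forall>g. has_gradient I f x0 g \<longrightarrow> (\<Sum>i\<in>I. g i * v i) = 0)"
      if f: "f \<in> vanishing_ideal I A" for f
    proof -
      have "f \<in> polynomials I" using f by (simp add: vanishing_ideal_def)
      from polynomials_has_gradient[OF this assms, of x0] obtain g0 where g0: "has_gradient I f x0 g0" ..
      have d: "((\<lambda>t. f (\<lambda>i. x0 i + t * v i)) has_field_derivative (\<Sum>i\<in>I. g i * v i)) (at 0)" if "has_gradient I f x0 g" for g
        by (rule has_gradientD[OF that]) (simp_all add: line_derivative)
      show ?thesis
      proof
        assume a: "((\<lambda>t. f (\<lambda>i. x0 i + t * v i)) has_field_derivative 0) (at 0)"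
        show "\<forall>g. has_gradient I f x0 g \<longrightarrow> (\<Sum>i\<in>I. g i * v i) = 0"
          using DERIV_unique[OF d a] by blast
      next
        assume "\<forall>g. has_gradient I f x0 g \<longrightarrow> (\<Sum>i\<in>I. g i * v i) = 0"
        with g0 d[OF g0] show "((\<lambda>t. f (\<lambda>i. x0 i + t * v i)) has_field_derivative 0) (at 0)" by simp
      qed
    qed
    then show ?thesis unfolding tangent_space_def by blast
  qed
  show ?thesis
  proof (rule fs.subspaceI)
    show "0 \<in> tangent_space I A x0" unfolding e by (simp add: affine_space_def)
  next
    fix v w assume "v \<in> tangent_space I A x0" "w \<in> tangent_space I A x0"
    then show "v + w \<in> tangent_space I A x0"
      unfolding e by (simp add: affine_space_def distrib_left sum.distrib)
  next
    fix c v assume v: "v \<in> tangent_space I A x0"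
    have "(\<Sum>i\<in>I. g i * (c * v i)) = c * (\<Sum>i\<in>I. g i * v i)" for g
      by (simp add: sum_distrib_left mult_ac)
    then show "(\<lambda>i. c * v i) \<in> tangent_space I A x0"
      using v unfolding e by (simp add: affine_space_def)
  qed
qed

lemma dim_eqI:
  assumes V: "fs.subspace V" and W: "fs.subspace W"
    and D: "Modules.module_hom (\<lambda>(c::complex) v i. c * v i) (\<lambda>(c::complex) v i. c * v i) D"
    and DE: "\<And>v. v \<in> V \<Longrightarrow> D v \<in> W \<and> E (D v) = v" "\<And>w. w \<in> W \<Longrightarrow> E w \<in> V \<and> D (E w) = w"
  shows "fs.dim V = fs.dim W"
proof -
  interpret D: module_hom "\<lambda>(c::complex) v i. c * v i" "\<lambda>(c::complex) v i. c * v i" D by (rule D)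
  interpret vp: vector_space_pair "\<lambda>(c::complex) (v::'a \<Rightarrow> complex) i. c * v i" "\<lambda>(c::complex) (v::'b \<Rightarrow> complex) i. c * v i" ..
  obtain B where B: "B \<subseteq> V" "fs.independent B" "V \<subseteq> fs.span B" "card B = fs.dim V"
    using fs.basis_exists[of V] by blast
  have sV: "fs.span B = V" using B V by (metis fs.span_minimal subset_antisym)
  have inj: "inj_on D V" by (metis DE(1) inj_onI)
  have "fs.independent (D ` B)"
    by (rule vp.linear_independent_injective_image) (use D B inj sV in \<open>auto simp: module_hom_iff_linear\<close>)
  moreover have "D ` B \<subseteq> W" using B DE by auto
  moreover have "W \<subseteq> fs.span (D ` B)"
  proof
    fix w assume "w \<in> W"
    then have "w = D (E w)" "E w \<in> fs.span B" using DE(2) sV by auto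
    then show "w \<in> fs.span (D ` B)" by (metis D.span_image imageI)
  qed
  moreover have "card (D ` B) = fs.dim V" using B inj by (metis card_image inj_on_subset)
  ultimately show ?thesis using fs.dim_unique by metis
qed

section \<open>Products with an affine space: tangent spaces and singular points\<close>

lemma tangent_space_affine: "v \<in> tangent_space I A x \<Longrightarrow> v \<in> affine_space I"
  by (simp add: tangent_space_def)

text \<open>The derivative of a polynomial vanishing on the product splits into two directions.
  Freezing the coordinates in \<open>K\<close> gives a polynomial vanishing on \<open>Y\<close>,
  which controls the directions of \<open>J\<close>. As the base point is in the closure of
  \<open>Y\<close>, the polynomial vanishes on the whole fibre through it, which controls those of
  \<open>K\<close>.\<close>

lemma tangent_space_cyl:
  assumes fin: "finite J" "finite K" "J \<inter> K = {}" and Y: "Y \<subseteq> affine_space J"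
    and z0: "z0 \<in> affine_space (J \<union> K)" "restr J z0 \<in> zariski_cl J Y"
  shows "tangent_space (J \<union> K) (cyl J K Y) z0 = {v \<in> affine_space (J \<union> K). restr J v \<in> tangent_space J Y (restr J z0)}"
proof (intro equalityI subsetI CollectI conjI)
  fix v assume v: "v \<in> tangent_space (J \<union> K) (cyl J K Y) z0"
  then show "v \<in> affine_space (J \<union> K)" by (rule tangent_space_affine)
  show "restr J v \<in> tangent_space J Y (restr J z0)"
    unfolding tangent_space_def
  proof (intro CollectI conjI restr_affine ballI)
    fix f assume "f \<in> vanishing_ideal J Y"
    then have f: "f \<in> polynomials J" "\<And>x. x \<in> Y \<Longrightarrow> f x = 0" by (auto simp: vanishing_ideal_def)
    have "f z = 0" if "z \<in> cyl J K Y" for z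
      using f(2)[of "restr J z"] that polynomials_restr[OF f(1), of z] by (simp add: cyl_def)
    then have "f \<in> vanishing_ideal (J \<union> K) (cyl J K Y)"
      using polynomials_mono[OF f(1), of "J \<union> K"] by (simp add: vanishing_ideal_def)
    then have "((\<lambda>t. f (\<lambda>i. z0 i + t * v i)) has_field_derivative 0) (at 0)"
      using v by (simp add: tangent_space_def)
    moreover have "f (\<lambda>i. restr J z0 i + t * restr J v i) = f (\<lambda>i. z0 i + t * v i)" for t
      by (rule polynomials_cong[OF f(1)]) (simp add: restr_def)
    ultimately show "((\<lambda>t. f (\<lambda>i. restr J z0 i + t * restr J v i)) has_field_derivative 0) (at 0)" by simp
  qed
next
  fix v assume "v \<in> {v \<in> affine_space (J \<union> K). restr J v \<in> tangent_space J Y (restr J z0)}"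
  then have v: "v \<in> affine_space (J \<union> K)" "restr J v \<in> tangent_space J Y (restr J z0)" by auto
  show "v \<in> tangent_space (J \<union> K) (cyl J K Y) z0"
    unfolding tangent_space_def
  proof (intro CollectI conjI v(1) ballI)
    fix f assume "f \<in> vanishing_ideal (J \<union> K) (cyl J K Y)"
    then have f: "f \<in> polynomials (J \<union> K)" "\<And>z. z \<in> cyl J K Y \<Longrightarrow> f z = 0" by (auto simp: vanishing_ideal_def)
    have sub: "(\<lambda>y. f (\<lambda>i. if i \<in> K then c i else y i)) \<in> vanishing_ideal J Y" for c
    proof -
      have "(\<lambda>y. f (\<lambda>i. if i \<in> K then c i else y i)) \<in> polynomials J"
      proof (rule polynomials_subst[OF f(1)])
        fix i assume "i \<in> J \<union> K"
        then show "(\<lambda>y. if i \<in> K then c i else y i) \<in> polynomials J"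
          by (cases "i \<in> K") (simp_all add: polynomials.coord polynomials.const)
      qed
      moreover have "f (\<lambda>i. if i \<in> K then c i else y i) = 0" if y: "y \<in> Y" for y
      proof -
        have "restr J (\<lambda>i. if i \<in> K then c i else y i) = y" "(\<lambda>i. if i \<in> K then c i else y i) \<in> affine_space (J \<union> K)"
          using fin(3) subsetD[OF Y y] by (auto simp: restr_def affine_space_def fun_eq_iff)
        then show ?thesis using f(2) y by (simp add: cyl_def)
      qed
      ultimately show ?thesis by (simp add: vanishing_ideal_def)
    qed
    from fin have finJK: "finite (J \<union> K)" by simp
    obtain g where g: "has_gradient (J \<union> K) f z0 g" using polynomials_has_gradient[OF f(1) finJK] by blast
    have dl: "((\<lambda>t. f (\<lambda>i. z0 i + t * w i)) has_field_derivative (\<Sum>i\<in>J \<union> K. g i * w i)) (at 0)" for w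
      by (rule has_gradientD[OF g]) (simp_all add: line_derivative)
    have "((\<lambda>t. f (\<lambda>i. z0 i + t * restr J v i)) has_field_derivative 0) (at 0)"
    proof -
      have "\<forall>f\<in>vanishing_ideal J Y. ((\<lambda>t. f (\<lambda>i. restr J z0 i + t * restr J v i)) has_field_derivative 0) (at 0)"
        using v(2) by (simp add: tangent_space_def)
      from bspec[OF this sub[of z0]]
      have "((\<lambda>t. f (\<lambda>i. if i \<in> K then z0 i else restr J z0 i + t * restr J v i)) has_field_derivative 0) (at 0)" .
      moreover have "(\<lambda>i. if i \<in> K then z0 i else restr J z0 i + t * restr J v i) = (\<lambda>i. z0 i + t * restr J v i)" for t
        using fin(3) z0(1) by (auto simp: restr_def affine_space_def fun_eq_iff)
      ultimately show ?thesis by simp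
    qed
    then have 1: "(\<Sum>i\<in>J \<union> K. g i * restr J v i) = 0" using dl DERIV_unique by blast
    have "((\<lambda>t. f (\<lambda>i. z0 i + t * restr K v i)) has_field_derivative 0) (at 0)"
    proof -
      have "f (\<lambda>i. z0 i + t * restr K v i) = 0" for t
      proof -
        have "f (\<lambda>i. if i \<in> K then z0 i + t * restr K v i else restr J z0 i) = 0"
          using zariski_clD[OF z0(2) sub[of "\<lambda>i. z0 i + t * restr K v i"]] .
        moreover have "(\<lambda>i. if i \<in> K then z0 i + t * restr K v i else restr J z0 i) = (\<lambda>i. z0 i + t * restr K v i)"
          using fin(3) z0(1) by (auto simp: restr_def affine_space_def fun_eq_iff)
        ultimately show ?thesis by simp
      qed
      then show ?thesis by simp
    qed
    then have 2: "(\<Sum>i\<in>J \<union> K. g i * restr K v i) = 0" using dl DERIV_unique by blast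
    have "g i * v i = g i * restr J v i + g i * restr K v i" for i
      using fin(3) v(1) by (auto simp: restr_def affine_space_def)
    then have "(\<Sum>i\<in>J \<union> K. g i * v i) = (\<Sum>i\<in>J \<union> K. g i * restr J v i) + (\<Sum>i\<in>J \<union> K. g i * restr K v i)"
      by (simp only: sum.distrib)
    with dl[of v] 1 2 show "((\<lambda>t. f (\<lambda>i. z0 i + t * v i)) has_field_derivative 0) (at 0)" by simp
  qed
qed

text \<open>The coordinates of \<open>K\<close> are added one at a time; each contributes one unit
  vector outside the span of the previous basis.\<close>

lemma basis_cyl:
  assumes "finite J" "finite K" "J \<inter> K = {}" and T: "fs.subspace T" "T \<subseteq> affine_space J"
  shows "\<exists>B. finite B \<and> fs.independent B \<and> B \<subseteq> cyl J K T \<and> cyl J K T \<subseteq> fs.span B \<and> card B = fs.dim T + card K"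
  using assms(2,3)
proof (induction K rule: finite_induct)
  case empty
  have c: "cyl J {} T = T" using T(2) by (auto simp: cyl_def restr_id)
  obtain B where B: "B \<subseteq> T" "fs.independent B" "T \<subseteq> fs.span B" "card B = fs.dim T"
    using fs.basis_exists[of T] by blast
  let ?e = "\<lambda>j i. if i = j then 1 else (0::complex)"
  have "v \<in> fs.span (?e ` J)" if "v \<in> affine_space J" for v
  proof -
    have "v = (\<Sum>j\<in>J. (\<lambda>i. v j * ?e j i))"
    proof
      fix i
      have "(\<Sum>j\<in>J. v j * ?e j i) = v i"
        using that assms(1) by (simp add: affine_space_def if_distrib[of "\<lambda>x. _ * x"] cong: if_cong)
      then show "v i = (\<Sum>j\<in>J. (\<lambda>i. v j * ?e j i)) i" by (simp only: sum_fun_apply)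
    qed
    also have "\<dots> \<in> fs.span (?e ` J)" by (intro fs.span_sum fs.span_scale fs.span_base imageI)
    finally show ?thesis .
  qed
  then have "B \<subseteq> fs.span (?e ` J)" using B(1) T(2) by blast
  then have "finite B" using fs.independent_span_bound[OF _ B(2)] assms(1) by blast
  then show ?case using B c by auto
next
  case (insert k K)
  then obtain B where B: "finite B" "fs.independent B" "B \<subseteq> cyl J K T" "cyl J K T \<subseteq> fs.span B" "card B = fs.dim T + card K"
    by auto
  define e where "e = (\<lambda>i. if i = k then 1 else (0::complex))"
  have kJ: "k \<notin> J" using insert.prems by auto
  have T0: "(\<lambda>_. 0) \<in> T" using fs.subspace_0[OF T(1)] by (simp add: zero_fun_def)
  have 0: "v k = 0" if "v \<in> fs.span B" for v
    using that
  proof (induction rule: fs.span_induct_alt)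
    case (step c b y)
    then have "b \<in> cyl J K T" using B(3) by auto
    then have "b k = 0" using kJ insert.hyps by (simp add: cyl_def affine_space_def)
    then show ?case using step by simp
  qed simp
  have eB: "e \<notin> fs.span B" using 0[of e] by (auto simp: e_def)
  then have eB': "e \<notin> B" using fs.span_base by blast
  have sub: "cyl J K T \<subseteq> cyl J (insert k K) T" by (auto simp: cyl_def affine_space_def)
  have "restr J e = (\<lambda>_. 0)" using kJ by (auto simp: restr_def e_def)
  then have "e \<in> cyl J (insert k K) T" using T0 by (auto simp: cyl_def affine_space_def e_def)
  moreover have "v \<in> fs.span (insert e B)" if v: "v \<in> cyl J (insert k K) T" for v
  proof -
    have "restr J (\<lambda>i. if i = k then 0 else v i) = restr J v" using kJ by (auto simp: restr_def)
    then have "(\<lambda>i. if i = k then 0 else v i) \<in> cyl J K T" using v by (auto simp: cyl_def affine_space_def)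
    then have "(\<lambda>i. if i = k then 0 else v i) \<in> fs.span (insert e B)" using B(4) fs.span_mono[of B "insert e B"] by blast
    moreover have "(\<lambda>i. v k * e i) \<in> fs.span (insert e B)" by (intro fs.span_scale fs.span_base) simp
    ultimately have "(\<lambda>i. if i = k then 0 else v i) + (\<lambda>i. v k * e i) \<in> fs.span (insert e B)" by (rule fs.span_add)
    moreover have "(\<lambda>i. if i = k then 0 else v i) + (\<lambda>i. v k * e i) = v" by (auto simp: e_def)
    ultimately show ?thesis by simp
  qed
  moreover have "fs.independent (insert e B)" using B(2) eB eB' by (simp add: fs.independent_insert)
  moreover have "card (insert e B) = fs.dim T + card (insert k K)" using B eB' insert.hyps by simp
  ultimately show ?case using B(1,3) sub by (intro exI[of _ "insert e B"]) auto
qed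

lemma tangent_dim_cyl:
  assumes fin: "finite J" "finite K" "J \<inter> K = {}" and Y: "Y \<subseteq> affine_space J"
    and z0: "z0 \<in> affine_space (J \<union> K)" "restr J z0 \<in> zariski_cl J Y"
  shows "tangent_dim (J \<union> K) (cyl J K Y) z0 = tangent_dim J Y (restr J z0) + card K"
proof -
  let ?T = "tangent_space J Y (restr J z0)"
  have e: "tangent_space (J \<union> K) (cyl J K Y) z0 = cyl J K ?T"
    unfolding tangent_space_cyl[OF assms] by (simp add: cyl_def)
  obtain B where "finite B" "fs.independent B" "B \<subseteq> cyl J K ?T" "cyl J K ?T \<subseteq> fs.span B" "card B = fs.dim ?T + card K"
    using basis_cyl[OF fin tangent_space_subspace[OF fin(1)], of Y "restr J z0"] tangent_space_affine by blast
  then have "fs.dim (cyl J K ?T) = fs.dim ?T + card K" using fs.dim_unique by blast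
  then show ?thesis unfolding tangent_dim_def e .
qed

lemma zariski_cl_cyl:
  assumes fin: "J \<inter> K = {}" and Y: "Y \<subseteq> affine_space J" and z0: "z0 \<in> affine_space (J \<union> K)"
  shows "z0 \<in> zariski_cl (J \<union> K) (cyl J K Y) \<longleftrightarrow> restr J z0 \<in> zariski_cl J Y"
proof
  assume z: "z0 \<in> zariski_cl (J \<union> K) (cyl J K Y)"
  have "f (restr J z0) = 0" if "f \<in> vanishing_ideal J Y" for f
  proof -
    from that have f: "f \<in> polynomials J" "\<And>x. x \<in> Y \<Longrightarrow> f x = 0" by (auto simp: vanishing_ideal_def)
    have "f z = 0" if "z \<in> cyl J K Y" for z
      using f(2)[of "restr J z"] that polynomials_restr[OF f(1), of z] by (simp add: cyl_def)
    then have "f \<in> vanishing_ideal (J \<union> K) (cyl J K Y)"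
      using polynomials_mono[OF f(1), of "J \<union> K"] by (simp add: vanishing_ideal_def)
    from zariski_clD[OF z this] show ?thesis using polynomials_restr[OF f(1)] by simp
  qed
  then show "restr J z0 \<in> zariski_cl J Y" by (simp add: zariski_cl_def restr_affine)
next
  assume z: "restr J z0 \<in> zariski_cl J Y"
  have "f z0 = 0" if "f \<in> vanishing_ideal (J \<union> K) (cyl J K Y)" for f
  proof -
    from that have f: "f \<in> polynomials (J \<union> K)" "\<And>z. z \<in> cyl J K Y \<Longrightarrow> f z = 0" by (auto simp: vanishing_ideal_def)
    have "(\<lambda>y. f (\<lambda>i. if i \<in> K then z0 i else y i)) \<in> polynomials J"
    proof (rule polynomials_subst[OF f(1)])
      fix i assume "i \<in> J \<union> K"
      then show "(\<lambda>y. if i \<in> K then z0 i else y i) \<in> polynomials J"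
        by (cases "i \<in> K") (simp_all add: polynomials.coord polynomials.const)
    qed
    moreover have "f (\<lambda>i. if i \<in> K then z0 i else y i) = 0" if y: "y \<in> Y" for y
    proof -
      have "restr J (\<lambda>i. if i \<in> K then z0 i else y i) = y" "(\<lambda>i. if i \<in> K then z0 i else y i) \<in> affine_space (J \<union> K)"
        using fin subsetD[OF Y y] by (auto simp: restr_def affine_space_def fun_eq_iff)
      then show ?thesis using f(2) y by (simp add: cyl_def)
    qed
    ultimately have "(\<lambda>y. f (\<lambda>i. if i \<in> K then z0 i else y i)) \<in> vanishing_ideal J Y" by (simp add: vanishing_ideal_def)
    from zariski_clD[OF z this] have "f (\<lambda>i. if i \<in> K then z0 i else restr J z0 i) = 0" .
    moreover have "(\<lambda>i. if i \<in> K then z0 i else restr J z0 i) = z0"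
      using fin z0 by (auto simp: restr_def affine_space_def fun_eq_iff)
    ultimately show ?thesis by simp
  qed
  then show "z0 \<in> zariski_cl (J \<union> K) (cyl J K Y)" using z0 by (simp add: zariski_cl_def)
qed

lemma cyl_affine: "cyl J K Y \<subseteq> affine_space (J \<union> K)"
  by (auto simp: cyl_def)

text \<open>The tangent dimension and the local dimension both grow by \<open>card K\<close>, which
  preserves their being different, also when the local dimension is infinite.\<close>

lemma singular_point_cyl:
  assumes fin: "finite J" "finite K" "J \<inter> K = {}" and Y: "Y \<subseteq> affine_space J"
    and z0: "z0 \<in> affine_space (J \<union> K)"
  shows "singular_point (J \<union> K) (zariski_cl (J \<union> K) (cyl J K Y)) z0 \<longleftrightarrow>
    singular_point J (zariski_cl J Y) (restr J z0)"
proof (cases "restr J z0 \<in> zariski_cl J Y")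
  case True
  have "enat (a + b) \<noteq> c + enat b \<longleftrightarrow> enat a \<noteq> c" for a b c by (cases c) auto
  then show ?thesis
    using True zariski_cl_cyl[OF fin(3) Y z0] tangent_dim_cyl[OF fin Y z0 True] local_dim_cyl[OF fin Y z0 True]
    by (simp add: singular_point_zariski_cl[OF Y] singular_point_zariski_cl[OF cyl_affine])
next
  case False
  then show ?thesis using zariski_cl_cyl[OF fin(3) Y z0] by (simp add: singular_point_def)
qed

section \<open>Local isomorphisms\<close>

lemma polynomials_rational_subst:
  assumes f: "f \<in> polynomials I" and F: "\<And>i. i \<in> I \<Longrightarrow> F i \<in> polynomials I'" and D: "D \<in> polynomials I'"
  shows "\<exists>N. \<exists>P\<in>polynomials I'. \<forall>z x. D z \<noteq> 0 \<longrightarrow> (\<forall>i\<in>I. x i = F i z / D z) \<longrightarrow> f x = P z / D z ^ N"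
  using f
proof induction
  case (const c)
  show ?case by (rule exI[of _ 0], rule bexI[of _ "\<lambda>_. c"]) (auto intro: polynomials.const)
next
  case (coord i)
  then show ?case using F by (intro exI[of _ 1] bexI[of _ "F i"]) auto
next
  case (add f g)
  then obtain N P M Q where *: "P \<in> polynomials I'" "Q \<in> polynomials I'"
    "\<And>z x. D z \<noteq> 0 \<Longrightarrow> (\<forall>i\<in>I. x i = F i z / D z) \<Longrightarrow> f x = P z / D z ^ N"
    "\<And>z x. D z \<noteq> 0 \<Longrightarrow> (\<forall>i\<in>I. x i = F i z / D z) \<Longrightarrow> g x = Q z / D z ^ M" by metis
  show ?case
  proof (rule exI[of _ "N + M"], rule bexI[of _ "\<lambda>z. P z * D z ^ M + Q z * D z ^ N"], intro allI impI)
    fix z x assume z: "D z \<noteq> 0" "\<forall>i\<in>I. x i = F i z / D z"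
    show "f x + g x = (P z * D z ^ M + Q z * D z ^ N) / D z ^ (N + M)"
      using *(3)[OF z] *(4)[OF z] z(1) by (simp add: power_add add_divide_distrib)
  qed (intro polynomials.add polynomials.mult polynomials_power * D)
next
  case (mult f g)
  then obtain N P M Q where *: "P \<in> polynomials I'" "Q \<in> polynomials I'"
    "\<And>z x. D z \<noteq> 0 \<Longrightarrow> (\<forall>i\<in>I. x i = F i z / D z) \<Longrightarrow> f x = P z / D z ^ N"
    "\<And>z x. D z \<noteq> 0 \<Longrightarrow> (\<forall>i\<in>I. x i = F i z / D z) \<Longrightarrow> g x = Q z / D z ^ M" by metis
  show ?case
  proof (rule exI[of _ "N + M"], rule bexI[of _ "\<lambda>z. P z * Q z"], intro allI impI)
    fix z x assume z: "D z \<noteq> 0" "\<forall>i\<in>I. x i = F i z / D z"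
    show "f x * g x = (P z * Q z) / D z ^ (N + M)"
      using *(3)[OF z] *(4)[OF z] z(1) by (simp add: power_add)
  qed (intro polynomials.mult *)
qed

text \<open>Mutually inverse maps between \<open>A\<close> near \<open>x0\<close> and \<open>B\<close> near \<open>z0\<close> with regular components.\<close>

locale local_iso =
  fixes I :: "'i set" and I' :: "'k set" and A B x0 z0 \<phi> \<psi> hA hB
  assumes fin: "finite I" "finite I'"
    and A: "A \<subseteq> affine_space I" and B: "B \<subseteq> affine_space I'"
    and x0: "x0 \<in> affine_space I" and z0: "z0 \<in> affine_space I'"
    and \<phi>: "\<And>i. i \<in> I' \<Longrightarrow> regular_at I x0 (\<lambda>x. \<phi> x i)"
    and \<psi>: "\<And>i. i \<in> I \<Longrightarrow> regular_at I' z0 (\<lambda>z. \<psi> z i)"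
    and \<phi>0: "\<phi> x0 = z0" and \<psi>0: "\<psi> z0 = x0"
    and hA: "hA \<in> polynomials I" "hA x0 \<noteq> 0" and hB: "hB \<in> polynomials I'" "hB z0 \<noteq> 0"
    and AB: "\<And>x. x \<in> A \<Longrightarrow> hA x \<noteq> 0 \<Longrightarrow> \<phi> x \<in> B \<and> \<psi> (\<phi> x) = x"
    and BA: "\<And>z. z \<in> B \<Longrightarrow> hB z \<noteq> 0 \<Longrightarrow> \<psi> z \<in> A \<and> \<phi> (\<psi> z) = z"
begin

lemma swap: "local_iso I' I B A z0 x0 \<psi> \<phi> hB hA"
  by unfold_locales (use fin A B x0 z0 \<phi> \<psi> \<phi>0 \<psi>0 hA hB AB BA in auto)

lemma zariski_cl_image:
  assumes "x0 \<in> zariski_cl I A"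
  shows "z0 \<in> zariski_cl I' B"
proof -
  have "f z0 = 0" if "f \<in> vanishing_ideal I' B" for f
  proof -
    from that have f: "f \<in> polynomials I'" "\<And>z. z \<in> B \<Longrightarrow> f z = 0" by (auto simp: vanishing_ideal_def)
    define R where "R = (\<lambda>x. f (\<phi> x))"
    have R: "regular_at I x0 R" unfolding R_def by (rule regular_at_poly_comp[where f = f and \<phi> = \<phi>, OF f(1) \<phi>])
    have "R x = 0" if "x \<in> A" "hA x \<noteq> 0" for x using AB[OF that] f(2) by (simp add: R_def)
    from regular_vanishing[OF R hA this] obtain G H where "G \<in> vanishing_ideal I A" "H x0 \<noteq> 0" "R x0 = G x0 / H x0" by blast
    then have "R x0 = 0" using zariski_clD[OF assms] by simp
    then show ?thesis by (simp add: R_def \<phi>0)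
  qed
  then show ?thesis using z0 by (simp add: zariski_cl_def)
qed

text \<open>Through \<open>\<psi>\<close>, polynomial functions near \<open>x0\<close> become
  quotients near \<open>z0\<close>. Clearing denominators by powers of one \<open>D\<close> gives a
  family with a common denominator, to which \<open>le_alg_dim_rational\<close> applies. The other
  inequality is the same statement with the roles swapped.\<close>

lemma local_dim_image: "local_dim I A x0 \<le> local_dim I' B z0"
proof -
  obtain k where k: "k \<in> polynomials I'" "k z0 \<noteq> 0" "local_dim I' B z0 = alg_dim I' {z \<in> B. k z \<noteq> 0}"
    using local_dim_attained[of I' z0 B] by blast
  have "\<forall>i\<in>I. \<exists>F H. F \<in> polynomials I' \<and> H \<in> polynomials I' \<and> H z0 \<noteq> 0 \<and> (\<forall>z. H z \<noteq> 0 \<longrightarrow> \<psi> z i = F z / H z)"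
    using \<psi> unfolding regular_at_def by blast
  from bchoice[OF this] obtain F0 where "\<forall>i\<in>I. \<exists>H. F0 i \<in> polynomials I' \<and> H \<in> polynomials I' \<and> H z0 \<noteq> 0 \<and> (\<forall>z. H z \<noteq> 0 \<longrightarrow> \<psi> z i = F0 i z / H z)" ..
  from bchoice[OF this] obtain H0 where FH: "\<forall>i\<in>I. F0 i \<in> polynomials I' \<and> H0 i \<in> polynomials I' \<and> H0 i z0 \<noteq> 0 \<and> (\<forall>z. H0 i z \<noteq> 0 \<longrightarrow> \<psi> z i = F0 i z / H0 i z)" ..
  define D where "D = (\<lambda>z. \<Prod>i\<in>I. H0 i z)"
  define F where "F = (\<lambda>i z. F0 i z * (\<Prod>j\<in>I - {i}. H0 j z))"
  have D: "D \<in> polynomials I'" "D z0 \<noteq> 0" unfolding D_def using FH fin(1) by (auto intro!: polynomials_prod)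
  have F: "F i \<in> polynomials I'" if "i \<in> I" for i
    unfolding F_def using FH that by (intro polynomials.mult polynomials_prod) auto
  have FD: "\<psi> z i = F i z / D z" if "i \<in> I" "D z \<noteq> 0" for i z
  proof -
    have "D z = H0 i z * (\<Prod>j\<in>I - {i}. H0 j z)" unfolding D_def by (rule prod.remove[OF fin(1) that(1)])
    then show ?thesis using FH that by (auto simp: F_def)
  qed
  define R where "R = (\<lambda>x. k (\<phi> x) * D (\<phi> x))"
  have "regular_at I x0 R" unfolding R_def
    using regular_at_mult[OF regular_at_poly_comp[where f = k and \<phi> = \<phi>, OF k(1) \<phi>] regular_at_poly_comp[where f = D and \<phi> = \<phi>, OF D(1) \<phi>]] .
  then obtain G H where GH: "G \<in> polynomials I" "H \<in> polynomials I" "H x0 \<noteq> 0" "\<And>x. H x \<noteq> 0 \<Longrightarrow> R x = G x / H x"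
    unfolding regular_at_def by blast
  have "R x0 \<noteq> 0" using k(2) D(2) by (simp add: R_def \<phi>0)
  then have "G x0 \<noteq> 0" using GH by auto
  \<comment> \<open>On this neighbourhood of \<open>x0\<close> the image under \<open>\<phi>\<close>
    lies in \<open>B\<close>, in the optimal neighbourhood of \<open>z0\<close>, and in the domain
    of the quotients that represent \<open>\<psi>\<close>.\<close>
  define h where "h = (\<lambda>x. hA x * H x * G x)"
  have h: "h \<in> polynomials I" "h x0 \<noteq> 0" unfolding h_def using hA GH \<open>G x0 \<noteq> 0\<close> by (auto intro!: polynomials.mult)
  define Y where "Y = {x \<in> A. h x \<noteq> 0}"
  have Y: "\<phi> x \<in> B" "\<psi> (\<phi> x) = x" "k (\<phi> x) \<noteq> 0" "D (\<phi> x) \<noteq> 0" if "x \<in> Y" for x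
  proof -
    from that have x: "x \<in> A" "hA x \<noteq> 0" "H x \<noteq> 0" "G x \<noteq> 0" by (auto simp: Y_def h_def)
    show "\<phi> x \<in> B" "\<psi> (\<phi> x) = x" using AB x by auto
    have "R x \<noteq> 0" using GH(4)[OF x(3)] x by simp
    then show "k (\<phi> x) \<noteq> 0" "D (\<phi> x) \<noteq> 0" by (auto simp: R_def)
  qed
  have "alg_dim I Y \<le> alg_dim I' (\<phi> ` Y)"
  proof (rule alg_dim_leI)
    fix m f assume f: "\<And>j. j < m \<Longrightarrow> f j \<in> polynomials I" "algebraically_independent_on Y m f"
    have "\<forall>j\<in>{..<m}. \<exists>N. \<exists>P\<in>polynomials I'. \<forall>z x. D z \<noteq> 0 \<longrightarrow> (\<forall>i\<in>I. x i = F i z / D z) \<longrightarrow> f j x = P z / D z ^ N"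
    proof
      fix j assume "j \<in> {..<m}"
      then have "f j \<in> polynomials I" using f(1) by simp
      from polynomials_rational_subst[where F = F and I' = I', OF this F D(1)]
      show "\<exists>N. \<exists>P\<in>polynomials I'. \<forall>z x. D z \<noteq> 0 \<longrightarrow> (\<forall>i\<in>I. x i = F i z / D z) \<longrightarrow> f j x = P z / D z ^ N" .
    qed
    from bchoice[OF this] obtain N where "\<forall>j\<in>{..<m}. \<exists>P. P\<in>polynomials I' \<and> (\<forall>z x. D z \<noteq> 0 \<longrightarrow> (\<forall>i\<in>I. x i = F i z / D z) \<longrightarrow> f j x = P z / D z ^ N j)"
      by blast
    from bchoice[OF this] obtain P where P: "\<forall>j\<in>{..<m}. P j\<in>polynomials I' \<and> (\<forall>z x. D z \<noteq> 0 \<longrightarrow> (\<forall>i\<in>I. x i = F i z / D z) \<longrightarrow> f j x = P j z / D z ^ N j)"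
      ..
    define M where "M = (\<Sum>j<m. N j)"
    have NM: "N j \<le> M" if "j < m" for j unfolding M_def using that by (intro member_le_sum) simp_all
    define P' where "P' = (\<lambda>j z. P j z * D z ^ (M - N j))"
    define Q where "Q = (\<lambda>z. D z ^ M)"
    have Qz: "Q z \<noteq> 0" if "z \<in> \<phi> ` Y" for z using Y that by (auto simp: Q_def)
    have Qp: "Q \<in> polynomials I'" unfolding Q_def by (rule polynomials_power[OF D(1)])
    have Pp: "P' j \<in> polynomials I'" if "j < m" for j
      unfolding P'_def using P that D(1) by (intro polynomials.mult polynomials_power) auto
    have val: "P' j (\<phi> x) / Q (\<phi> x) = f j x" if "j < m" "x \<in> Y" for j x
    proof -
      note Y = Y[OF that(2)]
      have "\<forall>i\<in>I. x i = F i (\<phi> x) / D (\<phi> x)" using FD[OF _ Y(4)] Y(2) by metis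
      then have "f j x = P j (\<phi> x) / D (\<phi> x) ^ N j" using P Y(4) that(1) by blast
      moreover have "D (\<phi> x) ^ M = D (\<phi> x) ^ N j * D (\<phi> x) ^ (M - N j)"
        using NM[OF that(1)] by (simp add: power_add[symmetric])
      ultimately show ?thesis using Y(4) by (simp add: P'_def Q_def)
    qed
    show "enat m \<le> alg_dim I' (\<phi> ` Y)"
    proof (rule le_alg_dim_rational[OF fin(2) Pp Qp Qz])
      show "algebraically_independent_on (\<phi> ` Y) m (\<lambda>j y. P' j y / Q y)"
        unfolding algebraically_independent_on_def
      proof (intro ballI impI allI)
        fix p w assume p: "p \<in> polynomials {..<m}" "\<forall>z\<in>\<phi> ` Y. p (\<lambda>j. P' j z / Q z) = 0"
        have "p (\<lambda>j. f j x) = 0" if "x \<in> Y" for x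
        proof -
          have "p (\<lambda>j. f j x) = p (\<lambda>j. P' j (\<phi> x) / Q (\<phi> x))"
            by (rule polynomials_cong[OF p(1)]) (simp add: val that)
          then show ?thesis using p(2) that by simp
        qed
        with f(2) p(1) show "p w = 0" unfolding algebraically_independent_on_def by blast
      qed
    qed
  qed
  also have "\<dots> \<le> alg_dim I' {z \<in> B. k z \<noteq> 0}" by (rule alg_dim_mono) (use Y in auto)
  finally have "alg_dim I Y \<le> local_dim I' B z0" by (simp add: k(3))
  moreover have "local_dim I A x0 \<le> alg_dim I Y" unfolding Y_def by (rule local_dim_le[OF h])
  ultimately show ?thesis by (rule order_trans[rotated])
qed

definition gradients :: "'k \<Rightarrow> 'i \<Rightarrow> complex" where
  "gradients k = (SOME g. has_gradient I (\<lambda>x. \<phi> x k) x0 g)"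

definition differential :: "('i \<Rightarrow> complex) \<Rightarrow> 'k \<Rightarrow> complex" where
  "differential v = (\<lambda>k. if k \<in> I' then \<Sum>i\<in>I. gradients k i * v i else 0)"

lemma gradients: "k \<in> I' \<Longrightarrow> has_gradient I (\<lambda>x. \<phi> x k) x0 (gradients k)"
  unfolding gradients_def 
  by (rule someI_ex[where P = "has_gradient I (\<lambda>x. \<phi> x k) x0"]) (rule regular_has_gradient[OF \<phi> fin(1)])

lemma differential_derivative:
  assumes "k \<in> I'"
  shows "((\<lambda>t. \<phi> (\<lambda>i. x0 i + t * v i) k) has_field_derivative differential v k) (at 0)"
proof -
  have "((\<lambda>t. \<phi> (\<lambda>i. x0 i + t * v i) k) has_field_derivative (\<Sum>i\<in>I. gradients k i * v i)) (at 0)"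
    by (rule has_gradientD[OF gradients[OF assms], where \<gamma> = "\<lambda>t i. x0 i + t * v i"]) (simp_all add: line_derivative)
  then show ?thesis using assms by (simp add: differential_def)
qed

lemma module_hom_differential: "Modules.module_hom (\<lambda>(c::complex) v i. c * v i) (\<lambda>(c::complex) v i. c * v i) differential"
  by unfold_locales (auto simp: differential_def fun_eq_iff algebra_simps sum.distrib sum_distrib_left)

lemma differential_tangent:
  assumes cl: "x0 \<in> zariski_cl I A" and v: "v \<in> tangent_space I A x0"
  shows "differential v \<in> tangent_space I' B z0"
proof -
  have "((\<lambda>t. f (\<lambda>i. z0 i + t * differential v i)) has_field_derivative 0) (at 0)" if "f \<in> vanishing_ideal I' B" for f
  proof -
    from that have f: "f \<in> polynomials I'" "\<And>z. z \<in> B \<Longrightarrow> f z = 0" by (auto simp: vanishing_ideal_def)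
    define R where "R = (\<lambda>x. f (\<phi> x))"
    have R: "regular_at I x0 R" unfolding R_def by (rule regular_at_poly_comp[where f = f and \<phi> = \<phi>, OF f(1) \<phi>])
    have "R x = 0" if "x \<in> A" "hA x \<noteq> 0" for x using AB[OF that] f(2) by (simp add: R_def)
    from tangent_regular[OF v fin(1) cl R hA this]
    have d0: "((\<lambda>t. f (\<phi> (\<lambda>i. x0 i + t * v i))) has_field_derivative 0) (at 0)" by (simp add: R_def)
    obtain g where g: "has_gradient I' f z0 g" using polynomials_has_gradient[OF f(1) fin(2)] by blast
    have "((\<lambda>t. f (\<phi> (\<lambda>i. x0 i + t * v i))) has_field_derivative (\<Sum>k\<in>I'. g k * differential v k)) (at 0)"
      by (rule has_gradientD[OF g]) (simp_all add: \<phi>0 differential_derivative)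
    with d0 have "(\<Sum>k\<in>I'. g k * differential v k) = 0" using DERIV_unique by blast
    moreover have "((\<lambda>t. f (\<lambda>i. z0 i + t * differential v i)) has_field_derivative (\<Sum>k\<in>I'. g k * differential v k)) (at 0)"
      by (rule has_gradientD[OF g]) (simp_all add: line_derivative)
    ultimately show ?thesis by simp
  qed
  then show ?thesis by (simp add: tangent_space_def affine_space_def differential_def)
qed

end

context local_iso
begin

interpretation sw: local_iso I' I B A z0 x0 \<psi> \<phi> hB hA by (rule swap)

text \<open>The composite is the identity on \<open>A\<close> only, so its differential is the
  identity on tangent vectors and in general not on the ambient space.\<close>

lemma differential_inverse:
  assumes cl: "x0 \<in> zariski_cl I A" and v: "v \<in> tangent_space I A x0"
  shows "sw.differential (differential v) = v"
proof
  fix i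
  show "sw.differential (differential v) i = v i"
  proof (cases "i \<in> I")
    case True
    define R where "R = (\<lambda>x. \<psi> (\<phi> x) i - x i)"
    define S where "S = (\<lambda>z. \<psi> z i)"
    have S: "regular_at I' (\<phi> x0) S" using \<psi>[OF True] by (simp add: S_def \<phi>0)
    have "regular_at I x0 R" unfolding R_def
      using regular_at_diff[OF regular_at_comp[where R = S and \<phi> = \<phi>, OF S \<phi>] regular_at_poly[OF polynomials.coord[OF True]]]
      by (simp add: S_def)
    from tangent_regular[OF v fin(1) cl this hA]
    have "((\<lambda>t. \<psi> (\<phi> (\<lambda>i. x0 i + t * v i)) i - (x0 i + t * v i)) has_field_derivative 0) (at 0)"
      using AB by (simp add: R_def)
    from DERIV_add[OF this line_derivative[of x0 i v]]
    have 1: "((\<lambda>t. \<psi> (\<phi> (\<lambda>i. x0 i + t * v i)) i) has_field_derivative v i) (at 0)" by simp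
    have "((\<lambda>t. \<psi> (\<phi> (\<lambda>i. x0 i + t * v i)) i) has_field_derivative (\<Sum>k\<in>I'. sw.gradients i k * differential v k)) (at 0)"
      by (rule has_gradientD[OF sw.gradients[OF True]]) (simp_all add: \<phi>0 differential_derivative)
    from DERIV_unique[OF 1 this] True show ?thesis by (simp add: sw.differential_def)
  next
    case False
    then show ?thesis using tangent_space_affine[OF v] by (simp add: sw.differential_def affine_space_def)
  qed
qed

end

context local_iso
begin

interpretation sw: local_iso I' I B A z0 x0 \<psi> \<phi> hB hA by (rule swap)

lemma singular_point_image:
  "singular_point I (zariski_cl I A) x0 \<longleftrightarrow> singular_point I' (zariski_cl I' B) z0"
proof (cases "x0 \<in> zariski_cl I A")
  case True
  then have zcl: "z0 \<in> zariski_cl I' B" by (rule zariski_cl_image)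
  have "local_dim I A x0 = local_dim I' B z0" using local_dim_image sw.local_dim_image by (rule antisym)
  moreover have "tangent_dim I A x0 = tangent_dim I' B z0"
    unfolding tangent_dim_def
    by (rule dim_eqI[OF tangent_space_subspace[OF fin(1)] tangent_space_subspace[OF fin(2)] module_hom_differential, where E = sw.differential])
      (simp_all add: differential_tangent[OF True] differential_inverse[OF True] sw.differential_tangent[OF zcl] sw.differential_inverse[OF zcl])
  ultimately show ?thesis using True zcl by (simp add: singular_point_zariski_cl[OF A] singular_point_zariski_cl[OF B])
next
  case False
  then have "z0 \<notin> zariski_cl I' B" using sw.zariski_cl_image by blast
  with False show ?thesis by (simp add: singular_point_def)
qed

end

subsection \<open>Matrices of polynomial functions\<close>

definition polymat :: "'i set \<Rightarrow> nat \<Rightarrow> nat \<Rightarrow> (('i \<Rightarrow> complex) \<Rightarrow> complex mat) \<Rightarrow> bool" where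
  "polymat I n m G \<longleftrightarrow> (\<forall>x. G x \<in> carrier_mat n m) \<and> (\<forall>i<n. \<forall>j<m. (\<lambda>x. G x $$ (i, j)) \<in> polynomials I)"

lemma polymatI:
  "(\<And>x. G x \<in> carrier_mat n m) \<Longrightarrow> (\<And>i j. i < n \<Longrightarrow> j < m \<Longrightarrow> (\<lambda>x. G x $$ (i, j)) \<in> polynomials I) \<Longrightarrow> polymat I n m G"
  by (simp add: polymat_def)

lemma polymatD:
  assumes "polymat I n m G"
  shows "G x \<in> carrier_mat n m" "i < n \<Longrightarrow> j < m \<Longrightarrow> (\<lambda>x. G x $$ (i, j)) \<in> polynomials I"
    "dim_row (G x) = n" "dim_col (G x) = m"
  using assms by (auto simp: polymat_def carrier_matD)

lemma polymat_mat:
  assumes "\<And>i j. i < n \<Longrightarrow> j < m \<Longrightarrow> g i j \<in> polynomials I"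
  shows "polymat I n m (\<lambda>x. mat n m (\<lambda>(i, j). g i j x))"
  by (rule polymatI) (simp_all add: assms)

lemma polymat_const: "A \<in> carrier_mat n m \<Longrightarrow> polymat I n m (\<lambda>_. A)"
  by (auto intro!: polymatI polynomials.const)

lemma polymat_mult:
  assumes "polymat I n k G" "polymat I k m H"
  shows "polymat I n m (\<lambda>x. G x * H x)"
proof (rule polymatI)
  show "G x * H x \<in> carrier_mat n m" for x using assms by (meson mult_carrier_mat polymatD(1))
  fix i j assume ij: "i < n" "j < m"
  have "(G x * H x) $$ (i, j) = (\<Sum>l\<in>{0..<k}. G x $$ (i, l) * H x $$ (l, j))" for x
    using ij polymatD[OF assms(1)] polymatD[OF assms(2)] by (simp add: scalar_prod_def)
  moreover have "(\<lambda>x. \<Sum>l\<in>{0..<k}. G x $$ (i, l) * H x $$ (l, j)) \<in> polynomials I"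
    using ij by (intro polynomials_sum polynomials.mult polymatD[OF assms(1)] polymatD[OF assms(2)]) simp_all
  ultimately show "(\<lambda>x. (G x * H x) $$ (i, j)) \<in> polynomials I" by simp
qed

lemma polymat_det:
  assumes "polymat I n n G"
  shows "(\<lambda>x. det (G x)) \<in> polynomials I"
proof -
  have "det (G x) = (\<Sum>p\<in>{p. p permutes {0..<n}}. signof p * (\<Prod>i = 0..<n. G x $$ (i, p i)))" for x
    by (rule det_def'[OF polymatD(1)[OF assms]])
  moreover have "(\<lambda>x. \<Sum>p\<in>{p. p permutes {0..<n}}. signof p * (\<Prod>i = 0..<n. G x $$ (i, p i))) \<in> polynomials I"
  proof (intro polynomials_sum polynomials.mult polynomials.const polynomials_prod polymatD(2)[OF assms])
    fix p i assume "p \<in> {p. p permutes {0..<n}}" "i \<in> {0..<n}"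
    then show "p i < n" using permutes_in_image[of p "{0..<n}" i] by simp
  qed simp
  ultimately show ?thesis by simp
qed

lemma polymat_adj:
  assumes "polymat I n n G"
  shows "polymat I n n (\<lambda>x. adj_mat (G x))"
proof (rule polymatI)
  show "adj_mat (G x) \<in> carrier_mat n n" for x using adj_mat(1)[OF polymatD(1)[OF assms]] .
  fix i j assume ij: "i < n" "j < n"
  have "polymat I (n - 1) (n - 1) (\<lambda>x. mat_delete (G x) j i)"
  proof (rule polymatI)
    show "mat_delete (G x) j i \<in> carrier_mat (n - 1) (n - 1)" for x
      by (rule mat_delete_carrier[OF polymatD(1)[OF assms]])
    fix a b assume "a < n - 1" "b < n - 1"
    then show "(\<lambda>x. mat_delete (G x) j i $$ (a, b)) \<in> polynomials I"
      using polymatD(3,4)[OF assms] by (simp add: mat_delete_def polymatD(2)[OF assms])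
  qed
  from polymat_det[OF this] have "(\<lambda>x. (- 1) ^ (j + i) * det (mat_delete (G x) j i)) \<in> polynomials I"
    by (intro polynomials.mult polynomials.const)
  moreover have "adj_mat (G x) $$ (i, j) = (- 1) ^ (j + i) * det (mat_delete (G x) j i)" for x
    using ij polymatD(3,4)[OF assms] by (simp add: adj_mat_def cofactor_def)
  ultimately show "(\<lambda>x. adj_mat (G x) $$ (i, j)) \<in> polynomials I" by simp
qed

subsection \<open>Leading blocks and the decomposition into unitriangular and upper triangular factors\<close>

definition lead :: "nat \<Rightarrow> 'a mat \<Rightarrow> 'a mat" where
  "lead k A = mat k k (\<lambda>(i, j). A $$ (i, j))"

lemma lead_carrier[simp]: "lead k A \<in> carrier_mat k k"
  and lead_dim[simp]: "dim_row (lead k A) = k" "dim_col (lead k A) = k"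
  and lead_index[simp]: "i < k \<Longrightarrow> j < k \<Longrightarrow> lead k A $$ (i, j) = A $$ (i, j)"
  by (simp_all add: lead_def)

lemma lead_self: "A \<in> carrier_mat n n \<Longrightarrow> lead n A = A"
  by (auto simp: lead_def)

lemma lead_lead: "k \<le> m \<Longrightarrow> lead k (lead m A) = lead k A"
  by (auto simp: lead_def)

lemma upper_triangularD': "upper_triangular A \<Longrightarrow> A \<in> carrier_mat n n \<Longrightarrow> j < i \<Longrightarrow> i < n \<Longrightarrow> A $$ (i, j) = 0"
  by auto

lemma upper_triangularI': "A \<in> carrier_mat n n \<Longrightarrow> (\<And>i j. j < i \<Longrightarrow> i < n \<Longrightarrow> A $$ (i, j) = 0) \<Longrightarrow> upper_triangular A"
  by (auto simp: upper_triangular_def)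

lemma index_mult_mat': "A \<in> carrier_mat n k \<Longrightarrow> B \<in> carrier_mat k m \<Longrightarrow> i < n \<Longrightarrow> j < m \<Longrightarrow>
    (A * B) $$ (i, j) = (\<Sum>l\<in>{0..<k}. A $$ (i, l) * B $$ (l, j))"
  by (simp add: scalar_prod_def)

lemma lead_mult_upper:
  fixes A :: "'a :: comm_ring_1 mat"
  assumes A: "A \<in> carrier_mat n n" and B: "B \<in> carrier_mat n n" and u: "upper_triangular B" and k: "k \<le> n"
  shows "lead k (A * B) = lead k A * lead k B"
proof (rule eq_matI)
  fix i j assume "i < dim_row (lead k A * lead k B)" "j < dim_col (lead k A * lead k B)"
  then have ij: "i < k" "j < k" by simp_all
  have "(A * B) $$ (i, j) = (\<Sum>l\<in>{0..<n}. A $$ (i, l) * B $$ (l, j))"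
    using ij k by (intro index_mult_mat'[OF A B]) simp_all
  also have "\<dots> = (\<Sum>l\<in>{0..<k}. A $$ (i, l) * B $$ (l, j))"
    using ij k upper_triangularD'[OF u B] by (intro sum.mono_neutral_right) auto
  also have "\<dots> = (lead k A * lead k B) $$ (i, j)"
    using ij by (subst index_mult_mat'[of _ k k _ k]) simp_all
  finally show "lead k (A * B) $$ (i, j) = (lead k A * lead k B) $$ (i, j)" using ij by simp
qed simp_all

lemma upper_triangular_mult:
  fixes A :: "'a :: comm_ring_1 mat"
  assumes "A \<in> carrier_mat n n" "B \<in> carrier_mat n n" "upper_triangular A" "upper_triangular B"
  shows "upper_triangular (A * B)"
proof (rule upper_triangularI'[of _ n])
  fix i j assume ij: "j < i" "i < n"
  have "A $$ (i, l) * B $$ (l, j) = 0" if "l \<in> {0..<n}" for l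
  proof (cases "l < i")
    case True
    then show ?thesis using upper_triangularD'[OF assms(3,1)] ij by simp
  next
    case False
    then show ?thesis using upper_triangularD'[OF assms(4,2), of j l] ij that by simp
  qed
  then show "(A * B) $$ (i, j) = 0"
    using ij by (subst index_mult_mat'[OF assms(1,2)]) simp_all
qed (use assms in simp)

definition minv :: "complex mat \<Rightarrow> complex mat" where
  "minv A = (1 / det A) \<cdot>\<^sub>m adj_mat A"

lemma minv:
  assumes "A \<in> carrier_mat n n" "det A \<noteq> 0"
  shows "minv A \<in> carrier_mat n n" "A * minv A = 1\<^sub>m n" "minv A * A = 1\<^sub>m n"
proof -
  note a = adj_mat[OF assms(1)]
  show c: "minv A \<in> carrier_mat n n" using a by (simp add: minv_def)
  have e: "(1 / det A) \<cdot>\<^sub>m (det A \<cdot>\<^sub>m 1\<^sub>m n) = 1\<^sub>m n" using assms(2) by (intro eq_matI) auto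
  show "A * minv A = 1\<^sub>m n" unfolding minv_def mult_smult_distrib[OF assms(1) a(1)] a(2) e ..
  show "minv A * A = 1\<^sub>m n" unfolding minv_def mult_smult_assoc_mat[OF a(1) assms(1)] a(3) e ..
qed

lemma det_minv:
  assumes "A \<in> carrier_mat n n" "det A \<noteq> 0"
  shows "det (minv A) \<noteq> 0"
proof
  assume "det (minv A) = 0"
  moreover have "det (A * minv A) = 1" using minv[OF assms] by simp
  ultimately show False using det_mult[OF assms(1) minv(1)[OF assms]] by simp
qed

lemma prod_list_diag_mat:
  "A \<in> carrier_mat n n \<Longrightarrow> prod_list (diag_mat A) = (\<Prod>i\<in>{0..<n}. A $$ (i, i))"
  by (simp add: diag_mat_def prod.list_conv_set_nth)

lemma upper_triangular_det_diag:
  fixes A :: "complex mat"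
  assumes "A \<in> carrier_mat n n" "upper_triangular A"
  shows "det A = (\<Prod>i\<in>{0..<n}. A $$ (i, i))"
  using det_upper_triangular[OF assms(2,1)] prod_list_diag_mat[OF assms(1)] by simp

text \<open>Back substitution in \<open>A * minv A = 1\<close>, column by column from the last row
  upward: the entries further down are already zero, and the diagonal of \<open>A\<close> has no
  zero.\<close>

lemma upper_triangular_minv:
  assumes A: "A \<in> carrier_mat n n" and u: "upper_triangular A" and d: "det A \<noteq> 0"
  shows "upper_triangular (minv A)"
proof -
  note m = minv[OF A d]
  have diag: "A $$ (i, i) \<noteq> 0" if "i < n" for i
    using d that unfolding upper_triangular_det_diag[OF A u] by auto
  have "minv A $$ (i, j) = 0" if "j < i" "i < n" for i j
    using that
  proof (induction "n - i" arbitrary: i rule: less_induct)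
    case less
    have "0 = (A * minv A) $$ (i, j)" unfolding m(2) using less.prems by simp
    also have "\<dots> = (\<Sum>l\<in>{0..<n}. A $$ (i, l) * minv A $$ (l, j))"
      using less.prems by (intro index_mult_mat'[OF A m(1)]) simp_all
    also have "\<dots> = (\<Sum>l\<in>{0..<n}. if l = i then A $$ (i, i) * minv A $$ (i, j) else 0)"
    proof (rule sum.cong[OF refl])
      fix l assume l: "l \<in> {0..<n}"
      consider "l < i" | "l = i" | "i < l" by linarith
      then show "A $$ (i, l) * minv A $$ (l, j) = (if l = i then A $$ (i, i) * minv A $$ (i, j) else 0)"
      proof cases
        case 1
        then show ?thesis using upper_triangularD'[OF u A] less.prems by simp
      next
        case 3
        then show ?thesis using less.hyps[of l] l less.prems by simp
      qed simp
    qed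
    also have "\<dots> = A $$ (i, i) * minv A $$ (i, j)" using less.prems by simp
    finally show ?case using diag[OF less.prems(2)] by simp
  qed
  then show ?thesis by (rule upper_triangularI'[OF m(1)])
qed

text \<open>The minor with rows \<open>0, ..., j - 1, i\<close> and columns
  \<open>0, ..., j\<close>. By Cramer's rule, quotients of such minors are the entries of the
  unitriangular factor.\<close>

definition lu_minor :: "complex mat \<Rightarrow> nat \<Rightarrow> nat \<Rightarrow> complex" where
  "lu_minor A i j = det (mat (Suc j) (Suc j) (\<lambda>(a, b). A $$ (if a < j then a else i, b)))"

definition lu_ok :: "nat \<Rightarrow> complex mat \<Rightarrow> bool" where
  "lu_ok n A \<longleftrightarrow> (\<forall>k<n. lu_minor A k k \<noteq> 0)"

definition lu_coord :: "nat \<Rightarrow> complex mat \<Rightarrow> nat \<times> nat \<Rightarrow> complex" where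
  "lu_coord n A = (\<lambda>(i, j). if j < i \<and> i < n then lu_minor A i j / lu_minor A j j else 0)"

lemma lower_unitriangular_carrier[simp]: "lower_unitriangular n x \<in> carrier_mat n n"
  and lower_unitriangular_dim[simp]: "dim_row (lower_unitriangular n x) = n" "dim_col (lower_unitriangular n x) = n"
  by (simp_all add: lower_unitriangular_def)

lemma lower_unitriangular_index[simp]:
  "i < n \<Longrightarrow> j < n \<Longrightarrow> lower_unitriangular n x $$ (i, j) = (if i = j then 1 else if j < i then x (i, j) else 0)"
  by (simp add: lower_unitriangular_def)

lemma det_lower_unitriangular[simp]: "det (lower_unitriangular n x) = 1"
proof -
  have "det (lower_unitriangular n x) = prod_list (diag_mat (lower_unitriangular n x))"
    by (rule det_lower_triangular[of n]) simp_all
  also have "\<dots> = 1" by (subst prod_list_diag_mat[of _ n]) simp_all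
  finally show ?thesis .
qed

text \<open>An upper triangular right factor acts on the first \<open>j + 1\<close> columns through
  its leading block, whatever rows are chosen. So all minors for this \<open>j\<close> are
  multiplied by one determinant, and their quotients depend on the unitriangular factor
  only.\<close>

lemma lu_minor_product:
  assumes b: "b \<in> carrier_mat n n" "upper_triangular b" and ij: "j \<le> i" "i < n"
  shows "lu_minor (lower_unitriangular n x * b) i j = (if i = j then 1 else x (i, j)) * det (lead (Suc j) b)"
proof -
  let ?L = "lower_unitriangular n x"
  let ?r = "\<lambda>a. if a < j then a else i"
  let ?M = "mat (Suc j) (Suc j) (\<lambda>(a, c). ?L $$ (?r a, c))"
  have "mat (Suc j) (Suc j) (\<lambda>(a, c). (?L * b) $$ (?r a, c)) = ?M * lead (Suc j) b"
  proof (rule eq_matI)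
    fix a c assume "a < dim_row (?M * lead (Suc j) b)" "c < dim_col (?M * lead (Suc j) b)"
    then have ac: "a < Suc j" "c < Suc j" by simp_all
    have ra: "?r a < n" using ac ij by simp
    have "(?L * b) $$ (?r a, c) = (\<Sum>l\<in>{0..<n}. ?L $$ (?r a, l) * b $$ (l, c))"
      using ac ij ra by (intro index_mult_mat'[OF _ b(1)]) simp_all
    also have "\<dots> = (\<Sum>l\<in>{0..<Suc j}. ?L $$ (?r a, l) * b $$ (l, c))"
      using ac ij upper_triangularD'[OF b(2,1)] by (intro sum.mono_neutral_right) auto
    also have "\<dots> = (?M * lead (Suc j) b) $$ (a, c)"
      using ac by (subst index_mult_mat'[of _ "Suc j" "Suc j" _ "Suc j"]) simp_all
    finally show "mat (Suc j) (Suc j) (\<lambda>(a, c). (?L * b) $$ (?r a, c)) $$ (a, c) = (?M * lead (Suc j) b) $$ (a, c)"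
      using ac by simp
  qed simp_all
  then have "lu_minor (?L * b) i j = det ?M * det (lead (Suc j) b)"
    unfolding lu_minor_def by (simp add: det_mult[of _ "Suc j"])
  moreover have "det ?M = prod_list (diag_mat ?M)"
    by (rule det_lower_triangular[of "Suc j"]) (use ij in auto)
  moreover have "prod_list (diag_mat ?M) = (\<Prod>a\<in>{0..<Suc j}. ?L $$ (?r a, a))"
    by (subst prod_list_diag_mat[of _ "Suc j"]) simp_all
  moreover have "\<dots> = (if i = j then 1 else x (i, j))"
    using ij by (simp add: prod.atLeast0_lessThan_Suc)
  ultimately show ?thesis by simp
qed

lemma upper_triangular_lead: "upper_triangular b \<Longrightarrow> b \<in> carrier_mat n n \<Longrightarrow> k \<le> n \<Longrightarrow> upper_triangular (lead k b)"
  by (rule upper_triangularI'[of _ k]) (auto simp: upper_triangularD')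

lemma det_lead_upper:
  fixes b :: "complex mat"
  assumes "b \<in> carrier_mat n n" "upper_triangular b" "det b \<noteq> 0" "k \<le> n"
  shows "det (lead k b) \<noteq> 0"
proof -
  have "b $$ (i, i) \<noteq> 0" if "i < n" for i
    using assms(3) that unfolding upper_triangular_det_diag[OF assms(1,2)] by auto
  then show ?thesis
    using assms(4) unfolding upper_triangular_det_diag[OF lead_carrier upper_triangular_lead[OF assms(2,1,4)]] by simp
qed

lemma lu_unique:
  assumes b: "b \<in> carrier_mat n n" "upper_triangular b" "det b \<noteq> 0" and x: "x \<in> affine_space (chart_index n)"
  shows "lu_ok n (lower_unitriangular n x * b)" "lu_coord n (lower_unitriangular n x * b) = x"
proof -
  have d: "det (lead (Suc j) b) \<noteq> 0" if "j < n" for j using det_lead_upper[OF b] that by simp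
  then show "lu_ok n (lower_unitriangular n x * b)"
    unfolding lu_ok_def by (simp add: lu_minor_product[OF b(1,2)])
  show "lu_coord n (lower_unitriangular n x * b) = x"
  proof
    fix p :: "nat \<times> nat"
    obtain i j where p: "p = (i, j)" by force
    show "lu_coord n (lower_unitriangular n x * b) p = x p"
      using x d[of j] by (auto simp: p lu_coord_def lu_minor_product[OF b(1,2)] affine_space_def chart_index_def)
  qed
qed

lemma lu_coord_affine: "lu_coord n A \<in> affine_space (chart_index n)"
  by (auto simp: lu_coord_def affine_space_def chart_index_def)

lemma lu_minor_lead:
  assumes "i < k" "j < k" shows "lu_minor (lead k A) i j = lu_minor A i j"
  unfolding lu_minor_def using assms by (intro arg_cong[of _ _ det] cong_mat) auto

lemma det_lead_Suc: "lu_minor A k k = det (lead (Suc k) A)"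
proof -
  have "(if a < k then a else k) = a" if "a < Suc k" for a using that by simp
  then have "mat (Suc k) (Suc k) (\<lambda>(a, b). A $$ (if a < k then a else k, b)) = lead (Suc k) A"
    unfolding lead_def by (intro cong_mat) auto
  then show ?thesis by (simp add: lu_minor_def)
qed

lemma border_decomposition:
  fixes A :: "'a :: zero mat"
  assumes "A \<in> carrier_mat (Suc n) (Suc n)"
  shows "A = four_block_mat (lead n A) (mat n 1 (\<lambda>(i, j). A $$ (i, n))) (mat 1 n (\<lambda>(i, j). A $$ (n, j))) (mat 1 1 (\<lambda>_. A $$ (n, n)))"
proof (rule eq_matI)
  fix i j assume "i < dim_row (four_block_mat (lead n A) (mat n 1 (\<lambda>(i, j). A $$ (i, n))) (mat 1 n (\<lambda>(i, j). A $$ (n, j))) (mat 1 1 (\<lambda>_. A $$ (n, n))))"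
    "j < dim_col (four_block_mat (lead n A) (mat n 1 (\<lambda>(i, j). A $$ (i, n))) (mat 1 n (\<lambda>(i, j). A $$ (n, j))) (mat 1 1 (\<lambda>_. A $$ (n, n))))"
  then have "i < n \<or> i = n" "j < n \<or> j = n" by auto
  then show "A $$ (i, j) = four_block_mat (lead n A) (mat n 1 (\<lambda>(i, j). A $$ (i, n))) (mat 1 n (\<lambda>(i, j). A $$ (n, j))) (mat 1 1 (\<lambda>_. A $$ (n, n))) $$ (i, j)"
    by auto
qed (use assms in simp_all)

lemma lower_unitriangular_eqI:
  assumes "L \<in> carrier_mat n n" "\<And>i. i < n \<Longrightarrow> L $$ (i, i) = 1" "\<And>i j. i < j \<Longrightarrow> j < n \<Longrightarrow> L $$ (i, j) = 0"
  shows "\<exists>x\<in>affine_space (chart_index n). L = lower_unitriangular n x"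
proof
  let ?x = "\<lambda>(i, j). if j < i \<and> i < n then L $$ (i, j) else 0"
  show "?x \<in> affine_space (chart_index n)" by (auto simp: affine_space_def chart_index_def)
  show "L = lower_unitriangular n ?x"
  proof (rule eq_matI)
    fix i j assume "i < dim_row (lower_unitriangular n ?x)" "j < dim_col (lower_unitriangular n ?x)"
    then show "L $$ (i, j) = lower_unitriangular n ?x $$ (i, j)"
      using assms(2)[of i] assms(3)[of i j] by (cases i j rule: linorder_cases) auto
  qed (use assms in auto)
qed

text \<open>Bordering: the leading block is factored by induction, the new row and column are solved
  for with the two factors, and the new corner is the Schur complement.\<close>

lemma lu_exists_aux:
  assumes "A \<in> carrier_mat n n" "lu_ok n A"
  shows "\<exists>x\<in>affine_space (chart_index n). \<exists>b\<in>carrier_mat n n. upper_triangular b \<and> A = lower_unitriangular n x * b"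
  using assms
proof (induction n arbitrary: A)
  case 0
  have "A = lower_unitriangular 0 (\<lambda>_. 0) * 0\<^sub>m 0 0" using 0 by (intro eq_matI) auto
  then show ?case
    by (intro bexI[of _ "\<lambda>_. 0"] bexI[of _ "0\<^sub>m 0 0"]) (auto simp: affine_space_def)
next
  case (Suc n)
  note A = Suc.prems(1)
  have "lu_ok n (lead n A)" using Suc.prems(2) by (simp add: lu_ok_def lu_minor_lead)
  from Suc.IH[OF lead_carrier this] obtain x b where x: "x \<in> affine_space (chart_index n)"
    and b: "b \<in> carrier_mat n n" "upper_triangular b" and Axb: "lead n A = lower_unitriangular n x * b" by blast
  let ?L = "lower_unitriangular n x"
  have db: "det b \<noteq> 0"
  proof (cases n)
    case 0
    then show ?thesis using b by (simp add: det_def)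
  next
    case (Suc k)
    then have "det (lead n A) \<noteq> 0" using \<open>lu_ok n (lead n A)\<close> by (auto simp: lu_ok_def det_lead_Suc lead_lead)
    then show ?thesis unfolding Axb using det_mult[of ?L n b] b by simp
  qed
  note mb = minv[OF b(1) db] and mL = minv[of ?L n, simplified]
  define c where "c = mat n 1 (\<lambda>(i, j). A $$ (i, n))"
  define r where "r = mat 1 n (\<lambda>(i, j). A $$ (n, j))"
  define d where "d = mat 1 1 (\<lambda>(i :: nat, j :: nat). A $$ (n, n))"
  have cr: "c \<in> carrier_mat n 1" "r \<in> carrier_mat 1 n" "d \<in> carrier_mat 1 1" by (simp_all add: c_def r_def d_def)
  have A4: "A = four_block_mat (lead n A) c r d"
    using border_decomposition[OF A] by (simp add: c_def r_def d_def case_prod_unfold)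
  let ?r' = "r * minv b" and ?c' = "minv ?L * c"
  let ?d' = "d - ?r' * ?c'"
  have r': "?r' \<in> carrier_mat 1 n" and c': "?c' \<in> carrier_mat n 1" using cr mb mL by simp_all
  have d': "?d' \<in> carrier_mat 1 1" by (rule minus_carrier_mat[OF mult_carrier_mat[OF r' c']])
  define L where "L = four_block_mat ?L (0\<^sub>m n 1) ?r' (1\<^sub>m 1)"
  define B where "B = four_block_mat b ?c' (0\<^sub>m 1 n) ?d'"
  have Lc: "L \<in> carrier_mat (Suc n) (Suc n)" and Bc: "B \<in> carrier_mat (Suc n) (Suc n)"
    unfolding L_def B_def
    using four_block_carrier_mat[of ?L n n "1\<^sub>m 1" 1 1] four_block_carrier_mat[OF b(1) d'] b r' c' cr
    by simp_all
  have "L * B = four_block_mat (?L * b + 0\<^sub>m n 1 * 0\<^sub>m 1 n) (?L * ?c' + 0\<^sub>m n 1 * ?d') (?r' * b + 1\<^sub>m 1 * 0\<^sub>m 1 n) (?r' * ?c' + 1\<^sub>m 1 * ?d')"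
    unfolding L_def B_def
    by (rule mult_four_block_mat[OF lower_unitriangular_carrier zero_carrier_mat r' one_carrier_mat b(1) c' zero_carrier_mat d'])
  also have "?L * b + 0\<^sub>m n 1 * 0\<^sub>m 1 n = lead n A"
    using b Axb right_add_zero_mat[OF mult_carrier_mat[OF lower_unitriangular_carrier b(1)], of x] by simp
  also have "?L * ?c' + 0\<^sub>m n 1 * ?d' = c"
  proof -
    have "?L * ?c' = (?L * minv ?L) * c"
      by (rule assoc_mult_mat[OF lower_unitriangular_carrier mL(1) cr(1), symmetric])
    then show ?thesis using left_mult_zero_mat[OF d'] right_add_zero_mat[OF cr(1)] left_mult_one_mat[OF cr(1)] mL(2) by simp
  qed
  also have "?r' * b + 1\<^sub>m 1 * 0\<^sub>m 1 n = r"
  proof -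
    have "?r' * b = r * (minv b * b)" by (rule assoc_mult_mat[OF cr(2) mb(1) b(1)])
    then show ?thesis using right_mult_one_mat[OF cr(2)] right_add_zero_mat[OF cr(2)] mb(3) by simp
  qed
  also have "?r' * ?c' + 1\<^sub>m 1 * ?d' = d"
  proof -
    have "w + (d - w) = d" if "w \<in> carrier_mat 1 1" for w
      by (rule eq_matI) (use that cr(3) in auto)
    from this[OF mult_carrier_mat[OF r' c']] show ?thesis unfolding left_mult_one_mat[OF d'] .
  qed
  finally have AL: "A = L * B" using A4 by simp
  have "\<exists>x\<in>affine_space (chart_index (Suc n)). L = lower_unitriangular (Suc n) x"
  proof (rule lower_unitriangular_eqI[OF Lc])
    show "L $$ (i, i) = 1" if "i < Suc n" for i using that r' by (auto simp: L_def)
    show "L $$ (i, j) = 0" if "i < j" "j < Suc n" for i j using that r' by (auto simp: L_def)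
  qed
  moreover have "upper_triangular B"
  proof (rule upper_triangularI'[OF Bc])
    show "B $$ (i, j) = 0" if "j < i" "i < Suc n" for i j
      using that b upper_triangularD'[OF b(2,1), of j i] c' cr by (auto simp: B_def)
  qed
  ultimately show ?case using AL Bc by metis
qed

lemma lu_exists:
  assumes "A \<in> carrier_mat n n" "lu_ok n A"
  shows "\<exists>b\<in>carrier_mat n n. upper_triangular b \<and> det b \<noteq> 0 \<and> A = lower_unitriangular n (lu_coord n A) * b"
proof -
  obtain x b where x: "x \<in> affine_space (chart_index n)" and b: "b \<in> carrier_mat n n" "upper_triangular b"
    and A: "A = lower_unitriangular n x * b" using lu_exists_aux[OF assms] by blast
  have "det b \<noteq> 0"
  proof (cases n)
    case 0
    then show ?thesis using b by (simp add: det_def)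
  next
    case (Suc k)
    then have "det A \<noteq> 0" using assms by (auto simp: lu_ok_def det_lead_Suc lead_self)
    then show ?thesis unfolding A using det_mult[of "lower_unitriangular n x" n b] b by simp
  qed
  with lu_unique(2)[OF b this x] b A show ?thesis by metis
qed

lemma polymat_lu_minor:
  assumes G: "polymat I n n G" and ij: "j \<le> i" "i < n"
  shows "(\<lambda>x. lu_minor (G x) i j) \<in> polynomials I"
proof -
  have "polymat I (Suc j) (Suc j) (\<lambda>x. mat (Suc j) (Suc j) (\<lambda>(a, b). (\<lambda>a b x. G x $$ (if a < j then a else i, b)) a b x))"
    by (rule polymat_mat) (use ij in \<open>auto intro!: polymatD(2)[OF G]\<close>)
  from polymat_det[OF this] show ?thesis by (simp add: lu_minor_def)
qed

lemma regular_lu_coord: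
  assumes G: "polymat I n n G" and ok: "lu_ok n (G x0)"
  shows "regular_at I x0 (\<lambda>x. lu_coord n (G x) p)"
proof -
  obtain i j where p: "p = (i, j)" by force
  show ?thesis
  proof (cases "j < i \<and> i < n")
    case True
    then have "regular_at I x0 (\<lambda>x. lu_minor (G x) i j / lu_minor (G x) j j)"
      using ok by (intro regular_at_divide regular_at_poly polymat_lu_minor[OF G]) (auto simp: lu_ok_def)
    then show ?thesis using True by (simp add: p lu_coord_def)
  next
    case False
    then have "lu_coord n (G x) p = 0" for x by (auto simp: p lu_coord_def)
    then show ?thesis by (simp add: regular_at_const)
  qed
qed

lemma lu_ok_polynomial:
  assumes G: "polymat I n n G"
  shows "(\<lambda>x. \<Prod>k<n. lu_minor (G x) k k) \<in> polynomials I"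
  by (intro polynomials_prod polymat_lu_minor[OF G]) simp_all

lemma lu_ok_iff: "lu_ok n A \<longleftrightarrow> (\<Prod>k<n. lu_minor A k k) \<noteq> 0"
  by (auto simp: lu_ok_def)

lemma polymat_lower_unitriangular: "polymat (chart_index n) n n (lower_unitriangular n)"
proof (rule polymatI)
  fix i j assume ij: "i < n" "j < n"
  consider "i = j" | "j < i" | "i < j" by linarith
  then show "(\<lambda>x. lower_unitriangular n x $$ (i, j)) \<in> polynomials (chart_index n)"
  proof cases
    case 2
    then show ?thesis using ij by (auto simp: chart_index_def intro: polynomials.coord)
  qed (use ij in \<open>simp_all add: polynomials.const\<close>)
qed simp

subsection \<open>Flags\<close>

lemma index_mult_mat_vec': "A \<in> carrier_mat n k \<Longrightarrow> x \<in> carrier_vec k \<Longrightarrow> i < n \<Longrightarrow>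
    (A *\<^sub>v x) $ i = (\<Sum>j\<in>{0..<k}. A $$ (i, j) * x $ j)"
  by (simp add: scalar_prod_def)

lemma col_space_eq_image:
  fixes P :: "complex mat"
  assumes P: "P \<in> carrier_mat n k"
  shows "vec_space.col_space n P = {P *\<^sub>v x |x. x \<in> carrier_vec k}"
  unfolding vec_space.col_space_eq[OF P] using P by auto

text \<open>Replaces a matrix with \<open>k\<close> columns by the square matrix \<open>G\<close>
  and vectors supported on the first \<open>k\<close> coordinates, so that all steps of a flag are
  described by one matrix.\<close>

lemma mult_vec_prefix:
  fixes G :: "complex mat"
  assumes G: "G \<in> carrier_mat n n" and k: "k \<le> n"
  shows "vec_space.col_space n (mat_of_cols n (take k (cols G))) =
    {G *\<^sub>v v |v. v \<in> carrier_vec n \<and> (\<forall>i. k \<le> i \<and> i < n \<longrightarrow> v $ i = 0)}" (is "?C = ?R")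
proof -
  let ?P = "mat_of_cols n (take k (cols G))"
  have P: "?P \<in> carrier_mat n k" using G k by (intro carrier_matI) auto
  have Pi: "?P $$ (i, j) = G $$ (i, j)" if "i < n" "j < k" for i j
    using that G k by (simp add: mat_of_cols_index)
  have C: "?C = {?P *\<^sub>v x |x. x \<in> carrier_vec k}"
    by (rule col_space_eq_image[OF P])
  have PG: "?P *\<^sub>v x = G *\<^sub>v v" if "x \<in> carrier_vec k" "v \<in> carrier_vec n" "\<And>i. i < k \<Longrightarrow> v $ i = x $ i" "\<And>i. k \<le> i \<Longrightarrow> i < n \<Longrightarrow> v $ i = 0" for x v
  proof (rule eq_vecI)
    fix i assume "i < dim_vec (G *\<^sub>v v)"
    then have i: "i < n" using G by simp
    have "(G *\<^sub>v v) $ i = (\<Sum>j\<in>{0..<n}. G $$ (i, j) * v $ j)"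
      by (rule index_mult_mat_vec'[OF G that(2) i])
    also have "\<dots> = (\<Sum>j\<in>{0..<k}. G $$ (i, j) * v $ j)" using k that by (intro sum.mono_neutral_right) auto
    also have "\<dots> = (\<Sum>j\<in>{0..<k}. ?P $$ (i, j) * x $ j)" using that Pi i by (intro sum.cong) auto
    also have "\<dots> = (?P *\<^sub>v x) $ i" by (rule index_mult_mat_vec'[OF P that(1) i, symmetric])
    finally show "(?P *\<^sub>v x) $ i = (G *\<^sub>v v) $ i" ..
  qed (use G P in simp)
  show ?thesis unfolding C
  proof (intro equalityI subsetI)
    fix y assume "y \<in> {?P *\<^sub>v x |x. x \<in> carrier_vec k}"
    then obtain x where x: "x \<in> carrier_vec k" "y = ?P *\<^sub>v x" by auto
    let ?v = "vec n (\<lambda>i. if i < k then x $ i else 0)"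
    have "?P *\<^sub>v x = G *\<^sub>v ?v" using x k by (intro PG) auto
    then show "y \<in> ?R" using x(2) by (intro CollectI exI[of _ ?v]) auto
  next
    fix y assume "y \<in> ?R"
    then obtain v where v: "v \<in> carrier_vec n" "y = G *\<^sub>v v" "\<And>i. k \<le> i \<Longrightarrow> i < n \<Longrightarrow> v $ i = 0" by auto
    have "?P *\<^sub>v vec k (\<lambda>i. v $ i) = G *\<^sub>v v" using v by (intro PG) auto
    then show "y \<in> {?P *\<^sub>v x |x. x \<in> carrier_vec k}" using v(2) by (intro CollectI exI[of _ "vec k (\<lambda>i. v $ i)"]) auto
  qed
qed

lemma det_carrier_GL: "g \<in> GL n \<longleftrightarrow> g \<in> carrier_mat n n \<and> det g \<noteq> 0"
proof
  assume "g \<in> GL n"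
  then have g: "g \<in> carrier_mat n n" "invertible_mat g" by (auto simp: GL_def)
  then obtain B where "inverts_mat g B" "inverts_mat B g" by (auto simp: invertible_mat_def)
  then have B: "g * B = 1\<^sub>m n" "B * g = 1\<^sub>m (dim_row B)" using g by (auto simp: inverts_mat_def)
  have "dim_col B = n" using arg_cong[OF B(1), of dim_col] by simp
  moreover have "dim_row B = n" using arg_cong[OF B(2), of dim_col] g by simp
  ultimately have "B \<in> carrier_mat n n" by auto
  from det_mult[OF g(1) this] B(1) have "det g * det B = 1" by simp
  then show "g \<in> carrier_mat n n \<and> det g \<noteq> 0" using g by auto
next
  assume g: "g \<in> carrier_mat n n \<and> det g \<noteq> 0"
  then have "invertible_mat g"
    unfolding invertible_mat_def inverts_mat_def using minv[of g n] by (intro conjI exI[of _ "minv g"]) auto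
  then show "g \<in> GL n" using g by (simp add: GL_def)
qed

lemma flag_nth:
  assumes "G \<in> carrier_mat n n" "k \<le> n"
  shows "flag_of n G ! k = {G *\<^sub>v v |v. v \<in> carrier_vec n \<and> (\<forall>i. k \<le> i \<and> i < n \<longrightarrow> v $ i = 0)}"
proof -
  have "flag_of n G ! k = vec_space.col_space n (mat_of_cols n (take k (cols G)))"
    using assms(2) unfolding flag_of_def by (simp add: nth_append del: upt_Suc)
  then show ?thesis using mult_vec_prefix[OF assms] by simp
qed

lemma flag_nth_upper_subset:
  assumes G: "G \<in> carrier_mat n n" and b: "b \<in> carrier_mat n n" "upper_triangular b" and k: "k \<le> n"
  shows "flag_of n (G * b) ! k \<subseteq> flag_of n G ! k"
proof
  fix y assume "y \<in> flag_of n (G * b) ! k"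
  then obtain v where v: "v \<in> carrier_vec n" "y = G * b *\<^sub>v v" "\<And>i. k \<le> i \<Longrightarrow> i < n \<Longrightarrow> v $ i = 0"
    unfolding flag_nth[OF mult_carrier_mat[OF G b(1)] k] by auto
  have "y = G *\<^sub>v (b *\<^sub>v v)" using v(1,2) assoc_mult_mat_vec[OF G b(1) v(1)] by simp
  moreover have "(b *\<^sub>v v) $ i = 0" if i: "k \<le> i" "i < n" for i
  proof -
    have "(b *\<^sub>v v) $ i = (\<Sum>j\<in>{0..<n}. b $$ (i, j) * v $ j)"
      using i by (intro index_mult_mat_vec'[OF b(1) v(1)])
    also have "\<dots> = 0"
    proof (rule sum.neutral, rule ballI)
      fix j assume "j \<in> {0..<n}"
      then show "b $$ (i, j) * v $ j = 0"
        using upper_triangularD'[OF b(2,1), of j i] v(3)[of j] i by (cases "j < i") auto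
    qed
    finally show ?thesis .
  qed
  moreover have "b *\<^sub>v v \<in> carrier_vec n" by (rule mult_mat_vec_carrier[OF b(1) v(1)])
  ultimately show "y \<in> flag_of n G ! k" unfolding flag_nth[OF G k] by auto
qed

lemma length_flag_of[simp]: "length (flag_of n G) = Suc n"
  by (simp add: flag_of_def)

lemma flag_of_upper:
  assumes G: "G \<in> carrier_mat n n" and b: "b \<in> carrier_mat n n" "upper_triangular b" "det b \<noteq> 0"
  shows "flag_of n (G * b) = flag_of n G"
proof (rule nth_equalityI)
  fix k assume "k < length (flag_of n (G * b))"
  then have k: "k \<le> n" by simp
  have "G * b * minv b = G * (b * minv b)" by (rule assoc_mult_mat[OF G b(1) minv(1)[OF b(1,3)]])
  then have e: "G * b * minv b = G" using minv(2)[OF b(1,3)] right_mult_one_mat[OF G] by simp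
  show "flag_of n (G * b) ! k = flag_of n G ! k"
  proof
    show "flag_of n (G * b) ! k \<subseteq> flag_of n G ! k" by (rule flag_nth_upper_subset[OF G b(1,2) k])
    from flag_nth_upper_subset[OF mult_carrier_mat[OF G b(1)] minv(1)[OF b(1,3)] upper_triangular_minv[OF b] k]
    show "flag_of n G ! k \<subseteq> flag_of n (G * b) ! k" unfolding e .
  qed
qed simp

lemma mult_unit_vec_col: "A \<in> carrier_mat n m \<Longrightarrow> j < m \<Longrightarrow> A *\<^sub>v unit_vec m j = col A j" for A :: "complex mat"
  by (intro eq_vecI) auto

text \<open>Used for two matrices \<open>A\<close>: another basis of the same flag, and the image of
  the basis under an endomorphism that stabilizes the flag.\<close>

lemma stable_prefix_imp_upper:
  fixes A G :: "complex mat"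
  assumes G: "G \<in> carrier_mat n n" "det G \<noteq> 0" and A: "A \<in> carrier_mat n n"
    and st: "\<And>j. j < n \<Longrightarrow> col A j \<in> flag_of n G ! Suc j"
  shows "upper_triangular (minv G * A)"
proof (rule upper_triangularI'[of _ n])
  note m = minv[OF G]
  show c: "minv G * A \<in> carrier_mat n n" using m A by simp
  fix i j assume ij: "j < i" "i < n"
  then obtain v where v: "v \<in> carrier_vec n" "col A j = G *\<^sub>v v" "\<And>i. Suc j \<le> i \<Longrightarrow> i < n \<Longrightarrow> v $ i = 0"
    using st[of j] unfolding flag_nth[OF G(1), of "Suc j"] by (auto simp: flag_nth[OF G(1)])
  have "col (minv G * A) j = minv G *\<^sub>v col A j" using ij by (intro col_mult2[OF m(1) A]) auto
  also have "\<dots> = (minv G * G) *\<^sub>v v" unfolding v(2) by (rule assoc_mult_mat_vec[OF m(1) G(1) v(1), symmetric])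
  also have "\<dots> = v" using v m by simp
  finally have "col (minv G * A) j $ i = v $ i" by simp
  then show "(minv G * A) $$ (i, j) = 0" using ij v(3)[of i] carrier_matD[OF c] by simp
qed

lemma flag_of_eqD:
  assumes G: "G \<in> carrier_mat n n" "det G \<noteq> 0" and G1: "G1 \<in> carrier_mat n n" "det G1 \<noteq> 0"
    and eq: "flag_of n G = flag_of n G1"
  shows "\<exists>b\<in>carrier_mat n n. upper_triangular b \<and> det b \<noteq> 0 \<and> G1 = G * b"
proof (intro bexI conjI)
  note m = minv[OF G]
  let ?b = "minv G * G1"
  show "?b \<in> carrier_mat n n" using m G1 by simp
  show "upper_triangular ?b"
  proof (rule stable_prefix_imp_upper[OF G G1(1)])
    fix j assume j: "j < n"
    have "col G1 j = G1 *\<^sub>v unit_vec n j" using mult_unit_vec_col[OF G1(1) j] by simp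
    then show "col G1 j \<in> flag_of n G ! Suc j" unfolding eq flag_nth[OF G1(1) Suc_leI[OF j]]
      using j by (intro CollectI exI[of _ "unit_vec n j"]) auto
  qed
  show "det ?b \<noteq> 0" using det_mult[OF m(1) G1(1)] det_minv[OF G] G1(2) by simp
  have "G * ?b = (G * minv G) * G1" by (rule assoc_mult_mat[OF G(1) m(1) G1(1), symmetric])
  then show "G1 = G * ?b" using m G1 by simp
qed

definition prefix_cols :: "nat \<Rightarrow> complex mat \<Rightarrow> complex mat" where
  "prefix_cols k G = mat_of_cols (dim_row G) (take k (cols G))"

lemma prefix_cols:
  assumes "G \<in> carrier_mat n n" "k \<le> n"
  shows "prefix_cols k G \<in> carrier_mat n k" "i < n \<Longrightarrow> j < k \<Longrightarrow> prefix_cols k G $$ (i, j) = G $$ (i, j)"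
    "vec_space.col_space n (prefix_cols k G) = flag_of n G ! k"
proof -
  show "prefix_cols k G \<in> carrier_mat n k" 
    unfolding prefix_cols_def using assms by (intro carrier_matI) auto
  show "i < n \<Longrightarrow> j < k \<Longrightarrow> prefix_cols k G $$ (i, j) = G $$ (i, j)"
    using assms by (simp add: mat_of_cols_index prefix_cols_def)
  show "vec_space.col_space n (prefix_cols k G) = flag_of n G ! k"
    unfolding prefix_cols_def using mult_vec_prefix[OF assms] flag_nth[OF assms] assms(1) by simp
qed

lemma rank_prefix_cols:
  assumes G: "G \<in> carrier_mat n n" "det G \<noteq> 0" and k: "k \<le> n"
  shows "vec_space.rank n (prefix_cols k G) = k"
proof -
  interpret V: vec_space "TYPE(complex)" n .
  have r: "V.rank G = n" using V.low_rank_det_zero[OF G] .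
  have d: "distinct (cols G)" using V.non_distinct_low_rank[OF G(1)] r by auto
  have li: "V.lin_indpt (set (cols G))" by (rule V.full_rank_lin_indpt[OF G(1) r d])
  have c: "cols (prefix_cols k G) = take k (cols G)"
    unfolding prefix_cols_def using G(1) cols_dim[of G] by (intro cols_mat_of_cols) (auto dest: in_set_takeD)
  have "V.lin_indpt (set (take k (cols G)))"
    by (rule V.subset_li_is_li[OF li set_take_subset])
  then show ?thesis
    using V.lin_indpt_full_rank[OF prefix_cols(1)[OF G(1) k]] d by (simp add: c)
qed

lemma flag_of_in_flags:
  assumes G: "G \<in> carrier_mat n n" "det G \<noteq> 0"
  shows "flag_of n G \<in> flags n"
proof -
  interpret V: vec_space "TYPE(complex)" n .
  have sp: "flag_of n G ! k = V.span (set (cols (prefix_cols k G)))" if "k \<le> n" for k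
    using prefix_cols(3)[OF G(1) that] by (simp add: V.col_space_def)
  have "VectorSpace.subspace class_ring (flag_of n G ! k) (module_vec TYPE(complex) n)" if k: "k \<le> n" for k
    unfolding sp[OF k] using V.span_is_subspace cols_dim[of "prefix_cols k G"] prefix_cols(1)[OF G(1) k] by simp
  moreover have "vectorspace.dim class_ring ((module_vec TYPE(complex) n)\<lparr>carrier := flag_of n G ! k\<rparr>) = k" if k: "k \<le> n" for k
    using rank_prefix_cols[OF G k] unfolding sp[OF k] V.rank_def .
  moreover have "flag_of n G ! i \<subseteq> flag_of n G ! Suc i" if i: "i < n" for i
    using i unfolding flag_nth[OF G(1) Suc_leI[OF i]] flag_nth[OF G(1) less_imp_le[OF i]] by auto
  ultimately show ?thesis by (simp add: flags_def)
qed

section \<open>Jordan types along a flag\<close>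

lemma young_diagram_similar:
  assumes "similar_mat A B" shows "young_diagram A mu \<longleftrightarrow> young_diagram B mu"
  using assms similar_mat_trans similar_mat_sym unfolding young_diagram_def jordan_nf_def by blast

lemma similar_matI':
  fixes A B P Q :: "complex mat"
  assumes "A \<in> carrier_mat n n" "B \<in> carrier_mat n n" "P \<in> carrier_mat n n" "det P \<noteq> 0" "A * P = P * B"
  shows "similar_mat A B"
proof -
  note m = minv[OF assms(3,4)]
  have "A = A * (P * minv P)" using m assms by simp
  also have "\<dots> = P * B * minv P"
    using assms(5) assoc_mult_mat[OF assms(1,3) m(1)] by simp
  finally have "similar_mat_wit A B P (minv P)"
    using assms m by (intro similar_mat_witI[of _ _ n]) auto
  then show ?thesis by (auto simp: similar_mat_def)
qed

lemma similar_matE':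
  fixes A B :: "complex mat"
  assumes "similar_mat A B" "A \<in> carrier_mat n n"
  obtains P where "P \<in> carrier_mat n n" "det P \<noteq> 0" "B \<in> carrier_mat n n" "A * P = P * B"
proof -
  from assms(1) obtain P Q where "similar_mat_wit A B P Q" by (auto simp: similar_mat_def)
  note w = similar_mat_witD2[OF assms(2) this]
  have d: "det P \<noteq> 0" using det_mult[OF w(6,7)] w(1) by auto
  have e: "A * P = P * B"
  proof -
    have "A * P = P * B * (Q * P)" unfolding w(3) using assoc_mult_mat[OF mult_carrier_mat[OF w(6,5)] w(7,6)] by simp
    then show ?thesis using w by simp
  qed
  show thesis by (rule that[OF w(6) d w(5) e])
qed

lemma young_diagram_on_flag:
  assumes G: "G \<in> carrier_mat n n" "det G \<noteq> 0" and u: "u \<in> carrier_mat n n"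
    and B: "B \<in> carrier_mat n n" "upper_triangular B" "u * G = G * B" and k: "k \<le> n"
  shows "young_diagram_on n u (flag_of n G ! k) mu \<longleftrightarrow> young_diagram (lead k B) mu"
proof
  interpret V: vec_space "TYPE(complex)" n .
  let ?P = "prefix_cols k G"
  note P = prefix_cols[OF G(1) k] and m = minv[OF G]
  have uP: "u * ?P = ?P * lead k B"
  proof (rule eq_matI)
    fix i j assume "i < dim_row (?P * lead k B)" "j < dim_col (?P * lead k B)"
    then have ij: "i < n" "j < k" using P(1) by auto
    have "(u * ?P) $$ (i, j) = (\<Sum>l\<in>{0..<n}. u $$ (i, l) * ?P $$ (l, j))" by (rule index_mult_mat'[OF u P(1) ij])
    also have "\<dots> = (u * G) $$ (i, j)" using ij k P(2) by (subst index_mult_mat'[OF u G(1)]) auto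
    also have "\<dots> = (\<Sum>l\<in>{0..<n}. G $$ (i, l) * B $$ (l, j))" unfolding B(3) using ij k by (intro index_mult_mat'[OF G(1) B(1)]) auto
    also have "\<dots> = (\<Sum>l\<in>{0..<k}. G $$ (i, l) * B $$ (l, j))"
      using ij k upper_triangularD'[OF B(2,1)] by (intro sum.mono_neutral_right) auto
    also have "\<dots> = (?P * lead k B) $$ (i, j)" using ij P by (subst index_mult_mat'[OF P(1), of _ k]) auto
    finally show "(u * ?P) $$ (i, j) = (?P * lead k B) $$ (i, j)" .
  qed (use u P(1) in auto)
  {
    assume "young_diagram (lead k B) mu"
    then show "young_diagram_on n u (flag_of n G ! k) mu"
      unfolding young_diagram_on_def using P rank_prefix_cols[OF G k] uP
      by (intro exI[of _ k] bexI[of _ ?P] bexI[of _ "lead k B"]) auto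
  }
  assume "young_diagram_on n u (flag_of n G ! k) mu"
  then obtain k' Q A where Q: "Q \<in> carrier_mat n k'" "A \<in> carrier_mat k' k'" "V.rank Q = k'"
    "V.col_space Q = flag_of n G ! k" "u * Q = Q * A" "young_diagram A mu"
    unfolding young_diagram_on_def by auto
  have "V.rank Q = V.rank ?P" using Q(4) P(3) unfolding V.rank_def V.col_space_def by simp
  then have k': "k' = k" using Q(3) rank_prefix_cols[OF G k] by simp
  note Q = Q[unfolded k']
  have fac: "\<exists>c\<in>carrier_mat k k. X = Y * c" if X: "X \<in> carrier_mat n k" and Y: "Y \<in> carrier_mat n k" and sub: "V.col_space X = V.col_space Y" for X Y
  proof -
    have "\<forall>j\<in>{..<k}. \<exists>v. v \<in> carrier_vec k \<and> col X j = Y *\<^sub>v v"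
    proof
      fix j assume "j \<in> {..<k}"
      then have "col X j \<in> V.col_space X"
        unfolding col_space_eq_image[OF X] using mult_unit_vec_col[OF X, of j]
        by (intro CollectI exI[of _ "unit_vec k j"]) auto
      then show "\<exists>v. v \<in> carrier_vec k \<and> col X j = Y *\<^sub>v v"
        unfolding sub col_space_eq_image[OF Y] by auto
    qed
    from bchoice[OF this] obtain f where f: "\<forall>j\<in>{..<k}. f j \<in> carrier_vec k \<and> col X j = Y *\<^sub>v f j" ..
    let ?c = "mat_of_cols k (map f [0..<k])"
    have c: "?c \<in> carrier_mat k k" by (intro carrier_matI) simp_all
    have "X = Y * ?c"
    proof (rule eq_matI)
      fix i j assume "i < dim_row (Y * ?c)" "j < dim_col (Y * ?c)"
      then have ij: "i < n" "j < k" using Y by auto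
      have "col ?c j = f j" using f ij by (subst col_mat_of_cols) auto
      then have "(Y * ?c) $$ (i, j) = (Y *\<^sub>v f j) $ i" using ij Y by simp
      also have "\<dots> = col X j $ i" using f ij by simp
      finally show "X $$ (i, j) = (Y * ?c) $$ (i, j)" using ij X by simp
    qed (use X Y in auto)
    with c show ?thesis by blast
  qed
  obtain c where c: "c \<in> carrier_mat k k" "Q = ?P * c" using fac[OF Q(1) P(1)] Q(4) P(3) by auto
  obtain d where d: "d \<in> carrier_mat k k" "?P = Q * d" using fac[OF P(1) Q(1)] Q(4) P(3) by auto
  \<comment> \<open>The first \<open>k\<close> rows of \<open>minv G\<close> are a left inverse of
    the prefix columns, which allows cancelling them.\<close>
  define R where "R = mat k n (\<lambda>(i, j). minv G $$ (i, j))"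
  have R: "R \<in> carrier_mat k n" by (simp add: R_def)
  have RP: "R * ?P = 1\<^sub>m k"
  proof (rule eq_matI)
    fix i j assume "i < dim_row (1\<^sub>m k :: complex mat)" "j < dim_col (1\<^sub>m k :: complex mat)"
    then have ij: "i < k" "j < k" by auto
    have "(R * ?P) $$ (i, j) = (minv G * G) $$ (i, j)"
      using ij k P(2) by (subst index_mult_mat'[OF R P(1)], simp_all, subst index_mult_mat'[OF m(1) G(1)]) (auto simp: R_def)
    then show "(R * ?P) $$ (i, j) = 1\<^sub>m k $$ (i, j)" using ij k m by simp
  qed (use R P in auto)
  have inj: "X = Y" if "X \<in> carrier_mat k k" "Y \<in> carrier_mat k k" "?P * X = ?P * Y" for X Y
  proof -
    have "R * (?P * X) = R * (?P * Y)" using that by simp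
    then have "(R * ?P) * X = (R * ?P) * Y"
      using assoc_mult_mat[OF R P(1) that(1)] assoc_mult_mat[OF R P(1) that(2)] by simp
    then show ?thesis using RP that by simp
  qed
  have cd: "c * d = 1\<^sub>m k"
  proof (rule inj)
    show "?P * (c * d) = ?P * 1\<^sub>m k"
      using c(2) d(2) assoc_mult_mat[OF P(1) c(1) d(1)] right_mult_one_mat[OF P(1)] by simp
  qed (use c d in auto)
  have dc: "det c \<noteq> 0" using det_mult[OF c(1) d(1)] cd by auto
  have "lead k B * c = c * A"
  proof (rule inj)
    have "?P * (lead k B * c) = u * ?P * c" using assoc_mult_mat[OF P(1) lead_carrier c(1)] uP by simp
    also have "\<dots> = u * Q" using assoc_mult_mat[OF u P(1) c(1)] c(2) by simp
    also have "\<dots> = ?P * (c * A)" using Q(5) c(2) assoc_mult_mat[OF P(1) c(1) Q(2)] by simp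
    finally show "?P * (lead k B * c) = ?P * (c * A)" .
  qed (use c Q(2) in auto)
  from similar_matI'[OF lead_carrier Q(2) c(1) dc this] Q(6)
  show "young_diagram (lead k B) mu" using young_diagram_similar by blast
qed

text \<open>The matrices of \<open>u\<close> in bases that are adapted to a flag of \<open>\<F>\<^sub>T\<close>.\<close>

definition adapted :: "nat \<Rightarrow> nat list list \<Rightarrow> complex mat \<Rightarrow> bool" where
  "adapted n T B \<longleftrightarrow> B \<in> carrier_mat n n \<and> upper_triangular B \<and>
     (\<forall>i\<le>n. young_diagram (lead i B) (shape (restrict_tableau i T)))"

lemma flag_of_in_flags_of_tableau:
  assumes G: "G \<in> carrier_mat n n" "det G \<noteq> 0" and u: "u \<in> carrier_mat n n"
  shows "flag_of n G \<in> flags_of_tableau n u T \<longleftrightarrow> (\<exists>B. adapted n T B \<and> u * G = G * B)"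
proof
  note m = minv[OF G]
  assume l: "flag_of n G \<in> flags_of_tableau n u T"
  let ?B = "minv G * (u * G)"
  have B: "?B \<in> carrier_mat n n" using m u G by simp
  have up: "upper_triangular ?B"
  proof (rule stable_prefix_imp_upper[OF G])
    show "u * G \<in> carrier_mat n n" using u G by simp
    fix j assume j: "j < n"
    have "col G j = G *\<^sub>v unit_vec n j" using mult_unit_vec_col[OF G(1) j] by simp
    then have "col G j \<in> flag_of n G ! Suc j" unfolding flag_nth[OF G(1) Suc_leI[OF j]]
      using j by (intro CollectI exI[of _ "unit_vec n j"]) auto
    then have "u *\<^sub>v col G j \<in> flag_of n G ! Suc j"
      using l j unfolding flags_of_tableau_def springer_fiber_def by auto
    moreover have "col (u * G) j = u *\<^sub>v col G j" using u G j by (intro col_mult2) auto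
    ultimately show "col (u * G) j \<in> flag_of n G ! Suc j" by simp
  qed
  have eq: "u * G = G * ?B"
    using assoc_mult_mat[OF G(1) m(1) mult_carrier_mat[OF u G(1)]] m left_mult_one_mat[OF mult_carrier_mat[OF u G(1)]] by simp
  have "adapted n T ?B"
    using l B up young_diagram_on_flag[OF G u B up eq] by (simp add: adapted_def flags_of_tableau_def)
  with eq show "\<exists>B. adapted n T B \<and> u * G = G * B" by blast
next
  assume "\<exists>B. adapted n T B \<and> u * G = G * B"
  then obtain B where B: "B \<in> carrier_mat n n" "upper_triangular B" "u * G = G * B"
    "\<And>i. i \<le> n \<Longrightarrow> young_diagram (lead i B) (shape (restrict_tableau i T))" by (auto simp: adapted_def)
  have "u *\<^sub>v w \<in> flag_of n G ! k" if k: "k \<le> n" and w: "w \<in> flag_of n G ! k" for k w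
  proof -
    from w obtain v where v: "v \<in> carrier_vec n" "w = G *\<^sub>v v" "\<And>i. k \<le> i \<Longrightarrow> i < n \<Longrightarrow> v $ i = 0"
      unfolding flag_nth[OF G(1) k] by auto
    have "u *\<^sub>v w = (G * B) *\<^sub>v v" unfolding v(2) B(3)[symmetric] by (rule assoc_mult_mat_vec[OF u G(1) v(1), symmetric])
    then have "u *\<^sub>v w \<in> flag_of n (G * B) ! k"
      unfolding flag_nth[OF mult_carrier_mat[OF G(1) B(1)] k] using v by blast
    then show ?thesis using flag_nth_upper_subset[OF G(1) B(1,2) k] by blast
  qed
  then show "flag_of n G \<in> flags_of_tableau n u T"
    using flag_of_in_flags[OF G] B(4) young_diagram_on_flag[OF G u B(1-3)]
    by (simp add: flags_of_tableau_def springer_fiber_def)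
qed

section \<open>Charts of the flag variety and closures in them\<close>

lemma finite_chart_index[simp]: "finite (chart_index n)"
  by (rule finite_subset[of _ "{..<n} \<times> {..<n}"]) (auto simp: chart_index_def)

lemma chart_in_flags: "g \<in> GL n \<Longrightarrow> chart n g x \<in> flags n"
  unfolding chart_def
  by (rule flag_of_in_flags) (auto simp: det_carrier_GL det_mult[of _ n])

lemma mult_minv_cancel:
  assumes "g \<in> carrier_mat n n" "det g \<noteq> 0" "X \<in> carrier_mat n m"
  shows "g * (minv g * X) = X" "minv g * (g * X) = X"
  using assoc_mult_mat[OF assms(1) minv(1)[OF assms(1,2)] assms(3)] assoc_mult_mat[OF minv(1)[OF assms(1,2)] assms(1,3)]
    minv(2,3)[OF assms(1,2)] assms(3) by simp_all

text \<open>The transition between charts: two invertible matrices give the same flag when they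
  differ by an invertible upper triangular right factor, so the coordinate in the chart of
  \<open>g\<close> is read off the unitriangular factor of
  \<open>minv g * g1 * lower_unitriangular n y\<close>.\<close>

lemma chart_eq_iff:
  assumes g: "g \<in> GL n" "g1 \<in> GL n" and z: "z \<in> affine_space (chart_index n)"
  shows "chart n g1 y = chart n g z \<longleftrightarrow>
    lu_ok n (minv g * g1 * lower_unitriangular n y) \<and> lu_coord n (minv g * g1 * lower_unitriangular n y) = z"
proof -
  let ?U = "lower_unitriangular n"
  have gc: "g \<in> carrier_mat n n" "det g \<noteq> 0" "g1 \<in> carrier_mat n n" "det g1 \<noteq> 0" using g by (auto simp: det_carrier_GL)
  note m = minv[OF gc(1,2)]
  let ?H = "minv g * g1 * ?U y"
  have H: "?H \<in> carrier_mat n n" by (rule mult_carrier_mat[OF mult_carrier_mat[OF m(1) gc(3)] lower_unitriangular_carrier])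
  have H': "?H = minv g * (g1 * ?U y)" by (rule assoc_mult_mat[OF m(1) gc(3) lower_unitriangular_carrier])
  have gU: "g * ?U z \<in> carrier_mat n n" "det (g * ?U z) \<noteq> 0" and g1U: "g1 * ?U y \<in> carrier_mat n n" "det (g1 * ?U y) \<noteq> 0"
    using gc by (auto simp: det_mult[of _ n])
  show ?thesis
  proof
    assume "chart n g1 y = chart n g z"
    then have "flag_of n (g * ?U z) = flag_of n (g1 * ?U y)" by (simp add: chart_def)
    from flag_of_eqD[OF gU g1U this] obtain b where b: "b \<in> carrier_mat n n" "upper_triangular b" "det b \<noteq> 0"
      "g1 * ?U y = g * ?U z * b" by blast
    have "g * ?U z * b = g * (?U z * b)" by (rule assoc_mult_mat[OF gc(1) lower_unitriangular_carrier b(1)])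
    then have "?H = ?U z * b" unfolding H' b(4)
      using mult_minv_cancel(2)[OF gc(1,2) mult_carrier_mat[OF lower_unitriangular_carrier b(1)], of z] by simp
    then show "lu_ok n ?H \<and> lu_coord n ?H = z" using lu_unique[OF b(1-3) z] by simp
  next
    assume "lu_ok n ?H \<and> lu_coord n ?H = z"
    then obtain b where b: "b \<in> carrier_mat n n" "upper_triangular b" "det b \<noteq> 0" "?H = ?U z * b"
      using lu_exists[OF H] by auto
    have "g1 * ?U y = g * (?U z * b)" using mult_minv_cancel(1)[OF gc(1,2) g1U(1)] b(4) H' by simp
    also have "\<dots> = g * ?U z * b" by (rule assoc_mult_mat[OF gc(1) lower_unitriangular_carrier b(1), symmetric])
    finally show "chart n g1 y = chart n g z" unfolding chart_def using flag_of_upper[OF gU(1) b(1-3)] by simp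
  qed
qed

text \<open>Openness is tested in every chart. In the chart of \<open>g1\<close> the set is given by
  \<open>D * P \<noteq> 0\<close>: \<open>D\<close> is the product of the leading minors, nonzero
  where the transition is defined, and \<open>P\<close> is the numerator of \<open>f\<close> along
  the transition.\<close>

lemma zariski_open_chart_image:
  assumes g: "g \<in> GL n" and f: "f \<in> polynomials (chart_index n)"
  shows "zariski_open n (chart n g ` {y \<in> affine_space (chart_index n). f y \<noteq> 0})" (is "zariski_open n ?W")
  unfolding zariski_open_def
proof (intro conjI ballI)
  let ?I = "chart_index n"
  show "?W \<subseteq> flags n" using chart_in_flags[OF g] by auto
  fix g1 assume g1: "g1 \<in> GL n"
  define H where "H = (\<lambda>y. minv g * g1 * lower_unitriangular n y)"
  have gc: "g \<in> carrier_mat n n" "det g \<noteq> 0" "g1 \<in> carrier_mat n n" using g g1 by (auto simp: det_carrier_GL)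
  have H: "polymat ?I n n H" unfolding H_def
    by (rule polymat_mult[OF polymat_const polymat_lower_unitriangular]) (use minv(1)[OF gc(1,2)] gc in simp)
  define D where "D = (\<lambda>y. \<Prod>k<n. lu_minor (H y) k k)"
  have D: "D \<in> polynomials ?I" unfolding D_def by (rule lu_ok_polynomial[OF H])
  define F where "F = (\<lambda>(i, j) y. lu_minor (H y) i j * (\<Prod>k\<in>{..<n} - {j}. lu_minor (H y) k k))"
  have F: "F p \<in> polynomials ?I" if "p \<in> ?I" for p
  proof -
    obtain i j where p: "p = (i, j)" "j < i" "i < n" using \<open>p \<in> ?I\<close> by (auto simp: chart_index_def)
    show ?thesis unfolding F_def p(1) prod.case
      by (intro polynomials.mult polynomials_prod polymat_lu_minor[OF H]) (use p in auto)
  qed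
  have FD: "lu_coord n (H y) p = F p y / D y" if "D y \<noteq> 0" "p \<in> ?I" for p y
  proof -
    obtain i j where p: "p = (i, j)" "j < i" "i < n" using \<open>p \<in> ?I\<close> by (auto simp: chart_index_def)
    have "D y = lu_minor (H y) j j * (\<Prod>k\<in>{..<n} - {j}. lu_minor (H y) k k)"
      unfolding D_def using p by (intro prod.remove) auto
    then show ?thesis using that(1) p by (auto simp: F_def lu_coord_def)
  qed
  have "\<exists>N. \<exists>P\<in>polynomials ?I. \<forall>y x. D y \<noteq> 0 \<longrightarrow> (\<forall>i\<in>?I. x i = F i y / D y) \<longrightarrow> f x = P y / D y ^ N"
    by (rule polynomials_rational_subst[where F = F, OF f F D])
  then obtain N P where P: "P \<in> polynomials ?I"
    "\<forall>y x. D y \<noteq> 0 \<longrightarrow> (\<forall>i\<in>?I. x i = F i y / D y) \<longrightarrow> f x = P y / D y ^ N"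
    by (elim exE bexE)
  have val: "f (lu_coord n (H y)) \<noteq> 0 \<longleftrightarrow> P y \<noteq> 0" if "D y \<noteq> 0" for y
  proof -
    have "\<forall>i\<in>?I. lu_coord n (H y) i = F i y / D y" using FD[OF that] by blast
    with P(2) that have "f (lu_coord n (H y)) = P y / D y ^ N" by blast
    then show ?thesis using that by simp
  qed
  have "chart_preimage n g1 ?W = {y \<in> affine_space ?I. D y * P y \<noteq> 0}"
  proof (intro equalityI subsetI)
    fix y assume "y \<in> chart_preimage n g1 ?W"
    then obtain z where z: "y \<in> affine_space ?I" "z \<in> affine_space ?I" "f z \<noteq> 0" "chart n g1 y = chart n g z"
      by (auto simp: chart_preimage_def)
    then have "lu_ok n (H y)" "lu_coord n (H y) = z" using chart_eq_iff[OF g g1 z(2), of y] by (auto simp: H_def)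
    then have "D y \<noteq> 0" "f (lu_coord n (H y)) \<noteq> 0" using z by (auto simp: lu_ok_iff D_def)
    then show "y \<in> {y \<in> affine_space ?I. D y * P y \<noteq> 0}" using val z(1) by simp
  next
    fix y assume "y \<in> {y \<in> affine_space ?I. D y * P y \<noteq> 0}"
    then have y: "y \<in> affine_space ?I" "D y \<noteq> 0" "P y \<noteq> 0" by auto
    then have "lu_ok n (H y)" by (simp add: lu_ok_iff D_def)
    then have "chart n g1 y = chart n g (lu_coord n (H y))"
      using chart_eq_iff[OF g g1 lu_coord_affine, of y "H y"] by (simp add: H_def)
    then show "y \<in> chart_preimage n g1 ?W" using y val lu_coord_affine by (auto simp: chart_preimage_def)
  qed
  then have "affine_space ?I - chart_preimage n g1 ?W = {y \<in> affine_space ?I. \<forall>f\<in>{\<lambda>y. D y * P y}. f y = 0}" by auto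
  then show "algebraic_set ?I (affine_space ?I - chart_preimage n g1 ?W)"
    unfolding algebraic_set_def using polynomials.mult[OF D P(1)] by blast
qed

text \<open>Principal open subsets of a chart are open in the flag variety, and open sets restrict
  to complements of zero sets. Hence the topological closure becomes, in each chart, the zero set of
  the vanishing ideal.\<close>

lemma chart_preimage_closure:
  assumes g: "g \<in> GL n"
  shows "chart_preimage n g (zariski n closure_of S) = zariski_cl (chart_index n) (chart_preimage n g S)"
proof (intro equalityI subsetI)
  let ?I = "chart_index n"
  fix x assume "x \<in> chart_preimage n g (zariski n closure_of S)"
  then have x: "x \<in> affine_space ?I" "chart n g x \<in> zariski n closure_of S" by (auto simp: chart_preimage_def)
  have "f x = 0" if f: "f \<in> vanishing_ideal ?I (chart_preimage n g S)" for f
  proof (rule ccontr)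
    assume "f x \<noteq> 0"
    let ?W = "chart n g ` {y \<in> affine_space ?I. f y \<noteq> 0}"
    have W: "zariski_open n ?W" using zariski_open_chart_image[OF g] f by (simp add: vanishing_ideal_def)
    have cW: "chart n g x \<in> ?W" using x \<open>f x \<noteq> 0\<close> by blast
    have "\<forall>T. chart n g x \<in> T \<and> zariski_open n T \<longrightarrow> (\<exists>y. y \<in> S \<and> y \<in> T)"
      using x(2) unfolding in_closure_of openin_zariski by (rule conjunct2)
    from spec[OF this, of ?W] W cW obtain y where y: "y \<in> S" "y \<in> ?W" by auto
    then obtain z where "z \<in> affine_space ?I" "f z \<noteq> 0" "chart n g z \<in> S" by auto
    then show False using f by (auto simp: vanishing_ideal_def chart_preimage_def)
  qed
  with x(1) show "x \<in> zariski_cl ?I (chart_preimage n g S)" by (simp add: zariski_cl_def)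
next
  let ?I = "chart_index n"
  fix x assume x: "x \<in> zariski_cl ?I (chart_preimage n g S)"
  then have xa: "x \<in> affine_space ?I" by (simp add: zariski_cl_def)
  have "openin (zariski n) (chart n g ` {y \<in> affine_space ?I. (1::complex) \<noteq> 0})"
    unfolding openin_zariski by (rule zariski_open_chart_image[OF g polynomials.const])
  from openin_subset[OF this] xa have top: "chart n g x \<in> topspace (zariski n)" by auto
  have "\<exists>y. y \<in> S \<and> y \<in> T" if T: "chart n g x \<in> T" "openin (zariski n) T" for T
  proof (rule ccontr)
    assume neg: "\<nexists>y. y \<in> S \<and> y \<in> T"
    have "algebraic_set ?I (affine_space ?I - chart_preimage n g T)"
      using T(2) g unfolding openin_zariski zariski_open_def by blast
    then obtain F where F: "F \<subseteq> polynomials ?I" "affine_space ?I - chart_preimage n g T = {x \<in> affine_space ?I. \<forall>f\<in>F. f x = 0}"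
      unfolding algebraic_set_def by blast
    have "f x = 0" if "f \<in> F" for f
    proof (rule zariski_clD[OF x])
      have "f y = 0" if "y \<in> chart_preimage n g S" for y
      proof -
        have "y \<in> affine_space ?I - chart_preimage n g T" using that neg by (auto simp: chart_preimage_def)
        then show ?thesis unfolding F(2) using \<open>f \<in> F\<close> by blast
      qed
      then show "f \<in> vanishing_ideal ?I (chart_preimage n g S)" using F(1) that by (auto simp: vanishing_ideal_def)
    qed
    then have "x \<in> affine_space ?I - chart_preimage n g T" unfolding F(2) using xa by blast
    then show False using T(1) xa by (simp add: chart_preimage_def)
  qed
  then have "chart n g x \<in> zariski n closure_of S" unfolding in_closure_of using top by blast
  with xa show "x \<in> chart_preimage n g (zariski n closure_of S)" by (simp add: chart_preimage_def)
qed

text \<open>This is \<open>flags_of_tableau\<close> for \<open>u\<close> seen in the chart of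
  \<open>g\<close>, where \<open>N\<close> is the matrix of \<open>u\<close> in the basis
  \<open>g\<close>; neither \<open>g\<close> nor \<open>u\<close> remains visible.\<close>

definition adapted_chart :: "nat \<Rightarrow> nat list list \<Rightarrow> complex mat \<Rightarrow> (nat \<times> nat \<Rightarrow> complex) set" where
  "adapted_chart n T N = {x \<in> affine_space (chart_index n).
     \<exists>B. adapted n T B \<and> N * lower_unitriangular n x = lower_unitriangular n x * B}"

lemma adapted_chart_affine: "adapted_chart n T N \<subseteq> affine_space (chart_index n)"
  by (auto simp: adapted_chart_def)

lemma chart_preimage_flags_of_tableau:
  assumes g: "g \<in> GL n" and u: "u \<in> carrier_mat n n" and N: "N \<in> carrier_mat n n" "u * g = g * N"
  shows "chart_preimage n g (flags_of_tableau n u T) = adapted_chart n T N"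
proof -
  have gc: "g \<in> carrier_mat n n" "det g \<noteq> 0" using g by (auto simp: det_carrier_GL)
  have "chart n g x \<in> flags_of_tableau n u T \<longleftrightarrow> (\<exists>B. adapted n T B \<and> N * lower_unitriangular n x = lower_unitriangular n x * B)" for x
  proof -
    let ?U = "lower_unitriangular n x"
    have gU: "g * ?U \<in> carrier_mat n n" "det (g * ?U) \<noteq> 0" using gc by (auto simp: det_mult[of _ n])
    have "u * (g * ?U) = g * ?U * B \<longleftrightarrow> N * ?U = ?U * B" if "adapted n T B" for B
    proof -
      have B: "B \<in> carrier_mat n n" using that by (simp add: adapted_def)
      have 1: "u * (g * ?U) = g * (N * ?U)"
        using assoc_mult_mat[OF u gc(1) lower_unitriangular_carrier[of n x]] assoc_mult_mat[OF gc(1) N(1) lower_unitriangular_carrier[of n x]] N(2) by simp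
      have 2: "g * ?U * B = g * (?U * B)" using assoc_mult_mat[OF gc(1) lower_unitriangular_carrier B] .
      have c: "N * ?U \<in> carrier_mat n n" "?U * B \<in> carrier_mat n n" using N B by (auto intro: mult_carrier_mat)
      show ?thesis unfolding 1 2
        using mult_minv_cancel(2)[OF gc c(1)] mult_minv_cancel(2)[OF gc c(2)] by metis
    qed
    then show ?thesis unfolding chart_def flag_of_in_flags_of_tableau[OF gU u] by blast
  qed
  then show ?thesis by (auto simp: chart_preimage_def adapted_chart_def)
qed

text \<open>The quantifier over charts becomes a quantifier over matrices similar to
  \<open>u\<close>. So only the similarity class of \<open>u\<close> enters, and a chart is chosen
  by choosing a convenient \<open>N\<close>.\<close>

lemma singular_springer_component:
  assumes u: "u \<in> carrier_mat n n"
  shows "singular n (springer_component n u T) \<longleftrightarrow>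
    (\<exists>N x. similar_mat N u \<and> singular_point (chart_index n) (zariski_cl (chart_index n) (adapted_chart n T N)) x)"
proof
  assume "singular n (springer_component n u T)"
  then obtain g x where g: "g \<in> GL n" and x: "singular_point (chart_index n) (chart_preimage n g (springer_component n u T)) x"
    unfolding singular_def by blast
  have gc: "g \<in> carrier_mat n n" "det g \<noteq> 0" using g by (auto simp: det_carrier_GL)
  let ?N = "minv g * (u * g)"
  have N: "?N \<in> carrier_mat n n" using minv[OF gc] u gc by simp
  have eq: "u * g = g * ?N" using mult_minv_cancel(1)[OF gc mult_carrier_mat[OF u gc(1)]] by simp
  have "similar_mat ?N u" using similar_matI'[OF u N gc eq] by (rule similar_mat_sym)
  moreover have "chart_preimage n g (springer_component n u T) = zariski_cl (chart_index n) (adapted_chart n T ?N)"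
    unfolding springer_component_def chart_preimage_closure[OF g] chart_preimage_flags_of_tableau[OF g u N eq] ..
  ultimately show "\<exists>N x. similar_mat N u \<and> singular_point (chart_index n) (zariski_cl (chart_index n) (adapted_chart n T N)) x"
    using x by auto
next
  assume "\<exists>N x. similar_mat N u \<and> singular_point (chart_index n) (zariski_cl (chart_index n) (adapted_chart n T N)) x"
  then obtain N x where N: "similar_mat u N" and x: "singular_point (chart_index n) (zariski_cl (chart_index n) (adapted_chart n T N)) x"
    using similar_mat_sym by blast
  from similar_matE'[OF N u] obtain g where g: "g \<in> carrier_mat n n" "det g \<noteq> 0" "N \<in> carrier_mat n n" "u * g = g * N" by blast
  then have gG: "g \<in> GL n" by (simp add: det_carrier_GL)
  have "chart_preimage n g (springer_component n u T) = zariski_cl (chart_index n) (adapted_chart n T N)"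
    unfolding springer_component_def chart_preimage_closure[OF gG] chart_preimage_flags_of_tableau[OF gG u g(3,4)] ..
  then show "singular n (springer_component n u T)" unfolding singular_def using gG x by metis
qed

subsection \<open>Linear algebra\<close>

text \<open>Induction on the number of forms. If the last form is nonzero somewhere on the common
  kernel of the others, a vector \<open>e\<close> dual to it tells which multiple of this form to
  subtract from \<open>f\<close>; otherwise the last form adds no condition.\<close>

lemma functional_factor:
  fixes r :: "nat \<Rightarrow> nat \<Rightarrow> complex"
  assumes "\<And>v. (\<And>i. i < k \<Longrightarrow> (\<Sum>j<m. r i j * v j) = 0) \<Longrightarrow> (\<Sum>j<m. f j * v j) = 0"
  shows "\<exists>\<mu>. \<forall>v. (\<Sum>j<m. f j * v j) = (\<Sum>i<k. \<mu> i * (\<Sum>j<m. r i j * v j))"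
  using assms
proof (induction k arbitrary: f)
  case 0
  then show ?case by simp
next
  case (Suc k)
  let ?p = "\<lambda>(f :: nat \<Rightarrow> complex) v. \<Sum>j<m. f j * v j"
  have lin: "?p g (\<lambda>j. v j - c * w j) = ?p g v - c * ?p g w" for g v c w
    by (simp add: algebra_simps sum_subtractf sum_distrib_left)
  show ?case
  proof (cases "\<exists>e. (\<forall>i<k. ?p (r i) e = 0) \<and> ?p (r k) e \<noteq> 0")
    case True
    then obtain e0 where e0: "\<And>i. i < k \<Longrightarrow> ?p (r i) e0 = 0" "?p (r k) e0 \<noteq> 0" by blast
    define e where "e = (\<lambda>j. e0 j / ?p (r k) e0)"
    have pe: "?p g e = ?p g e0 / ?p (r k) e0" for g by (simp add: e_def sum_divide_distrib)
    have e: "\<And>i. i < k \<Longrightarrow> ?p (r i) e = 0" "?p (r k) e = 1" using e0 by (simp_all add: pe)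
    define f' where "f' = (\<lambda>j. f j - ?p f e * r k j)"
    have f': "?p f' v = ?p f v - ?p f e * ?p (r k) v" for v
      unfolding f'_def by (simp add: algebra_simps sum_subtractf sum_distrib_left)
    have "?p f' v = 0" if v: "\<And>i. i < k \<Longrightarrow> ?p (r i) v = 0" for v
    proof -
      have "?p f (\<lambda>j. v j - ?p (r k) v * e j) = 0"
      proof (rule Suc.prems)
        fix i assume "i < Suc k"
        then show "?p (r i) (\<lambda>j. v j - ?p (r k) v * e j) = 0"
          unfolding lin using v[of i] e by (cases "i = k") auto
      qed
      then show ?thesis unfolding lin f' by (simp add: mult.commute)
    qed
    from Suc.IH[of f', OF this] obtain \<mu> where \<mu>: "\<And>v. ?p f' v = (\<Sum>i<k. \<mu> i * ?p (r i) v)" by blast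
    show ?thesis
    proof (intro exI allI)
      fix v
      have "?p f v = (\<Sum>i<k. \<mu> i * ?p (r i) v) + ?p f e * ?p (r k) v" using f'[of v] \<mu>[of v] by simp
      then show "?p f v = (\<Sum>i<Suc k. (\<mu>(k := ?p f e)) i * ?p (r i) v)" by simp
    qed
  next
    case False
    have "?p f v = 0" if "\<And>i. i < k \<Longrightarrow> ?p (r i) v = 0" for v
    proof (rule Suc.prems)
      fix i assume "i < Suc k"
      then show "?p (r i) v = 0" using that[of i] that False by (cases "i = k") auto
    qed
    from Suc.IH[of f, OF this] obtain \<mu> where \<mu>: "\<And>v. ?p f v = (\<Sum>i<k. \<mu> i * ?p (r i) v)" by blast
    show ?thesis
    proof (intro exI allI)
      fix v show "?p f v = (\<Sum>i<Suc k. (\<mu>(k := 0)) i * ?p (r i) v)" using \<mu>[of v] by simp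
    qed
  qed
qed

lemma row_factor:
  fixes X :: "complex mat"
  assumes X: "X \<in> carrier_mat n m" and f: "f \<in> carrier_mat 1 m"
    and ker: "\<And>v. v \<in> carrier_mat m 1 \<Longrightarrow> X * v = 0\<^sub>m n 1 \<Longrightarrow> f * v = 0\<^sub>m 1 1"
  shows "\<exists>\<mu>\<in>carrier_mat 1 n. f = \<mu> * X"
proof -
  have "(\<Sum>j<m. f $$ (0, j) * v j) = 0" if v: "\<And>i. i < n \<Longrightarrow> (\<Sum>j<m. X $$ (i, j) * v j) = 0" for v
  proof -
    let ?v = "mat m 1 (\<lambda>(j, _). v j)"
    have vc: "?v \<in> carrier_mat m 1" by simp
    have "X * ?v = 0\<^sub>m n 1"
    proof (rule eq_matI)
      fix i j assume ij: "i < dim_row (0\<^sub>m n 1 :: complex mat)" "j < dim_col (0\<^sub>m n 1 :: complex mat)"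
      then have "(X * ?v) $$ (i, j) = (\<Sum>l\<in>{0..<m}. X $$ (i, l) * v l)"
        by (subst index_mult_mat'[OF X vc]) auto
      then show "(X * ?v) $$ (i, j) = 0\<^sub>m n 1 $$ (i, j)" using v[of i] ij by (simp add: atLeast0LessThan)
    qed (use X in auto)
    from arg_cong[OF ker[OF vc this], of "\<lambda>A. A $$ (0, 0)"]
    show ?thesis by (subst (asm) index_mult_mat'[OF f vc]) (auto simp: atLeast0LessThan)
  qed
  from functional_factor[where r = "\<lambda>i j. X $$ (i, j)" and f = "\<lambda>j. f $$ (0, j)" and k = n and m = m, OF this]
  obtain \<mu> where \<mu>: "\<And>v. (\<Sum>j<m. f $$ (0, j) * v j) = (\<Sum>i<n. \<mu> i * (\<Sum>j<m. X $$ (i, j) * v j))" by blast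
  let ?\<mu> = "mat 1 n (\<lambda>(_, i). \<mu> i)"
  have mc: "?\<mu> \<in> carrier_mat 1 n" by simp
  have "f = ?\<mu> * X"
  proof (rule eq_matI)
    fix i j assume "i < dim_row (?\<mu> * X)" "j < dim_col (?\<mu> * X)"
    then have ij: "i = 0" "j < m" using X by auto
    have del: "(\<Sum>l<m. g l * (if l = j then 1 else 0)) = g j" for g :: "nat \<Rightarrow> complex"
      using ij by (simp add: if_distrib[of "\<lambda>x. _ * x"] cong: if_cong)
    have "f $$ (i, j) = (\<Sum>i<n. \<mu> i * X $$ (i, j))" using \<mu>[of "\<lambda>l. if l = j then 1 else 0"] ij unfolding del by simp
    also have "\<dots> = (?\<mu> * X) $$ (i, j)" using ij by (subst index_mult_mat'[OF mc X]) (auto simp: atLeast0LessThan)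
    finally show "f $$ (i, j) = (?\<mu> * X) $$ (i, j)" .
  qed (use X f in auto)
  with mc show ?thesis by blast
qed

lemma column_factor:
  fixes X :: "complex mat"
  assumes X: "X \<in> carrier_mat n m" and c: "c \<in> carrier_mat n 1"
    and ker: "\<And>\<mu>. \<mu> \<in> carrier_mat 1 n \<Longrightarrow> \<mu> * X = 0\<^sub>m 1 m \<Longrightarrow> \<mu> * c = 0\<^sub>m 1 1"
  shows "\<exists>k\<in>carrier_mat m 1. c = X * k"
proof -
  have "\<exists>\<mu>\<in>carrier_mat 1 m. c\<^sup>T = \<mu> * X\<^sup>T"
  proof (rule row_factor)
    fix v :: "complex mat" assume v: "v \<in> carrier_mat n 1" "X\<^sup>T * v = 0\<^sub>m m 1"
    have "(X\<^sup>T * v)\<^sup>T = v\<^sup>T * (X\<^sup>T)\<^sup>T" by (rule transpose_mult[OF _ v(1)]) (use X in simp)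
    then have "v\<^sup>T * X = 0\<^sub>m 1 m" unfolding v(2) by simp
    then have "v\<^sup>T * c = 0\<^sub>m 1 1" using v by (intro ker) auto
    moreover have "(v\<^sup>T * c)\<^sup>T = c\<^sup>T * (v\<^sup>T)\<^sup>T" by (rule transpose_mult[OF _ c]) (use v in simp)
    ultimately show "c\<^sup>T * v = 0\<^sub>m 1 1" by simp
  qed (use X c in auto)
  then obtain \<mu> where \<mu>: "\<mu> \<in> carrier_mat 1 m" "c\<^sup>T = \<mu> * X\<^sup>T" by blast
  have "c = (\<mu> * X\<^sup>T)\<^sup>T" using \<mu>(2) by (metis transpose_transpose)
  also have "\<dots> = (X\<^sup>T)\<^sup>T * \<mu>\<^sup>T" by (rule transpose_mult[OF \<mu>(1)]) (use X in simp)
  also have "(X\<^sup>T)\<^sup>T = X" by simp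
  finally show ?thesis using \<mu>(1) by (intro bexI[of _ "\<mu>\<^sup>T"]) auto
qed

text \<open>Reduced echelon form. The pivots \<open>S\<close> are coordinates on \<open>L\<close>,
  so the parameters of a point of \<open>L\<close> are among its own entries and a chart map can
  read them off polynomially.\<close>

lemma subspace_graph:
  fixes L :: "('i \<Rightarrow> complex) set"
  assumes "finite K" "L \<subseteq> affine_space K" "(\<lambda>_. 0) \<in> L"
    "\<And>v w. v \<in> L \<Longrightarrow> w \<in> L \<Longrightarrow> (\<lambda>i. v i + w i) \<in> L" "\<And>c v. v \<in> L \<Longrightarrow> (\<lambda>i. c * v i) \<in> L"
  shows "\<exists>S\<subseteq>K. \<exists>b. (\<forall>s\<in>S. b s \<in> L) \<and> (\<forall>s\<in>S. \<forall>s'\<in>S. b s s' = (if s = s' then 1 else 0)) \<and>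
    (\<forall>v\<in>L. \<forall>i. v i = (\<Sum>s\<in>S. v s * b s i))"
  using assms
proof (induction K arbitrary: L rule: finite_induct)
  case empty
  then show ?case by (intro exI[of _ "{}"]) (auto simp: affine_space_def)
next
  case (insert k K)
  let ?L = "{v \<in> L. v k = 0}"
  have "?L \<subseteq> affine_space K" using insert.prems(1) insert.hyps by (auto simp: affine_space_def)
  then have "\<exists>S\<subseteq>K. \<exists>b. (\<forall>s\<in>S. b s \<in> ?L) \<and> (\<forall>s\<in>S. \<forall>s'\<in>S. b s s' = (if s = s' then 1 else 0)) \<and>
    (\<forall>v\<in>?L. \<forall>i. v i = (\<Sum>s\<in>S. v s * b s i))"
    by (rule insert.IH) (use insert.prems in auto)
  then obtain S b where Sb: "S \<subseteq> K" "\<forall>s\<in>S. b s \<in> ?L" "\<forall>s\<in>S. \<forall>s'\<in>S. b s s' = (if s = s' then 1 else 0)"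
    "\<forall>v\<in>?L. \<forall>i. v i = (\<Sum>s\<in>S. v s * b s i)" by (elim exE conjE)
  have S: "S \<subseteq> K" "b s \<in> L" "b s k = 0" "b s s' = (if s = s' then 1 else 0)" if "s \<in> S" "s' \<in> S" for s s'
    using Sb(1,2,3) that by blast+
  have S5: "v i = (\<Sum>s\<in>S. v s * b s i)" if "v \<in> L" "v k = 0" for v i using Sb(4) that by blast
  have finS: "finite S" and kS: "k \<notin> S" using Sb(1) insert.hyps by (auto intro: finite_subset)
  have sumL: "(\<lambda>i. \<Sum>s\<in>S'. c s * b s i) \<in> L" if "S' \<subseteq> S" for c S'
    using finite_subset[OF that finS] that
  proof (induction S' rule: finite_induct)
    case empty
    then show ?case using insert.prems(2) by simp
  next
    case (insert s S')
    have "(\<lambda>i. c s * b s i + (\<Sum>s\<in>S'. c s * b s i)) \<in> L"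
      using insert by (intro \<open>\<And>v w. v \<in> L \<Longrightarrow> w \<in> L \<Longrightarrow> (\<lambda>i. v i + w i) \<in> L\<close> \<open>\<And>c v. v \<in> L \<Longrightarrow> (\<lambda>i. c * v i) \<in> L\<close> S(2)) auto
    then show ?case using insert by simp
  qed
  show ?case
  proof (cases "\<exists>e\<in>L. e k \<noteq> 0")
    case False
    then have "\<forall>v\<in>L. \<forall>i. v i = (\<Sum>s\<in>S. v s * b s i)" using S5 by blast
    moreover have "\<forall>s\<in>S. b s \<in> L" "S \<subseteq> insert k K" using Sb(1,2) by auto
    ultimately show ?thesis using Sb(3) by blast
  next
    case True
    then obtain e0 where e0: "e0 \<in> L" "e0 k \<noteq> 0" by blast
    define e1 where "e1 = (\<lambda>i. 1 / e0 k * e0 i)"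
    have e1: "e1 \<in> L" "e1 k = 1" using e0 insert.prems(4)[OF e0(1), of "1 / e0 k"] by (simp_all only: e1_def) simp
    define e where "e = (\<lambda>i. e1 i + (-1) * (\<Sum>s\<in>S. e1 s * b s i))"
    have eL: "e \<in> L" unfolding e_def by (intro insert.prems(3,4) e1 sumL) auto
    have ek: "e k = 1" using S(3) e1(2) by (simp add: e_def)
    have es: "e s = 0" if "s \<in> S" for s
    proof -
      have "(\<Sum>s'\<in>S. e1 s' * b s' s) = (\<Sum>s'\<in>S. if s' = s then e1 s' else 0)"
        using S(4) that by (intro sum.cong) auto
      then show ?thesis using finS that by (simp add: e_def)
    qed
    have "v i = (\<Sum>s\<in>insert k S. v s * (b(k := e)) s i)" if v: "v \<in> L" for v i
    proof -
      have "(\<lambda>i. v i + (- v k) * e i) \<in> L" by (intro insert.prems(3,4) v eL)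
      then have "v i + (- v k) * e i = (\<Sum>s\<in>S. (v s + (- v k) * e s) * b s i)"
        using S5[of "\<lambda>i. v i + (- v k) * e i" i] ek by simp
      also have "\<dots> = (\<Sum>s\<in>S. v s * b s i)" using es by (intro sum.cong) auto
      finally have "v i = v k * e i + (\<Sum>s\<in>S. v s * b s i)" by (simp add: algebra_simps)
      also have "(\<Sum>s\<in>S. v s * b s i) = (\<Sum>s\<in>S. v s * (b(k := e)) s i)" using kS by (intro sum.cong) auto
      finally show ?thesis using finS kS by simp
    qed
    then have 1: "\<forall>v\<in>L. \<forall>i. v i = (\<Sum>s\<in>insert k S. v s * (b(k := e)) s i)" by blast
    have 2: "\<forall>s\<in>insert k S. (b(k := e)) s \<in> L" using S(2) eL kS by auto
    have 3: "\<forall>s\<in>insert k S. \<forall>s'\<in>insert k S. (b(k := e)) s s' = (if s = s' then 1 else 0)"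
      using S(3,4) ek es kS by auto
    have "insert k S \<subseteq> insert k K" using Sb(1) by auto
    with 1 2 3 show ?thesis by (intro exI[of _ "insert k S"] exI[of _ "b(k := e)"] conjI)
  qed
qed

subsection \<open>Nilpotent matrices bordered by a column\<close>

text \<open>The matrix of an endomorphism in a basis whose first vectors span a hyperplane that
  contains the image: \<open>X\<close> is the restriction, and \<open>c\<close> is the image of the
  last basis vector.\<close>

definition border :: "complex mat \<Rightarrow> complex mat \<Rightarrow> complex mat" where
  "border X c = four_block_mat X c (0\<^sub>m 1 (dim_row X)) (0\<^sub>m 1 1)"

lemma mult_minus_column: "X \<in> carrier_mat n m \<Longrightarrow> k \<in> carrier_mat m 1 \<Longrightarrow> X * (- k) = - (X * k)" for X :: "complex mat"
  by (rule uminus_mult_right_mat) auto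

lemma border_carrier: "X \<in> carrier_mat m m \<Longrightarrow> border X c \<in> carrier_mat (Suc m) (Suc m)"
  unfolding border_def using four_block_carrier_mat[of X m m "0\<^sub>m 1 1" 1 1] by simp

lemma four_block_carrier_Suc:
  "A \<in> carrier_mat m m \<Longrightarrow> D \<in> carrier_mat 1 1 \<Longrightarrow> four_block_mat A B C D \<in> carrier_mat (Suc m) (Suc m)"
  using four_block_carrier_mat[of A m m D 1 1] by simp

lemma kernel_dim_mult_right:
  assumes "A \<in> carrier_mat n n" "B \<in> carrier_mat n n" "C \<in> carrier_mat n n" "B * C = 1\<^sub>m n"
  shows "kernel_dim (A * B) = kernel_dim A"
  unfolding kernel_dim_def using mat_kernel_dim_mult_eq_right[OF assms] assms(1,2) by simp

lemma kernel_dim_mult_left: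
  assumes A: "A \<in> carrier_mat n n" and B: "B \<in> carrier_mat n n" "C \<in> carrier_mat n n" "C * B = 1\<^sub>m n"
  shows "kernel_dim (B * A) = kernel_dim A"
  unfolding kernel_dim_def mat_kernel_mult_eq[OF A B] by simp

lemma kernel_dim_four_block:
  assumes "A \<in> carrier_mat n n" "D \<in> carrier_mat 1 1"
  shows "kernel_dim (four_block_mat A (0\<^sub>m n 1) (0\<^sub>m 1 n) D) = kernel_dim A + kernel_dim D"
  unfolding kernel_dim_def using kernel_four_block_0_mat[OF refl assms] assms by simp

lemma kernel_dim_0_1: "kernel_dim (0\<^sub>m 1 1 :: complex mat) = 1"
proof -
  have "jordan_block 1 (0::complex) ^\<^sub>m 1 = 0\<^sub>m 1 1" by (rule eq_matI) auto
  then show ?thesis unfolding kernel_dim_def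
    using dim_kernel_zero_jordan_block_pow[of 1 1, where ?'a = complex] by (metis index_zero_mat(3) min.idem)
qed

lemma kernel_dim_1_1: "kernel_dim (1\<^sub>m 1 :: complex mat) = 0"
  unfolding kernel_dim_def using kernel_one_mat(1)[of 1, where ?'a = complex] by simp

lemma kernel_dim_border_image:
  assumes X: "X \<in> carrier_mat m m" and k: "k \<in> carrier_mat m 1"
  shows "kernel_dim (border X (X * k)) = kernel_dim X + 1"
proof -
  let ?P = "four_block_mat (1\<^sub>m m) (- k) (0\<^sub>m 1 m) (1\<^sub>m 1)"
  let ?Q = "four_block_mat (1\<^sub>m m) k (0\<^sub>m 1 m) (1\<^sub>m 1)"
  have Xk: "X * k \<in> carrier_mat m 1" using X k by simp
  have mk: "- k \<in> carrier_mat m 1" using k by simp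
  have "?P * ?Q = four_block_mat (1\<^sub>m m * 1\<^sub>m m + (- k) * 0\<^sub>m 1 m) (1\<^sub>m m * k + (- k) * 1\<^sub>m 1) (0\<^sub>m 1 m * 1\<^sub>m m + 1\<^sub>m 1 * 0\<^sub>m 1 m) (0\<^sub>m 1 m * k + 1\<^sub>m 1 * 1\<^sub>m 1)"
    by (rule mult_four_block_mat[OF one_carrier_mat mk zero_carrier_mat one_carrier_mat one_carrier_mat k zero_carrier_mat one_carrier_mat])
  also have "\<dots> = four_block_mat (1\<^sub>m m) (0\<^sub>m m 1) (0\<^sub>m 1 m) (1\<^sub>m 1)"
    using k mk right_mult_one_mat[OF mk] by (intro cong_four_block_mat) (auto intro!: eq_matI)
  finally have PQ: "?P * ?Q = 1\<^sub>m (Suc m)" by (simp add: four_block_one_mat)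
  have "border X (X * k) * ?P = four_block_mat (X * 1\<^sub>m m + (X * k) * 0\<^sub>m 1 m) (X * (- k) + (X * k) * 1\<^sub>m 1) (0\<^sub>m 1 m * 1\<^sub>m m + 0\<^sub>m 1 1 * 0\<^sub>m 1 m) (0\<^sub>m 1 m * (- k) + 0\<^sub>m 1 1 * 1\<^sub>m 1)"
    unfolding border_def carrier_matD(1)[OF X]
    by (rule mult_four_block_mat[OF X Xk zero_carrier_mat zero_carrier_mat one_carrier_mat mk zero_carrier_mat one_carrier_mat])
  also have "X * 1\<^sub>m m + (X * k) * 0\<^sub>m 1 m = X"
    using right_mult_one_mat[OF X] right_mult_zero_mat[OF Xk] right_add_zero_mat[OF X] by simp
  also have "X * (- k) + (X * k) * 1\<^sub>m 1 = 0\<^sub>m m 1"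
    using uminus_l_inv_mat[OF Xk] right_mult_one_mat[OF Xk] mult_minus_column[OF X k] by simp
  also have "0\<^sub>m 1 m * 1\<^sub>m m + 0\<^sub>m 1 1 * 0\<^sub>m 1 m = (0\<^sub>m 1 m :: complex mat)" by simp
  also have "0\<^sub>m 1 m * (- k) + 0\<^sub>m 1 1 * 1\<^sub>m 1 = (0\<^sub>m 1 1 :: complex mat)" using mk by (simp add: left_mult_zero_mat[OF mk])
  finally have e: "border X (X * k) * ?P = four_block_mat X (0\<^sub>m m 1) (0\<^sub>m 1 m) (0\<^sub>m 1 1)" .
  have "kernel_dim (border X (X * k)) = kernel_dim (border X (X * k) * ?P)"
    by (rule kernel_dim_mult_right[OF border_carrier[OF X] _ _ PQ, symmetric]) (rule four_block_carrier_Suc, simp, simp)+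
  then show ?thesis unfolding e using kernel_dim_four_block[OF X, of "0\<^sub>m 1 1"] kernel_dim_0_1 by simp
qed

text \<open>There is a row \<open>\<mu>\<close> with \<open>\<mu> * X = 0\<close> and
  \<open>\<mu> * c = 1\<close>. Row operations with it put 1 into the corner and then clear
  \<open>c\<close>, which leaves a block sum of \<open>X\<close> with a part without kernel.\<close>

lemma kernel_dim_border_no_image:
  assumes X: "X \<in> carrier_mat m m" and c: "c \<in> carrier_mat m 1" and no: "\<not> (\<exists>k\<in>carrier_mat m 1. c = X * k)"
  shows "kernel_dim (border X c) = kernel_dim X"
proof -
  have "\<exists>\<mu>\<in>carrier_mat 1 m. \<mu> * X = 0\<^sub>m 1 m \<and> \<mu> * c \<noteq> 0\<^sub>m 1 1" using column_factor[OF X c] no by blast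
  then obtain \<mu>0 where \<mu>0: "\<mu>0 \<in> carrier_mat 1 m" "\<mu>0 * X = 0\<^sub>m 1 m" "\<mu>0 * c \<noteq> 0\<^sub>m 1 1" by blast
  have mc: "\<mu>0 * c \<in> carrier_mat 1 1" using \<mu>0(1) c by simp
  define a where "a = (\<mu>0 * c) $$ (0, 0)"
  have a: "a \<noteq> 0"
  proof
    assume "a = 0"
    then have "\<mu>0 * c = 0\<^sub>m 1 1" using mc by (intro eq_matI) (auto simp: a_def)
    with \<mu>0(3) show False by simp
  qed
  define \<mu> where "\<mu> = (1 / a) \<cdot>\<^sub>m \<mu>0"
  have \<mu>: "\<mu> \<in> carrier_mat 1 m" using \<mu>0(1) by (simp add: \<mu>_def)
  have \<mu>X: "\<mu> * X = 0\<^sub>m 1 m" unfolding \<mu>_def mult_smult_assoc_mat[OF \<mu>0(1) X] \<mu>0(2) by (rule eq_matI) auto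
  have \<mu>c: "\<mu> * c = 1\<^sub>m 1" unfolding \<mu>_def mult_smult_assoc_mat[OF \<mu>0(1) c]
  proof (rule eq_matI)
    fix i j assume "i < dim_row (1\<^sub>m 1 :: complex mat)" "j < dim_col (1\<^sub>m 1 :: complex mat)"
    then show "((1 / a) \<cdot>\<^sub>m (\<mu>0 * c)) $$ (i, j) = 1\<^sub>m 1 $$ (i, j)"
      using carrier_matD[OF mc] a by (subst index_smult_mat) (simp_all add: a_def[symmetric] del: index_mult_mat)
  qed (use mc in auto)
  let ?P = "four_block_mat (1\<^sub>m m) (0\<^sub>m m 1) \<mu> (1\<^sub>m 1)"
  let ?P' = "four_block_mat (1\<^sub>m m) (0\<^sub>m m 1) (- \<mu>) (1\<^sub>m 1)"
  let ?Q = "four_block_mat (1\<^sub>m m) (- c) (0\<^sub>m 1 m) (1\<^sub>m 1)"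
  let ?Q' = "four_block_mat (1\<^sub>m m) c (0\<^sub>m 1 m) (1\<^sub>m 1)"
  have mc': "- c \<in> carrier_mat m 1" and m\<mu>: "- \<mu> \<in> carrier_mat 1 m" using c \<mu> by simp_all
  have "?P' * ?P = four_block_mat (1\<^sub>m m * 1\<^sub>m m + 0\<^sub>m m 1 * \<mu>) (1\<^sub>m m * 0\<^sub>m m 1 + 0\<^sub>m m 1 * 1\<^sub>m 1) ((- \<mu>) * 1\<^sub>m m + 1\<^sub>m 1 * \<mu>) ((- \<mu>) * 0\<^sub>m m 1 + 1\<^sub>m 1 * 1\<^sub>m 1)"
    by (rule mult_four_block_mat[OF one_carrier_mat zero_carrier_mat m\<mu> one_carrier_mat one_carrier_mat zero_carrier_mat \<mu> one_carrier_mat])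
  also have "\<dots> = four_block_mat (1\<^sub>m m) (0\<^sub>m m 1) (0\<^sub>m 1 m) (1\<^sub>m 1)"
    using \<mu> m\<mu> right_mult_one_mat[OF m\<mu>] left_mult_one_mat[OF \<mu>] right_mult_zero_mat[OF m\<mu>] left_mult_zero_mat[OF \<mu>] uminus_l_inv_mat[OF \<mu>]
    by (intro cong_four_block_mat) auto
  finally have PP: "?P' * ?P = 1\<^sub>m (Suc m)" by (simp add: four_block_one_mat)
  have "?Q' * ?Q = four_block_mat (1\<^sub>m m * 1\<^sub>m m + c * 0\<^sub>m 1 m) (1\<^sub>m m * (- c) + c * 1\<^sub>m 1) (0\<^sub>m 1 m * 1\<^sub>m m + 1\<^sub>m 1 * 0\<^sub>m 1 m) (0\<^sub>m 1 m * (- c) + 1\<^sub>m 1 * 1\<^sub>m 1)"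
    by (rule mult_four_block_mat[OF one_carrier_mat c zero_carrier_mat one_carrier_mat one_carrier_mat mc' zero_carrier_mat one_carrier_mat])
  also have "\<dots> = four_block_mat (1\<^sub>m m) (0\<^sub>m m 1) (0\<^sub>m 1 m) (1\<^sub>m 1)"
    using c mc' right_mult_one_mat[OF c] left_mult_one_mat[OF mc'] right_mult_zero_mat[OF c] left_mult_zero_mat[OF mc'] uminus_l_inv_mat[OF c]
    by (intro cong_four_block_mat) auto
  finally have QQ: "?Q' * ?Q = 1\<^sub>m (Suc m)" by (simp add: four_block_one_mat)
  have "?P * border X c = four_block_mat (1\<^sub>m m * X + 0\<^sub>m m 1 * 0\<^sub>m 1 m) (1\<^sub>m m * c + 0\<^sub>m m 1 * 0\<^sub>m 1 1) (\<mu> * X + 1\<^sub>m 1 * 0\<^sub>m 1 m) (\<mu> * c + 1\<^sub>m 1 * 0\<^sub>m 1 1)"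
    unfolding border_def carrier_matD(1)[OF X]
    by (rule mult_four_block_mat[OF one_carrier_mat zero_carrier_mat \<mu> one_carrier_mat X c zero_carrier_mat zero_carrier_mat])
  also have "\<dots> = four_block_mat X c (0\<^sub>m 1 m) (1\<^sub>m 1)"
    using X c \<mu>X \<mu>c by (intro cong_four_block_mat) auto
  finally have e1: "?P * border X c = four_block_mat X c (0\<^sub>m 1 m) (1\<^sub>m 1)" .
  have "?Q * four_block_mat X c (0\<^sub>m 1 m) (1\<^sub>m 1) = four_block_mat (1\<^sub>m m * X + (- c) * 0\<^sub>m 1 m) (1\<^sub>m m * c + (- c) * 1\<^sub>m 1) (0\<^sub>m 1 m * X + 1\<^sub>m 1 * 0\<^sub>m 1 m) (0\<^sub>m 1 m * c + 1\<^sub>m 1 * 1\<^sub>m 1)"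
    by (rule mult_four_block_mat[OF one_carrier_mat mc' zero_carrier_mat one_carrier_mat X c zero_carrier_mat one_carrier_mat])
  also have "\<dots> = four_block_mat X (0\<^sub>m m 1) (0\<^sub>m 1 m) (1\<^sub>m 1)"
    using X c mc' right_mult_one_mat[OF mc'] right_mult_zero_mat[OF mc'] left_mult_one_mat[OF c] left_mult_zero_mat[OF c] left_mult_zero_mat[OF X]
    by (intro cong_four_block_mat) (auto intro!: eq_matI)
  finally have e2: "?Q * four_block_mat X c (0\<^sub>m 1 m) (1\<^sub>m 1) = four_block_mat X (0\<^sub>m m 1) (0\<^sub>m 1 m) (1\<^sub>m 1)" .
  note f1 = four_block_carrier_Suc[OF one_carrier_mat one_carrier_mat]
  have "kernel_dim (border X c) = kernel_dim (?P * border X c)"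
    by (rule kernel_dim_mult_left[OF border_carrier[OF X] f1 f1 PP, symmetric])
  also have "\<dots> = kernel_dim (?Q * four_block_mat X c (0\<^sub>m 1 m) (1\<^sub>m 1))"
    unfolding e1 by (rule kernel_dim_mult_left[OF four_block_carrier_Suc[OF X one_carrier_mat] f1 f1 QQ, symmetric])
  also have "\<dots> = kernel_dim X" unfolding e2 using kernel_dim_four_block[OF X, of "1\<^sub>m 1"] kernel_dim_1_1 by simp
  finally show ?thesis .
qed

lemma border_mult_column:
  assumes X: "X \<in> carrier_mat m m" and c: "c \<in> carrier_mat m 1" and w: "w \<in> carrier_mat (Suc m) 1"
  shows "border X c * w = 0\<^sub>m (Suc m) 1 \<longleftrightarrow>
    X * mat m 1 (\<lambda>(i, j). w $$ (i, 0)) + w $$ (m, 0) \<cdot>\<^sub>m c = 0\<^sub>m m 1" (is "?l = ?r")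
proof -
  let ?w = "mat m 1 (\<lambda>(i, j). w $$ (i, 0))"
  have wc: "?w \<in> carrier_mat m 1" by simp
  note B = border_carrier[OF X, of c]
  have ent: "(border X c * w) $$ (i, 0) = (if i < m then (X * ?w + w $$ (m, 0) \<cdot>\<^sub>m c) $$ (i, 0) else 0)" if i: "i < Suc m" for i
  proof -
    have "(border X c * w) $$ (i, 0) = (\<Sum>l\<in>{0..<Suc m}. border X c $$ (i, l) * w $$ (l, 0))"
      by (rule index_mult_mat'[OF B w i]) simp
    also have "\<dots> = (\<Sum>l\<in>{0..<m}. border X c $$ (i, l) * w $$ (l, 0)) + border X c $$ (i, m) * w $$ (m, 0)" by simp
    also have "\<dots> = (if i < m then (\<Sum>l\<in>{0..<m}. X $$ (i, l) * ?w $$ (l, 0)) + c $$ (i, 0) * w $$ (m, 0) else 0)"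
      using i X c by (auto simp: border_def intro!: sum.cong)
    also have "\<dots> = (if i < m then (X * ?w) $$ (i, 0) + c $$ (i, 0) * w $$ (m, 0) else 0)"
      using index_mult_mat'[OF X wc, of i 0] by simp
    finally show ?thesis using X c by simp
  qed
  show ?thesis
  proof
    assume l: ?l
    show ?r
    proof (rule eq_matI)
      fix i j assume "i < dim_row (0\<^sub>m m 1 :: complex mat)" "j < dim_col (0\<^sub>m m 1 :: complex mat)"
      then show "(X * ?w + w $$ (m, 0) \<cdot>\<^sub>m c) $$ (i, j) = 0\<^sub>m m 1 $$ (i, j)"
        using ent[of i] l by simp
    qed (use X c in auto)
  next
    assume r: ?r
    show ?l
    proof (rule eq_matI)
      fix i j assume "i < dim_row (0\<^sub>m (Suc m) 1 :: complex mat)" "j < dim_col (0\<^sub>m (Suc m) 1 :: complex mat)"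
      then show "(border X c * w) $$ (i, j) = 0\<^sub>m (Suc m) 1 $$ (i, j)"
        using ent[of i] r by simp
    qed (use B w in auto)
  qed
qed

text \<open>The kernel of the bordered matrix meets the hyperplane in the kernel of
  \<open>X\<close>, so the dimensions agree exactly when the kernel does not leave the hyperplane.
  This turns a comparison of Jordan types into a linear condition on the hyperplane.\<close>

lemma kernel_dim_border_eq:
  assumes X: "X \<in> carrier_mat m m" and c: "c \<in> carrier_mat m 1"
  shows "kernel_dim (border X c) = kernel_dim X \<longleftrightarrow>
    (\<forall>w\<in>carrier_mat (Suc m) 1. border X c * w = 0\<^sub>m (Suc m) 1 \<longrightarrow> w $$ (m, 0) = 0)" (is "?l = ?r")
proof
  assume l: ?l
  show ?r
  proof (intro ballI impI, rule ccontr)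
    fix w assume w: "w \<in> carrier_mat (Suc m) 1" "border X c * w = 0\<^sub>m (Suc m) 1" "w $$ (m, 0) \<noteq> 0"
    define v where "v = mat m 1 (\<lambda>(i, j). w $$ (i, 0))"
    define a where "a = w $$ (m, 0)"
    have v: "v \<in> carrier_mat m 1" by (simp add: v_def)
    have e: "X * v + a \<cdot>\<^sub>m c = 0\<^sub>m m 1" using border_mult_column[OF X c w(1)] w(2) by (simp add: v_def a_def)
    have "c = (- 1 / a) \<cdot>\<^sub>m (X * v)"
    proof (rule eq_matI)
      fix i j assume "i < dim_row ((- 1 / a) \<cdot>\<^sub>m (X * v))" "j < dim_col ((- 1 / a) \<cdot>\<^sub>m (X * v))"
      then have ij: "i < m" "j = 0" using X v by auto
      have "(X * v) $$ (i, 0) + a * c $$ (i, 0) = 0" using arg_cong[OF e, of "\<lambda>A. A $$ (i, 0)"] ij X c v by simp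
      then have "(X * v) $$ (i, 0) = - a * c $$ (i, 0)" by (simp add: add_eq_0_iff)
      then show "c $$ (i, j) = ((- 1 / a) \<cdot>\<^sub>m (X * v)) $$ (i, j)" using ij X v w(3) by (simp add: a_def)
    qed (use X v c in auto)
    then have "c = X * ((- 1 / a) \<cdot>\<^sub>m v)" using mult_smult_distrib[OF X v] by simp
    with kernel_dim_border_image[OF X, of "(- 1 / a) \<cdot>\<^sub>m v"] v l show False by simp
  qed
next
  assume r: ?r
  have "\<not> (\<exists>k\<in>carrier_mat m 1. c = X * k)"
  proof
    assume "\<exists>k\<in>carrier_mat m 1. c = X * k"
    then obtain k where k: "k \<in> carrier_mat m 1" "c = X * k" by blast
    let ?w = "mat (Suc m) 1 (\<lambda>(i, j). if i < m then - k $$ (i, 0) else 1)"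
    have "mat m 1 (\<lambda>(i, j). ?w $$ (i, 0)) = - k" using k by (intro eq_matI) auto
    moreover have "X * (- k) + 1 \<cdot>\<^sub>m c = 0\<^sub>m m 1"
    proof -
      have "1 \<cdot>\<^sub>m c = c" by (rule eq_matI) auto
      then show ?thesis using mult_minus_column[OF X k(1)] uminus_l_inv_mat[OF c] k(2) by simp
    qed
    ultimately have "border X c * ?w = 0\<^sub>m (Suc m) 1" by (subst border_mult_column[OF X c]) auto
    from bspec[OF r, of ?w] this show False by simp
  qed
  then show ?l by (rule kernel_dim_border_no_image[OF X c])
qed

lemma kernel_dim_border_cases:
  assumes X: "X \<in> carrier_mat m m" and c: "c \<in> carrier_mat m 1"
  shows "kernel_dim (border X c) = kernel_dim X \<or> kernel_dim (border X c) = kernel_dim X + 1"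
  using kernel_dim_border_image[OF X] kernel_dim_border_no_image[OF X c] by blast

lemma border_mult:
  assumes X: "X \<in> carrier_mat m m" "c \<in> carrier_mat m 1" and Y: "Y \<in> carrier_mat m m" "d \<in> carrier_mat m 1"
  shows "border X c * border Y d = border (X * Y) (X * d)"
proof -
  have "border X c * border Y d = four_block_mat (X * Y + c * 0\<^sub>m 1 m) (X * d + c * 0\<^sub>m 1 1) (0\<^sub>m 1 m * Y + 0\<^sub>m 1 1 * 0\<^sub>m 1 m) (0\<^sub>m 1 m * d + 0\<^sub>m 1 1 * 0\<^sub>m 1 1)"
    unfolding border_def carrier_matD(1)[OF X(1)] carrier_matD(1)[OF Y(1)]
    by (rule mult_four_block_mat[OF X zero_carrier_mat zero_carrier_mat Y zero_carrier_mat zero_carrier_mat])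
  also have "X * Y + c * 0\<^sub>m 1 m = X * Y"
    using right_mult_zero_mat[OF X(2)] right_add_zero_mat[OF mult_carrier_mat[OF X(1) Y(1)]] by simp
  also have "X * d + c * 0\<^sub>m 1 1 = X * d"
    using right_mult_zero_mat[OF X(2)] right_add_zero_mat[OF mult_carrier_mat[OF X(1) Y(2)]] by simp
  also have "0\<^sub>m 1 m * Y + 0\<^sub>m 1 1 * 0\<^sub>m 1 m = 0\<^sub>m 1 m" using left_mult_zero_mat[OF Y(1)] by simp
  also have "0\<^sub>m 1 m * d + 0\<^sub>m 1 1 * 0\<^sub>m 1 1 = 0\<^sub>m 1 1" using left_mult_zero_mat[OF Y(2)] by simp
  finally show ?thesis using X(1) by (simp add: border_def)
qed

lemma border_pow:
  assumes X: "X \<in> carrier_mat m m" and c: "c \<in> carrier_mat m 1"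
  shows "border X c ^\<^sub>m Suc j = border (X ^\<^sub>m Suc j) (X ^\<^sub>m j * c)"
proof (induction j)
  case 0
  show ?case using X c by (simp add: left_mult_one_mat[OF border_carrier[OF X]] left_mult_one_mat[OF X] left_mult_one_mat[OF c] carrier_matD[OF border_carrier[OF X]])
next
  case (Suc j)
  have "border X c ^\<^sub>m Suc (Suc j) = border (X ^\<^sub>m Suc j) (X ^\<^sub>m j * c) * border X c" using Suc by simp
  also have "\<dots> = border (X ^\<^sub>m Suc j * X) (X ^\<^sub>m Suc j * c)"
    by (rule border_mult) (use X c in \<open>auto intro!: mult_carrier_mat[of _ m m]\<close>)
  finally show ?case by simp
qed

subsection \<open>Jordan types of nilpotent matrices\<close>

lemma char_matrix_0: "A \<in> carrier_mat n n \<Longrightarrow> char_matrix A 0 = A" for A :: "complex mat"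
  by (rule eq_matI) (auto simp: char_matrix_def)

text \<open>The right-hand side counts the boxes in the first \<open>j\<close> columns of the
  diagram.\<close>

lemma young_diagram_kernel_dim:
  assumes "young_diagram A mu" "A \<in> carrier_mat n n"
  shows "kernel_dim (A ^\<^sub>m j) = (\<Sum>m\<leftarrow>mu. min j m)"
proof -
  have "dim_gen_eigenspace A 0 j = (\<Sum>n\<leftarrow>map fst [(n, e)\<leftarrow>map (\<lambda>m. (m, 0::complex)) mu. e = 0]. min j n)"
    using assms(1) unfolding young_diagram_def by (intro dim_gen_eigenspace) auto
  moreover have "filter (\<lambda>(n, e). e = 0) (map (\<lambda>m. (m, 0::complex)) mu) = map (\<lambda>m. (m, 0)) mu"
    by (induction mu) auto
  ultimately show ?thesis
    by (simp add: dim_gen_eigenspace_def char_matrix_0[OF assms(2)] o_def)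
qed

lemma young_diagram_dim:
  assumes "young_diagram A mu" shows "A \<in> carrier_mat (sum_list mu) (sum_list mu)"
proof -
  have "similar_mat A (jordan_matrix (map (\<lambda>m. (m, 0::complex)) mu))"
    using assms by (simp add: young_diagram_def jordan_nf_def)
  from similar_matD[OF this] obtain n P Q where *: "{A, jordan_matrix (map (\<lambda>m. (m, 0::complex)) mu), P, Q} \<subseteq> carrier_mat n n" by blast
  then have "dim_row (jordan_matrix (map (\<lambda>m. (m, 0::complex)) mu)) = n" by auto
  then have "n = sum_list mu" by (simp add: o_def)
  with * show ?thesis by auto
qed

lemma young_diagram_pos: "young_diagram A mu \<Longrightarrow> 0 \<notin> set mu"
  by (auto simp: young_diagram_def jordan_nf_def image_image)

text \<open>Minus the second difference of these sums in \<open>j\<close> counts the parts equal to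
  \<open>j + 1\<close>.\<close>

lemma count_of_min_sums:
  fixes mu nu :: "nat list"
  assumes "\<And>j. (\<Sum>m\<leftarrow>mu. min j m) = (\<Sum>m\<leftarrow>nu. min j m)" "0 \<notin> set mu" "0 \<notin> set nu"
  shows "mset mu = mset nu"
proof (rule multiset_eqI)
  have c: "2 * (\<Sum>m\<leftarrow>xs. min (Suc j) m) = (\<Sum>m\<leftarrow>xs. min j m) + (\<Sum>m\<leftarrow>xs. min (Suc (Suc j)) m) + count (mset xs) (Suc j)" for xs :: "nat list" and j
    by (induction xs) (auto simp: min_def)
  fix x show "count (mset mu) x = count (mset nu) x"
  proof (cases x)
    case 0
    then show ?thesis using assms(2,3) by (metis count_mset_0_iff)
  next
    case (Suc j)
    show ?thesis using c[where xs = mu and j = j] c[where xs = nu and j = j] assms(1) Suc by simp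
  qed
qed

lemma sorted_desc_eq:
  fixes mu nu :: "nat list"
  assumes "sorted_wrt (\<ge>) mu" "sorted_wrt (\<ge>) nu" "mset mu = mset nu"
  shows "mu = nu"
proof -
  have "sorted (rev mu)" "sorted (rev nu)" using assms(1,2) by (simp_all add: sorted_wrt_rev)
  then have "rev mu = rev nu" using assms(3) by (metis mset_rev properties_for_sort)
  then show ?thesis by simp
qed

lemma young_diagram_eqI:
  assumes "young_diagram A mu" "A \<in> carrier_mat n n" "sorted_wrt (\<ge>) nu" "0 \<notin> set nu"
    "\<And>j. kernel_dim (A ^\<^sub>m j) = (\<Sum>m\<leftarrow>nu. min j m)"
  shows "young_diagram A nu"
proof -
  have "mset mu = mset nu"
    by (rule count_of_min_sums) (use assms young_diagram_kernel_dim[OF assms(1,2)] young_diagram_pos[OF assms(1)] in auto)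
  with assms(1,3) have "mu = nu" by (intro sorted_desc_eq) (auto simp: young_diagram_def)
  then show ?thesis using assms(1) by simp
qed

section \<open>Order of Jordan blocks and existence of the Jordan type\<close>

lemma similar_mat_four_block_swap:
  fixes A B :: "complex mat"
  assumes A: "A \<in> carrier_mat n n" and B: "B \<in> carrier_mat m m"
  shows "similar_mat (four_block_mat A (0\<^sub>m n m) (0\<^sub>m m n) B) (four_block_mat B (0\<^sub>m m n) (0\<^sub>m n m) A)"
proof -
  let ?P = "four_block_mat (0\<^sub>m n m) (1\<^sub>m n) (1\<^sub>m m) (0\<^sub>m m n) :: complex mat"
  let ?Q = "four_block_mat (0\<^sub>m m n) (1\<^sub>m m) (1\<^sub>m n) (0\<^sub>m n m) :: complex mat"
  let ?X = "four_block_mat A (0\<^sub>m n m) (0\<^sub>m m n) B" and ?Y = "four_block_mat B (0\<^sub>m m n) (0\<^sub>m n m) A"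
  have dims: "?X \<in> carrier_mat (n + m) (n + m)" "?Y \<in> carrier_mat (n + m) (n + m)"
    "?P \<in> carrier_mat (n + m) (n + m)" "?Q \<in> carrier_mat (n + m) (n + m)"
    using four_block_carrier_mat[OF A B] four_block_carrier_mat[OF B A]
    by (auto simp: add.commute intro!: carrier_matI)
  have "?P * ?Q = four_block_mat (0\<^sub>m n m * 0\<^sub>m m n + 1\<^sub>m n * 1\<^sub>m n) (0\<^sub>m n m * 1\<^sub>m m + 1\<^sub>m n * 0\<^sub>m n m) (1\<^sub>m m * 0\<^sub>m m n + 0\<^sub>m m n * 1\<^sub>m n) (1\<^sub>m m * 1\<^sub>m m + 0\<^sub>m m n * 0\<^sub>m n m)"
    by (rule mult_four_block_mat) auto
  also have "\<dots> = 1\<^sub>m (n + m)" by (simp add: four_block_one_mat)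
  finally have PQ: "?P * ?Q = 1\<^sub>m (n + m)" .
  have d: "det ?P \<noteq> 0" using det_mult[OF dims(3,4)] PQ by auto
  have "?X * ?P = four_block_mat (A * 0\<^sub>m n m + 0\<^sub>m n m * 1\<^sub>m m) (A * 1\<^sub>m n + 0\<^sub>m n m * 0\<^sub>m m n) (0\<^sub>m m n * 0\<^sub>m n m + B * 1\<^sub>m m) (0\<^sub>m m n * 1\<^sub>m n + B * 0\<^sub>m m n)"
    by (rule mult_four_block_mat) (use A B in auto)
  also have "\<dots> = four_block_mat (0\<^sub>m n m) A B (0\<^sub>m m n)"
    using A B by (intro cong_four_block_mat) auto
  finally have XP: "?X * ?P = four_block_mat (0\<^sub>m n m) A B (0\<^sub>m m n)" .
  have "?P * ?Y = four_block_mat (0\<^sub>m n m * B + 1\<^sub>m n * 0\<^sub>m n m) (0\<^sub>m n m * 0\<^sub>m m n + 1\<^sub>m n * A) (1\<^sub>m m * B + 0\<^sub>m m n * 0\<^sub>m n m) (1\<^sub>m m * 0\<^sub>m m n + 0\<^sub>m m n * A)"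
    by (rule mult_four_block_mat) (use A B in auto)
  also have "\<dots> = four_block_mat (0\<^sub>m n m) A B (0\<^sub>m m n)"
    using A B by (intro cong_four_block_mat) auto
  finally have "?X * ?P = ?P * ?Y" using XP by simp
  from similar_matI'[OF dims(1,2,3) d this] show ?thesis .
qed

lemma jordan_matrix_append:
  "jordan_matrix (xs @ ys) = four_block_mat (jordan_matrix xs) (0\<^sub>m (sum_list (map fst xs)) (sum_list (map fst ys)))
     (0\<^sub>m (sum_list (map fst ys)) (sum_list (map fst xs))) (jordan_matrix ys)"
proof -
  have "jordan_matrix (xs @ ys) = four_block_mat (jordan_matrix xs) (0\<^sub>m (dim_row (jordan_matrix xs)) (dim_col (jordan_matrix ys)))
     (0\<^sub>m (dim_row (jordan_matrix ys)) (dim_col (jordan_matrix xs))) (jordan_matrix ys)"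
    unfolding jordan_matrix_def map_append diag_block_mat_append Let_def ..
  then show ?thesis by simp
qed

lemma similar_jordan_matrix_rotate: "similar_mat (jordan_matrix (xs @ ys)) (jordan_matrix (ys @ xs))" for xs ys :: "(nat \<times> complex) list"
  unfolding jordan_matrix_append by (rule similar_mat_four_block_swap) simp_all

lemma similar_jordan_matrix_mset:
  fixes xs ys :: "(nat \<times> complex) list"
  assumes "mset xs = mset ys"
  shows "similar_mat (jordan_matrix xs) (jordan_matrix ys)"
  using assms
proof (induction xs arbitrary: ys)
  case Nil
  then show ?case by (simp add: similar_mat_refl[OF jordan_matrix_carrier])
next
  case (Cons x xs)
  then have "x \<in> set ys" by (metis list.set_intros(1) mset_eq_setD)
  then obtain ys1 ys2 where ys: "ys = ys1 @ x # ys2" by (meson split_list)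
  obtain n a where x: "x = (n, a)" by force
  have ms: "mset xs = mset (ys2 @ ys1)" using Cons.prems by (simp add: ys)
  then have ss: "sum_list (map fst xs) = sum_list (map fst (ys2 @ ys1))"
    by (metis mset_map sum_mset_sum_list)
  have "similar_mat (jordan_matrix (x # xs)) (jordan_matrix (x # ys2 @ ys1))"
    unfolding x jordan_matrix_Cons ss[symmetric]
    by (rule similar_mat_four_block_0_0[OF _ Cons.IH[OF ms]]) (simp_all add: similar_mat_refl[of _ n])
  moreover have "similar_mat (jordan_matrix ((x # ys2) @ ys1)) (jordan_matrix (ys1 @ x # ys2))"
    by (rule similar_jordan_matrix_rotate)
  ultimately show ?case unfolding ys by (metis append_Cons similar_mat_trans)
qed

lemma young_diagram_of_jordan:
  assumes "similar_mat A (jordan_matrix (map (\<lambda>m. (m, 0)) nu))" "mset nu = mset mu" "sorted_wrt (\<ge>) mu" "0 \<notin> set mu"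
  shows "young_diagram A mu"
proof -
  have "similar_mat (jordan_matrix (map (\<lambda>m. (m, 0::complex)) nu)) (jordan_matrix (map (\<lambda>m. (m, 0)) mu))"
    by (rule similar_jordan_matrix_mset) (simp add: assms(2))
  with assms(1) have "similar_mat A (jordan_matrix (map (\<lambda>m. (m, 0::complex)) mu))" by (rule similar_mat_trans)
  then show ?thesis using assms(3,4) by (auto simp: young_diagram_def jordan_nf_def)
qed

text \<open>A Jordan form exists over the complex numbers. A block with nonzero eigenvalue would
  contribute nothing to the kernel of \<open>A ^\<^sub>m k\<close>, which is the whole
  space.\<close>

lemma young_diagram_exists:
  assumes A: "A \<in> carrier_mat n n" and nil: "A ^\<^sub>m k = 0\<^sub>m n n"
  shows "\<exists>mu. young_diagram A mu"
proof -
  obtain as where "char_poly A = (\<Prod>a\<leftarrow>as. [:- a, 1:])" using char_poly_factorized[OF A] by blast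
  from jordan_nf_exists[OF A this] obtain n_as where jnf: "jordan_nf A n_as" by blast
  then have sim: "similar_mat A (jordan_matrix n_as)" and pos: "0 \<notin> fst ` set n_as" by (auto simp: jordan_nf_def)
  have z: "a = 0" if ma: "(m, a) \<in> set n_as" for m a
  proof -
    have "m \<noteq> 0" using pos ma by force
    have sn: "sum_list (map fst n_as) = n"
      using similar_matD[OF sim] A by (metis carrier_matD(1) insert_subset jordan_matrix_dim(1))
    have "kernel_dim (A ^\<^sub>m k) = n"
    proof -
      have "jordan_nf (0\<^sub>m n n :: complex mat) (replicate n (1, 0))"
      proof -
        have "jordan_matrix (replicate n (1, 0::complex)) = 0\<^sub>m n n"
        proof (induction n)
          case (Suc n)
          have "jordan_block 1 (0::complex) = 0\<^sub>m 1 1" by (rule eq_matI) auto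
          then show ?case using Suc by (simp add: jordan_matrix_Cons sum_list_replicate)
        qed (simp add: jordan_matrix_def)
        then show ?thesis using similar_mat_refl[of "0\<^sub>m n n" n] by (auto simp: jordan_nf_def)
      qed
      from dim_gen_eigenspace[OF this, of 0 1] have "kernel_dim (0\<^sub>m n n :: complex mat) = n"
        by (simp add: dim_gen_eigenspace_def char_matrix_0[of _ n] filter_replicate sum_list_replicate)
      then show ?thesis by (simp add: nil)
    qed
    moreover have "kernel_dim (A ^\<^sub>m k) = (\<Sum>n\<leftarrow>map fst [(n, e)\<leftarrow>n_as. e = 0]. min k n)"
      using dim_gen_eigenspace[OF jnf, of 0 k] by (simp add: dim_gen_eigenspace_def char_matrix_0[OF A])
    moreover have "(\<Sum>n\<leftarrow>map fst [(n, e)\<leftarrow>xs. e = 0]. min k n) + (if a = 0 then 0 else m) \<le> sum_list (map fst xs)" if "(m, a) \<in> set xs" for xs :: "(nat \<times> complex) list"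
      using that
    proof (induction xs)
      case (Cons x xs)
      have le: "(\<Sum>n\<leftarrow>map fst [(n, e)\<leftarrow>ys. e = 0]. min k n) \<le> sum_list (map fst ys)" for ys :: "(nat \<times> complex) list"
        by (induction ys) auto
      show ?case using Cons le[of xs] by (cases x; cases "(m, a) \<in> set xs") auto
    qed simp
    from this[OF ma] have "(\<Sum>n\<leftarrow>map fst [(n, e)\<leftarrow>n_as. e = 0]. min k n) + (if a = 0 then 0 else m) \<le> n" using sn by simp
    ultimately show ?thesis using \<open>m \<noteq> 0\<close> by (cases "a = 0") auto
  qed
  let ?nu = "map fst n_as"
  have n_as: "n_as = map (\<lambda>m. (m, 0)) ?nu" using z by (induction n_as) auto
  have "young_diagram A (rev (sort ?nu))"
  proof (rule young_diagram_of_jordan)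
    show "similar_mat A (jordan_matrix (map (\<lambda>m. (m, 0)) ?nu))" using sim n_as by simp
    show "sorted_wrt (\<ge>) (rev (sort ?nu))" by (simp add: sorted_wrt_rev)
  qed (use pos in auto)
  then show ?thesis by blast
qed

section \<open>Adding a box to a Jordan type\<close>

definition diag_one :: "nat \<Rightarrow> complex mat \<Rightarrow> complex mat" where
  "diag_one m X = four_block_mat X (0\<^sub>m m 1) (0\<^sub>m 1 m) (1\<^sub>m 1)"

lemma diag_one_carrier: "X \<in> carrier_mat m m \<Longrightarrow> diag_one m X \<in> carrier_mat (Suc m) (Suc m)"
  unfolding diag_one_def by (rule four_block_carrier_Suc) auto

lemma diag_one_index:
  assumes "X \<in> carrier_mat m m" "i < Suc m" "j < Suc m"
  shows "diag_one m X $$ (i, j) = (if i < m \<and> j < m then X $$ (i, j) else if i = j then 1 else 0)"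
  using assms by (auto simp: diag_one_def)

lemma det_diag_one: "X \<in> carrier_mat m m \<Longrightarrow> det (diag_one m X) = det X"
  unfolding diag_one_def by (subst det_four_block_mat_lower_left_zero[of _ m _ 1]) auto

lemma border_index:
  assumes "X \<in> carrier_mat m m" "c \<in> carrier_mat m 1" "i < Suc m" "j < Suc m"
  shows "border X c $$ (i, j) = (if i = m then 0 else if j < m then X $$ (i, j) else c $$ (i, 0))"
  using assms by (auto simp: border_def)

lemma border_diag_one:
  assumes X: "X \<in> carrier_mat m m" and c: "c \<in> carrier_mat m 1" and P: "P \<in> carrier_mat m m"
  shows "border X c * diag_one m P = border (X * P) c" "diag_one m P * border X c = border (P * X) (P * c)"
proof -
  have "border X c * diag_one m P = four_block_mat (X * P + c * 0\<^sub>m 1 m) (X * 0\<^sub>m m 1 + c * 1\<^sub>m 1) (0\<^sub>m 1 m * P + 0\<^sub>m 1 1 * 0\<^sub>m 1 m) (0\<^sub>m 1 m * 0\<^sub>m m 1 + 0\<^sub>m 1 1 * 1\<^sub>m 1)"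
    unfolding border_def diag_one_def carrier_matD(1)[OF X]
    by (rule mult_four_block_mat[OF X c zero_carrier_mat zero_carrier_mat P zero_carrier_mat zero_carrier_mat one_carrier_mat])
  also have "\<dots> = border (X * P) c"
    unfolding border_def
    using X P c right_mult_zero_mat[OF c] right_add_zero_mat[OF mult_carrier_mat[OF X P]] right_mult_zero_mat[OF X]
      right_mult_one_mat[OF c] left_add_zero_mat[OF c] left_mult_zero_mat[OF P]
    by (intro cong_four_block_mat) auto
  finally show "border X c * diag_one m P = border (X * P) c" .
  have "diag_one m P * border X c = four_block_mat (P * X + 0\<^sub>m m 1 * 0\<^sub>m 1 m) (P * c + 0\<^sub>m m 1 * 0\<^sub>m 1 1) (0\<^sub>m 1 m * X + 1\<^sub>m 1 * 0\<^sub>m 1 m) (0\<^sub>m 1 m * c + 1\<^sub>m 1 * 0\<^sub>m 1 1)"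
    unfolding border_def diag_one_def carrier_matD(1)[OF X]
    by (rule mult_four_block_mat[OF P zero_carrier_mat zero_carrier_mat one_carrier_mat X c zero_carrier_mat zero_carrier_mat])
  also have "\<dots> = border (P * X) (P * c)"
    unfolding border_def
    using X P c right_add_zero_mat[OF mult_carrier_mat[OF P X]] right_add_zero_mat[OF mult_carrier_mat[OF P c]]
      left_mult_zero_mat[OF X] left_mult_zero_mat[OF c]
    by (intro cong_four_block_mat) auto
  finally show "diag_one m P * border X c = border (P * X) (P * c)" .
qed

lemma jordan_matrix_single: "jordan_matrix [(k, a)] = jordan_block k a"
  unfolding jordan_matrix_def by (simp add: diag_block_mat_singleton del: diag_block_mat.simps)

text \<open>A Jordan chain is prolonged by a new vector that is mapped to its last vector, the unit
  vector with index \<open>m - 1\<close>. For \<open>k = 0\<close> the new vector is mapped to 0 and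
  forms a block of size 1.\<close>

lemma jordan_matrix_extend:
  fixes xs :: "nat list" and k :: nat
  defines "m \<equiv> sum_list xs + k"
  shows "border (jordan_matrix (map (\<lambda>m. (m, 0)) (xs @ [k]))) (mat m 1 (\<lambda>(i, j). if 0 < k \<and> Suc i = m then 1 else 0)) =
    jordan_matrix (map (\<lambda>m. (m, 0)) (xs @ [Suc k]))" (is "border ?J ?e = ?J'")
proof -
  let ?X = "jordan_matrix (map (\<lambda>m. (m, 0::complex)) xs)"
  let ?S = "sum_list xs"
  have sl: "sum_list (map fst (map (\<lambda>m. (m, 0::complex)) ys)) = sum_list ys" for ys :: "nat list" by (simp add: o_def)
  have X: "?X \<in> carrier_mat ?S ?S" using jordan_matrix_carrier[of "map (\<lambda>m. (m, 0::complex)) xs"] unfolding sl .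
  have J: "jordan_matrix (map (\<lambda>m. (m, 0::complex)) (xs @ [k])) = four_block_mat ?X (0\<^sub>m ?S k) (0\<^sub>m k ?S) (jordan_block k 0)" for k
    using jordan_matrix_append[of "map (\<lambda>m. (m, 0::complex)) xs" "[(k, 0)]"] unfolding sl by (simp add: jordan_matrix_single)
  have Jc: "?J \<in> carrier_mat m m" using jordan_matrix_carrier[of "map (\<lambda>m. (m, 0::complex)) (xs @ [k])"] unfolding sl by (simp add: m_def)
  have Jc': "?J' \<in> carrier_mat (Suc m) (Suc m)" using jordan_matrix_carrier[of "map (\<lambda>m. (m, 0::complex)) (xs @ [Suc k])"] unfolding sl by (simp add: m_def)
  show ?thesis
  proof (rule eq_matI)
    fix i j assume "i < dim_row ?J'" "j < dim_col ?J'"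
    then have ij: "i < Suc m" "j < Suc m" using Jc' by auto
    have "border ?J ?e $$ (i, j) = (if i = m then 0 else if j < m then ?J $$ (i, j) else ?e $$ (i, 0))"
      by (rule border_index[OF Jc _ ij]) simp
    also have "\<dots> = ?J' $$ (i, j)"
    proof -
      have c1: "?J $$ (i, j) = (if i < ?S then if j < ?S then ?X $$ (i, j) else 0 else if j < ?S then 0 else jordan_block k 0 $$ (i - ?S, j - ?S))" if "i < m" "j < m"
        unfolding J using that X by (auto simp: m_def)
      have c2: "?J' $$ (i, j) = (if i < ?S then if j < ?S then ?X $$ (i, j) else 0 else if j < ?S then 0 else jordan_block (Suc k) 0 $$ (i - ?S, j - ?S))"
        unfolding J using ij X by (auto simp: m_def)
      consider "i < m" "j < m" | "i < m" "j = m" | "i = m" using ij by linarith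
      then show ?thesis
      proof cases
        case 1
        then have "i \<noteq> m" by simp
        moreover have "jordan_block k (0::complex) $$ (i - ?S, j - ?S) = jordan_block (Suc k) 0 $$ (i - ?S, j - ?S)"
          if "\<not> i < ?S" "\<not> j < ?S"
          using 1 that by (subst (1 2) jordan_block_index) (simp_all add: m_def)
        ultimately show ?thesis unfolding c2 using c1 1 by simp
      next
        case 2
        have k: "jordan_block (Suc k) (0::complex) $$ (i - ?S, k) = (if Suc (i - ?S) = k then 1 else 0)" if "\<not> i < ?S"
          using 2 that by (subst jordan_block_index) (auto simp: m_def)
        have "i \<noteq> m" "\<not> j < m" "\<not> m < ?S" "m - ?S = k" using 2 by (simp_all add: m_def)
        moreover have "\<not> i < ?S \<Longrightarrow> (Suc (i - ?S) = k) = (0 < k \<and> Suc i = m)" "i < ?S \<Longrightarrow> \<not> (0 < k \<and> Suc i = m)"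
          by (auto simp: m_def)
        ultimately show ?thesis unfolding c2 using k 2 by (cases "i < ?S") simp_all
      next
        case 3
        have k: "jordan_block (Suc k) (0::complex) $$ (k, j - ?S) = 0" if "\<not> j < ?S"
          using ij(2) that by (subst jordan_block_index) (auto simp: m_def)
        have "\<not> m < ?S" "m - ?S = k" by (simp_all add: m_def)
        then show ?thesis unfolding c2 using k 3 by simp
      qed
    qed
    finally show "border ?J ?e $$ (i, j) = ?J' $$ (i, j)" .
  qed (use Jc' border_carrier[OF Jc, of ?e] in auto)
qed

lemma jordan_matrix_append_0: "jordan_matrix (xs @ [(0, 0::complex)]) = jordan_matrix xs"
proof -
  have "jordan_block 0 (0::complex) \<in> carrier_mat 0 0" by simp
  then show ?thesis unfolding jordan_matrix_append jordan_matrix_single by (intro eq_matI) auto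
qed

text \<open>Provides, for a matrix of the smaller type, a nilpotent matrix of the larger type whose
  restriction to a hyperplane it is. The block of size \<open>a - 1\<close> is placed last and
  lengthened; for \<open>a = 1\<close> an empty block takes its place, so that both cases are the
  same computation.\<close>

lemma extension_exists:
  assumes N': "N' \<in> carrier_mat m m" and y: "young_diagram N' mu'"
    and ms': "mset mu' = (if a > 1 then add_mset (a - 1) (mset xs) else mset xs)" and a: "a \<ge> 1"
    and ms: "mset mu = add_mset a (mset xs)" and mu: "sorted_wrt (\<ge>) mu" "0 \<notin> set mu"
  shows "\<exists>c\<in>carrier_mat m 1. young_diagram (border N' c) mu"
proof -
  define k where "k = a - 1"
  let ?J = "jordan_matrix (map (\<lambda>m. (m, 0::complex)) (xs @ [k]))"
  have "similar_mat N' (jordan_matrix (map (\<lambda>m. (m, 0::complex)) mu'))" using y by (simp add: young_diagram_def jordan_nf_def)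
  moreover have "similar_mat (jordan_matrix (map (\<lambda>m. (m, 0::complex)) mu')) ?J"
  proof (cases "a > 1")
    case True
    then show ?thesis using ms' by (intro similar_jordan_matrix_mset) (simp add: k_def)
  next
    case False
    then have "?J = jordan_matrix (map (\<lambda>m. (m, 0)) xs)" using jordan_matrix_append_0 by (simp add: k_def)
    then show ?thesis using False ms' similar_jordan_matrix_mset[of "map (\<lambda>m. (m, 0::complex)) mu'" "map (\<lambda>m. (m, 0)) xs"] by simp
  qed
  ultimately have sim: "similar_mat N' ?J" by (rule similar_mat_trans)
  from similar_matE'[OF this N'] obtain P where P: "P \<in> carrier_mat m m" "det P \<noteq> 0" "?J \<in> carrier_mat m m" "N' * P = P * ?J" by blast
  have m: "m = sum_list xs + k" using carrier_matD(1)[OF P(3)] unfolding jordan_matrix_dim by (simp add: o_def)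
  define e where "e = mat m 1 (\<lambda>(i, j). if 0 < k \<and> Suc i = m then 1 else (0::complex))"
  have e: "e \<in> carrier_mat m 1" by (simp add: e_def)
  have B: "border ?J e = jordan_matrix (map (\<lambda>m. (m, 0)) (xs @ [a]))"
    using jordan_matrix_extend[of xs k] a unfolding e_def m k_def by simp
  let ?c = "P * e"
  have c: "?c \<in> carrier_mat m 1" using P(1) e by simp
  have "border N' ?c * diag_one m P = border (P * ?J) (P * e)" unfolding border_diag_one(1)[OF N' c P(1)] P(4) ..
  also have "\<dots> = diag_one m P * border ?J e" using border_diag_one(2)[OF P(3) e P(1)] by simp
  finally have eq: "border N' ?c * diag_one m P = diag_one m P * border ?J e" .
  have "similar_mat (border N' ?c) (border ?J e)"
    by (rule similar_matI'[OF border_carrier[OF N'] border_carrier[OF P(3)] diag_one_carrier[OF P(1)] _ eq])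
      (use det_diag_one[OF P(1)] P(2) in simp)
  then have "similar_mat (border N' ?c) (jordan_matrix (map (\<lambda>m. (m, 0)) (xs @ [a])))" unfolding B .
  from young_diagram_of_jordan[OF this _ mu] ms have "young_diagram (border N' ?c) mu" by simp
  with c show ?thesis by blast
qed

section \<open>Conjugation of powers and elements of a centralizer\<close>

lemma conj_pow:
  fixes A B P :: "complex mat"
  assumes "A \<in> carrier_mat n n" "B \<in> carrier_mat n n" "P \<in> carrier_mat n n" "A * P = P * B"
  shows "A ^\<^sub>m k * P = P * B ^\<^sub>m k"
proof (induction k)
  case 0
  then show ?case using assms by simp
next
  case (Suc k)
  have Ak: "A ^\<^sub>m k \<in> carrier_mat n n" and Bk: "B ^\<^sub>m k \<in> carrier_mat n n" using assms by auto
  have "A ^\<^sub>m Suc k * P = A ^\<^sub>m k * (A * P)" using assoc_mult_mat[OF Ak assms(1,3)] by simp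
  also have "\<dots> = (A ^\<^sub>m k * P) * B" unfolding assms(4) by (rule assoc_mult_mat[OF Ak assms(3,2), symmetric])
  also have "\<dots> = P * B ^\<^sub>m Suc k" unfolding Suc using assoc_mult_mat[OF assms(3) Bk assms(2)] by simp
  finally show ?case .
qed

lemma add_right_commute_mat:
  "A \<in> carrier_mat n n \<Longrightarrow> B \<in> carrier_mat n n \<Longrightarrow> C \<in> carrier_mat n n \<Longrightarrow> A + B + C = A + C + B" for A :: "complex mat"
  by (intro eq_matI) auto

text \<open>The sum of \<open>M ^\<^sub>m i * W * M ^\<^sub>m (k - 1 - i)\<close> over
  \<open>i < k\<close>.\<close>

fun commuting_sum :: "nat \<Rightarrow> complex mat \<Rightarrow> complex mat \<Rightarrow> nat \<Rightarrow> complex mat" where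
  "commuting_sum n M W 0 = 0\<^sub>m n n"
| "commuting_sum n M W (Suc k) = commuting_sum n M W k * M + M ^\<^sub>m k * W"

lemma commuting_sum_carrier: "M \<in> carrier_mat n n \<Longrightarrow> W \<in> carrier_mat n n \<Longrightarrow> commuting_sum n M W k \<in> carrier_mat n n"
  by (induction k) auto

text \<open>Telescoping: the commutator of \<open>M\<close> with the sum is
  \<open>M ^\<^sub>m k * W - W * M ^\<^sub>m k\<close>. If both products vanish, the sum lies in the
  centralizer of \<open>M\<close>.\<close>

lemma commuting_sum_commutes:
  assumes M: "M \<in> carrier_mat n n" and W: "W \<in> carrier_mat n n"
  shows "M * commuting_sum n M W k + W * M ^\<^sub>m k = commuting_sum n M W k * M + M ^\<^sub>m k * W"
proof (induction k)
  case 0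
  then show ?case using M W left_add_zero_mat[OF W] by simp
next
  case (Suc k)
  let ?N = "commuting_sum n M W k"
  note N = commuting_sum_carrier[OF M W, of k]
  have Mk: "M ^\<^sub>m k \<in> carrier_mat n n" using M by auto
  have c: "X * Y \<in> carrier_mat n n" if "X \<in> carrier_mat n n" "Y \<in> carrier_mat n n" for X Y :: "complex mat" using that by simp
  note NM = c[OF N M] and MkW = c[OF Mk W]
  have "M * (?N * M + M ^\<^sub>m k * W) = M * (?N * M) + M * (M ^\<^sub>m k * W)" by (rule mult_add_distrib_mat[OF M NM MkW])
  also have "M * (?N * M) = (M * ?N) * M" by (rule assoc_mult_mat[OF M N M, symmetric])
  also have "M * (M ^\<^sub>m k * W) = M ^\<^sub>m Suc k * W"
    using assoc_mult_mat[OF M Mk W] conj_pow[OF M M M refl, of k] by simp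
  finally have 1: "M * commuting_sum n M W (Suc k) = (M * ?N) * M + M ^\<^sub>m Suc k * W" by simp
  have "W * M ^\<^sub>m Suc k = (W * M ^\<^sub>m k) * M" using assoc_mult_mat[OF W Mk M] by simp
  then have "M * commuting_sum n M W (Suc k) + W * M ^\<^sub>m Suc k = ((M * ?N) * M + (W * M ^\<^sub>m k) * M) + M ^\<^sub>m Suc k * W"
    unfolding 1 by (simp only: add_right_commute_mat[OF c[OF c[OF M N] M] c[OF pow_carrier_mat[OF M] W] c[OF c[OF W Mk] M]])
  also have "(M * ?N) * M + (W * M ^\<^sub>m k) * M = (M * ?N + W * M ^\<^sub>m k) * M"
    by (rule add_mult_distrib_mat[OF c[OF M N] c[OF W Mk] M, symmetric])
  also have "\<dots> = commuting_sum n M W (Suc k) * M" unfolding Suc by simp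
  finally show ?case .
qed

text \<open>All summands with a positive power of \<open>M\<close> on the left have zero last
  row.\<close>

lemma commuting_sum_last_row:
  assumes M: "M \<in> carrier_mat (Suc m) (Suc m)" and W: "W \<in> carrier_mat (Suc m) (Suc m)"
    and z: "\<And>j. j < Suc m \<Longrightarrow> M $$ (m, j) = 0" and j: "j < Suc m"
  shows "commuting_sum (Suc m) M W (Suc k) $$ (m, j) = (W * M ^\<^sub>m k) $$ (m, j)"
  using j
proof (induction k arbitrary: j)
  case 0
  then show ?case using M W left_mult_zero_mat[OF M] left_add_zero_mat[OF W] right_mult_one_mat[OF W] left_mult_one_mat[OF W] by simp
next
  case (Suc k)
  let ?N = "commuting_sum (Suc m) M W (Suc k)"
  note N = commuting_sum_carrier[OF M W, of "Suc k"]
  have Mk: "M ^\<^sub>m k \<in> carrier_mat (Suc m) (Suc m)" using M by auto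
  have MS: "M ^\<^sub>m Suc k \<in> carrier_mat (Suc m) (Suc m)" using M by auto
  have WMk: "W * M ^\<^sub>m k \<in> carrier_mat (Suc m) (Suc m)" by (rule mult_carrier_mat[OF W Mk])
  have zp: "(M ^\<^sub>m Suc k) $$ (m, l) = 0" if "l < Suc m" for l
  proof -
    have "M ^\<^sub>m Suc k = M * M ^\<^sub>m k" using conj_pow[OF M M M refl, of k] by simp
    then show ?thesis using z that by (simp only: index_mult_mat'[OF M Mk lessI that]) simp
  qed
  have "(M ^\<^sub>m Suc k * W) $$ (m, j) = 0" using zp by (simp only: index_mult_mat'[OF MS W lessI Suc.prems]) simp
  moreover have "(?N * M) $$ (m, j) = (W * M ^\<^sub>m k * M) $$ (m, j)"
    unfolding index_mult_mat'[OF N M lessI Suc.prems] index_mult_mat'[OF WMk M lessI Suc.prems]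
    by (rule sum.cong[OF refl]) (simp only: Suc.IH atLeastLessThan_iff)
  moreover have "W * M ^\<^sub>m k * M = W * M ^\<^sub>m Suc k" using assoc_mult_mat[OF W Mk M] by simp
  moreover have "commuting_sum (Suc m) M W (Suc (Suc k)) $$ (m, j) = (?N * M) $$ (m, j) + (M ^\<^sub>m Suc k * W) $$ (m, j)"
    unfolding commuting_sum.simps(2)[of _ _ _ "Suc k"]
    using Suc.prems carrier_matD[OF mult_carrier_mat[OF MS W]] by (intro index_add_mat) simp_all
  ultimately show ?case by simp
qed

subsection \<open>Charts and hyperplanes\<close>

text \<open>The first \<open>m\<close> columns span the graph of the linear form \<open>y\<close>
  over the standard hyperplane, so this matrix carries the standard hyperplane to the one given by
  \<open>y\<close>.\<close>

definition shear :: "nat \<Rightarrow> (nat \<Rightarrow> complex) \<Rightarrow> complex mat" where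
  "shear m y = mat (Suc m) (Suc m) (\<lambda>(i, j). if i = j then 1 else if i = m then y j else 0)"

lemma shear_carrier[simp]: "shear m y \<in> carrier_mat (Suc m) (Suc m)"
  by (simp add: shear_def)

lemma shear_index: "i < Suc m \<Longrightarrow> j < Suc m \<Longrightarrow> shear m y $$ (i, j) = (if i = j then 1 else if i = m then y j else 0)"
  by (simp add: shear_def)

lemma shear_cong: "(\<And>j. j < m \<Longrightarrow> y j = z j) \<Longrightarrow> shear m y = shear m z"
  by (rule eq_matI) (auto simp: shear_def)

lemma shear_mult_index:
  assumes A: "A \<in> carrier_mat (Suc m) k" and ij: "i < Suc m" "j < k"
  shows "(shear m y * A) $$ (i, j) = (if i = m then (\<Sum>l<m. y l * A $$ (l, j)) + A $$ (m, j) else A $$ (i, j))"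
proof -
  have "(shear m y * A) $$ (i, j) = (\<Sum>l\<in>{0..<Suc m}. shear m y $$ (i, l) * A $$ (l, j))"
    by (rule index_mult_mat'[OF shear_carrier A ij])
  also have "\<dots> = (\<Sum>l<m. shear m y $$ (i, l) * A $$ (l, j)) + shear m y $$ (i, m) * A $$ (m, j)"
    by (simp add: atLeast0LessThan)
  also have "\<dots> = (if i = m then (\<Sum>l<m. y l * A $$ (l, j)) + A $$ (m, j) else A $$ (i, j))"
  proof (cases "i = m")
    case True
    have "(\<Sum>l<m. shear m y $$ (i, l) * A $$ (l, j)) = (\<Sum>l<m. y l * A $$ (l, j))"
      using True by (intro sum.cong) (auto simp: shear_index)
    then show ?thesis using True by (simp add: shear_index)
  next
    case False
    then have i: "i < m" using ij by simp
    have "(\<Sum>l<m. shear m y $$ (i, l) * A $$ (l, j)) = (\<Sum>l<m. if l = i then A $$ (i, j) else 0)"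
      using False ij by (intro sum.cong) (auto simp: shear_index)
    also have "\<dots> = A $$ (i, j)" using i by simp
    finally show ?thesis using False ij by (simp add: shear_index)
  qed
  finally show ?thesis .
qed

lemma mult_shear_index:
  assumes A: "A \<in> carrier_mat k (Suc m)" and ij: "i < k" "j < Suc m"
  shows "(A * shear m y) $$ (i, j) = (if j = m then A $$ (i, m) else A $$ (i, j) + A $$ (i, m) * y j)"
proof -
  have "(A * shear m y) $$ (i, j) = (\<Sum>l\<in>{0..<Suc m}. A $$ (i, l) * shear m y $$ (l, j))"
    by (rule index_mult_mat'[OF A shear_carrier ij])
  also have "\<dots> = (\<Sum>l<m. A $$ (i, l) * shear m y $$ (l, j)) + A $$ (i, m) * shear m y $$ (m, j)"
    by (simp add: atLeast0LessThan)
  also have "(\<Sum>l<m. A $$ (i, l) * shear m y $$ (l, j)) = (\<Sum>l<m. if l = j then A $$ (i, j) else 0)"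
    using ij by (intro sum.cong) (auto simp: shear_index)
  also have "\<dots> = (if j < m then A $$ (i, j) else 0)" by simp
  finally show ?thesis using ij by (auto simp: shear_index)
qed

lemma shear_mult_shear: "shear m y * shear m z = shear m (\<lambda>j. y j + z j)"
proof (rule eq_matI)
  fix i j assume "i < dim_row (shear m (\<lambda>j. y j + z j))" "j < dim_col (shear m (\<lambda>j. y j + z j))"
  then have ij: "i < Suc m" "j < Suc m" by (auto simp: shear_def)
  show "(shear m y * shear m z) $$ (i, j) = shear m (\<lambda>j. y j + z j) $$ (i, j)"
    unfolding mult_shear_index[OF shear_carrier ij] using ij by (auto simp: shear_index)
qed (auto simp: shear_def)

lemma shear_0: "(\<And>j. j < m \<Longrightarrow> y j = 0) \<Longrightarrow> shear m y = 1\<^sub>m (Suc m)"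
  by (rule eq_matI) (auto simp: shear_def)

lemma shear_inverse: "shear m (\<lambda>j. - y j) * shear m y = 1\<^sub>m (Suc m)" "shear m y * shear m (\<lambda>j. - y j) = 1\<^sub>m (Suc m)"
  unfolding shear_mult_shear by (rule shear_0, simp)+

lemma det_of_inverse:
  fixes A :: "complex mat"
  assumes "A \<in> carrier_mat n n" "B \<in> carrier_mat n n" "A * B = 1\<^sub>m n"
  shows "det A \<noteq> 0"
  using det_mult[OF assms(1,2)] assms(3) by auto

lemma det_shear: "det (shear m y) \<noteq> 0"
  by (rule det_of_inverse[OF _ _ shear_inverse(2)]) auto

text \<open>The determinant is 1, so the adjugate is the inverse and its entries are polynomials in
  \<open>x\<close>.\<close>

definition unitri_inv :: "nat \<Rightarrow> (nat \<times> nat \<Rightarrow> complex) \<Rightarrow> complex mat" where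
  "unitri_inv m x = adj_mat (lower_unitriangular m x)"

lemma unitri_inv:
  "unitri_inv m x \<in> carrier_mat m m" "lower_unitriangular m x * unitri_inv m x = 1\<^sub>m m"
  "unitri_inv m x * lower_unitriangular m x = 1\<^sub>m m"
proof -
  have "1 \<cdot>\<^sub>m A = A" for A :: "complex mat" by (rule eq_matI) auto
  then show "unitri_inv m x \<in> carrier_mat m m" "lower_unitriangular m x * unitri_inv m x = 1\<^sub>m m"
    "unitri_inv m x * lower_unitriangular m x = 1\<^sub>m m"
    unfolding unitri_inv_def using adj_mat[OF lower_unitriangular_carrier[of m x]] by simp_all
qed

text \<open>The hyperplane of the flag with chart coordinates \<open>x\<close> is the graph of the linear form
  \<open>hyperplane_coord m x\<close> over the span of the first \<open>m\<close> basis vectors.\<close>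

definition hyperplane_coord :: "nat \<Rightarrow> (nat \<times> nat \<Rightarrow> complex) \<Rightarrow> nat \<Rightarrow> complex" where
  "hyperplane_coord m x j = (\<Sum>l<m. x (m, l) * unitri_inv m x $$ (l, j))"

lemma shear_diag_one_index:
  assumes X: "X \<in> carrier_mat m m" and ij: "i < Suc m" "j < Suc m"
  shows "(shear m y * diag_one m X) $$ (i, j) =
    (if i < m then if j < m then X $$ (i, j) else 0 else if j < m then \<Sum>l<m. y l * X $$ (l, j) else 1)"
proof -
  have "(\<Sum>l<m. y l * diag_one m X $$ (l, j)) = (if j < m then \<Sum>l<m. y l * X $$ (l, j) else 0)"
    using ij by (auto simp: diag_one_index[OF X] intro!: sum.cong sum.neutral)
  then show ?thesis
    unfolding shear_mult_index[OF diag_one_carrier[OF X] ij] using ij by (auto simp: diag_one_index[OF X])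
qed

lemma row_times_inverse:
  assumes A: "A \<in> carrier_mat m m" and B: "B \<in> carrier_mat m m" and AB: "A * B = 1\<^sub>m m" and j: "j < m"
  shows "(\<Sum>l<m. (\<Sum>p<m. z p * A $$ (p, l)) * B $$ (l, j)) = (z j :: complex)"
proof -
  have "(\<Sum>l<m. (\<Sum>p<m. z p * A $$ (p, l)) * B $$ (l, j)) = (\<Sum>p<m. \<Sum>l<m. z p * (A $$ (p, l) * B $$ (l, j)))"
    unfolding sum_distrib_right by (subst sum.swap) (simp add: mult.assoc)
  also have "\<dots> = (\<Sum>p<m. z p * (A * B) $$ (p, j))"
    using j by (intro sum.cong refl) (simp add: index_mult_mat'[OF A B] atLeast0LessThan sum_distrib_left del: index_mult_mat)
  also have "\<dots> = (\<Sum>p<m. if p = j then z p else 0)" unfolding AB using j by (intro sum.cong) auto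
  also have "\<dots> = z j" using j by simp
  finally show ?thesis .
qed

text \<open>Splits the chart coordinates of a flag: the first factor depends on the hyperplane only,
  the second describes the flag inside it, transported to the standard hyperplane.\<close>

lemma unitriangular_decomposition:
  "lower_unitriangular (Suc m) x = shear m (hyperplane_coord m x) * diag_one m (lower_unitriangular m x)"
proof (rule eq_matI)
  fix i j assume "i < dim_row (shear m (hyperplane_coord m x) * diag_one m (lower_unitriangular m x))"
    "j < dim_col (shear m (hyperplane_coord m x) * diag_one m (lower_unitriangular m x))"
  then have ij: "i < Suc m" "j < Suc m" using diag_one_carrier[OF lower_unitriangular_carrier[of m x]] by (auto simp: shear_def)
  have "(\<Sum>l<m. hyperplane_coord m x l * lower_unitriangular m x $$ (l, j)) = x (m, j)" if "j < m"
    unfolding hyperplane_coord_def by (rule row_times_inverse[OF unitri_inv(1) lower_unitriangular_carrier unitri_inv(3) that])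
  then show "lower_unitriangular (Suc m) x $$ (i, j) = (shear m (hyperplane_coord m x) * diag_one m (lower_unitriangular m x)) $$ (i, j)"
    unfolding shear_diag_one_index[OF lower_unitriangular_carrier ij] using ij by (auto simp: less_Suc_eq)
qed (use diag_one_carrier[OF lower_unitriangular_carrier[of m x]] in \<open>auto simp: shear_def\<close>)

lemma hyperplane_coord_compose:
  assumes x: "\<And>i j. j < i \<Longrightarrow> i < m \<Longrightarrow> x (i, j) = x' (i, j)"
    and z: "\<And>j. j < m \<Longrightarrow> x (m, j) = (\<Sum>l<m. y l * lower_unitriangular m x' $$ (l, j))" and j: "j < m"
  shows "hyperplane_coord m x j = y j"
proof -
  have U: "lower_unitriangular m x = lower_unitriangular m x'"
    by (rule eq_matI) (auto simp: x)
  show ?thesis unfolding hyperplane_coord_def unitri_inv_def U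
    using row_times_inverse[OF lower_unitriangular_carrier unitri_inv(1) unitri_inv(2) j, of y x'] z
    by (simp add: unitri_inv_def)
qed

lemma lead_mult_right:
  fixes A B :: "complex mat"
  assumes A: "A \<in> carrier_mat (Suc m) (Suc m)" and B: "B \<in> carrier_mat (Suc m) (Suc m)"
    and z: "\<And>i j. i < m \<Longrightarrow> j < m \<Longrightarrow> A $$ (i, m) * B $$ (m, j) = 0"
  shows "lead m (A * B) = lead m A * lead m B"
proof (rule eq_matI)
  fix i j assume "i < dim_row (lead m A * lead m B)" "j < dim_col (lead m A * lead m B)"
  then have ij: "i < m" "j < m" by auto
  have "(A * B) $$ (i, j) = (\<Sum>l\<in>{0..<Suc m}. A $$ (i, l) * B $$ (l, j))"
    using ij by (intro index_mult_mat'[OF A B]) auto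
  also have "\<dots> = (\<Sum>l\<in>{0..<m}. lead m A $$ (i, l) * lead m B $$ (l, j))" using z ij by simp
  also have "\<dots> = (lead m A * lead m B) $$ (i, j)" using ij by (subst index_mult_mat'[of _ m m _ m]) simp_all
  finally show "lead m (A * B) $$ (i, j) = (lead m A * lead m B) $$ (i, j)" using ij by simp
qed simp_all

lemma lead_diag_one: "X \<in> carrier_mat m m \<Longrightarrow> lead m (diag_one m X) = X"
  by (rule eq_matI) (auto simp: diag_one_index)

lemma lead_border: "X \<in> carrier_mat m m \<Longrightarrow> c \<in> carrier_mat m 1 \<Longrightarrow> lead m (border X c) = X"
  by (rule eq_matI) (auto simp: border_index)

definition last_col :: "nat \<Rightarrow> complex mat \<Rightarrow> complex mat" where
  "last_col m M = mat m 1 (\<lambda>(i, j). M $$ (i, m))"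

lemma last_col_carrier[simp]: "last_col m M \<in> carrier_mat m 1"
  by (simp add: last_col_def)

lemma border_lead:
  assumes M: "M \<in> carrier_mat (Suc m) (Suc m)" and z: "\<And>j. j < Suc m \<Longrightarrow> M $$ (m, j) = 0"
  shows "M = border (lead m M) (last_col m M)"
proof (rule eq_matI)
  note B = border_carrier[OF lead_carrier, of m M "last_col m M"]
  fix i j assume "i < dim_row (border (lead m M) (last_col m M))" "j < dim_col (border (lead m M) (last_col m M))"
  then have ij: "i < Suc m" "j < Suc m" using B by auto
  show "M $$ (i, j) = border (lead m M) (last_col m M) $$ (i, j)"
    unfolding border_index[OF lead_carrier last_col_carrier ij] using ij z by (auto simp: last_col_def less_Suc_eq)
qed (use M border_carrier[OF lead_carrier, of m M "last_col m M"] in auto)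

text \<open>Upper triangularity leaves only the corner of the last row, and the \<open>K\<close>-th
  power of the corner is an entry of \<open>B ^\<^sub>m K\<close>. Geometrically, the image lies in
  the hyperplane of the flag.\<close>

lemma upper_nilpotent_last_row:
  fixes B :: "complex mat"
  assumes B: "B \<in> carrier_mat (Suc m) (Suc m)" and up: "upper_triangular B" and nil: "B ^\<^sub>m K = 0\<^sub>m (Suc m) (Suc m)"
    and j: "j < Suc m"
  shows "B $$ (m, j) = 0"
proof -
  have row: "B $$ (m, l) = 0" if "l < m" for l using upper_triangularD'[OF up B that] by simp
  have pw: "(B ^\<^sub>m k) $$ (m, l) = (if l = m then B $$ (m, m) ^ k else 0)" if "l < Suc m" for k l
    using that
  proof (induction k arbitrary: l)
    case 0
    then show ?case using B by auto
  next
    case (Suc k)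
    have Bk: "B ^\<^sub>m k \<in> carrier_mat (Suc m) (Suc m)" using B by auto
    have "(B ^\<^sub>m Suc k) $$ (m, l) = (\<Sum>p\<in>{0..<Suc m}. (B ^\<^sub>m k) $$ (m, p) * B $$ (p, l))"
      by (simp only: pow_mat.simps) (rule index_mult_mat'[OF Bk B lessI Suc.prems])
    also have "\<dots> = (\<Sum>p\<in>{0..<Suc m}. if p = m then B $$ (m, m) ^ k * B $$ (m, l) else 0)"
      by (rule sum.cong) (auto simp: Suc.IH)
    also have "\<dots> = B $$ (m, m) ^ k * B $$ (m, l)" by simp
    finally show ?case using row Suc.prems by (auto simp: less_Suc_eq)
  qed
  from pw[of m K] nil have "B $$ (m, m) ^ K = 0" by simp
  then have "B $$ (m, m) = 0" by simp
  then show ?thesis using row j by (auto simp: less_Suc_eq)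
qed

lemma adapted_Suc:
  assumes "B \<in> carrier_mat (Suc m) (Suc m)"
  shows "adapted (Suc m) T B \<longleftrightarrow> upper_triangular B \<and> adapted m T (lead m B) \<and>
    young_diagram B (shape (restrict_tableau (Suc m) T))"
proof -
  have "lead i (lead m B) = lead i B" if "i \<le> m" for i using that by (rule lead_lead)
  moreover have "upper_triangular B \<Longrightarrow> upper_triangular (lead m B)"
    using upper_triangular_lead[OF _ assms, of m] by simp
  ultimately show ?thesis using assms lead_self[OF assms] by (auto simp: adapted_def le_Suc_eq)
qed

lemma upper_triangular_border:
  "X \<in> carrier_mat m m \<Longrightarrow> c \<in> carrier_mat m 1 \<Longrightarrow> upper_triangular X \<Longrightarrow> upper_triangular (border X c)"
  by (rule upper_triangularI'[OF border_carrier]) (auto simp: border_index upper_triangularD')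

text \<open>This is a change to another basis of the same flag: an upper triangular matrix
  conjugates leading blocks by leading blocks.\<close>

lemma adapted_conj:
  assumes B: "adapted m T B" and b: "b \<in> carrier_mat m m" "upper_triangular b" "det b \<noteq> 0"
  shows "adapted m T (b * B * minv b)"
proof -
  note mb = minv[OF b(1,3)]
  have Bc: "B \<in> carrier_mat m m" "upper_triangular B" using B by (auto simp: adapted_def)
  let ?C = "b * B * minv b"
  have bB: "b * B \<in> carrier_mat m m" using b Bc by simp
  have C: "?C \<in> carrier_mat m m" using bB mb by simp
  have uC: "upper_triangular ?C"
    by (rule upper_triangular_mult[OF bB mb(1) upper_triangular_mult[OF b(1) Bc(1) b(2) Bc(2)] upper_triangular_minv[OF b]])
  have "?C * b = b * B * (minv b * b)" by (rule assoc_mult_mat[OF bB mb(1) b(1)])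
  then have eq: "?C * b = b * B" using mb(3) right_mult_one_mat[OF bB] by simp
  have "young_diagram (lead i ?C) (shape (restrict_tableau i T))" if i: "i \<le> m" for i
  proof -
    have "lead i ?C * lead i b = lead i b * lead i B"
      using lead_mult_upper[OF C b(1,2) i] lead_mult_upper[OF b(1) Bc i] eq by simp
    from similar_matI'[OF lead_carrier lead_carrier lead_carrier det_lead_upper[OF b i] this]
    show ?thesis using B i young_diagram_similar unfolding adapted_def by blast
  qed
  with C uC show ?thesis by (simp add: adapted_def)
qed

subsection \<open>The local product structure over an orbit of hyperplanes\<close>

lemma nilpotent_of_conj:
  fixes N B P :: "complex mat"
  assumes N: "N \<in> carrier_mat n n" "N ^\<^sub>m K = 0\<^sub>m n n" and eq: "N * P = P * B"
    and P: "P \<in> carrier_mat n n" "det P \<noteq> 0" and B: "B \<in> carrier_mat n n"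
  shows "B ^\<^sub>m K = 0\<^sub>m n n"
proof -
  have BK: "B ^\<^sub>m K \<in> carrier_mat n n" using B by auto
  have "N ^\<^sub>m K * P = P * B ^\<^sub>m K" by (rule conj_pow[OF N(1) B P(1) eq])
  then have "P * B ^\<^sub>m K = 0\<^sub>m n n" unfolding N(2) using left_mult_zero_mat[OF P(1)] by simp
  then have "minv P * (P * B ^\<^sub>m K) = 0\<^sub>m n n" using right_mult_zero_mat[OF minv(1)[OF P]] by simp
  then show ?thesis unfolding mult_minv_cancel(2)[OF P BK] .
qed

text \<open>By \<open>below\<close> the kernel of the power \<open>a - 1\<close> has the same
  dimension on the hyperplane as on the whole space, so it does not leave the hyperplane. For
  \<open>a = 1\<close> the power is the identity and the kernel is zero.\<close>

lemma kernel_in_hyperplane: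
  assumes X: "X \<in> carrier_mat m m" and d: "d \<in> carrier_mat m 1"
    and yX: "young_diagram X (shape (restrict_tableau m T))"
    and yB: "young_diagram (border X d) (shape (restrict_tableau (Suc m) T))"
    and below: "(\<Sum>p\<leftarrow>shape (restrict_tableau m T). min (a - 1) p) = (\<Sum>p\<leftarrow>shape (restrict_tableau (Suc m) T). min (a - 1) p)"
    and w: "w \<in> carrier_mat (Suc m) 1" "border X d ^\<^sub>m (a - 1) * w = 0\<^sub>m (Suc m) 1"
  shows "w $$ (m, 0) = 0"
proof (cases "a - 1")
  case 0
  then have "w = 0\<^sub>m (Suc m) 1" using w left_mult_one_mat[OF w(1)] carrier_matD(1)[OF border_carrier[OF X, of d]] by simp
  then show ?thesis by simp
next
  case (Suc j)
  have "kernel_dim (border X d ^\<^sub>m Suc j) = kernel_dim (X ^\<^sub>m Suc j)"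
    using young_diagram_kernel_dim[OF yX X, of "Suc j"] young_diagram_kernel_dim[OF yB border_carrier[OF X], of "Suc j"] below
    by (simp only: Suc)
  then have "kernel_dim (border (X ^\<^sub>m Suc j) (X ^\<^sub>m j * d)) = kernel_dim (X ^\<^sub>m Suc j)" unfolding border_pow[OF X d] .
  moreover have "X ^\<^sub>m Suc j \<in> carrier_mat m m" "X ^\<^sub>m j * d \<in> carrier_mat m 1"
    using X d by (auto intro!: mult_carrier_mat[of _ m m])
  ultimately have "border (X ^\<^sub>m Suc j) (X ^\<^sub>m j * d) * w = 0\<^sub>m (Suc m) 1 \<longrightarrow> w $$ (m, 0) = 0"
    using kernel_dim_border_eq w(1) by blast
  then show ?thesis using w(2) unfolding Suc border_pow[OF X d] by blast
qed

text \<open>\<open>C\<close> is left arbitrary because two conjugates of \<open>N\<close> are used: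
  one relative to a base hyperplane and, later, one without any base. Once the shear is removed, the
  flag consists of the truncated flag and the whole space, so block statements about
  \<open>B\<close> pass to \<open>C\<close>.\<close>

lemma adapted_leading_block:
  fixes C B :: "complex mat"
  assumes B: "adapted (Suc m) T B" and nil: "B ^\<^sub>m K = 0\<^sub>m (Suc m) (Suc m)"
    and C: "C \<in> carrier_mat (Suc m) (Suc m)"
    and CD: "C * diag_one m (lower_unitriangular m x) = diag_one m (lower_unitriangular m x) * B"
  shows "j < Suc m \<Longrightarrow> C $$ (m, j) = 0"
    "lead m C * lower_unitriangular m x = lower_unitriangular m x * lead m B"
    "young_diagram (lead m C) (shape (restrict_tableau m T))"
proof -
  let ?U = "lower_unitriangular m x"
  let ?C = C and ?D = "diag_one m ?U"
  note D = diag_one_carrier[OF lower_unitriangular_carrier[of m x]]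
  have dD: "det ?D \<noteq> 0" using det_diag_one[OF lower_unitriangular_carrier[of m x]] by simp
  have Bc: "B \<in> carrier_mat (Suc m) (Suc m)" "upper_triangular B" using B by (auto simp: adapted_def)
  have Bz: "B $$ (m, j) = 0" if "j < Suc m" for j
    by (rule upper_nilpotent_last_row[OF Bc nil that])
  have DBz: "(?D * B) $$ (m, j) = 0" if j: "j < Suc m" for j
  proof -
    have "(?D * B) $$ (m, j) = (\<Sum>l\<in>{0..<Suc m}. ?D $$ (m, l) * B $$ (l, j))" by (rule index_mult_mat'[OF D Bc(1) lessI j])
    also have "\<dots> = 0"
      by (rule sum.neutral) (auto simp: diag_one_index[OF lower_unitriangular_carrier] Bz[OF j])
    finally show ?thesis .
  qed
  show Cz: "?C $$ (m, j) = 0" if j: "j < Suc m" for j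
  proof -
    note mD = minv[OF D dD]
    have "?C = (?C * ?D) * minv ?D" using assoc_mult_mat[OF C D mD(1)] mD(2) right_mult_one_mat[OF C] by simp
    then have "?C $$ (m, j) = (\<Sum>l\<in>{0..<Suc m}. (?D * B) $$ (m, l) * minv ?D $$ (l, j))"
      unfolding CD using index_mult_mat'[OF mult_carrier_mat[OF D Bc(1)] mD(1) lessI j] by metis
    also have "\<dots> = 0" by (rule sum.neutral) (simp add: DBz del: index_mult_mat)
    finally show ?thesis .
  qed
  have "lead m (?C * ?D) = lead m ?C * lead m ?D"
    by (rule lead_mult_right[OF C D]) (simp add: diag_one_index[OF lower_unitriangular_carrier])
  moreover have "lead m (?D * B) = lead m ?D * lead m B"
    by (rule lead_mult_right[OF D Bc(1)]) (simp add: Bz)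
  ultimately show eq': "lead m ?C * ?U = ?U * lead m B"
    using CD lead_diag_one[OF lower_unitriangular_carrier[of m x]] by simp
  show "young_diagram (lead m ?C) (shape (restrict_tableau m T))"
  proof -
    have "young_diagram (lead m B) (shape (restrict_tableau m T))" using B by (auto simp: adapted_def)
    moreover have "similar_mat (lead m ?C) (lead m B)"
      by (rule similar_matI'[OF lead_carrier lead_carrier lower_unitriangular_carrier _ eq']) simp
    ultimately show ?thesis using young_diagram_similar by blast
  qed
qed

text \<open>The base hyperplane is that of \<open>y0\<close>; in coordinates adapted to it
  \<open>N\<close> is bordered, and its restriction \<open>N'\<close> has the type of the smaller
  tableau. The column \<open>a\<close> of the removed box enters through \<open>below\<close> and
  \<open>at\<close>, that is, through the kernel dimensions of the powers \<open>a - 1\<close> and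
  \<open>a\<close>.\<close>

locale hyperplane_chart =
  fixes m :: nat and N N' c :: "complex mat" and y0 :: "nat \<Rightarrow> complex" and T :: "nat list list" and a K :: nat
  assumes N: "N \<in> carrier_mat (Suc m) (Suc m)" and nil: "N ^\<^sub>m K = 0\<^sub>m (Suc m) (Suc m)"
    and N': "N' \<in> carrier_mat m m" and c: "c \<in> carrier_mat m 1"
    and M0: "shear m (\<lambda>j. - y0 j) * N * shear m y0 = border N' c"
    and yN: "young_diagram N (shape (restrict_tableau (Suc m) T))"
    and yN': "young_diagram N' (shape (restrict_tableau m T))"
    and a: "a \<ge> 1"
    and below: "(\<Sum>p\<leftarrow>shape (restrict_tableau m T). min (a - 1) p) = (\<Sum>p\<leftarrow>shape (restrict_tableau (Suc m) T). min (a - 1) p)"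
    and at: "(\<Sum>p\<leftarrow>shape (restrict_tableau m T). min a p) \<noteq> (\<Sum>p\<leftarrow>shape (restrict_tableau (Suc m) T). min a p)"
begin

definition M :: "complex mat" where "M = border N' c"

text \<open>The matrix of \<open>N\<close> in a basis adapted to the hyperplane of
  \<open>y0 + v\<close>, as \<open>N_shear\<close> shows.\<close>

definition conj_by :: "(nat \<Rightarrow> complex) \<Rightarrow> complex mat" where
  "conj_by v = shear m (\<lambda>j. - v j) * M * shear m v"

lemma M_carrier: "M \<in> carrier_mat (Suc m) (Suc m)"
  unfolding M_def by (rule border_carrier[OF N'])

lemma conj_by_carrier: "conj_by v \<in> carrier_mat (Suc m) (Suc m)"
  unfolding conj_by_def using M_carrier by (intro mult_carrier_mat[of _ _ "Suc m"]) auto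

lemma shear_conj_by: "shear m v * conj_by v = M * shear m v"
proof -
  have S: "shear m (\<lambda>j. - v j) * M \<in> carrier_mat (Suc m) (Suc m)" using M_carrier by (intro mult_carrier_mat[of _ _ "Suc m"]) auto
  have "shear m v * conj_by v = shear m v * (shear m (\<lambda>j. - v j) * M) * shear m v"
    unfolding conj_by_def by (rule assoc_mult_mat[OF shear_carrier S shear_carrier, symmetric])
  also have "shear m v * (shear m (\<lambda>j. - v j) * M) = (shear m v * shear m (\<lambda>j. - v j)) * M"
    by (rule assoc_mult_mat[OF shear_carrier shear_carrier M_carrier, symmetric])
  finally show ?thesis unfolding shear_inverse(2) left_mult_one_mat[OF M_carrier] .
qed

lemma conj_by_shear: "conj_by v * shear m (\<lambda>j. - v j) = shear m (\<lambda>j. - v j) * M"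
proof -
  have S: "shear m (\<lambda>j. - v j) * M \<in> carrier_mat (Suc m) (Suc m)" using M_carrier by (intro mult_carrier_mat[of _ _ "Suc m"]) auto
  have "conj_by v * shear m (\<lambda>j. - v j) = shear m (\<lambda>j. - v j) * M * (shear m v * shear m (\<lambda>j. - v j))"
    unfolding conj_by_def by (rule assoc_mult_mat[OF S shear_carrier shear_carrier])
  then show ?thesis unfolding shear_inverse(2) right_mult_one_mat[OF S] .
qed

lemma N_shear: "N * shear m (\<lambda>j. y0 j + v j) = shear m (\<lambda>j. y0 j + v j) * conj_by v"
proof -
  have Sc: "shear m (\<lambda>j. - y0 j) * N \<in> carrier_mat (Suc m) (Suc m)" using N by (intro mult_carrier_mat[of _ _ "Suc m"]) auto
  have "shear m y0 * M = shear m y0 * (shear m (\<lambda>j. - y0 j) * N) * shear m y0"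
    unfolding M_def M0[symmetric] by (rule assoc_mult_mat[OF shear_carrier Sc shear_carrier, symmetric])
  also have "shear m y0 * (shear m (\<lambda>j. - y0 j) * N) = (shear m y0 * shear m (\<lambda>j. - y0 j)) * N"
    by (rule assoc_mult_mat[OF shear_carrier shear_carrier N, symmetric])
  finally have 1: "shear m y0 * M = N * shear m y0" unfolding shear_inverse(2) left_mult_one_mat[OF N] .
  have "N * shear m (\<lambda>j. y0 j + v j) = N * (shear m y0 * shear m v)" unfolding shear_mult_shear ..
  also have "\<dots> = shear m y0 * M * shear m v" unfolding 1 by (rule assoc_mult_mat[OF N shear_carrier shear_carrier, symmetric])
  also have "\<dots> = shear m y0 * (shear m v * conj_by v)" unfolding shear_conj_by by (rule assoc_mult_mat[OF shear_carrier M_carrier shear_carrier])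
  also have "\<dots> = shear m y0 * shear m v * conj_by v" by (rule assoc_mult_mat[OF shear_carrier shear_carrier conj_by_carrier, symmetric])
  finally show ?thesis unfolding shear_mult_shear .
qed

lemma similar_conj_by: "similar_mat N (conj_by v)"
  by (rule similar_matI'[OF N conj_by_carrier shear_carrier det_shear N_shear])

lemma young_conj_by: "young_diagram (conj_by v) (shape (restrict_tableau (Suc m) T))"
  using young_diagram_similar[OF similar_conj_by] yN by blast

definition shift :: "(nat \<times> nat \<Rightarrow> complex) \<Rightarrow> nat \<Rightarrow> complex" where
  "shift x = (\<lambda>j. if j < m then hyperplane_coord m x j - y0 j else 0)"

lemma unitriangular_shift:
  "lower_unitriangular (Suc m) x = shear m (\<lambda>j. y0 j + shift x j) * diag_one m (lower_unitriangular m x)"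
  unfolding unitriangular_decomposition by (rule arg_cong[of _ _ "\<lambda>A. A * _"], rule shear_cong) (simp add: shift_def)

lemma chart_equation:
  assumes B: "B \<in> carrier_mat (Suc m) (Suc m)"
  shows "N * lower_unitriangular (Suc m) x = lower_unitriangular (Suc m) x * B \<longleftrightarrow>
    conj_by (shift x) * diag_one m (lower_unitriangular m x) = diag_one m (lower_unitriangular m x) * B"
proof -
  let ?S = "shear m (\<lambda>j. y0 j + shift x j)" and ?D = "diag_one m (lower_unitriangular m x)"
  note D = diag_one_carrier[OF lower_unitriangular_carrier[of m x]]
  have 1: "N * lower_unitriangular (Suc m) x = ?S * (conj_by (shift x) * ?D)"
    unfolding unitriangular_shift assoc_mult_mat[OF N shear_carrier D, symmetric] N_shear
    by (rule assoc_mult_mat[OF shear_carrier conj_by_carrier D])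
  have 2: "lower_unitriangular (Suc m) x * B = ?S * (?D * B)"
    unfolding unitriangular_shift by (rule assoc_mult_mat[OF shear_carrier D B])
  show ?thesis unfolding 1 2
    using mult_minv_cancel(2)[OF shear_carrier det_shear mult_carrier_mat[OF conj_by_carrier D]]
      mult_minv_cancel(2)[OF shear_carrier det_shear mult_carrier_mat[OF D B]] by metis
qed

text \<open>The hyperplanes containing the image of \<open>M\<close> and the kernel of \<open>M\<^sup>a\<^sup>-\<^sup>1\<close>, as translates of the base
  hyperplane. Near the latter they form one orbit of the centralizer of \<open>M\<close>.\<close>

definition L :: "(nat \<Rightarrow> complex) set" where
  "L = {v \<in> affine_space {..<m}.
     (\<forall>w\<in>carrier_mat (Suc m) 1. M ^\<^sub>m (a - 1) * w = 0\<^sub>m (Suc m) 1 \<longrightarrow> (\<Sum>j<m. v j * w $$ (j, 0)) = 0) \<and>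
     (\<forall>l<Suc m. (\<Sum>j<m. v j * M $$ (j, l)) = 0)}"

lemma young_M: "young_diagram M (shape (restrict_tableau (Suc m) T))"
proof -
  have "conj_by (\<lambda>_. 0) = M"
    unfolding conj_by_def using shear_0[of m "\<lambda>_. 0"] left_mult_one_mat[OF M_carrier] right_mult_one_mat[OF M_carrier] by simp
  then show ?thesis using young_conj_by[of "\<lambda>_. 0"] by simp
qed

lemma M_last_row: "l < Suc m \<Longrightarrow> M $$ (m, l) = 0"
  unfolding M_def by (simp add: border_index[OF N' c])

text \<open>A vector in the kernel of \<open>M ^\<^sub>m (a - 1)\<close> has last coordinate 0
  before and after the shear, because both the base hyperplane and its translate contain the kernel
  of the respective power; the difference is its pairing with \<open>v\<close>. The condition on the
  image comes in the same way from vanishing last rows.\<close>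

lemma adapted_in_L:
  assumes B: "adapted (Suc m) T B"
    and eq: "N * lower_unitriangular (Suc m) x = lower_unitriangular (Suc m) x * B"
  shows "shift x \<in> L" "lead m (conj_by (shift x)) * lower_unitriangular m x = lower_unitriangular m x * lead m B"
proof -
  let ?v = "shift x" and ?U = "lower_unitriangular m x"
  let ?C = "conj_by ?v"
  note C = conj_by_carrier[of ?v]
  have Bc: "B \<in> carrier_mat (Suc m) (Suc m)" using B by (auto simp: adapted_def)
  have CD: "?C * diag_one m ?U = diag_one m ?U * B" using chart_equation[OF Bc] eq by blast
  have "B ^\<^sub>m K = 0\<^sub>m (Suc m) (Suc m)"
    by (rule nilpotent_of_conj[OF N nil eq lower_unitriangular_carrier _ Bc]) simp
  note block = adapted_leading_block[OF B this C CD]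
  note Cz = block(1) and yl = block(3)
  show "lead m (conj_by ?v) * ?U = ?U * lead m B" by (rule block(2))
  have Cb: "?C = border (lead m ?C) (last_col m ?C)" by (rule border_lead[OF C Cz])
  show "shift x \<in> L"
    unfolding L_def
  proof (intro CollectI conjI ballI impI allI)
    show "?v \<in> affine_space {..<m}" by (simp add: affine_space_def shift_def)
    fix l assume l: "l < Suc m"
    have "(shear m (\<lambda>j. - ?v j) * M) $$ (m, l) = (?C * shear m (\<lambda>j. - ?v j)) $$ (m, l)" unfolding conj_by_shear ..
    also have "\<dots> = 0" unfolding mult_shear_index[OF C lessI l] using Cz l by simp
    finally show "(\<Sum>j<m. ?v j * M $$ (j, l)) = 0"
      unfolding shear_mult_index[OF M_carrier lessI l] using M_last_row[OF l] by (simp add: sum_negf)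
  next
    fix w assume w: "w \<in> carrier_mat (Suc m) 1" "M ^\<^sub>m (a - 1) * w = 0\<^sub>m (Suc m) 1"
    let ?E = "shear m (\<lambda>j. - ?v j)"
    have Ew: "?E * w \<in> carrier_mat (Suc m) 1" by (rule mult_carrier_mat[OF shear_carrier w(1)])
    have Mk: "M ^\<^sub>m k \<in> carrier_mat (Suc m) (Suc m)" and Ck: "?C ^\<^sub>m k \<in> carrier_mat (Suc m) (Suc m)" for k using M_carrier C by auto
    have "?C ^\<^sub>m (a - 1) * (?E * w) = (?C ^\<^sub>m (a - 1) * ?E) * w" by (rule assoc_mult_mat[OF Ck shear_carrier w(1), symmetric])
    also have "\<dots> = ?E * (M ^\<^sub>m (a - 1) * w)"
      unfolding conj_pow[OF C M_carrier shear_carrier conj_by_shear] by (rule assoc_mult_mat[OF shear_carrier Mk w(1)])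
    also have "\<dots> = 0\<^sub>m (Suc m) 1" unfolding w(2) by (rule right_mult_zero_mat[OF shear_carrier])
    finally have "border (lead m ?C) (last_col m ?C) ^\<^sub>m (a - 1) * (?E * w) = 0\<^sub>m (Suc m) 1" using Cb by simp
    from kernel_in_hyperplane[OF lead_carrier last_col_carrier yl _ below Ew this] young_conj_by[of ?v] Cb
    have "(?E * w) $$ (m, 0) = 0" by simp
    moreover have "w $$ (m, 0) = 0"
      using kernel_in_hyperplane[OF N' c yN' _ below w(1)] young_M w(2) unfolding M_def by blast
    ultimately show "(\<Sum>j<m. ?v j * w $$ (j, 0)) = 0"
      by (simp add: shear_mult_index[OF w(1)] sum_negf del: index_mult_mat)
  qed
qed

text \<open>Needed for the way back from \<open>L\<close> to flags: the translate contains the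
  image, so the matrix is again bordered.\<close>

lemma conj_by_last_row:
  assumes v: "v \<in> L" and j: "j < Suc m"
  shows "conj_by v $$ (m, j) = 0"
proof -
  have S: "shear m (\<lambda>j. - v j) * M \<in> carrier_mat (Suc m) (Suc m)" using M_carrier by (intro mult_carrier_mat[of _ _ "Suc m"]) auto
  have "(shear m (\<lambda>j. - v j) * M) $$ (m, l) = 0" if l: "l < Suc m" for l
    unfolding shear_mult_index[OF M_carrier lessI l] using v l M_last_row[OF l] by (simp add: L_def sum_negf)
  then show ?thesis unfolding conj_by_def mult_shear_index[OF S lessI j] using j by simp
qed

end

context hyperplane_chart
begin

lemma L_zero: "(\<lambda>_. 0) \<in> L"
  by (simp add: L_def affine_space_def)

lemma L_add: "v \<in> L \<Longrightarrow> w \<in> L \<Longrightarrow> (\<lambda>i. v i + w i) \<in> L"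
  by (simp add: L_def affine_space_def distrib_right sum.distrib)

lemma L_scale: "v \<in> L \<Longrightarrow> (\<lambda>i. k * v i) \<in> L"
  by (simp add: L_def affine_space_def mult.assoc sum_distrib_left[symmetric])

lemma L_sum:
  assumes "finite S" "\<And>s. s \<in> S \<Longrightarrow> b s \<in> L"
  shows "(\<lambda>i. \<Sum>s\<in>S. t s * b s i) \<in> L"
  using assms
proof (induction S rule: finite_induct)
  case empty
  then show ?case using L_zero by simp
next
  case (insert s S)
  have "(\<lambda>i. t s * b s i + (\<Sum>s\<in>S. t s * b s i)) \<in> L"
    using insert by (intro L_add L_scale) auto
  then show ?case using insert.hyps by simp
qed

text \<open>At the power \<open>a\<close> the kernel dimensions differ, so the kernel leaves the
  base hyperplane. The last coordinate is normalized because it becomes the factor in front of the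
  row \<open>\<mu>\<close> in \<open>commuting_exists\<close>.\<close>

lemma kernel_vector_exists: "\<exists>w\<in>carrier_mat (Suc m) 1. M ^\<^sub>m a * w = 0\<^sub>m (Suc m) 1 \<and> w $$ (m, 0) = 1"
proof -
  obtain k where k: "a = Suc k" using a by (cases a) auto
  have "kernel_dim (M ^\<^sub>m a) \<noteq> kernel_dim (N' ^\<^sub>m a)"
    using young_diagram_kernel_dim[OF young_M M_carrier, of a] young_diagram_kernel_dim[OF yN' N', of a] at by simp
  then have "kernel_dim (border (N' ^\<^sub>m Suc k) (N' ^\<^sub>m k * c)) \<noteq> kernel_dim (N' ^\<^sub>m Suc k)"
    unfolding k M_def border_pow[OF N' c] .
  moreover have "N' ^\<^sub>m Suc k \<in> carrier_mat m m" "N' ^\<^sub>m k * c \<in> carrier_mat m 1"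
    using N' c by (auto intro!: mult_carrier_mat[of _ m m])
  ultimately obtain w where w: "w \<in> carrier_mat (Suc m) 1" "border (N' ^\<^sub>m Suc k) (N' ^\<^sub>m k * c) * w = 0\<^sub>m (Suc m) 1" "w $$ (m, 0) \<noteq> 0"
    using kernel_dim_border_eq by blast
  have Mw: "M ^\<^sub>m a * w = 0\<^sub>m (Suc m) 1" unfolding k M_def border_pow[OF N' c] by (rule w(2))
  have Ma: "M ^\<^sub>m a \<in> carrier_mat (Suc m) (Suc m)" using M_carrier by auto
  let ?w = "(1 / w $$ (m, 0)) \<cdot>\<^sub>m w"
  have "M ^\<^sub>m a * ?w = 0\<^sub>m (Suc m) 1"
    unfolding mult_smult_distrib[OF Ma w(1)] Mw by (rule eq_matI) auto
  moreover have "?w $$ (m, 0) = 1" using w by simp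
  ultimately show ?thesis using w(1) by (intro bexI[of _ ?w]) auto
qed

text \<open>With \<open>k = a - 1\<close>, the form \<open>F\<close> given by \<open>- f\<close>
  kills the kernel of \<open>M ^\<^sub>m k\<close>, so \<open>F = \<mu> * M ^\<^sub>m k\<close>. For
  \<open>w\<close> from \<open>kernel_vector_exists\<close>, the matrix \<open>W = w * \<mu>\<close>
  satisfies \<open>M ^\<^sub>m a * W = 0\<close>, and
  \<open>W * M ^\<^sub>m a = w * F * M = 0\<close> since \<open>F\<close> kills the image. Hence
  \<open>commuting_sum\<close> commutes with \<open>M\<close>, and its last row is that of
  \<open>w * F\<close>.\<close>

lemma commuting_exists:
  assumes f: "f \<in> L"
  shows "\<exists>X\<in>carrier_mat (Suc m) (Suc m). M * X = X * M \<and> (\<forall>j<m. X $$ (m, j) = - f j) \<and> X $$ (m, m) = 0"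
proof -
  obtain k where k: "a = Suc k" using a by (cases a) auto
  define F where "F = mat 1 (Suc m) (\<lambda>(_, j). if j < m then - f j else 0)"
  have F: "F \<in> carrier_mat 1 (Suc m)" by (simp add: F_def)
  have Mk: "M ^\<^sub>m k \<in> carrier_mat (Suc m) (Suc m)" for k using M_carrier by auto
  have Fmul: "(F * X) $$ (0, l) = - (\<Sum>j<m. f j * X $$ (j, l))" if "X \<in> carrier_mat (Suc m) p" "l < p" for X l p
  proof -
    have "(F * X) $$ (0, l) = (\<Sum>j\<in>{0..<Suc m}. F $$ (0, j) * X $$ (j, l))"
      by (intro index_mult_mat'[OF F that(1)]) (use that in auto)
    also have "\<dots> = (\<Sum>j<m. - (f j * X $$ (j, l)))" by (simp add: F_def atLeast0LessThan)
    finally show ?thesis by (simp add: sum_negf)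
  qed
  have "\<exists>\<mu>\<in>carrier_mat 1 (Suc m). F = \<mu> * M ^\<^sub>m k"
  proof (rule row_factor[OF Mk F])
    fix w assume w: "w \<in> carrier_mat (Suc m) 1" "M ^\<^sub>m k * w = 0\<^sub>m (Suc m) 1"
    moreover have "a - 1 = k" using k by simp
    ultimately have "(\<Sum>j<m. f j * w $$ (j, 0)) = 0" using f unfolding L_def by simp
    then have "(F * w) $$ (0, 0) = 0" using Fmul[OF w(1)] by simp
    moreover have "F * w \<in> carrier_mat 1 1" by (rule mult_carrier_mat[OF F w(1)])
    ultimately show "F * w = 0\<^sub>m 1 1" by (intro eq_matI) auto
  qed
  then obtain \<mu> where \<mu>: "\<mu> \<in> carrier_mat 1 (Suc m)" "F = \<mu> * M ^\<^sub>m k" by blast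
  have FM: "F * M = 0\<^sub>m 1 (Suc m)"
  proof (rule eq_matI)
    fix i j assume "i < dim_row (0\<^sub>m 1 (Suc m) :: complex mat)" "j < dim_col (0\<^sub>m 1 (Suc m) :: complex mat)"
    then show "(F * M) $$ (i, j) = 0\<^sub>m 1 (Suc m) $$ (i, j)"
      using Fmul[OF M_carrier, of j] f by (simp add: L_def del: index_mult_mat)
  qed (use F M_carrier in auto)
  obtain w where w: "w \<in> carrier_mat (Suc m) 1" "M ^\<^sub>m a * w = 0\<^sub>m (Suc m) 1" "w $$ (m, 0) = 1"
    using kernel_vector_exists by blast
  define W where "W = w * \<mu>"
  have W: "W \<in> carrier_mat (Suc m) (Suc m)" unfolding W_def by (rule mult_carrier_mat[OF w(1) \<mu>(1)])
  have MW: "M ^\<^sub>m a * W = 0\<^sub>m (Suc m) (Suc m)"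
    unfolding W_def assoc_mult_mat[OF Mk w(1) \<mu>(1), symmetric] w(2) by (rule left_mult_zero_mat[OF \<mu>(1)])
  have "\<mu> * M ^\<^sub>m a = (\<mu> * M ^\<^sub>m k) * M" unfolding k using assoc_mult_mat[OF \<mu>(1) Mk M_carrier] by simp
  then have \<mu>M: "\<mu> * M ^\<^sub>m a = 0\<^sub>m 1 (Suc m)" using \<mu>(2) FM by simp
  have WM: "W * M ^\<^sub>m a = 0\<^sub>m (Suc m) (Suc m)"
    unfolding W_def assoc_mult_mat[OF w(1) \<mu>(1) Mk] \<mu>M by (rule right_mult_zero_mat[OF w(1)])
  let ?X = "commuting_sum (Suc m) M W a"
  have X: "?X \<in> carrier_mat (Suc m) (Suc m)" by (rule commuting_sum_carrier[OF M_carrier W])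
  have "M * ?X = ?X * M"
    using commuting_sum_commutes[OF M_carrier W, of a] unfolding MW WM
      right_add_zero_mat[OF mult_carrier_mat[OF M_carrier X]] right_add_zero_mat[OF mult_carrier_mat[OF X M_carrier]] .
  moreover have last: "?X $$ (m, j) = F $$ (0, j)" if j: "j < Suc m" for j
  proof -
    have "?X $$ (m, j) = (W * M ^\<^sub>m k) $$ (m, j)"
      unfolding k by (rule commuting_sum_last_row[OF M_carrier W M_last_row j])
    also have "W * M ^\<^sub>m k = w * F" unfolding W_def \<mu>(2) by (rule assoc_mult_mat[OF w(1) \<mu>(1) Mk])
    also have "(w * F) $$ (m, j) = (\<Sum>l\<in>{0..<1}. w $$ (m, l) * F $$ (l, j))" by (rule index_mult_mat'[OF w(1) F lessI j])
    finally show ?thesis using w(3) by simp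
  qed
  ultimately show ?thesis using X last by (intro bexI[of _ ?X]) (simp_all add: F_def)
qed

end

section \<open>An explicit polynomial trivialization\<close>

lemma polymat_mono: "polymat I n k G \<Longrightarrow> I \<subseteq> J \<Longrightarrow> polymat J n k G"
  unfolding polymat_def by (meson polynomials_mono)

lemma polymat_shear:
  assumes v: "\<And>j. j < m \<Longrightarrow> (\<lambda>x. v x j) \<in> polynomials I"
  shows "polymat I (Suc m) (Suc m) (\<lambda>x. shear m (v x))"
  unfolding shear_def
proof (rule polymat_mat)
  fix i j assume "i < Suc m" "j < Suc m"
  then consider "i = j" | "i \<noteq> j" "i = m" "j < m" | "i \<noteq> j" "i \<noteq> m" by linarith
  then show "(\<lambda>x. if i = j then 1 else if i = m then v x j else 0) \<in> polynomials I"
    by cases (simp_all add: polynomials.const v)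
qed

lemma chart_index_Suc: "chart_index (Suc m) = chart_index m \<union> {m} \<times> {..<m}"
  by (auto simp: chart_index_def)

lemma adj_mat_cancel:
  fixes q X :: "complex mat"
  assumes q: "q \<in> carrier_mat m m" and X: "X \<in> carrier_mat m k"
  shows "q * (adj_mat q * X) = det q \<cdot>\<^sub>m X" "adj_mat q * (q * X) = det q \<cdot>\<^sub>m X"
proof -
  note a = adj_mat[OF q]
  have "(det q \<cdot>\<^sub>m 1\<^sub>m m) * X = det q \<cdot>\<^sub>m X"
    using mult_smult_assoc_mat[OF one_carrier_mat X] left_mult_one_mat[OF X] by simp
  then show "q * (adj_mat q * X) = det q \<cdot>\<^sub>m X" "adj_mat q * (q * X) = det q \<cdot>\<^sub>m X"
    using assoc_mult_mat[OF q a(1) X] assoc_mult_mat[OF a(1) q X] a(2,3) by simp_all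
qed

lemma upper_triangular_smult_minv:
  assumes b: "b \<in> carrier_mat m m" "upper_triangular b" "det b \<noteq> 0" and d: "d \<noteq> 0"
  shows "d \<cdot>\<^sub>m minv b \<in> carrier_mat m m" "upper_triangular (d \<cdot>\<^sub>m minv b)" "det (d \<cdot>\<^sub>m minv b) \<noteq> 0"
proof -
  note mb = minv[OF b(1,3)]
  show "d \<cdot>\<^sub>m minv b \<in> carrier_mat m m" using mb by simp
  show "upper_triangular (d \<cdot>\<^sub>m minv b)"
    using upper_triangularD'[OF upper_triangular_minv[OF b] mb(1)] mb(1)
    by (intro upper_triangularI'[of _ m]) auto
  show "det (d \<cdot>\<^sub>m minv b) \<noteq> 0" using det_minv[OF b(1,3)] d by simp
qed

text \<open>With the adjugate in place of the inverse the factorization survives, because the scalar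
  \<open>det q\<close> is absorbed into the upper triangular factor.\<close>

lemma adj_factor_back:
  assumes q: "q \<in> carrier_mat m m" "det q \<noteq> 0" and b: "b \<in> carrier_mat m m" "upper_triangular b" "det b \<noteq> 0"
    and U: "U \<in> carrier_mat m m" and V: "V \<in> carrier_mat m m"
  shows "q * U = V * b \<Longrightarrow> adj_mat q * V = U * (det q \<cdot>\<^sub>m minv b)"
    "adj_mat q * U = V * b \<Longrightarrow> q * V = U * (det q \<cdot>\<^sub>m minv b)"
proof -
  note mb = minv[OF b(1,3)] and a = adj_mat[OF q(1)]
  have Vb: "V = V * b * minv b" using assoc_mult_mat[OF V b(1) mb(1)] mb(2) right_mult_one_mat[OF V] by simp
  have s: "(det q \<cdot>\<^sub>m U) * minv b = U * (det q \<cdot>\<^sub>m minv b)"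
    using mult_smult_assoc_mat[OF U mb(1)] mult_smult_distrib[OF U mb(1)] by simp
  {
    assume e: "q * U = V * b"
    have "adj_mat q * V = adj_mat q * (q * U * minv b)" using Vb e by simp
    also have "\<dots> = adj_mat q * (q * U) * minv b" by (rule assoc_mult_mat[OF a(1) mult_carrier_mat[OF q(1) U] mb(1), symmetric])
    finally show "adj_mat q * V = U * (det q \<cdot>\<^sub>m minv b)" unfolding adj_mat_cancel(2)[OF q(1) U] s .
  }
  {
    assume e: "adj_mat q * U = V * b"
    have "q * V = q * (adj_mat q * U * minv b)" using Vb e by simp
    also have "\<dots> = q * (adj_mat q * U) * minv b" by (rule assoc_mult_mat[OF q(1) mult_carrier_mat[OF a(1) U] mb(1), symmetric])
    finally show "q * V = U * (det q \<cdot>\<^sub>m minv b)" unfolding adj_mat_cancel(1)[OF q(1) U] s .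
  }
qed

lemma conj_upper_equation:
  assumes X: "X \<in> carrier_mat m m" and V: "V \<in> carrier_mat m m" and b: "b \<in> carrier_mat m m" "det b \<noteq> 0"
    and B: "B \<in> carrier_mat m m" and e: "X * (V * b) = V * b * B"
  shows "X * V = V * (b * B * minv b)"
proof -
  note mb = minv[OF b]
  have Vb: "V * b \<in> carrier_mat m m" and bB: "b * B \<in> carrier_mat m m" using V b B by simp_all
  have "X * V = X * (V * b * minv b)" using assoc_mult_mat[OF V b(1) mb(1)] mb(2) right_mult_one_mat[OF V] by simp
  also have "\<dots> = X * (V * b) * minv b" by (rule assoc_mult_mat[OF X Vb mb(1), symmetric])
  also have "\<dots> = V * (b * B) * minv b" unfolding e using assoc_mult_mat[OF V b(1) B] by simp
  also have "\<dots> = V * (b * B * minv b)" by (rule assoc_mult_mat[OF V bB mb(1)])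
  finally show ?thesis .
qed

text \<open>\<open>b\<close> is the echelon basis of \<open>L\<close>, and \<open>X s\<close> is a
  centralizer element with last row \<open>- b s\<close>. By \<open>Lb\<close>, the identity plus
  the combination of the \<open>X s\<close> with coefficients \<open>v s\<close> then has last row
  \<open>(- v, 1)\<close> for every \<open>v\<close> in \<open>L\<close>.\<close>

locale hyperplane_chart_basis = hyperplane_chart +
  fixes S :: "nat set" and b :: "nat \<Rightarrow> nat \<Rightarrow> complex" and X :: "nat \<Rightarrow> complex mat"
  assumes S: "S \<subseteq> {..<m}" and bL: "\<And>s. s \<in> S \<Longrightarrow> b s \<in> L"
    and bS: "\<And>s s'. s \<in> S \<Longrightarrow> s' \<in> S \<Longrightarrow> b s s' = (if s = s' then 1 else 0)"
    and Lb: "\<And>v i. v \<in> L \<Longrightarrow> v i = (\<Sum>s\<in>S. v s * b s i)"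
    and X: "\<And>s. s \<in> S \<Longrightarrow> X s \<in> carrier_mat (Suc m) (Suc m)" "\<And>s. s \<in> S \<Longrightarrow> M * X s = X s * M"
      "\<And>s j. s \<in> S \<Longrightarrow> j < m \<Longrightarrow> X s $$ (m, j) = - b s j" "\<And>s. s \<in> S \<Longrightarrow> X s $$ (m, m) = 0"
begin

lemma finite_S: "finite S"
  using S by (rule finite_subset) simp

text \<open>\<open>P v\<close> is an element of the centralizer of \<open>M\<close> that takes the translate by \<open>v\<close> to the base hyperplane,
  and \<open>q v\<close> is the map that it induces on hyperplanes. The entries of both are polynomial in \<open>v\<close>.\<close>

definition P :: "(nat \<Rightarrow> complex) \<Rightarrow> complex mat" where
  "P v = mat (Suc m) (Suc m) (\<lambda>(i, j). (if i = j then 1 else 0) + (\<Sum>s\<in>S. v s * X s $$ (i, j)))"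

lemma P_carrier: "P v \<in> carrier_mat (Suc m) (Suc m)"
  by (simp add: P_def)

lemma P_commutes: "M * P v = P v * M"
proof (rule eq_matI)
  fix i j assume "i < dim_row (P v * M)" "j < dim_col (P v * M)"
  then have ij: "i < Suc m" "j < Suc m" using P_carrier[of v] M_carrier by auto
  have "(\<Sum>l\<in>{0..<Suc m}. \<Sum>s\<in>S. v s * (M $$ (i, l) * X s $$ (l, j))) = (\<Sum>s\<in>S. \<Sum>l\<in>{0..<Suc m}. v s * (M $$ (i, l) * X s $$ (l, j)))"
    by (rule sum.swap)
  also have "\<dots> = (\<Sum>s\<in>S. v s * (M * X s) $$ (i, j))"
    by (intro sum.cong refl) (simp only: index_mult_mat'[OF M_carrier X(1) ij] sum_distrib_left)
  also have "\<dots> = (\<Sum>s\<in>S. v s * (X s * M) $$ (i, j))" by (intro sum.cong refl) (simp only: X(2))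
  also have "\<dots> = (\<Sum>s\<in>S. \<Sum>l\<in>{0..<Suc m}. v s * (X s $$ (i, l) * M $$ (l, j)))"
    by (intro sum.cong refl) (simp only: index_mult_mat'[OF X(1) M_carrier ij] sum_distrib_left)
  also have "\<dots> = (\<Sum>l\<in>{0..<Suc m}. \<Sum>s\<in>S. v s * (X s $$ (i, l) * M $$ (l, j)))"
    by (rule sum.swap)
  finally have swap: "(\<Sum>l\<in>{0..<Suc m}. \<Sum>s\<in>S. v s * (M $$ (i, l) * X s $$ (l, j))) = (\<Sum>l\<in>{0..<Suc m}. \<Sum>s\<in>S. v s * (X s $$ (i, l) * M $$ (l, j)))" .
  have "(M * P v) $$ (i, j) = (\<Sum>l\<in>{0..<Suc m}. M $$ (i, l) * P v $$ (l, j))" by (rule index_mult_mat'[OF M_carrier P_carrier ij])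
  also have "\<dots> = (\<Sum>l\<in>{0..<Suc m}. (if l = j then M $$ (i, j) else 0) + (\<Sum>s\<in>S. v s * (M $$ (i, l) * X s $$ (l, j))))"
    using ij by (intro sum.cong) (auto simp: P_def distrib_left sum_distrib_left mult.left_commute)
  also have "\<dots> = M $$ (i, j) + (\<Sum>l\<in>{0..<Suc m}. \<Sum>s\<in>S. v s * (M $$ (i, l) * X s $$ (l, j)))"
    using ij unfolding sum.distrib by simp
  also have "\<dots> = M $$ (i, j) + (\<Sum>l\<in>{0..<Suc m}. \<Sum>s\<in>S. v s * (X s $$ (i, l) * M $$ (l, j)))" unfolding swap ..
  also have "\<dots> = (\<Sum>l\<in>{0..<Suc m}. (if l = i then M $$ (i, j) else 0) + (\<Sum>s\<in>S. v s * (X s $$ (i, l) * M $$ (l, j))))"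
    using ij unfolding sum.distrib by simp
  also have "\<dots> = (\<Sum>l\<in>{0..<Suc m}. P v $$ (i, l) * M $$ (l, j))"
    using ij by (intro sum.cong) (auto simp: P_def distrib_right sum_distrib_right mult.assoc)
  also have "\<dots> = (P v * M) $$ (i, j)" by (rule index_mult_mat'[OF P_carrier M_carrier ij, symmetric])
  finally show "(M * P v) $$ (i, j) = (P v * M) $$ (i, j)" .
qed (use carrier_matD[OF P_carrier] carrier_matD[OF M_carrier] in auto)

lemma P_last_row:
  assumes "v \<in> L"
  shows "j < m \<Longrightarrow> P v $$ (m, j) = - v j" "P v $$ (m, m) = 1"
proof -
  show "P v $$ (m, j) = - v j" if "j < m"
    using that Lb[OF assms, of j] by (simp add: P_def X(3) sum_negf)
  show "P v $$ (m, m) = 1" by (simp add: P_def X(4))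
qed

definition q :: "(nat \<Rightarrow> complex) \<Rightarrow> complex mat" where
  "q v = lead m (P v * shear m v)"

lemma q_carrier[simp]: "q v \<in> carrier_mat m m"
  by (simp add: q_def)

text \<open>The last row of \<open>P v * shear m v\<close> is \<open>(0, ..., 0, 1)\<close>: the
  signs in \<open>P v\<close> cancel the shear. So this matrix preserves the standard hyperplane,
  and its leading block intertwines the restrictions of \<open>N\<close> to the translate and to the
  base hyperplane.\<close>

lemma q_conj:
  assumes v: "v \<in> L"
  shows "q v * lead m (conj_by v) = N' * q v"
proof -
  let ?Q = "P v * shear m v"
  have Q: "?Q \<in> carrier_mat (Suc m) (Suc m)" by (rule mult_carrier_mat[OF P_carrier shear_carrier])
  have Qz: "?Q $$ (m, j) = 0" if "j < m" for j
    using that P_last_row[OF v] by (simp add: mult_shear_index[OF P_carrier lessI])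
  have "?Q * conj_by v = P v * (M * shear m v)"
    unfolding shear_conj_by[symmetric] by (rule assoc_mult_mat[OF P_carrier shear_carrier conj_by_carrier])
  also have "\<dots> = P v * M * shear m v" by (rule assoc_mult_mat[OF P_carrier M_carrier shear_carrier, symmetric])
  also have "\<dots> = M * ?Q" unfolding P_commutes[symmetric] by (rule assoc_mult_mat[OF M_carrier P_carrier shear_carrier])
  finally have eq: "?Q * conj_by v = M * ?Q" .
  have "lead m (?Q * conj_by v) = q v * lead m (conj_by v)"
    unfolding q_def by (rule lead_mult_right[OF Q conj_by_carrier]) (simp add: conj_by_last_row[OF v])
  moreover have "lead m (M * ?Q) = lead m M * q v"
    unfolding q_def by (rule lead_mult_right[OF M_carrier Q]) (simp add: Qz del: index_mult_mat)
  moreover have "lead m M = N'" unfolding M_def by (rule lead_border[OF N' c])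
  ultimately show ?thesis using eq by simp
qed

lemma q_0: "q (\<lambda>_. 0) = 1\<^sub>m m"
proof -
  have "P (\<lambda>_. 0) = 1\<^sub>m (Suc m)" by (rule eq_matI) (auto simp: P_def)
  then have "P (\<lambda>_. 0) * shear m (\<lambda>_. 0) = 1\<^sub>m (Suc m)" using shear_0[of m "\<lambda>_. 0"] by simp
  then show ?thesis unfolding q_def by (intro eq_matI) auto
qed

lemma polymat_q:
  assumes v: "\<And>j. j < m \<Longrightarrow> (\<lambda>x. v x j) \<in> polynomials I"
  shows "polymat I m m (\<lambda>x. q (v x))"
proof -
  have vS: "(\<lambda>x. v x s) \<in> polynomials I" if "s \<in> S" for s using v S that by auto
  have "polymat I (Suc m) (Suc m) (\<lambda>x. P (v x))" unfolding P_def
  proof (rule polymat_mat)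
    fix i j
    show "(\<lambda>x. (if i = j then 1 else 0) + (\<Sum>s\<in>S. v x s * X s $$ (i, j))) \<in> polynomials I"
      by (intro polynomials.add polynomials.const polynomials_sum polynomials.mult vS)
  qed
  moreover have "polymat I (Suc m) (Suc m) (\<lambda>x. shear m (v x))" by (rule polymat_shear) (rule v)
  ultimately have Q: "polymat I (Suc m) (Suc m) (\<lambda>x. P (v x) * shear m (v x))" by (rule polymat_mult)
  show ?thesis unfolding q_def
    by (rule polymatI) (simp_all add: polymatD(2)[OF Q] del: index_mult_mat)
qed

end

lemma lower_unitriangular_cong:
  "(\<And>i j. j < i \<Longrightarrow> i < m \<Longrightarrow> x (i, j) = y (i, j)) \<Longrightarrow> lower_unitriangular m x = lower_unitriangular m y"
  by (rule eq_matI) auto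

lemma lower_unitriangular_restr: "lower_unitriangular m (restr (chart_index m) x) = lower_unitriangular m x"
  by (rule lower_unitriangular_cong) (simp add: restr_def chart_index_def)

lemma polymat_lower_unitriangular_Suc: "polymat (chart_index (Suc m)) m m (lower_unitriangular m)"
  by (rule polymat_mono[OF polymat_lower_unitriangular]) (auto simp: chart_index_Suc)

lemma polynomial_hyperplane_coord:
  assumes j: "j < m"
  shows "(\<lambda>x. hyperplane_coord m x j) \<in> polynomials (chart_index (Suc m))"
proof -
  have U: "polymat (chart_index (Suc m)) m m (\<lambda>x. unitri_inv m x)"
    unfolding unitri_inv_def by (rule polymat_adj[OF polymat_lower_unitriangular_Suc])
  show ?thesis unfolding hyperplane_coord_def
    by (intro polynomials_sum polynomials.mult polynomials.coord polymatD(2)[OF U]) (use j in \<open>auto simp: chart_index_def\<close>)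
qed

lemma last_row_hyperplane_coord:
  "j < m \<Longrightarrow> (\<Sum>l<m. hyperplane_coord m x l * lower_unitriangular m x $$ (l, j)) = x (m, j)"
  unfolding hyperplane_coord_def by (rule row_times_inverse[OF unitri_inv(1) lower_unitriangular_carrier unitri_inv(3)])

lemma adj_mat_one: "adj_mat (1\<^sub>m m) = (1\<^sub>m m :: complex mat)"
proof -
  note a = adj_mat[OF one_carrier_mat[of m, where 'a = complex]]
  have "adj_mat (1\<^sub>m m) = adj_mat (1\<^sub>m m) * (1\<^sub>m m :: complex mat)" using right_mult_one_mat[OF a(1)] by simp
  also have "\<dots> = 1\<^sub>m m" unfolding a(3) by (intro eq_matI) auto
  finally show ?thesis .
qed

lemma lu_lower_unitriangular:
  assumes "x \<in> affine_space (chart_index m)"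
  shows "lu_ok m (lower_unitriangular m x)" "lu_coord m (lower_unitriangular m x) = x"
proof -
  have "upper_triangular (1\<^sub>m m :: complex mat)" "det (1\<^sub>m m :: complex mat) \<noteq> 0" by auto
  note lu = lu_unique[OF one_carrier_mat this assms, unfolded right_mult_one_mat[OF lower_unitriangular_carrier]]
  show "lu_ok m (lower_unitriangular m x)" "lu_coord m (lower_unitriangular m x) = x" by (rule lu)+
qed

text \<open>The point of the chart for \<open>m + 1\<close> whose flag has the hyperplane given by \<open>y\<close> and the truncation given by \<open>x\<close>.\<close>

definition extend_chart :: "nat \<Rightarrow> (nat \<Rightarrow> complex) \<Rightarrow> (nat \<times> nat \<Rightarrow> complex) \<Rightarrow> nat \<times> nat \<Rightarrow> complex" where
  "extend_chart m y x = (\<lambda>(i, j). if i = m then if j < m then \<Sum>l<m. y l * lower_unitriangular m x $$ (l, j) else 0 else x (i, j))"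

lemma extend_chart_affine:
  "x \<in> affine_space (chart_index m) \<Longrightarrow> extend_chart m y x \<in> affine_space (chart_index (Suc m))"
  by (auto simp: extend_chart_def affine_space_def chart_index_def)

lemma lower_unitriangular_extend_chart[simp]: "lower_unitriangular m (extend_chart m y x) = lower_unitriangular m x"
  by (rule lower_unitriangular_cong) (simp add: extend_chart_def)

lemma hyperplane_coord_extend_chart: "j < m \<Longrightarrow> hyperplane_coord m (extend_chart m y x) j = y j"
  by (rule hyperplane_coord_compose[of m _ x]) (simp_all add: extend_chart_def)

lemma extend_chart_cong: "(\<And>l. l < m \<Longrightarrow> y l = y' l) \<Longrightarrow> extend_chart m y x = extend_chart m y' x"
  by (auto simp: extend_chart_def fun_eq_iff intro!: sum.cong)

lemma extend_chart_restr:
  assumes x: "x \<in> affine_space (chart_index (Suc m))"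
  shows "extend_chart m (hyperplane_coord m x) (restr (chart_index m) x) = x"
proof
  fix p :: "nat \<times> nat" obtain i j where p: "p = (i, j)" by force
  have z: "x (i, j) = 0" if "\<not> (j < i \<and> i < Suc m)" using x that by (simp add: affine_space_def chart_index_def)
  have "extend_chart m (hyperplane_coord m x) (restr (chart_index m) x) (i, j) =
    (if i = m then if j < m then x (m, j) else 0 else restr (chart_index m) x (i, j))"
    by (simp add: extend_chart_def lower_unitriangular_restr last_row_hyperplane_coord del: lower_unitriangular_index)
  also have "\<dots> = x (i, j)" using z by (auto simp: restr_def chart_index_def)
  finally show "extend_chart m (hyperplane_coord m x) (restr (chart_index m) x) p = x p" unfolding p .
qed

section \<open>The chart maps between the flags of the tableau and the product\<close>

context hyperplane_chart_basis
begin

text \<open>The entries of \<open>z\<close> in row \<open>m\<close> at the positions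
  \<open>S\<close> are the parameters of a point of \<open>L\<close>; these positions are the
  coordinates of the affine factor.\<close>

definition theta :: "(nat \<times> nat \<Rightarrow> complex) \<Rightarrow> nat \<Rightarrow> complex" where
  "theta z = (\<lambda>j. \<Sum>s\<in>S. z (m, s) * b s j)"

text \<open>A basis of the truncated flag after its transport to the base hyperplane. It is not
  unitriangular in general, hence the coordinates \<open>lu_coord\<close> in
  \<open>chart_to\<close>.\<close>

definition fwd :: "(nat \<times> nat \<Rightarrow> complex) \<Rightarrow> complex mat" where
  "fwd x = q (shift x) * lower_unitriangular m x"

text \<open>The adjugate instead of the inverse keeps the entries polynomial; the lost factor \<open>det (q v)\<close> does
  not change the flag.\<close>

definition bwd :: "(nat \<times> nat \<Rightarrow> complex) \<Rightarrow> complex mat" where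
  "bwd z = adj_mat (q (theta z)) * lower_unitriangular m z"

definition chart_to :: "(nat \<times> nat \<Rightarrow> complex) \<Rightarrow> nat \<times> nat \<Rightarrow> complex" where
  "chart_to x = (\<lambda>(i, j). if i = m then if j \<in> S then shift x j else 0 else lu_coord m (fwd x) (i, j))"

definition chart_from :: "(nat \<times> nat \<Rightarrow> complex) \<Rightarrow> nat \<times> nat \<Rightarrow> complex" where
  "chart_from z = extend_chart m (\<lambda>l. y0 l + theta z l) (lu_coord m (bwd z))"

lemma theta_L: "theta z \<in> L"
  unfolding theta_def by (rule L_sum[OF finite_S bL])

lemma theta_S: "s \<in> S \<Longrightarrow> theta z s = z (m, s)"
  using finite_S by (simp add: theta_def bS if_distrib cong: if_cong)

lemma adj_q_carrier: "adj_mat (q v) \<in> carrier_mat m m"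
  by (rule adj_mat(1)[OF q_carrier])

lemma fwd_carrier: "fwd x \<in> carrier_mat m m"
  unfolding fwd_def by (rule mult_carrier_mat[OF q_carrier lower_unitriangular_carrier])

lemma bwd_carrier: "bwd z \<in> carrier_mat m m"
  unfolding bwd_def by (rule mult_carrier_mat[OF adj_q_carrier lower_unitriangular_carrier])

lemma L_outside: "v \<in> L \<Longrightarrow> j \<ge> m \<Longrightarrow> v j = 0"
  by (simp add: L_def affine_space_def)

lemma lower_unitriangular_chart_to: "lower_unitriangular m (chart_to x) = lower_unitriangular m (lu_coord m (fwd x))"
  by (rule lower_unitriangular_cong) (simp add: chart_to_def)

lemma lower_unitriangular_chart_from: "lower_unitriangular m (chart_from x) = lower_unitriangular m (lu_coord m (bwd x))"
  unfolding chart_from_def by simp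

lemma shift_extend_chart: "v \<in> L \<Longrightarrow> shift (extend_chart m (\<lambda>l. y0 l + v l) x) = v"
  by (auto simp: shift_def fun_eq_iff hyperplane_coord_extend_chart L_outside)

lemma shift_chart_from: "shift (chart_from z) = theta z"
  unfolding chart_from_def by (rule shift_extend_chart[OF theta_L])

lemma theta_chart_to:
  assumes "shift x \<in> L"
  shows "theta (chart_to x) = shift x"
proof
  fix j
  have "theta (chart_to x) j = (\<Sum>s\<in>S. shift x s * b s j)" by (simp add: theta_def chart_to_def)
  also have "\<dots> = shift x j" by (rule Lb[OF assms, symmetric])
  finally show "theta (chart_to x) j = shift x j" .
qed

lemma chart_to_affine: "chart_to x \<in> affine_space (chart_index m \<union> {m} \<times> S)"
  using lu_coord_affine[of m "fwd x"] by (auto simp: chart_to_def affine_space_def)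

lemma restr_chart_to: "restr (chart_index m) (chart_to x) = lu_coord m (fwd x)"
  using lu_coord_affine[of m "fwd x"] by (auto simp: chart_to_def affine_space_def restr_def chart_index_def fun_eq_iff)

lemma det_q_of_fwd:
  assumes "fwd x = lower_unitriangular m z * bb" "bb \<in> carrier_mat m m" "det bb \<noteq> 0"
  shows "det (q (shift x)) \<noteq> 0"
proof -
  have "det (fwd x) \<noteq> 0" unfolding assms(1) det_mult[OF lower_unitriangular_carrier assms(2)] using assms(3) by simp
  then show ?thesis unfolding fwd_def det_mult[OF q_carrier lower_unitriangular_carrier] by simp
qed

text \<open>The decomposition of \<open>fwd x\<close> returns to chart coordinates of the smaller
  flag variety, and its triangular factor only conjugates the adapted matrix. The same decomposition
  forces \<open>q\<close> to be invertible and is reversed by \<open>bwd\<close>, up to a scalar in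
  the triangular factor.\<close>

lemma chart_to_correct:
  assumes x: "x \<in> adapted_chart (Suc m) T N" and ok: "lu_ok m (fwd x)"
  shows "chart_to x \<in> cyl (chart_index m) ({m} \<times> S) (adapted_chart m T N')" "chart_from (chart_to x) = x"
proof -
  let ?U = "lower_unitriangular m x" and ?v = "shift x"
  define xx where "xx = lu_coord m (fwd x)"
  let ?V = "lower_unitriangular m xx"
  obtain B where B: "adapted (Suc m) T B" and eq: "N * lower_unitriangular (Suc m) x = lower_unitriangular (Suc m) x * B"
    and xa: "x \<in> affine_space (chart_index (Suc m))" using x by (auto simp: adapted_chart_def)
  have Bc: "B \<in> carrier_mat (Suc m) (Suc m)" using B by (simp add: adapted_def)
  have lB: "adapted m T (lead m B)" using B adapted_Suc[OF Bc] by blast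
  note v = adapted_in_L(1)[OF B eq] and e = adapted_in_L(2)[OF B eq]
  obtain bb where bb: "bb \<in> carrier_mat m m" "upper_triangular bb" "det bb \<noteq> 0" and f: "fwd x = ?V * bb"
    using lu_exists[OF fwd_carrier ok] unfolding xx_def by blast
  note dq = det_q_of_fwd[OF f bb(1,3)]
  have f': "q ?v * ?U = ?V * bb" using f by (simp add: fwd_def)
  have "N' * (?V * bb) = N' * q ?v * ?U" unfolding f'[symmetric] by (rule assoc_mult_mat[OF N' q_carrier lower_unitriangular_carrier, symmetric])
  also have "\<dots> = q ?v * (lead m (conj_by ?v) * ?U)"
    unfolding q_conj[OF v, symmetric] by (rule assoc_mult_mat[OF q_carrier lead_carrier lower_unitriangular_carrier])
  also have "\<dots> = ?V * bb * lead m B"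
    unfolding e f'[symmetric] by (rule assoc_mult_mat[OF q_carrier lower_unitriangular_carrier lead_carrier, symmetric])
  finally have "N' * ?V = ?V * (bb * lead m B * minv bb)"
    by (rule conj_upper_equation[OF N' lower_unitriangular_carrier bb(1,3) lead_carrier])
  then have "xx \<in> adapted_chart m T N'"
    unfolding adapted_chart_def using adapted_conj[OF lB bb] lu_coord_affine[of m "fwd x"] by (auto simp: xx_def)
  then show "chart_to x \<in> cyl (chart_index m) ({m} \<times> S) (adapted_chart m T N')"
    unfolding cyl_def by (simp add: chart_to_affine restr_chart_to xx_def)
  have "bwd (chart_to x) = ?U * (det (q ?v) \<cdot>\<^sub>m minv bb)"
    unfolding bwd_def theta_chart_to[OF v] lower_unitriangular_chart_to xx_def[symmetric]
    by (rule adj_factor_back(1)[OF q_carrier dq bb lower_unitriangular_carrier lower_unitriangular_carrier f'])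
  then have "bwd (chart_to x) = lower_unitriangular m (restr (chart_index m) x) * (det (q ?v) \<cdot>\<^sub>m minv bb)"
    unfolding lower_unitriangular_restr .
  then have "lu_coord m (bwd (chart_to x)) = restr (chart_index m) x"
    using lu_unique(2)[OF upper_triangular_smult_minv[OF bb dq] restr_affine] by simp
  then have "chart_from (chart_to x) = extend_chart m (\<lambda>l. y0 l + ?v l) (restr (chart_index m) x)"
    unfolding chart_from_def theta_chart_to[OF v] by simp
  also have "\<dots> = extend_chart m (hyperplane_coord m x) (restr (chart_index m) x)"
    by (rule extend_chart_cong) (simp add: shift_def)
  finally show "chart_from (chart_to x) = x" unfolding extend_chart_restr[OF xa] .
qed

text \<open>Here invertibility of \<open>q\<close> is a separate condition: \<open>bwd\<close>
  contains the adjugate, and the adjugate of a 1 by 1 matrix is 1 whatever its entry.\<close>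

lemma chart_from_correct:
  assumes z: "z \<in> cyl (chart_index m) ({m} \<times> S) (adapted_chart m T N')" and ok: "lu_ok m (bwd z)" and dq: "det (q (theta z)) \<noteq> 0"
  shows "chart_from z \<in> adapted_chart (Suc m) T N" "chart_to (chart_from z) = z"
proof -
  let ?U = "lower_unitriangular m z" and ?v = "theta z"
  define xx where "xx = lu_coord m (bwd z)"
  let ?V = "lower_unitriangular m xx" and ?X = "lead m (conj_by ?v)" and ?l = "last_col m (conj_by ?v)"
  have za: "z \<in> affine_space (chart_index m \<union> {m} \<times> S)" and "restr (chart_index m) z \<in> adapted_chart m T N'"
    using z by (auto simp: cyl_def)
  then obtain B' where B': "adapted m T B'" and eq: "N' * ?U = ?U * B'"
    unfolding adapted_chart_def by (auto simp: lower_unitriangular_restr)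
  have B'c: "B' \<in> carrier_mat m m" using B' by (simp add: adapted_def)
  obtain bb where bb: "bb \<in> carrier_mat m m" "upper_triangular bb" "det bb \<noteq> 0" and f: "bwd z = ?V * bb"
    using lu_exists[OF bwd_carrier ok] unfolding xx_def by blast
  have f': "adj_mat (q ?v) * ?U = ?V * bb" using f by (simp add: bwd_def)
  have Vb: "?V * bb \<in> carrier_mat m m" by (rule mult_carrier_mat[OF lower_unitriangular_carrier bb(1)])
  let ?d = "det (q ?v)"
  have qf: "q ?v * (?V * bb) = ?d \<cdot>\<^sub>m ?U"
    unfolding f'[symmetric] by (rule adj_mat_cancel(1)[OF q_carrier lower_unitriangular_carrier])
  have "q ?v * (?X * (?V * bb)) = N' * q ?v * (?V * bb)"
    unfolding q_conj[OF theta_L, symmetric] by (rule assoc_mult_mat[OF q_carrier lead_carrier Vb, symmetric])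
  also have "\<dots> = N' * (?d \<cdot>\<^sub>m ?U)" unfolding qf[symmetric] by (rule assoc_mult_mat[OF N' q_carrier Vb])
  also have "\<dots> = ?d \<cdot>\<^sub>m (?U * B')" unfolding eq[symmetric] by (rule mult_smult_distrib[OF N' lower_unitriangular_carrier])
  also have "\<dots> = (?d \<cdot>\<^sub>m ?U) * B'" by (rule mult_smult_assoc_mat[OF lower_unitriangular_carrier B'c, symmetric])
  also have "\<dots> = q ?v * (?V * bb * B')" unfolding qf[symmetric] by (rule assoc_mult_mat[OF q_carrier Vb B'c])
  finally have "minv (q ?v) * (q ?v * (?X * (?V * bb))) = minv (q ?v) * (q ?v * (?V * bb * B'))" by simp
  then have "?X * (?V * bb) = ?V * bb * B'"
    unfolding mult_minv_cancel(2)[OF q_carrier dq mult_carrier_mat[OF lead_carrier Vb]]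
      mult_minv_cancel(2)[OF q_carrier dq mult_carrier_mat[OF Vb B'c]] .
  then have XV: "?X * ?V = ?V * (bb * B' * minv bb)"
    by (rule conj_upper_equation[OF lead_carrier lower_unitriangular_carrier bb(1,3) B'c])
  define B'' where "B'' = bb * B' * minv bb"
  have B'': "adapted m T B''" unfolding B''_def by (rule adapted_conj[OF B' bb])
  have B''c: "B'' \<in> carrier_mat m m" and B''u: "upper_triangular B''" using B'' by (simp_all add: adapted_def)
  have dV: "det ?V \<noteq> 0" by simp
  \<comment> \<open>The last column of \<open>B\<close> is forced: it must express the last column
    of \<open>conj_by\<close> in the basis given by \<open>?V\<close>.\<close>
  define l where "l = minv ?V * ?l"
  have l: "l \<in> carrier_mat m 1" unfolding l_def by (rule mult_carrier_mat[OF minv(1)[OF lower_unitriangular_carrier dV] last_col_carrier])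
  have Vl: "?V * l = ?l" unfolding l_def by (rule mult_minv_cancel(1)[OF lower_unitriangular_carrier dV last_col_carrier])
  define B where "B = border B'' l"
  have Bc: "B \<in> carrier_mat (Suc m) (Suc m)" unfolding B_def by (rule border_carrier[OF B''c])
  have C: "conj_by ?v = border ?X ?l" by (rule border_lead[OF conj_by_carrier conj_by_last_row[OF theta_L]])
  have "border ?X ?l * diag_one m ?V = diag_one m ?V * B"
    unfolding B_def border_diag_one(1)[OF lead_carrier last_col_carrier lower_unitriangular_carrier]
      border_diag_one(2)[OF B''c l lower_unitriangular_carrier] Vl XV[folded B''_def] ..
  moreover have "conj_by ?v * diag_one m ?V = border ?X ?l * diag_one m ?V" by (rule arg_cong[OF C, of "\<lambda>A. A * _"])
  ultimately have "conj_by ?v * diag_one m ?V = diag_one m ?V * B" by simp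
  then have NU: "N * lower_unitriangular (Suc m) (chart_from z) = lower_unitriangular (Suc m) (chart_from z) * B"
    unfolding chart_equation[OF Bc] shift_chart_from lower_unitriangular_chart_from xx_def[symmetric] .
  have "young_diagram B (shape (restrict_tableau (Suc m) T))"
    using young_diagram_similar[OF similar_matI'[OF N Bc lower_unitriangular_carrier _ NU]] yN by simp
  then have "adapted (Suc m) T B"
    unfolding adapted_Suc[OF Bc] using upper_triangular_border[OF B''c l B''u] lead_border[OF B''c l] B'' by (simp add: B_def)
  then show "chart_from z \<in> adapted_chart (Suc m) T N"
    unfolding adapted_chart_def chart_from_def using NU extend_chart_affine[OF lu_coord_affine] by (auto simp: chart_from_def)
  have "fwd (chart_from z) = ?U * (?d \<cdot>\<^sub>m minv bb)"
    unfolding fwd_def shift_chart_from lower_unitriangular_chart_from xx_def[symmetric]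
    by (rule adj_factor_back(2)[OF q_carrier dq bb lower_unitriangular_carrier lower_unitriangular_carrier f'])
  then have "fwd (chart_from z) = lower_unitriangular m (restr (chart_index m) z) * (?d \<cdot>\<^sub>m minv bb)"
    unfolding lower_unitriangular_restr .
  then have lu: "lu_coord m (fwd (chart_from z)) = restr (chart_index m) z"
    using lu_unique(2)[OF upper_triangular_smult_minv[OF bb dq] restr_affine] by simp
  show "chart_to (chart_from z) = z"
  proof
    fix p :: "nat \<times> nat" obtain i j where p: "p = (i, j)" by force
    have "chart_to (chart_from z) (i, j) = (if i = m then if j \<in> S then z (m, j) else 0 else restr (chart_index m) z (i, j))"
      unfolding chart_to_def shift_chart_from lu by (simp add: theta_S)
    also have "\<dots> = z (i, j)" using za by (auto simp: affine_space_def restr_def chart_index_def)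
    finally show "chart_to (chart_from z) p = z p" unfolding p .
  qed
qed

lemma polymat_fwd: "polymat (chart_index (Suc m)) m m fwd"
proof -
  have sh: "(\<lambda>x. shift x j) \<in> polynomials (chart_index (Suc m))" if "j < m" for j
    unfolding shift_def using that by (simp add: polynomials_diff polynomial_hyperplane_coord polynomials.const)
  have "polymat (chart_index (Suc m)) m m (\<lambda>x. q (shift x) * lower_unitriangular m x)"
    by (rule polymat_mult[OF polymat_q polymat_lower_unitriangular_Suc]) (rule sh)
  then show ?thesis by (simp only: fwd_def[abs_def])
qed

lemma polymat_bwd: "polymat (chart_index m \<union> {m} \<times> S) m m bwd"
  and polynomial_theta: "(\<lambda>z. theta z j) \<in> polynomials (chart_index m \<union> {m} \<times> S)"
  and polynomial_det_q: "(\<lambda>z. det (q (theta z))) \<in> polynomials (chart_index m \<union> {m} \<times> S)"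
proof -
  let ?J = "chart_index m \<union> {m} \<times> S"
  show th: "(\<lambda>z. theta z j) \<in> polynomials ?J" for j
    unfolding theta_def by (intro polynomials_sum polynomials.mult polynomials.coord polynomials.const) auto
  have q: "polymat ?J m m (\<lambda>z. q (theta z))" by (rule polymat_q) (rule th)
  show "(\<lambda>z. det (q (theta z))) \<in> polynomials ?J" by (rule polymat_det[OF q])
  have "polymat ?J m m (\<lambda>z. adj_mat (q (theta z)) * lower_unitriangular m z)"
    by (rule polymat_mult[OF polymat_adj[OF q] polymat_mono[OF polymat_lower_unitriangular]]) simp
  then show "polymat ?J m m bwd" by (simp only: bwd_def[abs_def])
qed

text \<open>At the base point the shift is 0 and \<open>q\<close> is the identity, so
  \<open>fwd\<close> and \<open>bwd\<close> are unitriangular and both chart maps are regular there.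
  \<open>x0\<close> also serves as the point of the product whose affine coordinates are all
  0.\<close>

lemma singular_point_extend_chart_basis:
  assumes x0: "x0 \<in> affine_space (chart_index m)"
  shows "singular_point (chart_index (Suc m)) (zariski_cl (chart_index (Suc m)) (adapted_chart (Suc m) T N)) (extend_chart m y0 x0) \<longleftrightarrow>
    singular_point (chart_index m) (zariski_cl (chart_index m) (adapted_chart m T N')) x0"
proof -
  let ?I = "chart_index (Suc m)" and ?J = "chart_index m" and ?K = "{m} \<times> S"
  let ?e = "extend_chart m y0 x0"
  have x0m: "x0 (m, s) = 0" for s using x0 by (simp add: affine_space_def chart_index_def)
  have x0a: "x0 \<in> affine_space (?J \<union> ?K)" using x0 by (simp add: affine_space_def)
  have she: "shift ?e = (\<lambda>_. 0)" using shift_extend_chart[OF L_zero, of x0] by simp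
  have th0: "theta x0 = (\<lambda>_. 0)" by (simp add: theta_def x0m)
  have fe: "fwd ?e = lower_unitriangular m x0" unfolding fwd_def she q_0 by (simp add: left_mult_one_mat[of _ m m])
  have be: "bwd x0 = lower_unitriangular m x0" unfolding bwd_def th0 q_0 adj_mat_one by (simp add: left_mult_one_mat[of _ m m])
  note lu = lu_lower_unitriangular[OF x0]
  have to0: "chart_to ?e = x0"
    unfolding chart_to_def fe lu(2) she using x0m by (auto simp: fun_eq_iff)
  have from0: "chart_from x0 = ?e" unfolding chart_from_def be lu(2) th0 by simp
  have reg_to: "regular_at ?I ?e (\<lambda>x. chart_to x p)" if p: "p \<in> ?J \<union> ?K" for p
  proof (cases "fst p = m")
    case True
    then obtain s where s: "p = (m, s)" "s \<in> S" using p by (auto simp: chart_index_def)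
    then have "s < m" using S by auto
    then have "(\<lambda>x. shift x s) \<in> polynomials ?I"
      unfolding shift_def by (simp add: polynomials_diff polynomial_hyperplane_coord polynomials.const)
    then show ?thesis using s by (simp add: chart_to_def regular_at_poly)
  next
    case False
    then have "(\<lambda>x. chart_to x p) = (\<lambda>x. lu_coord m (fwd x) p)" by (auto simp: chart_to_def fun_eq_iff split: prod.splits)
    moreover have "lu_ok m (fwd ?e)" unfolding fe by (rule lu(1))
    ultimately show ?thesis using regular_lu_coord[OF polymat_fwd] by simp
  qed
  have reg_lu: "regular_at (?J \<union> ?K) x0 (\<lambda>z. lu_coord m (bwd z) p)" for p
    by (rule regular_lu_coord[OF polymat_bwd]) (unfold be, rule lu(1))
  have reg_from: "regular_at (?J \<union> ?K) x0 (\<lambda>z. chart_from z p)" if p: "p \<in> ?I" for p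
  proof (cases "fst p = m")
    case True
    then obtain j where j: "p = (m, j)" "j < m" using p by (auto simp: chart_index_def)
    have "regular_at (?J \<union> ?K) x0 (\<lambda>z. lower_unitriangular m (lu_coord m (bwd z)) $$ (l, j))" if "l < m" for l
      using that j(2) by (cases l j rule: linorder_cases) (simp_all add: regular_at_const reg_lu)
    then have "regular_at (?J \<union> ?K) x0 (\<lambda>z. \<Sum>l<m. (y0 l + theta z l) * lower_unitriangular m (lu_coord m (bwd z)) $$ (l, j))"
      by (intro regular_at_sum regular_at_mult[OF regular_at_add[OF regular_at_const regular_at_poly[OF polynomial_theta]]]) auto
    then show ?thesis using j by (simp add: chart_from_def extend_chart_def)
  next
    case False
    then have "(\<lambda>z. chart_from z p) = (\<lambda>z. lu_coord m (bwd z) p)"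
      by (auto simp: chart_from_def extend_chart_def fun_eq_iff split: prod.splits)
    then show ?thesis using reg_lu by simp
  qed
  define hA where "hA = (\<lambda>x. \<Prod>k<m. lu_minor (fwd x) k k)"
  define hB where "hB = (\<lambda>z. (\<Prod>k<m. lu_minor (bwd z) k k) * det (q (theta z)))"
  have hA: "hA x \<noteq> 0 \<longleftrightarrow> lu_ok m (fwd x)" for x by (simp add: hA_def lu_ok_iff)
  have hB: "hB z \<noteq> 0 \<longleftrightarrow> lu_ok m (bwd z) \<and> det (q (theta z)) \<noteq> 0" for z by (simp add: hB_def lu_ok_iff)
  have rx: "restr ?J x0 = x0" by (rule restr_id[OF x0])
  have finS: "finite ?K" using finite_S by simp
  interpret local_iso ?I "?J \<union> ?K" "adapted_chart (Suc m) T N" "cyl ?J ?K (adapted_chart m T N')" ?e x0 chart_to chart_from hA hB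
  proof
    show "finite ?I" "finite (?J \<union> ?K)" using finS by auto
    show "adapted_chart (Suc m) T N \<subseteq> affine_space ?I" by (rule adapted_chart_affine)
    show "cyl ?J ?K (adapted_chart m T N') \<subseteq> affine_space (?J \<union> ?K)" by (rule cyl_affine)
    show "?e \<in> affine_space ?I" by (rule extend_chart_affine[OF x0])
    show "x0 \<in> affine_space (?J \<union> ?K)" by (rule x0a)
    show "\<And>i. i \<in> ?J \<union> ?K \<Longrightarrow> regular_at ?I ?e (\<lambda>x. chart_to x i)" by (rule reg_to)
    show "\<And>i. i \<in> ?I \<Longrightarrow> regular_at (?J \<union> ?K) x0 (\<lambda>z. chart_from z i)" by (rule reg_from)
    show "chart_to ?e = x0" "chart_from x0 = ?e" by (rule to0, rule from0)
    show "hA \<in> polynomials ?I" unfolding hA_def by (rule lu_ok_polynomial[OF polymat_fwd])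
    show "hB \<in> polynomials (?J \<union> ?K)" unfolding hB_def by (rule polynomials.mult[OF lu_ok_polynomial[OF polymat_bwd] polynomial_det_q])
    show "hA ?e \<noteq> 0" unfolding hA fe by (rule lu(1))
    show "hB x0 \<noteq> 0" unfolding hB be th0 q_0 using lu(1) by simp
    show "\<And>x. x \<in> adapted_chart (Suc m) T N \<Longrightarrow> hA x \<noteq> 0 \<Longrightarrow> chart_to x \<in> cyl ?J ?K (adapted_chart m T N') \<and> chart_from (chart_to x) = x"
      unfolding hA using chart_to_correct by blast
    show "\<And>z. z \<in> cyl ?J ?K (adapted_chart m T N') \<Longrightarrow> hB z \<noteq> 0 \<Longrightarrow> chart_from z \<in> adapted_chart (Suc m) T N \<and> chart_to (chart_from z) = z"
      unfolding hB using chart_from_correct by blast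
  qed
  have disj: "?J \<inter> ?K = {}" by (auto simp: chart_index_def)
  show ?thesis
    using singular_point_image singular_point_cyl[OF finite_chart_index finS disj adapted_chart_affine x0a] rx by simp
qed

end

context hyperplane_chart
begin

text \<open>The auxiliary choices, an echelon basis of \<open>L\<close> and the centralizer
  elements, are made here, so that later arguments only have to supply a base hyperplane of the
  right type.\<close>

lemma singular_point_extend_chart:
  assumes x0: "x0 \<in> affine_space (chart_index m)"
  shows "singular_point (chart_index (Suc m)) (zariski_cl (chart_index (Suc m)) (adapted_chart (Suc m) T N)) (extend_chart m y0 x0) \<longleftrightarrow>
    singular_point (chart_index m) (zariski_cl (chart_index m) (adapted_chart m T N')) x0"
proof -
  have La: "L \<subseteq> affine_space {..<m}" by (auto simp: L_def)
  from subspace_graph[OF finite_lessThan La L_zero L_add L_scale]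
  obtain S where S': "S \<subseteq> {..<m} \<and> (\<exists>b. (\<forall>s\<in>S. b s \<in> L) \<and> (\<forall>s\<in>S. \<forall>s'\<in>S. b s s' = (if s = s' then 1 else 0)) \<and>
    (\<forall>v\<in>L. \<forall>i. v i = (\<Sum>s\<in>S. v s * b s i)))" by (rule exE)
  from conjunct2[OF S'] obtain b where b: "(\<forall>s\<in>S. b s \<in> L) \<and> (\<forall>s\<in>S. \<forall>s'\<in>S. b s s' = (if s = s' then 1 else 0)) \<and>
    (\<forall>v\<in>L. \<forall>i. v i = (\<Sum>s\<in>S. v s * b s i))" by (rule exE)
  have "\<forall>s\<in>S. \<exists>X. X \<in> carrier_mat (Suc m) (Suc m) \<and> M * X = X * M \<and> (\<forall>j<m. X $$ (m, j) = - b s j) \<and> X $$ (m, m) = 0"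
  proof
    fix s assume "s \<in> S"
    with conjunct1[OF b] have "b s \<in> L" by (rule bspec)
    from commuting_exists[OF this] show "\<exists>X. X \<in> carrier_mat (Suc m) (Suc m) \<and> M * X = X * M \<and> (\<forall>j<m. X $$ (m, j) = - b s j) \<and> X $$ (m, m) = 0"
      unfolding Bex_def .
  qed
  from bchoice[OF this] obtain X where X: "\<forall>s\<in>S. X s \<in> carrier_mat (Suc m) (Suc m) \<and> M * X s = X s * M \<and> (\<forall>j<m. X s $$ (m, j) = - b s j) \<and> X s $$ (m, m) = 0"
    by (rule exE)
  interpret hyperplane_chart_basis m N N' c y0 T a K S b X
  proof
    show "S \<subseteq> {..<m}" by (rule conjunct1[OF S'])
    show "\<And>s. s \<in> S \<Longrightarrow> b s \<in> L" using conjunct1[OF b] by (rule bspec)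
    show "\<And>s s'. s \<in> S \<Longrightarrow> s' \<in> S \<Longrightarrow> b s s' = (if s = s' then 1 else 0)"
      by (rule bspec[OF bspec[OF conjunct1[OF conjunct2[OF b]]]])
    show "\<And>v i. v \<in> L \<Longrightarrow> v i = (\<Sum>s\<in>S. v s * b s i)"
      by (rule spec[OF bspec[OF conjunct2[OF conjunct2[OF b]]]])
  qed (use X in simp_all)
  show ?thesis by (rule singular_point_extend_chart_basis[OF x0])
qed

end

subsection \<open>Removing the largest entry of a tableau\<close>

lemma restrict_restrict_tableau:
  assumes "i \<le> m"
  shows "restrict_tableau i (restrict_tableau m T) = restrict_tableau i T"
proof -
  have f: "filter (\<lambda>e. e \<le> i) (filter (\<lambda>e. e \<le> m) row) = filter (\<lambda>e. e \<le> i) row" for row :: "nat list"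
    unfolding filter_filter using assms by (intro filter_cong) auto
  then have "filter (\<lambda>e. e \<le> m) row = [] \<Longrightarrow> filter (\<lambda>e. e \<le> i) row = []" for row :: "nat list"
    by (metis filter.simps(1))
  with f show ?thesis by (induction T) (auto simp: restrict_tableau_def)
qed

text \<open>\<open>adapted m T\<close> looks only at entries up to \<open>m\<close>, so the
  arguments can keep the tableau \<open>T\<close> for both components.\<close>

lemma adapted_chart_restrict_tableau:
  "adapted_chart m (restrict_tableau m T) N = adapted_chart m T N"
  by (simp add: adapted_chart_def adapted_def restrict_restrict_tableau cong: conj_cong)

lemma restrict_tableau_id:
  assumes "[] \<notin> set T" "\<And>row e. row \<in> set T \<Longrightarrow> e \<in> set row \<Longrightarrow> e \<le> i"
  shows "restrict_tableau i T = T"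
  using assms
proof (induction T)
  case (Cons row T)
  then have "filter (\<lambda>e. e \<le> i) row = row" by (intro filter_True) auto
  with Cons show ?case by (auto simp: restrict_tableau_def)
qed (simp add: restrict_tableau_def)

lemma restrict_tableau_append: "restrict_tableau i (T @ T') = restrict_tableau i T @ restrict_tableau i T'"
  by (simp add: restrict_tableau_def)

lemma tableau_restrict_self:
  assumes "is_partition lam n" "standard_tableau lam T"
  shows "restrict_tableau n T = T"
proof (rule restrict_tableau_id)
  show "[] \<notin> set T" using assms by (force simp: is_partition_def standard_tableau_def shape_def)
  show "e \<le> n" if "row \<in> set T" "e \<in> set row" for row e
  proof -
    have eq: "set (concat T) = {1..n}" using assms unfolding is_partition_def standard_tableau_def by blast
    have "e \<in> set (concat T)" using that by auto
    then show ?thesis unfolding eq by simp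
  qed
qed

lemma tableau_last_box:
  assumes lam: "is_partition lam (Suc m)" and T: "standard_tableau lam T"
  obtains T1 T2 xs where "T = T1 @ (xs @ [Suc m]) # T2"
    "restrict_tableau m T = T1 @ (if xs = [] then [] else [xs]) @ T2"
    "\<forall>row\<in>set T1 \<union> set T2. Suc m \<notin> set row" "Suc m \<notin> set xs"
proof -
  have ent: "set (concat T) = {1..Suc m}" and dist: "distinct (concat T)"
    and rows: "\<And>row. row \<in> set T \<Longrightarrow> sorted_wrt (<) row"
    using lam T by (auto simp: is_partition_def standard_tableau_def)
  have ne: "[] \<notin> set T" using lam T by (force simp: is_partition_def standard_tableau_def shape_def)
  have le: "e \<le> Suc m" if "row \<in> set T" "e \<in> set row" for row e
  proof -
    have "e \<in> set (concat T)" using that by auto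
    then show ?thesis unfolding ent by simp
  qed
  have "Suc m \<in> set (concat T)" unfolding ent by simp
  then obtain row where row: "row \<in> set T" "Suc m \<in> set row" by auto
  obtain T1 T2 where T12: "T = T1 @ row # T2" using split_list[OF row(1)] by blast
  obtain xs ys where r: "row = xs @ Suc m # ys" using split_list[OF row(2)] by blast
  have ys: "ys = []"
  proof (rule ccontr)
    assume "ys \<noteq> []"
    then have "hd ys \<in> set ys" by simp
    then have "Suc m < hd ys" "hd ys \<le> Suc m" using rows[OF row(1)] le[OF row(1), of "hd ys"] by (auto simp: r sorted_wrt_append)
    then show False by simp
  qed
  have nT: "Suc m \<notin> set row'" if "row' \<in> set T1 \<union> set T2" for row'
    using that dist by (auto simp: T12 r)
  have nx: "Suc m \<notin> set xs" using dist by (simp add: T12 r)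
  have le': "e \<le> m" if "row' \<in> set T1 \<union> set T2 \<or> row' = xs" "e \<in> set row'" for row' e
  proof -
    have "e \<noteq> Suc m" using that nT nx by auto
    moreover have "e \<le> Suc m" using that le[of row' e] le[OF row(1), of e] by (auto simp: T12 r)
    ultimately show ?thesis by simp
  qed
  have "restrict_tableau m T1 = T1" "restrict_tableau m T2 = T2"
    by (rule restrict_tableau_id; use ne le' T12 in auto)+
  moreover have "restrict_tableau m [xs @ [Suc m]] = (if xs = [] then [] else [xs])"
  proof -
    have "filter (\<lambda>e. e \<le> m) xs = xs" using le' by (intro filter_True) auto
    then show ?thesis by (simp add: restrict_tableau_def)
  qed
  moreover have T': "T = T1 @ [xs @ [Suc m]] @ T2" using T12 r ys by simp
  ultimately have "restrict_tableau m T = T1 @ (if xs = [] then [] else [xs]) @ T2"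
    by (simp only: restrict_tableau_append)
  then show ?thesis using T' nT nx by (intro that) auto
qed

text \<open>Multisets of row lengths suffice for comparing Jordan types. The removed box ends its
  row, so its column \<open>a\<close> is the length of this row; if the box is in the last column,
  the row is as long as the first one.\<close>

lemma tableau_removed_box:
  assumes lam: "is_partition lam (Suc m)" and T: "standard_tableau lam T"
  obtains a zs where "a \<ge> 1" "mset lam = add_mset a (mset zs)"
    "mset (shape (restrict_tableau m T)) = (if a > 1 then add_mset (a - 1) (mset zs) else mset zs)"
    "in_last_column (Suc m) T \<longrightarrow> (\<forall>p\<in>set lam. p \<le> a)"
proof -
  obtain T1 T2 xs where Teq: "T = T1 @ (xs @ [Suc m]) # T2"
    and T': "restrict_tableau m T = T1 @ (if xs = [] then [] else [xs]) @ T2"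
    and nT: "\<forall>row\<in>set T1 \<union> set T2. Suc m \<notin> set row" and nx: "Suc m \<notin> set xs"
    by (rule tableau_last_box[OF lam T])
  have sh: "lam = map length T" using T by (simp add: standard_tableau_def shape_def)
  let ?a = "Suc (length xs)" and ?zs = "map length T1 @ map length T2"
  show ?thesis
  proof (rule that[of ?a ?zs])
    show "?a \<ge> 1" by simp
    show "mset lam = add_mset ?a (mset ?zs)" unfolding sh Teq by simp
    show "mset (shape (restrict_tableau m T)) = (if ?a > 1 then add_mset (?a - 1) (mset ?zs) else mset ?zs)"
      unfolding T' shape_def by auto
    show "in_last_column (Suc m) T \<longrightarrow> (\<forall>p\<in>set lam. p \<le> ?a)"
    proof (rule impI)
      assume "in_last_column (Suc m) T"
      then obtain r c where rc: "r < length T" "c < length (T ! r)" "T ! r ! c = Suc m" "Suc c = length (T ! 0)"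
        by (auto simp: in_last_column_def)
      have "T ! r \<in> set T" "Suc m \<in> set (T ! r)" using rc nth_mem[of c "T ! r"] by auto
      then have "T ! r = xs @ [Suc m]" using nT by (auto simp: Teq)
      then have c: "c = length xs" using rc(2,3) nx nth_mem[of c xs] by (cases "c < length xs") (auto simp: nth_append)
      have "0 < length T" by (simp add: Teq)
      then have "lam ! 0 = length (T ! 0)" unfolding sh by (rule nth_map)
      then have a0: "lam ! 0 = ?a" using rc(4) c by simp
      show "\<forall>p\<in>set lam. p \<le> ?a"
      proof
        fix p assume "p \<in> set lam"
        then obtain i where i: "i < length lam" "p = lam ! i" by (auto simp: in_set_conv_nth)
        have "sorted_wrt (\<ge>) lam" using lam by (simp add: is_partition_def)
        then show "p \<le> ?a" using sorted_wrt_nth_less[of "(\<ge>)" lam 0 i] i a0 by (cases "i = 0") auto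
      qed
    qed
  qed
qed

text \<open>The sums count the boxes in the first \<open>j\<close> columns, and the removed box is
  in column \<open>a\<close>.\<close>

lemma min_sums_removed_box:
  fixes lam lam' :: "nat list"
  assumes "a \<ge> 1" "mset lam = add_mset a (mset zs)" "mset lam' = (if a > 1 then add_mset (a - 1) (mset zs) else mset zs)"
  shows "(\<Sum>p\<leftarrow>lam. min j p) = (\<Sum>p\<leftarrow>lam'. min j p) + (if j \<ge> a then 1 else 0)"
proof -
  have s: "(\<Sum>p\<leftarrow>xs. min j p) = (\<Sum>p\<in>#mset xs. min j p)" for xs :: "nat list"
    by (simp add: sum_mset_sum_list[symmetric])
  show ?thesis unfolding s assms(2,3) using assms(1) by auto
qed

subsection \<open>Singular points of the two components\<close>

lemma young_diagram_unique_similar: "young_diagram A mu \<Longrightarrow> young_diagram B mu \<Longrightarrow> similar_mat A B"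
  unfolding young_diagram_def jordan_nf_def using similar_mat_trans similar_mat_sym by blast

lemma nilpotent_similar:
  assumes "nilpotent_mat n u" "similar_mat N u"
  obtains K where "N \<in> carrier_mat n n" "N ^\<^sub>m K = 0\<^sub>m n n"
proof -
  obtain K where u: "u \<in> carrier_mat n n" "u ^\<^sub>m K = 0\<^sub>m n n" using assms(1) by (auto simp: nilpotent_mat_def)
  obtain P where P: "P \<in> carrier_mat n n" "det P \<noteq> 0" "N \<in> carrier_mat n n" "u * P = P * N"
    using similar_matE'[OF similar_mat_sym[OF assms(2)] u(1)] by blast
  show ?thesis by (rule that[OF P(3) nilpotent_of_conj[OF u P(4,1,2,3)]])
qed

text \<open>The closed conditions without reference to a base hyperplane. This form is needed at
  points of the closure, where no hyperplane of the right type is known in advance.\<close>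

lemma adapted_chart_hyperplane:
  assumes N: "N \<in> carrier_mat (Suc m) (Suc m)" and nil: "N ^\<^sub>m K = 0\<^sub>m (Suc m) (Suc m)"
    and yN: "young_diagram N (shape (restrict_tableau (Suc m) T))"
    and below: "(\<Sum>p\<leftarrow>shape (restrict_tableau m T). min (a - 1) p) = (\<Sum>p\<leftarrow>shape (restrict_tableau (Suc m) T). min (a - 1) p)"
    and x: "x \<in> adapted_chart (Suc m) T N"
  defines "y \<equiv> hyperplane_coord m x"
  shows "j < Suc m \<Longrightarrow> (shear m (\<lambda>j. - y j) * N * shear m y) $$ (m, j) = 0"
    "w \<in> carrier_mat (Suc m) 1 \<Longrightarrow> N ^\<^sub>m (a - 1) * w = 0\<^sub>m (Suc m) 1 \<Longrightarrow> (shear m (\<lambda>j. - y j) * w) $$ (m, 0) = 0"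
proof -
  let ?E = "shear m (\<lambda>j. - y j)" and ?S = "shear m y" and ?D = "diag_one m (lower_unitriangular m x)"
  let ?U = "lower_unitriangular (Suc m) x"
  define C where "C = ?E * N * ?S"
  have EN: "?E * N \<in> carrier_mat (Suc m) (Suc m)" by (rule mult_carrier_mat[OF shear_carrier N])
  have C: "C \<in> carrier_mat (Suc m) (Suc m)" unfolding C_def by (rule mult_carrier_mat[OF EN shear_carrier])
  note D = diag_one_carrier[OF lower_unitriangular_carrier[of m x]]
  obtain B where B: "adapted (Suc m) T B" and eq: "N * ?U = ?U * B" using x by (auto simp: adapted_chart_def)
  have Bc: "B \<in> carrier_mat (Suc m) (Suc m)" using B by (simp add: adapted_def)
  have Bn: "B ^\<^sub>m K = 0\<^sub>m (Suc m) (Suc m)"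
    by (rule nilpotent_of_conj[OF N nil eq lower_unitriangular_carrier _ Bc]) simp
  have U: "?U = ?S * ?D" unfolding y_def by (rule unitriangular_decomposition)
  have "C * ?D = ?E * N * ?U" unfolding C_def U by (rule assoc_mult_mat[OF EN shear_carrier D])
  also have "\<dots> = ?E * (?U * B)" unfolding eq[symmetric] by (rule assoc_mult_mat[OF shear_carrier N lower_unitriangular_carrier])
  also have "\<dots> = ?E * ?U * B" by (rule assoc_mult_mat[OF shear_carrier lower_unitriangular_carrier Bc, symmetric])
  also have "?E * ?U = ?E * ?S * ?D" unfolding U by (rule assoc_mult_mat[OF shear_carrier shear_carrier D, symmetric])
  also have "\<dots> = ?D" unfolding shear_inverse(1) by (rule left_mult_one_mat[OF D])
  finally have CD: "C * ?D = ?D * B" .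
  note block = adapted_leading_block[OF B Bn C CD]
  show "(?E * N * ?S) $$ (m, j) = 0" if "j < Suc m" using block(1)[OF that] unfolding C_def .
  have "C * ?E = ?E * N * (?S * ?E)" unfolding C_def by (rule assoc_mult_mat[OF EN shear_carrier shear_carrier])
  then have CE: "C * ?E = ?E * N" unfolding shear_inverse(2) right_mult_one_mat[OF EN] .
  have yC: "young_diagram C (shape (restrict_tableau (Suc m) T))"
    using young_diagram_similar[OF similar_matI'[OF C N shear_carrier det_shear CE]] yN by simp
  have Cb: "C = border (lead m C) (last_col m C)" by (rule border_lead[OF C block(1)])
  assume w: "w \<in> carrier_mat (Suc m) 1" "N ^\<^sub>m (a - 1) * w = 0\<^sub>m (Suc m) 1"
  have Ew: "?E * w \<in> carrier_mat (Suc m) 1" by (rule mult_carrier_mat[OF shear_carrier w(1)])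
  have Nk: "N ^\<^sub>m k \<in> carrier_mat (Suc m) (Suc m)" and Ck: "C ^\<^sub>m k \<in> carrier_mat (Suc m) (Suc m)" for k using N C by auto
  have "C ^\<^sub>m (a - 1) * (?E * w) = (C ^\<^sub>m (a - 1) * ?E) * w" by (rule assoc_mult_mat[OF Ck shear_carrier w(1), symmetric])
  also have "\<dots> = ?E * (N ^\<^sub>m (a - 1) * w)"
    unfolding conj_pow[OF C N shear_carrier CE] by (rule assoc_mult_mat[OF shear_carrier Nk w(1)])
  also have "\<dots> = 0\<^sub>m (Suc m) 1" unfolding w(2) by (rule right_mult_zero_mat[OF shear_carrier])
  finally have "border (lead m C) (last_col m C) ^\<^sub>m (a - 1) * (?E * w) = 0\<^sub>m (Suc m) 1" using Cb by simp
  from kernel_in_hyperplane[OF lead_carrier last_col_carrier block(3) _ below Ew this] yC Cb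
  show "(?E * w) $$ (m, 0) = 0" by simp
qed

text \<open>The conditions persist on the closure because they are polynomial in \<open>x\<close>.\<close>

lemma zariski_cl_hyperplane:
  assumes N: "N \<in> carrier_mat (Suc m) (Suc m)" and nil: "N ^\<^sub>m K = 0\<^sub>m (Suc m) (Suc m)"
    and yN: "young_diagram N (shape (restrict_tableau (Suc m) T))"
    and below: "(\<Sum>p\<leftarrow>shape (restrict_tableau m T). min (a - 1) p) = (\<Sum>p\<leftarrow>shape (restrict_tableau (Suc m) T). min (a - 1) p)"
    and x: "x \<in> zariski_cl (chart_index (Suc m)) (adapted_chart (Suc m) T N)"
  defines "y \<equiv> hyperplane_coord m x"
  shows "j < Suc m \<Longrightarrow> (shear m (\<lambda>j. - y j) * N * shear m y) $$ (m, j) = 0"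
    "w \<in> carrier_mat (Suc m) 1 \<Longrightarrow> N ^\<^sub>m (a - 1) * w = 0\<^sub>m (Suc m) 1 \<Longrightarrow> (shear m (\<lambda>j. - y j) * w) $$ (m, 0) = 0"
proof -
  let ?I = "chart_index (Suc m)"
  note cond = adapted_chart_hyperplane[OF N nil yN below]
  have E: "polymat ?I (Suc m) (Suc m) (\<lambda>x. shear m (\<lambda>j. - hyperplane_coord m x j))"
    by (rule polymat_shear, rule polynomials_uminus, rule polynomial_hyperplane_coord)
  have S: "polymat ?I (Suc m) (Suc m) (\<lambda>x. shear m (hyperplane_coord m x))"
    by (rule polymat_shear, rule polynomial_hyperplane_coord)
  note ENS = polymat_mult[OF polymat_mult[OF E polymat_const[OF N]] S]
  {
    assume j: "j < Suc m"
    define f where "f = (\<lambda>x. (shear m (\<lambda>j. - hyperplane_coord m x j) * N * shear m (hyperplane_coord m x)) $$ (m, j))"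
    have "f \<in> vanishing_ideal ?I (adapted_chart (Suc m) T N)"
      unfolding vanishing_ideal_def f_def using polymatD(2)[OF ENS lessI j] cond(1)[OF _ j] by blast
    from zariski_clD[OF x this] show "(shear m (\<lambda>j. - y j) * N * shear m y) $$ (m, j) = 0" unfolding f_def y_def .
  }
  assume w: "w \<in> carrier_mat (Suc m) 1" "N ^\<^sub>m (a - 1) * w = 0\<^sub>m (Suc m) 1"
  define f where "f = (\<lambda>x. (shear m (\<lambda>j. - hyperplane_coord m x j) * w) $$ (m, 0))"
  have "f \<in> polynomials ?I" unfolding f_def by (rule polymatD(2)[OF polymat_mult[OF E polymat_const[OF w(1)]] lessI]) simp
  then have "f \<in> vanishing_ideal ?I (adapted_chart (Suc m) T N)"
    unfolding vanishing_ideal_def f_def using cond(2)[OF _ w] by blast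
  from zariski_clD[OF x this] show "(shear m (\<lambda>j. - y j) * w) $$ (m, 0) = 0" unfolding f_def y_def .
qed

lemma kernel_pow_mono:
  fixes A :: "complex mat"
  assumes A: "A \<in> carrier_mat n n" and w: "w \<in> carrier_mat n 1" "A ^\<^sub>m j * w = 0\<^sub>m n 1" and jk: "j \<le> k"
  shows "A ^\<^sub>m k * w = 0\<^sub>m n 1"
  using jk
proof (induction k rule: dec_induct)
  case base
  show ?case by (rule w(2))
next
  case (step k)
  have Ak: "A ^\<^sub>m k \<in> carrier_mat n n" using A by auto
  have "A ^\<^sub>m Suc k * w = A * A ^\<^sub>m k * w" using conj_pow[OF A A A refl] by simp
  also have "\<dots> = A * (A ^\<^sub>m k * w)" by (rule assoc_mult_mat[OF A Ak w(1)])
  also have "\<dots> = 0\<^sub>m n 1" unfolding step.IH by (rule right_mult_zero_mat[OF A])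
  finally show ?case .
qed

lemma min_sum_bounded: "(\<And>p. p \<in> set lam \<Longrightarrow> p \<le> j) \<Longrightarrow> (\<Sum>p\<leftarrow>lam. min j p) = sum_list (lam :: nat list)"
  by (induction lam) auto

lemma min_sum_le: "(\<Sum>p\<leftarrow>lam. min j p) \<le> sum_list (lam :: nat list)"
  by (induction lam) auto

text \<open>The restriction to the last column enters only here: no part of \<open>lam\<close> exceeds \<open>a\<close>, so \<open>C\<^sup>j = 0\<close> for
  \<open>j \<ge> a\<close> and no condition on the hyperplane is missing.\<close>

lemma young_diagram_hyperplane:
  assumes X: "X \<in> carrier_mat m m" and d: "d \<in> carrier_mat m 1" and nil: "border X d ^\<^sub>m K = 0\<^sub>m (Suc m) (Suc m)"
    and yC: "young_diagram (border X d) lam" and a: "a \<ge> 1"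
    and ker: "\<And>w. w \<in> carrier_mat (Suc m) 1 \<Longrightarrow> border X d ^\<^sub>m (a - 1) * w = 0\<^sub>m (Suc m) 1 \<Longrightarrow> w $$ (m, 0) = 0"
    and le: "\<And>p. p \<in> set lam \<Longrightarrow> p \<le> a"
    and sums: "\<And>j. (\<Sum>p\<leftarrow>lam. min j p) = (\<Sum>p\<leftarrow>lam'. min j p) + (if j \<ge> a then 1 else 0)"
    and lam': "sorted_wrt (\<ge>) lam'" "0 \<notin> set lam'"
  shows "young_diagram X lam'"
proof -
  let ?C = "border X d"
  have C: "?C \<in> carrier_mat (Suc m) (Suc m)" by (rule border_carrier[OF X])
  have Xk: "X ^\<^sub>m k \<in> carrier_mat m m" and Xd: "X ^\<^sub>m k * d \<in> carrier_mat m 1" and Ck: "?C ^\<^sub>m k \<in> carrier_mat (Suc m) (Suc m)" for k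
    using X d C by (auto intro!: mult_carrier_mat[of _ m m])
  \<comment> \<open>Nilpotency gives \<open>X\<close> some Jordan type \<open>nu\<close>; its kernel
    dimensions are then compared with those prescribed by \<open>lam'\<close>.\<close>
  have "X ^\<^sub>m Suc K = 0\<^sub>m m m"
  proof -
    have "border (X ^\<^sub>m Suc K) (X ^\<^sub>m K * d) = 0\<^sub>m (Suc m) (Suc m)"
      unfolding border_pow[OF X d, symmetric] using nil left_mult_zero_mat[OF C] by simp
    then have "lead m (border (X ^\<^sub>m Suc K) (X ^\<^sub>m K * d)) = lead m (0\<^sub>m (Suc m) (Suc m))" by simp
    then show ?thesis unfolding lead_border[OF Xk Xd] by (auto intro!: eq_matI)
  qed
  then obtain nu where nu: "young_diagram X nu" using young_diagram_exists[OF X] by blast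
  have "sum_list nu = m" using carrier_matD(1)[OF young_diagram_dim[OF nu]] carrier_matD(1)[OF X] by simp
  then have kX: "kernel_dim (X ^\<^sub>m j) \<le> m" for j unfolding young_diagram_kernel_dim[OF nu X] using min_sum_le[of j nu] by simp
  have sl: "sum_list lam = Suc m" using carrier_matD(1)[OF young_diagram_dim[OF yC]] carrier_matD(1)[OF C] by simp
  have "kernel_dim (X ^\<^sub>m j) = (\<Sum>p\<leftarrow>lam'. min j p)" for j
  proof (cases j)
    case 0
    have "(\<Sum>p\<leftarrow>xs. min 0 p) = 0" for xs :: "nat list" by (induction xs) auto
    then show ?thesis unfolding young_diagram_kernel_dim[OF nu X] 0 by simp
  next
    case (Suc i)
    note kC = young_diagram_kernel_dim[OF yC C, of j]
    have bp: "?C ^\<^sub>m j = border (X ^\<^sub>m j) (X ^\<^sub>m i * d)" unfolding Suc by (rule border_pow[OF X d])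
    show ?thesis
    proof (cases "j \<ge> a")
      case True
      \<comment> \<open>The kernel is everything here, and bordering raises the kernel dimension by
        at most one, which leaves only \<open>m\<close> for \<open>X\<close>.\<close>
      have "kernel_dim (?C ^\<^sub>m j) = Suc m" unfolding kC sl[symmetric] by (rule min_sum_bounded) (use le True in force)
      then have "kernel_dim (X ^\<^sub>m j) = m"
        using kernel_dim_border_cases[OF Xk Xd, of j i] kX[of j] unfolding bp by linarith
      moreover have "(\<Sum>p\<leftarrow>lam'. min j p) = m" using sums[of j] True kC \<open>kernel_dim (?C ^\<^sub>m j) = Suc m\<close> by simp
      ultimately show ?thesis by simp
    next
      case False
      \<comment> \<open>Kernels increase with the power, so for \<open>j < a\<close> the condition
        at \<open>a - 1\<close> already keeps them in the hyperplane.\<close>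
      have "w $$ (m, 0) = 0" if w: "w \<in> carrier_mat (Suc m) 1" "?C ^\<^sub>m j * w = 0\<^sub>m (Suc m) 1" for w
      proof (rule ker[OF w(1)])
        show "?C ^\<^sub>m (a - 1) * w = 0\<^sub>m (Suc m) 1" by (rule kernel_pow_mono[OF C w]) (use False in simp)
      qed
      then have "kernel_dim (border (X ^\<^sub>m j) (X ^\<^sub>m i * d)) = kernel_dim (X ^\<^sub>m j)"
        using kernel_dim_border_eq[OF Xk Xd, of j i] unfolding bp by blast
      then show ?thesis using sums[of j] False kC unfolding bp by simp
    qed
  qed
  then show ?thesis by (rule young_diagram_eqI[OF nu X lam'])
qed

text \<open>\<open>a\<close> is the length of the row that ends with the removed box, and
  \<open>zs\<close> lists the lengths of the other rows.\<close>

context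
  fixes m :: nat and lam :: "nat list" and T :: "nat list list" and u u' :: "complex mat" and a :: nat and zs :: "nat list"
  assumes lam: "is_partition lam (Suc m)" and T: "standard_tableau lam T"
    and u: "nilpotent_mat (Suc m) u" "young_diagram u lam"
    and u': "nilpotent_mat m u'" "young_diagram u' (shape (restrict_tableau m T))"
    and box: "a \<ge> 1" "mset lam = add_mset a (mset zs)"
      "mset (shape (restrict_tableau m T)) = (if a > 1 then add_mset (a - 1) (mset zs) else mset zs)"
begin

lemma shape_restrict_all: "shape (restrict_tableau (Suc m) T) = lam"
  unfolding tableau_restrict_self[OF lam T] using T by (simp add: standard_tableau_def)

lemma sums: "(\<Sum>p\<leftarrow>lam. min j p) = (\<Sum>p\<leftarrow>shape (restrict_tableau m T). min j p) + (if j \<ge> a then 1 else 0)"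
  by (rule min_sums_removed_box[OF box])

lemma hyperplane_chartI:
  assumes "N \<in> carrier_mat (Suc m) (Suc m)" "N ^\<^sub>m K = 0\<^sub>m (Suc m) (Suc m)" "N' \<in> carrier_mat m m" "c \<in> carrier_mat m 1"
    "shear m (\<lambda>j. - y j) * N * shear m y = border N' c" "young_diagram N lam"
    "young_diagram N' (shape (restrict_tableau m T))"
  shows "hyperplane_chart m N N' c y T a K"
  using assms box(1) sums[of "a - 1"] sums[of a] by unfold_locales (simp_all add: shape_restrict_all)

text \<open>The matrix is chosen to fit the singular point: \<open>N'\<close> is bordered so that
  the standard hyperplane, with \<open>y = 0\<close>, has the type of the smaller tableau. By
  similarity to \<open>u\<close> the bordered matrix belongs to a chart of the larger component, and
  the singular point extends to that chart.\<close>

lemma singular_of_restriction: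
  assumes "singular m (springer_component m u' (restrict_tableau m T))"
  shows "singular (Suc m) (springer_component (Suc m) u T)"
proof -
  have u'c: "u' \<in> carrier_mat m m" and uc: "u \<in> carrier_mat (Suc m) (Suc m)" using u(1) u'(1) by (auto simp: nilpotent_mat_def)
  obtain N' x where N': "similar_mat N' u'"
    and x: "singular_point (chart_index m) (zariski_cl (chart_index m) (adapted_chart m T N')) x"
    using assms unfolding singular_springer_component[OF u'c] adapted_chart_restrict_tableau by blast
  have xa: "x \<in> affine_space (chart_index m)" using x by (simp add: singular_point_def zariski_cl_def)
  obtain K' where N'c: "N' \<in> carrier_mat m m" using nilpotent_similar[OF u'(1) N'] by blast
  have yN': "young_diagram N' (shape (restrict_tableau m T))" using young_diagram_similar[OF N'] u'(2) by simp
  have "sorted_wrt (\<ge>) lam" "0 \<notin> set lam" using lam by (simp_all add: is_partition_def)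
  then obtain c where c: "c \<in> carrier_mat m 1" and yN: "young_diagram (border N' c) lam"
    using extension_exists[OF N'c yN' box(3,1,2)] by blast
  have sim: "similar_mat (border N' c) u" by (rule young_diagram_unique_similar[OF yN u(2)])
  obtain K where K: "border N' c \<in> carrier_mat (Suc m) (Suc m)" "border N' c ^\<^sub>m K = 0\<^sub>m (Suc m) (Suc m)"
    by (rule nilpotent_similar[OF u(1) sim])
  have "shear m (\<lambda>j. - 0) * border N' c * shear m (\<lambda>_. 0) = border N' c"
    using shear_0[of m "\<lambda>_. - 0"] shear_0[of m "\<lambda>_. 0"] left_mult_one_mat[OF K(1)] right_mult_one_mat[OF K(1)] by simp
  then interpret hyperplane_chart m "border N' c" N' c "\<lambda>_. 0" T a K
    by (rule hyperplane_chartI[OF K N'c c _ yN yN'])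
  show ?thesis
    unfolding singular_springer_component[OF uc] using sim singular_point_extend_chart[OF xa] x by blast
qed

text \<open>The hyperplane of the singular flag itself is the base. The closed conditions hold on
  the closure, and with the bound on \<open>lam\<close> they determine the Jordan type of the
  restriction, so that the local product structure is available at this point.\<close>

lemma restriction_singular:
  assumes le: "\<And>p. p \<in> set lam \<Longrightarrow> p \<le> a" and sing: "singular (Suc m) (springer_component (Suc m) u T)"
  shows "singular m (springer_component m u' (restrict_tableau m T))"
proof -
  have u'c: "u' \<in> carrier_mat m m" and uc: "u \<in> carrier_mat (Suc m) (Suc m)" using u(1) u'(1) by (auto simp: nilpotent_mat_def)
  obtain N x where sim: "similar_mat N u"
    and x: "singular_point (chart_index (Suc m)) (zariski_cl (chart_index (Suc m)) (adapted_chart (Suc m) T N)) x"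
    using sing unfolding singular_springer_component[OF uc] by blast
  have xz: "x \<in> zariski_cl (chart_index (Suc m)) (adapted_chart (Suc m) T N)" using x by (simp add: singular_point_def)
  then have xa: "x \<in> affine_space (chart_index (Suc m))" by (simp add: zariski_cl_def)
  obtain K where N: "N \<in> carrier_mat (Suc m) (Suc m)" and nil: "N ^\<^sub>m K = 0\<^sub>m (Suc m) (Suc m)"
    by (rule nilpotent_similar[OF u(1) sim])
  have yN: "young_diagram N lam" using young_diagram_similar[OF sim] u(2) by simp
  define y where "y = hyperplane_coord m x"
  let ?E = "shear m (\<lambda>j. - y j)" and ?S = "shear m y"
  define C where "C = ?E * N * ?S"
  have EN: "?E * N \<in> carrier_mat (Suc m) (Suc m)" by (rule mult_carrier_mat[OF shear_carrier N])
  have C: "C \<in> carrier_mat (Suc m) (Suc m)" unfolding C_def by (rule mult_carrier_mat[OF EN shear_carrier])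
  have below: "(\<Sum>p\<leftarrow>shape (restrict_tableau m T). min (a - 1) p) = (\<Sum>p\<leftarrow>shape (restrict_tableau (Suc m) T). min (a - 1) p)"
    using sums[of "a - 1"] box(1) by (simp add: shape_restrict_all)
  note cond = zariski_cl_hyperplane[OF N nil yN[folded shape_restrict_all] below xz, folded y_def]
  define X where "X = lead m C"
  define d where "d = last_col m C"
  have Cb: "C = border X d" unfolding X_def d_def by (rule border_lead[OF C]) (unfold C_def, rule cond(1))
  have X: "X \<in> carrier_mat m m" and d: "d \<in> carrier_mat m 1" unfolding X_def d_def by (rule lead_carrier last_col_carrier)+
  have "?S * C = ?S * (?E * N) * ?S" unfolding C_def by (rule assoc_mult_mat[OF shear_carrier EN shear_carrier, symmetric])
  also have "?S * (?E * N) = ?S * ?E * N" by (rule assoc_mult_mat[OF shear_carrier shear_carrier N, symmetric])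
  also have "\<dots> = N" unfolding shear_inverse(2) by (rule left_mult_one_mat[OF N])
  finally have NS: "N * ?S = ?S * C" by simp
  have Cn: "C ^\<^sub>m K = 0\<^sub>m (Suc m) (Suc m)" by (rule nilpotent_of_conj[OF N nil NS shear_carrier det_shear C])
  have yC: "young_diagram C lam" using young_diagram_similar[OF similar_matI'[OF N C shear_carrier det_shear NS]] yN by simp
  have ker: "w $$ (m, 0) = 0" if w: "w \<in> carrier_mat (Suc m) 1" "C ^\<^sub>m (a - 1) * w = 0\<^sub>m (Suc m) 1" for w
  proof -
    have Sw: "?S * w \<in> carrier_mat (Suc m) 1" by (rule mult_carrier_mat[OF shear_carrier w(1)])
    have Nk: "N ^\<^sub>m (a - 1) \<in> carrier_mat (Suc m) (Suc m)" and Ck: "C ^\<^sub>m (a - 1) \<in> carrier_mat (Suc m) (Suc m)" using N C by auto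
    have "N ^\<^sub>m (a - 1) * (?S * w) = N ^\<^sub>m (a - 1) * ?S * w" by (rule assoc_mult_mat[OF Nk shear_carrier w(1), symmetric])
    also have "\<dots> = ?S * (C ^\<^sub>m (a - 1) * w)"
      unfolding conj_pow[OF N C shear_carrier NS] by (rule assoc_mult_mat[OF shear_carrier Ck w(1)])
    also have "\<dots> = 0\<^sub>m (Suc m) 1" unfolding w(2) by (rule right_mult_zero_mat[OF shear_carrier])
    finally have "(?E * (?S * w)) $$ (m, 0) = 0" by (rule cond(2)[OF Sw])
    moreover have "?E * (?S * w) = ?E * ?S * w" by (rule assoc_mult_mat[OF shear_carrier shear_carrier w(1), symmetric])
    ultimately show ?thesis unfolding shear_inverse(1) left_mult_one_mat[OF w(1)] by simp
  qed
  have lam': "sorted_wrt (\<ge>) (shape (restrict_tableau m T))" using u'(2) by (simp add: young_diagram_def)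
  have yX: "young_diagram X (shape (restrict_tableau m T))"
    by (rule young_diagram_hyperplane[OF X d Cn[unfolded Cb] yC[unfolded Cb] box(1) ker[unfolded Cb] le sums lam' young_diagram_pos[OF u'(2)]])
  interpret hyperplane_chart m N X d y T a K
    by (rule hyperplane_chartI[OF N nil X d Cb[unfolded C_def] yN yX])
  have "extend_chart m y (restr (chart_index m) x) = x" unfolding y_def by (rule extend_chart_restr[OF xa])
  then have "singular_point (chart_index m) (zariski_cl (chart_index m) (adapted_chart m T X)) (restr (chart_index m) x)"
    using singular_point_extend_chart[OF restr_affine, of x] x by simp
  moreover have "similar_mat X u'" by (rule young_diagram_unique_similar[OF yX u'(2)])
  ultimately show ?thesis
    unfolding singular_springer_component[OF u'c] adapted_chart_restrict_tableau by blast
qed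

end

theorem theorem2p1:
  fixes n :: nat and lam :: "nat list" and T T' :: "nat list list" and u u' :: "complex mat"
  assumes "n \<ge> 1"
    and "is_partition lam n"
    and "standard_tableau lam T"
    and "T' = restrict_tableau (n - 1) T"
    and "nilpotent_mat n u" and "young_diagram u (shape T)"
    and "nilpotent_mat (n - 1) u'" and "young_diagram u' (shape T')"
  shows "(singular (n - 1) (springer_component (n - 1) u' T') \<longrightarrow> singular n (springer_component n u T)) \<and>
    (in_last_column n T \<longrightarrow>
      (singular n (springer_component n u T) \<longleftrightarrow> singular (n - 1) (springer_component (n - 1) u' T')))"
proof -
  obtain m where n: "n = Suc m" using assms(1) by (cases n) auto
  have m: "n - 1 = m" by (simp add: n)
  have lam: "is_partition lam (Suc m)" using assms(2) by (simp add: n)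
  have yu: "young_diagram u lam" using assms(3,6) by (simp add: standard_tableau_def)
  have u': "nilpotent_mat m u'" "young_diagram u' (shape (restrict_tableau m T))" using assms(7,8) unfolding assms(4) m .
  have u: "nilpotent_mat (Suc m) u" using assms(5) by (simp add: n)
  obtain a zs where box: "a \<ge> 1" "mset lam = add_mset a (mset zs)"
    "mset (shape (restrict_tableau m T)) = (if a > 1 then add_mset (a - 1) (mset zs) else mset zs)"
    and last_col_le: "in_last_column (Suc m) T \<longrightarrow> (\<forall>p\<in>set lam. p \<le> a)"
    by (rule tableau_removed_box[OF lam assms(3)])
  note hyps = lam assms(3) u yu u' box
  show ?thesis
    unfolding assms(4) m unfolding n
    using singular_of_restriction[OF hyps] restriction_singular[OF hyps] last_col_le by blast
qed

end
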